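(* Let $\nu>-1$, $\delta>0$ and $1\le p<\infty$. Then the following are equivalent: (i) for every $f\in L^p((0,1),d\mu_\nu)$ one has $\mathcal{B}_R^\delta(f,x)\to f(x)$ as $R\to\infty$ for almost every $x\in(0,1)$; (ii) $p_0(\delta)\le p$, where $$p_0(\delta)=\begin{cases}1,& \text{if } \delta>\nu+1/2 \text{ or } -1<\nu\le -1/2,\\ \frac{4(\nu+1)}{2\nu+3+2\delta},& \text{if } \delta\le \nu+1/2 \text{ and } \nu>-1/2.\end{cases}$$
   Context: Let $J_\nu$ denote the Bessel function of the first kind of order $\nu>-1$ and let $0<s_1<s_2<\dots$ be the successive positive zeros of $J_\nu$. Let $d\mu_\nu(x)=x^{2\nu+1}\,dx$ on $(0,1)$. Define $\psi_j(x)=\frac{\sqrt2}{|J_{\nu+1}(s_j)|}x^{-\nu}J_\nu(s_jx)$, $j\ge1$; this is a complete orthonormal system in $L^2((0,1),d\mu_\nu)$. For $f$ on $(0,1)$ set $a_j(f)=\int_0^1 f(y)\psi_j(y)\,d\mu_\nu(y)$. For $\delta>0$ and $R>0$ the Bochner–Riesz means are $\mathcal{B}_R^\delta(f,x)=\sum_{j\ge1}\left(1-\frac{s_j^2}{R^2}\right)_+^\delta a_j(f)\psi_j(x)$, where $(1-s^2)_+=\max\{1-s^2,0\}$. *)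

theory Defs
  imports "HOL-Analysis.Analysis"
begin

definition besselJ :: "real \<Rightarrow> real \<Rightarrow> real" where
  "besselJ \<nu> x = (\<Sum>k. (-1) ^ k / (fact k * Gamma (real k + \<nu> + 1)) * (x / 2) powr (2 * real k + \<nu>))"

text \<open>The j-th positive zero (j >= 1) of J_nu: the positive zero s with exactly j-1 positive zeros below it.\<close>
definition bessel_zero :: "real \<Rightarrow> nat \<Rightarrow> real" where
  "bessel_zero \<nu> j = (THE s. 0 < s \<and> besselJ \<nu> s = 0 \<and>
       card {t. 0 < t \<and> t < s \<and> besselJ \<nu> t = 0} = j - 1)"

definition fb_psi :: "real \<Rightarrow> nat \<Rightarrow> real \<Rightarrow> real" where
  "fb_psi \<nu> j x = sqrt 2 / \<bar>besselJ (\<nu> + 1) (bessel_zero \<nu> j)\<bar> * x powr (- \<nu>) * besselJ \<nu> (bessel_zero \<nu> j * x)"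

definition mu_nu :: "real \<Rightarrow> real measure" where
  "mu_nu \<nu> = density (lebesgue_on {0<..<1}) (\<lambda>x. ennreal (x powr (2 * \<nu> + 1)))"

definition fb_coeff :: "real \<Rightarrow> (real \<Rightarrow> real) \<Rightarrow> nat \<Rightarrow> real" where
  "fb_coeff \<nu> f j = (\<integral>y. f y * fb_psi \<nu> j y \<partial>(mu_nu \<nu>))"

text \<open>Bochner--Riesz means; only the finitely many j with s_j < R contribute.\<close>
definition bochner_riesz :: "real \<Rightarrow> real \<Rightarrow> real \<Rightarrow> (real \<Rightarrow> real) \<Rightarrow> real \<Rightarrow> real" where
  "bochner_riesz \<nu> \<delta> R f x =
     (\<Sum>j\<in>{j. 1 \<le> j \<and> bessel_zero \<nu> j < R}.
        (max (1 - (bessel_zero \<nu> j)\<^sup>2 / R\<^sup>2) 0) powr \<delta> * fb_coeff \<nu> f j * fb_psi \<nu> j x)"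

definition in_Lp_mu :: "real \<Rightarrow> real \<Rightarrow> (real \<Rightarrow> real) \<Rightarrow> bool" where
  "in_Lp_mu \<nu> p f \<longleftrightarrow> f \<in> borel_measurable (mu_nu \<nu>) \<and> integrable (mu_nu \<nu>) (\<lambda>x. \<bar>f x\<bar> powr p)"

definition p0 :: "real \<Rightarrow> real \<Rightarrow> real" where
  "p0 \<nu> \<delta> = (if \<delta> > \<nu> + 1/2 \<or> (-1 < \<nu> \<and> \<nu> \<le> -1/2) then 1
              else 4 * (\<nu> + 1) / (2 * \<nu> + 3 + 2 * \<delta>))"

end

theory Submission
  imports Defs "HOL-Complex_Analysis.Complex_Analysis" "HOL-Real_Asymp.Real_Asymp"
begin

text \<open>
  Convergence. The kernel \<open>K\<^sub>R(x,y) = \<Sum> (1 - s\<^sup>2/R\<^sup>2)\<^sup>\<delta> \<psi>\<^sub>s(x) \<psi>\<^sub>s(y)\<close> is a sum of residues at the zeros \<open>s\<close> of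
  \<open>z \<phi>(xz) Z(y,z) / \<phi>(z)\<close>, where \<open>\<phi>\<close> and \<open>Z(\<cdot>,z)\<close> solve the radial Bessel equation with Cauchy data at \<open>0\<close> and \<open>1\<close>.
  Moving the sum to a vertical line near \<open>R\<close> bounds the kernel, for \<open>x\<close> in a compact subset of \<open>(0,1)\<close>, by
  \<open>R (1 + R |x - y|)\<^sup>-\<^sup>1\<^sup>-\<^sup>\<delta>\<close> when \<open>y\<close> is away from \<open>0\<close> and by \<open>R\<^sup>-\<^sup>\<delta> (R / (1 + R y))\<^sup>\<nu>\<^sup>+\<^sup>1\<^sup>/\<^sup>2\<close> near \<open>0\<close>
  (the exponent being replaced by \<open>0\<close> if \<open>\<nu> < -1/2\<close>). The first bound gives convergence at every Lebesgue point, and the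
  second one is harmless exactly when the weight is bounded in the space dual to \<open>L\<^sup>p\<close>, that is when \<open>p \<ge> p\<^sub>0\<close>.

  Divergence. Bounded Riesz means of order \<open>\<delta>\<close> force the terms of the series at the zeros \<open>s\<close> to be \<open>O(s\<^sup>\<delta>)\<close>. If \<open>p < p\<^sub>0\<close>,
  a lacunary sum of multiples of indicators of intervals \<open>(0, c K\<^sup>-\<^sup>k)\<close> lies in \<open>L\<^sup>p\<close> but has coefficients at the zeros in
  \<open>[K\<^sup>k, 2K\<^sup>k]\<close> so large that convergence at \<open>x\<close> forces \<open>sin(s x + \<eta>) \<rightarrow> 0\<close> along them. As consecutive zeros differ by
  about \<open>\<pi>\<close>, this gives \<open>sin(\<pi> x) = 0\<close>, which fails for every \<open>x\<close> in \<open>(0,1)\<close>.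
\<close>

section \<open>An energy estimate\<close>

text \<open>Classical Bessel asymptotics are replaced by one Gronwall argument. After removal of the
  first-order term both solutions obey u'' = (m/w^2 - 1) u up to scaling, with m = \<nu>^2 - 1/4.
  Along a straight path the energy |u'|^2 + |u|^2 changes only through the imaginary part of the
  path and the integral of |m|/|w|^2. This yields upper bounds, an asymptotic formula with error
  O(1/|w|) and, from it, lower bounds. The obstacle for the contour is the branch point of (1 -
  z^2/R^2)^\<delta> at R: the line must stay to its left and yet avoid the zeros of \<phi>. It is
  placed where |sin(Re z + \<eta>)| = 1, at most \<pi> away from R; the zeros skipped are boundedly
  many, each with a factor O(R^-\<delta>). With t = Im z the factor on the line is about R^-\<delta>
  (1 + |t|)^\<delta>, the Green function decays like exp(-|x - y||t|), and integration in t produces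
  the exponent 1 + \<delta>. Working at a fixed x with Lebesgue points avoids maximal functions.
  Hence the end point p = p0 is no harder than larger p: the weight to the power dual to p0 has an
  integral bounded uniformly in R.\<close>

lemma energy_derivative_bound:
  fixes u u1 q e \<zeta> :: complex
  assumes e: "norm e = 1" and \<zeta>: "\<zeta> \<noteq> 0" and q: "norm q \<le> norm \<zeta> * g"
  shows "\<bar>2 * (u1 \<bullet> (e * (q - \<zeta>\<^sup>2) * u)) + (norm \<zeta>)\<^sup>2 * (2 * (u \<bullet> (e * u1)))\<bar>
          \<le> (2 * \<bar>Im (e * \<zeta>)\<bar> + g) * ((norm u1)\<^sup>2 + (norm \<zeta>)\<^sup>2 * (norm u)\<^sup>2)"
proof -
  \<comment> \<open>The scaling by \<zeta> makes the two halves of the energy symmetric: it becomes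
    |u1|^2 + |p|^2.\<close>
  define p where "p = \<zeta> * u"
  have nz: "complex_of_real ((norm \<zeta>)\<^sup>2) = \<zeta> * cnj \<zeta>" by (rule complex_norm_square)
  have inn: "z \<bullet> w = Re (cnj z * w)" for z w :: complex by (simp add: inner_complex_def)
  have i1: "u1 \<bullet> (e * (q - \<zeta>\<^sup>2) * u) = Re (cnj u1 * e * q * u) - Re (cnj u1 * e * \<zeta> * p)"
    unfolding inn p_def by (simp add: algebra_simps power2_eq_square)
  have i2: "(norm \<zeta>)\<^sup>2 * (u \<bullet> (e * u1)) = Re (\<zeta> * cnj p * e * u1)"
  proof -
    have "(norm \<zeta>)\<^sup>2 * (u \<bullet> (e * u1)) = Re (of_real ((norm \<zeta>)\<^sup>2) * (cnj u * (e * u1)))"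
      unfolding inn by (simp only: times_complex.sel Re_complex_of_real Im_complex_of_real)
    also have "\<dots> = Re (\<zeta> * cnj p * e * u1)"
      unfolding nz p_def by (simp add: mult_ac)
    finally show ?thesis .
  qed
  \<comment> \<open>The two leading terms combine to the real part of e\<zeta> times a number minus
    its conjugate, which is purely imaginary. Only Im (e\<zeta>) survives: in a direction with
    e\<zeta> real the unperturbed energy is conserved.\<close>
  have i3: "Re (\<zeta> * cnj p * e * u1) - Re (cnj u1 * e * \<zeta> * p) = - 2 * Im (e * \<zeta>) * Im (cnj p * u1)"
  proof -
    have "cnj p * u1 - cnj u1 * p = 2 * \<i> * of_real (Im (cnj p * u1))"
      by (simp add: complex_eq_iff)
    then have "Re ((e * \<zeta>) * (cnj p * u1 - cnj u1 * p)) = Re ((e * \<zeta>) * (2 * \<i> * of_real (Im (cnj p * u1))))"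
      by simp
    then show ?thesis by (simp add: algebra_simps)
  qed
  have b1: "\<bar>Im (cnj p * u1)\<bar> \<le> norm p * norm u1"
    using abs_Im_le_cmod[of "cnj p * u1"] by (simp add: norm_mult)
  have am: "2 * (norm p * norm u1) \<le> (norm p)\<^sup>2 + (norm u1)\<^sup>2"
    using sum_squares_bound[of "norm p" "norm u1"] by (simp add: mult_ac)
  have pn: "(norm p)\<^sup>2 = (norm \<zeta>)\<^sup>2 * (norm u)\<^sup>2" by (simp add: p_def norm_mult power_mult_distrib)
  have b2: "\<bar>2 * Re (cnj u1 * e * q * u)\<bar> \<le> g * ((norm p)\<^sup>2 + (norm u1)\<^sup>2)"
  proof -
    have "\<bar>Re (cnj u1 * e * q * u)\<bar> \<le> norm u1 * norm q * norm u"
      using abs_Re_le_cmod[of "cnj u1 * e * q * u"] e by (simp add: norm_mult)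
    also have "\<dots> \<le> norm u1 * (norm \<zeta> * g) * norm u"
      by (intro mult_right_mono mult_left_mono q) auto
    also have "\<dots> = g * (norm p * norm u1)" by (simp add: p_def norm_mult)
    finally have x: "\<bar>2 * Re (cnj u1 * e * q * u)\<bar> \<le> g * (2 * (norm p * norm u1))" by simp
    have "0 \<le> norm \<zeta> * g" using q norm_ge_zero[of q] by linarith
    then have "0 \<le> g" using \<zeta> by (simp add: zero_le_mult_iff)
    then show ?thesis using x am by (meson mult_left_mono order_trans)
  qed
  have "\<bar>2 * (u1 \<bullet> (e * (q - \<zeta>\<^sup>2) * u)) + (norm \<zeta>)\<^sup>2 * (2 * (u \<bullet> (e * u1)))\<bar>
      = \<bar>2 * Re (cnj u1 * e * q * u) + 2 * (- 2 * Im (e * \<zeta>) * Im (cnj p * u1))\<bar>"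
    unfolding i3[symmetric] using i1 i2 by (simp add: algebra_simps)
  also have "\<dots> \<le> \<bar>2 * Re (cnj u1 * e * q * u)\<bar> + 4 * \<bar>Im (e * \<zeta>)\<bar> * \<bar>Im (cnj p * u1)\<bar>"
  proof -
    have "\<bar>2 * A + 2 * (- 2 * B * C)\<bar> \<le> \<bar>2 * A\<bar> + 4 * \<bar>B\<bar> * \<bar>C\<bar>" for A B C :: real
      by (rule order_trans[OF abs_triangle_ineq]) (simp add: abs_mult)
    then show ?thesis .
  qed
  also have "\<dots> \<le> g * ((norm p)\<^sup>2 + (norm u1)\<^sup>2) + 4 * \<bar>Im (e * \<zeta>)\<bar> * (norm p * norm u1)"
    using b1 b2 by (intro add_mono mult_left_mono) auto
  also have "\<dots> \<le> g * ((norm p)\<^sup>2 + (norm u1)\<^sup>2) + 2 * \<bar>Im (e * \<zeta>)\<bar> * ((norm p)\<^sup>2 + (norm u1)\<^sup>2)"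
    using mult_left_mono[OF am, of "2 * \<bar>Im (e * \<zeta>)\<bar>"] by (simp add: algebra_simps)
  finally show ?thesis unfolding pn by (simp add: algebra_simps)
qed

text \<open>Gronwall's inequality in both directions for u'' = e^2 (Q - \<zeta>^2) u, where e is the
  unit direction of a straight segment in the complex plane and g bounds |Q|/|\<zeta>|. The backward
  estimate is the one that transports lower bounds and uniqueness.\<close>

lemma energy_bound:
  fixes u u1 Q :: "real \<Rightarrow> complex" and e \<zeta> :: complex and g G :: "real \<Rightarrow> real"
  assumes ab: "a \<le> b" and e: "norm e = 1" and \<zeta>: "\<zeta> \<noteq> 0"
    and cont: "continuous_on {a..b} u" "continuous_on {a..b} u1" "continuous_on {a..b} G"
    and du: "\<And>t. a < t \<Longrightarrow> t < b \<Longrightarrow> (u has_vector_derivative e * u1 t) (at t)"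
    and du1: "\<And>t. a < t \<Longrightarrow> t < b \<Longrightarrow> (u1 has_vector_derivative e * (Q t - \<zeta>\<^sup>2) * u t) (at t)"
    and dG: "\<And>t. a < t \<Longrightarrow> t < b \<Longrightarrow> (G has_real_derivative g t) (at t)"
    and Q: "\<And>t. a < t \<Longrightarrow> t < b \<Longrightarrow> norm (Q t) \<le> norm \<zeta> * g t"
  shows "(norm (u1 b))\<^sup>2 + (norm \<zeta>)\<^sup>2 * (norm (u b))\<^sup>2 \<le>
           ((norm (u1 a))\<^sup>2 + (norm \<zeta>)\<^sup>2 * (norm (u a))\<^sup>2) * exp (2 * \<bar>Im (e * \<zeta>)\<bar> * (b - a) + (G b - G a))" (is ?th1)
    and "(norm (u1 a))\<^sup>2 + (norm \<zeta>)\<^sup>2 * (norm (u a))\<^sup>2 \<le>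
           ((norm (u1 b))\<^sup>2 + (norm \<zeta>)\<^sup>2 * (norm (u b))\<^sup>2) * exp (2 * \<bar>Im (e * \<zeta>)\<bar> * (b - a) + (G b - G a))" (is ?th2)
proof -
  define \<beta> where "\<beta> = 2 * \<bar>Im (e * \<zeta>)\<bar>"
  define N where "N = (\<lambda>t. (norm (u1 t))\<^sup>2 + (norm \<zeta>)\<^sup>2 * (norm (u t))\<^sup>2)"
  define N' where "N' = (\<lambda>t. 2 * (u1 t \<bullet> (e * (Q t - \<zeta>\<^sup>2) * u t)) + (norm \<zeta>)\<^sup>2 * (2 * (u t \<bullet> (e * u1 t))))"
  have dsq: "((\<lambda>t. (norm (f t))\<^sup>2) has_real_derivative 2 * (f t \<bullet> f')) (at t)"
    if "(f has_vector_derivative f') (at t)" for f :: "real \<Rightarrow> complex" and f' t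
  proof -
    have "((\<lambda>t. f t \<bullet> f t) has_vector_derivative (f t \<bullet> f' + f' \<bullet> f t)) (at t)"
      by (rule bounded_bilinear.has_vector_derivative[OF bounded_bilinear_inner that that])
    then show ?thesis
      by (simp add: power2_norm_eq_inner has_real_derivative_iff_has_vector_derivative inner_commute)
  qed
  have dN: "(N has_real_derivative N' t) (at t)" if "a < t" "t < b" for t
    unfolding N_def N'_def
    by (intro DERIV_add DERIV_cmult dsq du du1 that)
  have N'b: "\<bar>N' t\<bar> \<le> (\<beta> + g t) * N t" if "a < t" "t < b" for t
    unfolding N'_def N_def \<beta>_def by (rule energy_derivative_bound[OF e \<zeta> Q[OF that]])
  have cN: "continuous_on {a..b} N" unfolding N_def
    by (intro continuous_intros cont)
  \<comment> \<open>The integrating factor makes this product nonincreasing; with the opposite sign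
    in the exponent it will be nondecreasing.\<close>
  have "N b * exp (- (\<beta> * b + G b)) \<le> N a * exp (- (\<beta> * a + G a))"
  proof (rule DERIV_nonpos_imp_decreasing_open[OF ab])
    fix t assume t: "a < t" "t < b"
    have "((\<lambda>t. N t * exp (- (\<beta> * t + G t))) has_real_derivative (N' t - (\<beta> + g t) * N t) * exp (- (\<beta> * t + G t))) (at t)"
      by (auto intro!: derivative_eq_intros dN dG t simp: algebra_simps)
    moreover have "(N' t - (\<beta> + g t) * N t) * exp (- (\<beta> * t + G t)) \<le> 0"
      using N'b[OF t] by (intro mult_nonpos_nonneg) auto
    ultimately show "\<exists>y. ((\<lambda>t. N t * exp (- (\<beta> * t + G t))) has_real_derivative y) (at t) \<and> y \<le> 0" by blast
  next
    show "continuous_on {a..b} (\<lambda>t. N t * exp (- (\<beta> * t + G t)))" by (intro continuous_intros cN cont)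
  qed
  then have "N b * exp (- (\<beta> * b + G b)) * exp (\<beta> * b + G b) \<le> N a * exp (- (\<beta> * a + G a)) * exp (\<beta> * b + G b)"
    by (intro mult_right_mono) auto
  then have "N b \<le> N a * exp (\<beta> * (b - a) + (G b - G a))"
    by (simp add: mult.assoc exp_add[symmetric] algebra_simps)
  then show ?th1 by (simp add: N_def \<beta>_def)
  have "N a * exp (\<beta> * a + G a) \<le> N b * exp (\<beta> * b + G b)"
  proof (rule DERIV_nonneg_imp_increasing_open[OF ab])
    fix t assume t: "a < t" "t < b"
    have "((\<lambda>t. N t * exp (\<beta> * t + G t)) has_real_derivative (N' t + (\<beta> + g t) * N t) * exp (\<beta> * t + G t)) (at t)"
      by (auto intro!: derivative_eq_intros dN dG t simp: algebra_simps)
    moreover have "0 \<le> (N' t + (\<beta> + g t) * N t) * exp (\<beta> * t + G t)"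
      using N'b[OF t] by (intro mult_nonneg_nonneg) auto
    ultimately show "\<exists>y. ((\<lambda>t. N t * exp (\<beta> * t + G t)) has_real_derivative y) (at t) \<and> 0 \<le> y" by blast
  next
    show "continuous_on {a..b} (\<lambda>t. N t * exp (\<beta> * t + G t))" by (intro continuous_intros cN cont)
  qed
  then have "N a * exp (\<beta> * a + G a) * exp (- (\<beta> * a + G a)) \<le> N b * exp (\<beta> * b + G b) * exp (- (\<beta> * a + G a))"
    by (intro mult_right_mono) auto
  then have "N a \<le> N b * exp (\<beta> * (b - a) + (G b - G a))"
    by (simp add: mult.assoc exp_add[symmetric] algebra_simps)
  then show ?th2 by (simp add: N_def \<beta>_def)
qed

section \<open>The normalised Bessel function\<close>

text \<open>Taylor coefficients of the hypergeometric function 0F1(; \<nu>+1; -t/4). The Pochhammer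
  symbol in place of a quotient of Gamma values normalises the value at 0 to 1.\<close>

definition bcoef :: "real \<Rightarrow> nat \<Rightarrow> real" where
  "bcoef \<nu> k = (-1) ^ k / (4 ^ k * fact k * pochhammer (\<nu> + 1) k)"

definition bser :: "real \<Rightarrow> 'a::{real_normed_field,banach} \<Rightarrow> 'a" where
  "bser \<nu> t = (\<Sum>k. of_real (bcoef \<nu> k) * t ^ k)"

text \<open>\<open>J\<^sub>\<nu>(x) = x\<^sup>\<nu> \<phi>\<^sub>\<nu>(x) / (2\<^sup>\<nu> \<Gamma>(\<nu>+1))\<close>, with \<open>\<phi>\<^sub>\<nu>\<close> entire and even.\<close>
definition bphi :: "real \<Rightarrow> 'a::{real_normed_field,banach} \<Rightarrow> 'a" where
  "bphi \<nu> w = bser \<nu> (w\<^sup>2)"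

text \<open>The derivative of \<open>bphi\<close> as an explicit formula of order \<nu>+1: it is
  regular at 0 and, up to a power of the argument, a multiple of J of order \<nu>+1, the normaliser
  in \<open>fb_psi\<close>.\<close>

definition bphi' :: "real \<Rightarrow> 'a::{real_normed_field,banach} \<Rightarrow> 'a" where
  "bphi' \<nu> w = - (w / of_real (2 * (\<nu> + 1))) * bphi (\<nu> + 1) w"

lemma bcoef_0: "bcoef \<nu> 0 = 1"
  by (simp add: bcoef_def)

lemma bcoef_Suc:
  assumes "\<nu> > -1"
  shows "bcoef \<nu> (Suc k) = - bcoef \<nu> k / (4 * (real k + 1) * (\<nu> + 1 + real k))"
  using assms by (simp add: bcoef_def pochhammer_Suc mult_ac)

lemma bcoef_shift:
  assumes "\<nu> > -1"
  shows "(real k + 1) * bcoef \<nu> (Suc k) = - bcoef (\<nu> + 1) k / (4 * (\<nu> + 1))"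
  using assms by (simp add: bcoef_def pochhammer_rec mult_ac add_ac divide_simps)

lemma summable_bser:
  fixes t :: "'a::{real_normed_field,banach}"
  assumes nu: "\<nu> > -1"
  shows "summable (\<lambda>k. of_real (bcoef \<nu> k) * t ^ k)"
proof -
  have "(\<lambda>k. norm t / (4 * (real k + 1) * (\<nu> + 1 + real k))) \<longlonglongrightarrow> 0"
    by real_asymp
  then have "eventually (\<lambda>k. norm t / (4 * (real k + 1) * (\<nu> + 1 + real k)) < 1/2) sequentially"
    by (rule order_tendstoD) simp
  then obtain N where N: "\<And>k. k \<ge> N \<Longrightarrow> norm t / (4 * (real k + 1) * (\<nu> + 1 + real k)) < 1/2"
    by (auto simp: eventually_sequentially)
  show ?thesis
  proof (rule summable_ratio_test[of "1/2" N])
    fix n assume n: "N \<le> n"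
    have "norm (of_real (bcoef \<nu> (Suc n)) * t ^ Suc n :: 'a) =
        norm t / (4 * (real n + 1) * (\<nu> + 1 + real n)) * norm (of_real (bcoef \<nu> n) * t ^ n :: 'a)"
    proof -
      have 1: "norm (of_real a * t ^ k :: 'a) = \<bar>a\<bar> * norm t ^ k" for a k
        by (simp add: norm_mult norm_power)
      have 2: "\<bar>bcoef \<nu> (Suc n)\<bar> = \<bar>bcoef \<nu> n\<bar> / (4 * (real n + 1) * (\<nu> + 1 + real n))"
        using nu unfolding bcoef_Suc[OF nu] by (simp add: abs_mult)
      show ?thesis unfolding 1 2 by simp
    qed
    also have "\<dots> \<le> 1/2 * norm (of_real (bcoef \<nu> n) * t ^ n :: 'a)"
      using N[OF n] by (intro mult_right_mono) auto
    finally show "norm (of_real (bcoef \<nu> (Suc n)) * t ^ Suc n :: 'a) \<le> 1/2 * norm (of_real (bcoef \<nu> n) * t ^ n :: 'a)" .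
  qed simp
qed

lemma bser_has_field_derivative:
  fixes t :: "'a::{real_normed_field,banach}"
  assumes nu: "\<nu> > -1"
  shows "(bser \<nu> has_field_derivative - bser (\<nu> + 1) t / of_real (4 * (\<nu> + 1))) (at t)"
proof -
  have "(bser \<nu> has_field_derivative (\<Sum>k. diffs (\<lambda>k. of_real (bcoef \<nu> k)) k * t ^ k)) (at t)"
    unfolding bser_def[abs_def]
    by (rule termdiffs_strong_converges_everywhere[OF summable_bser[OF nu]])
  also have "(\<lambda>k. diffs (\<lambda>k. of_real (bcoef \<nu> k)) k * t ^ k) =
      (\<lambda>k. - 1 / of_real (4 * (\<nu> + 1)) * (of_real (bcoef (\<nu> + 1) k) * t ^ k))"
  proof
    fix k
    have "diffs (\<lambda>k. of_real (bcoef \<nu> k)) k = (of_real ((real k + 1) * bcoef \<nu> (Suc k)) :: 'a)"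
      by (simp add: diffs_def)
    then show "diffs (\<lambda>k. of_real (bcoef \<nu> k)) k * t ^ k =
        - 1 / of_real (4 * (\<nu> + 1)) * (of_real (bcoef (\<nu> + 1) k) * t ^ k)"
      unfolding bcoef_shift[OF nu] by simp
  qed
  also have "(\<Sum>k. - 1 / of_real (4 * (\<nu> + 1)) * (of_real (bcoef (\<nu> + 1) k) * t ^ k)) =
      - 1 / of_real (4 * (\<nu> + 1)) * bser (\<nu> + 1) t"
    unfolding bser_def by (rule suminf_mult) (use nu in \<open>auto intro!: summable_bser\<close>)
  finally show ?thesis by simp
qed

text \<open>Contiguity relation, the power series form of J_\<nu> + J_(\<nu>+2) = (2(\<nu>+1)/x)
  J_(\<nu>+1). It is what closes the system of derivatives into the Bessel equation.\<close>

lemma bser_recurrence: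
  fixes t :: "'a::{real_normed_field,banach}"
  assumes nu: "\<nu> > -1"
  shows "t / of_real (4 * (\<nu> + 1) * (\<nu> + 2)) * bser (\<nu> + 2) t = bser (\<nu> + 1) t - bser \<nu> t"
proof -
  have s: "summable (\<lambda>k. of_real (bcoef \<mu> k) * t ^ k)" if "\<mu> \<ge> \<nu>" for \<mu>
    using nu that by (intro summable_bser) auto
  have e: "of_real (bcoef (\<nu> + 1) (Suc k)) * t ^ Suc k - of_real (bcoef \<nu> (Suc k)) * t ^ Suc k =
      t / of_real (4 * (\<nu> + 1) * (\<nu> + 2)) * (of_real (bcoef (\<nu> + 2) k) * t ^ k)" for k
  proof -
    have "bcoef (\<nu> + 1) (Suc k) - bcoef \<nu> (Suc k) = 1 / (4 * (\<nu> + 1) * (\<nu> + 2)) * bcoef (\<nu> + 2) k"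
    proof -
      have p2: "pochhammer (\<nu> + 2) (Suc k) = (\<nu> + 2) * pochhammer (\<nu> + 3) k"
        by (subst pochhammer_rec) (simp add: add_ac)
      have "pochhammer (\<nu> + 1) (Suc k) * (\<nu> + 2 + real k) = (\<nu> + 1) * (pochhammer (\<nu> + 2) k * (\<nu> + 2 + real k))"
        by (subst pochhammer_rec) (simp add: add_ac)
      also have "pochhammer (\<nu> + 2) k * (\<nu> + 2 + real k) = (\<nu> + 2) * pochhammer (\<nu> + 3) k"
        unfolding p2[symmetric] by (simp add: pochhammer_Suc mult_ac)
      finally have p: "pochhammer (\<nu> + 1) (Suc k) * (\<nu> + 2 + real k) = (\<nu> + 1) * (\<nu> + 2) * pochhammer (\<nu> + 3) k"
        by (simp add: mult_ac)
      have pos: "pochhammer (\<nu> + 3) k > 0" "pochhammer (\<nu> + 1) (Suc k) > 0" using nu by (auto intro!: pochhammer_pos)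
      have p1: "pochhammer (\<nu> + 1) (Suc k) = (\<nu> + 1) * (\<nu> + 2) * pochhammer (\<nu> + 3) k / (\<nu> + 2 + real k)"
        using p nu by (simp add: field_simps)
      have "bcoef (\<nu> + 1) (Suc k) - bcoef \<nu> (Suc k) = (-1) ^ Suc k / (4 ^ Suc k * fact (Suc k)) *
          (1 / pochhammer (\<nu> + 2) (Suc k) - 1 / pochhammer (\<nu> + 1) (Suc k))"
      proof -
        have "bcoef \<mu> (Suc k) = (-1) ^ Suc k / (4 ^ Suc k * fact (Suc k)) * (1 / pochhammer (\<mu> + 1) (Suc k))" for \<mu>
          by (simp only: bcoef_def times_divide_times_eq mult_1_right)
        moreover have "\<nu> + 1 + 1 = \<nu> + 2" by simp
        ultimately show ?thesis by (simp only: right_diff_distrib)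
      qed
      also have "1 / pochhammer (\<nu> + 2) (Suc k) - 1 / pochhammer (\<nu> + 1) (Suc k) =
          - (real k + 1) / ((\<nu> + 1) * (\<nu> + 2) * pochhammer (\<nu> + 3) k)"
        unfolding p2 p1 using nu pos(1) by (simp add: divide_simps)
      finally have D: "bcoef (\<nu> + 1) (Suc k) - bcoef \<nu> (Suc k) = (-1) ^ Suc k / (4 ^ Suc k * fact (Suc k)) *
          (- (real k + 1) / ((\<nu> + 1) * (\<nu> + 2) * pochhammer (\<nu> + 3) k))" .
      have B: "bcoef (\<nu> + 2) k = (-1) ^ k / (4 ^ k * fact k * pochhammer (\<nu> + 3) k)"
        by (simp add: bcoef_def add_ac)
      show ?thesis unfolding D B using nu pos(1) by (simp add: divide_simps) (simp add: algebra_simps)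
    qed
    then show ?thesis
      by (simp add: left_diff_distrib[symmetric] of_real_diff[symmetric] del: of_real_diff)
  qed
  have "bser (\<nu> + 1) t - bser \<nu> t = (\<Sum>k. of_real (bcoef (\<nu> + 1) k) * t ^ k - of_real (bcoef \<nu> k) * t ^ k)"
    unfolding bser_def by (rule suminf_diff) (auto intro: s)
  \<comment> \<open>Both series start with 1, so the constant terms cancel and the index can be
    shifted.\<close>
  also have "\<dots> = (\<Sum>k. of_real (bcoef (\<nu> + 1) (Suc k)) * t ^ Suc k - of_real (bcoef \<nu> (Suc k)) * t ^ Suc k)"
    using suminf_split_head[of "\<lambda>k. of_real (bcoef (\<nu> + 1) k) * t ^ k - of_real (bcoef \<nu> k) * t ^ k"]
    by (simp add: summable_diff s bcoef_0)
  also have "\<dots> = t / of_real (4 * (\<nu> + 1) * (\<nu> + 2)) * bser (\<nu> + 2) t"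
    unfolding e bser_def by (rule suminf_mult) (auto intro: s)
  finally show ?thesis by simp
qed

lemma bphi_has_field_derivative:
  assumes nu: "\<nu> > -1"
  shows "(bphi \<nu> has_field_derivative bphi' \<nu> w) (at w)"
proof -
  have "((\<lambda>w. bser \<nu> (w\<^sup>2)) has_field_derivative - bser (\<nu> + 1) (w\<^sup>2) / of_real (4 * (\<nu> + 1)) * (2 * w)) (at w)"
    by (rule DERIV_chain'[OF _ bser_has_field_derivative[OF nu]]) (auto intro!: derivative_eq_intros)
  moreover have "- bser (\<nu> + 1) (w\<^sup>2) / of_real (4 * (\<nu> + 1)) * (2 * w) = bphi' \<nu> w"
  proof -
    have "of_real (4 * (\<nu> + 1)) = (2 * of_real (2 * (\<nu> + 1)) :: 'a)" by simp
    moreover have "of_real (2 * (\<nu> + 1)) \<noteq> (0 :: 'a)" unfolding of_real_eq_0_iff using nu by simp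
    ultimately show ?thesis unfolding bphi'_def bphi_def by (simp add: field_simps del: of_real_mult of_real_add)
  qed
  ultimately show ?thesis unfolding bphi_def[abs_def] by simp
qed

text \<open>The radial Bessel equation \<phi>'' + (2\<nu>+1)/w \<phi>' + \<phi> = 0. Differentiating
  the formula for \<open>bphi'\<close> first produces order \<nu>+2, which
  \<open>bser_recurrence\<close> eliminates.\<close>

lemma bphi'_has_field_derivative:
  assumes nu: "\<nu> > -1" and w: "w \<noteq> 0"
  shows "(bphi' \<nu> has_field_derivative - bphi \<nu> w - of_real (2 * \<nu> + 1) / w * bphi' \<nu> w) (at w)"
proof -

  have "(bphi' \<nu> has_field_derivative - (1 / of_real (2 * (\<nu> + 1))) * bphi (\<nu> + 1) w
      + (- (w / of_real (2 * (\<nu> + 1))) * bphi' (\<nu> + 1) w)) (at w)"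
  proof -
    have d1: "((\<lambda>w. - (w / of_real (2 * (\<nu> + 1)))) has_field_derivative - (1 / of_real (2 * (\<nu> + 1)))) (at w)"
      by (intro DERIV_minus DERIV_cdivide DERIV_ident)
    have "\<nu> + 1 > -1" using nu by simp
    note DERIV_mult[OF d1 bphi_has_field_derivative[OF this]]
    then show ?thesis unfolding bphi'_def[of \<nu>, abs_def] by (simp only: mult.commute)
  qed
  moreover have "w\<^sup>2 / of_real (4 * (\<nu> + 1) * (\<nu> + 2)) * bphi (\<nu> + 2) w = bphi (\<nu> + 1) w - bphi \<nu> w"
    unfolding bphi_def by (rule bser_recurrence[OF nu])
  moreover have "- (w / of_real (2 * (\<nu> + 1))) * bphi' (\<nu> + 1) w = w\<^sup>2 / of_real (4 * (\<nu> + 1) * (\<nu> + 2)) * bphi (\<nu> + 2) w"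
  proof -
    have "of_real (4 * (\<nu> + 1) * (\<nu> + 2)) = (of_real (2 * (\<nu> + 1)) * of_real (2 * (\<nu> + 2)) :: 'a)"
      unfolding of_real_mult[symmetric] by (rule arg_cong[where f = of_real]) (simp add: algebra_simps)
    moreover have "\<nu> + 1 + 1 = \<nu> + 2" by simp
    moreover have "- (w / a) * (- (w / b) * X) = w\<^sup>2 / (a * b) * X" for a b X :: 'a
      by (simp add: power2_eq_square)
    ultimately show ?thesis unfolding bphi'_def by (simp only:)
  qed
  moreover have "- (1 / of_real (2 * (\<nu> + 1))) * bphi (\<nu> + 1) w + (bphi (\<nu> + 1) w - bphi \<nu> w)
     = - bphi \<nu> w - of_real (2 * \<nu> + 1) / w * bphi' \<nu> w"
  proof -
    have "of_real (2 * \<nu> + 1) / w * bphi' \<nu> w = - (of_real (2 * \<nu> + 1) / of_real (2 * (\<nu> + 1))) * bphi (\<nu> + 1) w"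
    proof -
      have "c / w * (- (w / a) * X) = - (c / a) * X" for a c X :: 'a
        using w by (simp add: mult_ac)
      then show ?thesis unfolding bphi'_def .
    qed
    moreover have "(of_real (2 * \<nu> + 1) / of_real (2 * (\<nu> + 1)) :: 'a) = 1 - 1 / of_real (2 * (\<nu> + 1))"
    proof -
      have "of_real (2 * \<nu> + 1) = (of_real (2 * (\<nu> + 1)) - 1 :: 'a)" by simp
      moreover have "of_real (2 * (\<nu> + 1)) \<noteq> (0 :: 'a)" unfolding of_real_eq_0_iff using nu by simp
      ultimately show ?thesis by (metis (no_types) diff_divide_distrib divide_self)
    qed
    moreover have "- r * X + (X - Y) = - Y - (- (1 - r) * X)" for r X Y :: 'a
      by (simp add: algebra_simps)
    ultimately show ?thesis by (simp only:)
  qed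
  ultimately show ?thesis by (simp only:)
qed

lemma bphi_of_real: "bphi \<nu> (of_real x) = (of_real (bphi \<nu> x) :: 'a::{real_normed_field,banach})"
  if "\<nu> > -1"
proof -
  have "(\<lambda>k. of_real (of_real (bcoef \<nu> k) * (x\<^sup>2) ^ k)) sums (of_real (bser \<nu> (x\<^sup>2)) :: 'a)"
    unfolding sums_of_real_iff bser_def using summable_bser[OF that] by (rule summable_sums)
  then show ?thesis unfolding bphi_def bser_def by (simp add: sums_iff)
qed

lemma bphi'_of_real: "bphi' \<nu> (of_real x) = (of_real (bphi' \<nu> x) :: 'a::{real_normed_field,banach})"
  if "\<nu> > -1"
  using that by (simp add: bphi'_def bphi_of_real)

lemma bphi_minus: "bphi \<nu> (- w) = bphi \<nu> w"
  by (simp add: bphi_def)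

lemma bphi'_minus: "bphi' \<nu> (- w) = - bphi' \<nu> w"
  by (simp add: bphi'_def bphi_minus)

lemma bphi_0 [simp]: "bphi \<nu> 0 = (1 :: 'a::{real_normed_field,banach})"
  unfolding bphi_def bser_def
  using powser_zero[of "\<lambda>k. of_real (bcoef \<nu> k) :: 'a"] by (simp add: bcoef_def)

lemma bphi_cnj: "bphi \<nu> (cnj w) = cnj (bphi \<nu> w)" if "\<nu> > -1"
proof -
  have "(\<lambda>k. of_real (bcoef \<nu> k) * (w\<^sup>2) ^ k) sums bser \<nu> (w\<^sup>2)"
    unfolding bser_def using summable_bser[OF that] by (rule summable_sums)
  then have "(\<lambda>k. cnj (of_real (bcoef \<nu> k) * (w\<^sup>2) ^ k)) sums cnj (bser \<nu> (w\<^sup>2))"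
    by (subst sums_cnj)
  then show ?thesis unfolding bphi_def bser_def by (simp add: sums_iff)
qed

text \<open>On the imaginary axis the signs of the coefficients cancel against those of the powers,
  leaving nonnegative terms with first term 1. This excludes the zeros with negative square, which
  Green's identity alone cannot.\<close>

lemma bphi_imaginary_nonzero:
  assumes nu: "\<nu> > -1" shows "bphi \<nu> (\<i> * of_real y) \<noteq> 0"
proof -
  have "bser \<nu> (- (y\<^sup>2)) > 0"
  proof -
    have e: "bcoef \<nu> k * (- (y\<^sup>2)) ^ k = (y\<^sup>2) ^ k / (4 ^ k * fact k * pochhammer (\<nu> + 1) k)" for k
    proof -
      have "(-1) ^ k * (- (y\<^sup>2)) ^ k = (y\<^sup>2) ^ k" by (simp flip: power_mult_distrib)
      then show ?thesis unfolding bcoef_def by simp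
    qed
    have "0 < (\<Sum>k. of_real (bcoef \<nu> k) * (- (y\<^sup>2)) ^ k)"
    proof (rule suminf_pos2[of _ 0])
      show "summable (\<lambda>k. of_real (bcoef \<nu> k) * (- y\<^sup>2) ^ k)" by (rule summable_bser[OF nu])
      show "0 \<le> of_real (bcoef \<nu> n) * (- y\<^sup>2) ^ n" for n
        using nu by (auto simp: e intro!: divide_nonneg_nonneg mult_nonneg_nonneg pochhammer_nonneg)
    qed (simp add: bcoef_def)
    then show ?thesis by (simp add: bser_def)
  qed
  moreover have "bphi \<nu> (\<i> * of_real y) = of_real (bser \<nu> (- (y\<^sup>2)))"
  proof -
    have "(\<lambda>k. of_real (of_real (bcoef \<nu> k) * (- (y\<^sup>2)) ^ k)) sums (of_real (bser \<nu> (- (y\<^sup>2))) :: complex)"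
      unfolding sums_of_real_iff bser_def using summable_bser[OF nu] by (rule summable_sums)
    then show ?thesis unfolding bphi_def bser_def by (simp add: sums_iff power_mult_distrib)
  qed
  ultimately show ?thesis by simp
qed

lemma besselJ_bphi:
  assumes nu: "\<nu> > -1" and x: "x > 0"
  shows "besselJ \<nu> x = x powr \<nu> / (2 powr \<nu> * Gamma (\<nu> + 1)) * bphi \<nu> x"
proof -
  have e: "(-1) ^ k / (fact k * Gamma (real k + \<nu> + 1)) * (x / 2) powr (2 * real k + \<nu>) =
     x powr \<nu> / (2 powr \<nu> * Gamma (\<nu> + 1)) * (of_real (bcoef \<nu> k) * (x\<^sup>2) ^ k)" for k
  proof -
    have "pochhammer (\<nu> + 1) k = Gamma (real k + \<nu> + 1) / Gamma (\<nu> + 1)"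
      using nu by (subst pochhammer_Gamma) (auto simp: nonpos_Ints_def add_ac)
    moreover have "Gamma (real k + \<nu> + 1) > 0" "Gamma (\<nu> + 1) > 0" using nu by (auto intro!: Gamma_real_pos)
    moreover have "(x / 2) powr (2 * real k + \<nu>) = x powr \<nu> / 2 powr \<nu> * ((x\<^sup>2) ^ k / 4 ^ k)"
    proof -
      have "(x / 2) powr (2 * real k) = ((x / 2)\<^sup>2) ^ k"
        using x powr_realpow[of "x/2" "2 * k"] by (simp add: power_mult)
      also have "\<dots> = (x\<^sup>2) ^ k / 4 ^ k" by (simp add: power_divide)
      finally show ?thesis using x by (simp add: powr_add powr_divide mult_ac)
    qed
    ultimately show ?thesis by (simp add: bcoef_def mult_ac)
  qed
  show ?thesis unfolding besselJ_def bphi_def bser_def e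
    by (rule suminf_mult) (rule summable_bser[OF nu])
qed

text \<open>The normaliser of \<open>fb_psi\<close> thus carries the same prefactor that relates
  J_\<nu> to \<open>bphi\<close>, so the Gamma constants cancel in the orthonormal system.\<close>

lemma besselJ_Suc_bphi':
  assumes nu: "\<nu> > -1" and x: "x > 0"
  shows "besselJ (\<nu> + 1) x = - (x powr \<nu> / (2 powr \<nu> * Gamma (\<nu> + 1))) * bphi' \<nu> x"
proof -
  have "Gamma (\<nu> + 2) = (\<nu> + 1) * Gamma (\<nu> + 1)"
    using Gamma_plus1[of "\<nu> + 1"] nu by (auto simp: nonpos_Ints_def add_ac)
  then show ?thesis using nu x
    by (simp add: besselJ_bphi bphi'_def powr_add field_simps add_ac)
qed

section \<open>Asymptotics in the right half plane\<close>

text \<open>A multiple of sqrt(w) J_\<nu>(w): the factor w^(\<nu>+1/2) removes the first-order term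
  of the Bessel equation. The principal branch confines it to the plane cut along the nonpositive
  reals.\<close>

definition bU :: "real \<Rightarrow> complex \<Rightarrow> complex" where
  "bU \<nu> w = w powr of_real (\<nu> + 1/2) * bphi \<nu> w"

definition bU' :: "real \<Rightarrow> complex \<Rightarrow> complex" where
  "bU' \<nu> w = w powr of_real (\<nu> + 1/2) * (bphi' \<nu> w + of_real (\<nu> + 1/2) / w * bphi \<nu> w)"

lemma bU_has_field_derivative:
  assumes nu: "\<nu> > -1" and w: "w \<notin> \<real>\<^sub>\<le>\<^sub>0"
  shows "(bU \<nu> has_field_derivative bU' \<nu> w) (at w)"
proof -
  have w0: "w \<noteq> 0" using w by auto
  define a where "a = complex_of_real (\<nu> + 1/2)"
  have p: "((\<lambda>w. w powr a) has_field_derivative a * (w powr a / w)) (at w)"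
    using has_field_derivative_powr[OF w, of a] w0 by (simp add: powr_diff)
  have "((\<lambda>w. w powr a * bphi \<nu> w) has_field_derivative (a * (w powr a / w) * bphi \<nu> w + bphi' \<nu> w * w powr a)) (at w)"
    by (rule DERIV_mult[OF p bphi_has_field_derivative[OF nu]])
  then show ?thesis unfolding bU_def[abs_def] bU'_def a_def[symmetric] by (simp add: algebra_simps)
qed

lemma bU'_has_field_derivative:
  assumes nu: "\<nu> > -1" and w: "w \<notin> \<real>\<^sub>\<le>\<^sub>0"
  shows "(bU' \<nu> has_field_derivative (of_real (\<nu>\<^sup>2 - 1/4) / w\<^sup>2 - 1) * bU \<nu> w) (at w)"
proof -
  have w0: "w \<noteq> 0" using w by auto
  define a where "a = complex_of_real (\<nu> + 1/2)"
  have p: "((\<lambda>w. w powr a) has_field_derivative a * (w powr a / w)) (at w)"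
    using has_field_derivative_powr[OF w, of a] w0 by (simp add: powr_diff)
  have i: "((\<lambda>w. a / w) has_field_derivative - a / w\<^sup>2) (at w)"
    using w0 by (auto intro!: derivative_eq_intros simp: power2_eq_square)
  have nu2: "of_real (2 * \<nu> + 1) = 2 * a" "of_real (\<nu>\<^sup>2 - 1/4) = a * (a - 1)"
    by (simp_all add: a_def power2_eq_square algebra_simps)
  have "((\<lambda>w. w powr a * (bphi' \<nu> w + a / w * bphi \<nu> w)) has_field_derivative
     (a * (w powr a / w) * (bphi' \<nu> w + a / w * bphi \<nu> w) +
      ((- bphi \<nu> w - of_real (2 * \<nu> + 1) / w * bphi' \<nu> w) + (- a / w\<^sup>2 * bphi \<nu> w + bphi' \<nu> w * (a / w))) * w powr a)) (at w)"
    by (rule DERIV_mult[OF p DERIV_add[OF bphi'_has_field_derivative[OF nu w0] DERIV_mult[OF i bphi_has_field_derivative[OF nu]]]])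
  moreover have "(a * (w powr a / w) * (bphi' \<nu> w + a / w * bphi \<nu> w) +
      ((- bphi \<nu> w - of_real (2 * \<nu> + 1) / w * bphi' \<nu> w) + (- a / w\<^sup>2 * bphi \<nu> w + bphi' \<nu> w * (a / w))) * w powr a)
      = (of_real (\<nu>\<^sup>2 - 1/4) / w\<^sup>2 - 1) * (w powr a * bphi \<nu> w)"
    unfolding nu2 using w0 by (simp add: field_simps power2_eq_square)
  ultimately show ?thesis unfolding bU'_def[abs_def] bU_def a_def[symmetric] by simp
qed

lemma bU_of_real:
  assumes "\<nu> > -1" "a > 0"
  shows "bU \<nu> (of_real a) = of_real (a powr (\<nu> + 1/2) * bphi \<nu> a)"
    and "bU' \<nu> (of_real a) = of_real (a powr (\<nu> + 1/2) * (bphi' \<nu> a + (\<nu> + 1/2) / a * bphi \<nu> a))"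
  using assms by (simp_all add: bU_def bU'_def bphi_of_real bphi'_of_real flip: powr_of_real)

lemma norm_bU: "norm (bU \<nu> w) = norm w powr (\<nu> + 1/2) * norm (bphi \<nu> w)"
  by (simp add: bU_def norm_mult norm_powr_real_powr')

text \<open>Two points of equal modulus r in the closed first quadrant span at most a right angle,
  so the mixed term of |p|^2 is nonnegative and the chord stays at distance r / sqrt 2 from 0. A
  chord replaces the arc because \<open>energy_bound\<close> works along straight paths.\<close>

lemma chord_bounds:
  assumes w: "0 \<le> Re w" "0 \<le> Im w" "norm w = r" and r: "r > 0"
    and p: "p \<in> closed_segment (of_real r) w"
  shows "r\<^sup>2 / 2 \<le> (norm p)\<^sup>2" "0 \<le> Re p" "0 \<le> Im p" "Im p \<le> Im w" "p \<notin> \<real>\<^sub>\<le>\<^sub>0"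
proof -
  obtain s where s: "0 \<le> s" "s \<le> 1" "p = (1 - s) *\<^sub>R of_real r + s *\<^sub>R w"
    using p by (auto simp: in_segment)
  have Rp: "Re p = (1 - s) * r + s * Re w" and Ip: "Im p = s * Im w" using s(3) by simp_all
  show "0 \<le> Re p" "0 \<le> Im p" using s w r by (auto simp: Rp Ip)
  show "Im p \<le> Im w" using s w unfolding Ip by (simp add: mult_left_le_one_le)
  have rw: "r\<^sup>2 = (Re w)\<^sup>2 + (Im w)\<^sup>2" using w(3) by (auto simp: cmod_power2)
  have "(norm p)\<^sup>2 = ((1 - s) * r + s * Re w)\<^sup>2 + (s * Im w)\<^sup>2" by (simp add: cmod_power2 Rp Ip)
  also have "\<dots> = (1 - s)\<^sup>2 * r\<^sup>2 + s\<^sup>2 * ((Re w)\<^sup>2 + (Im w)\<^sup>2) + 2 * (s * (1 - s)) * (r * Re w)"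
    by (simp add: power2_eq_square algebra_simps)
  also have "\<dots> \<ge> (1 - s)\<^sup>2 * r\<^sup>2 + s\<^sup>2 * r\<^sup>2"
    unfolding rw[symmetric] using s w r by simp
  also have "(1 - s)\<^sup>2 * r\<^sup>2 + s\<^sup>2 * r\<^sup>2 \<ge> r\<^sup>2 / 2"
  proof -
    have "0 \<le> (2 * s - 1)\<^sup>2 * r\<^sup>2 / 2" by simp
    then show ?thesis by (simp add: power2_eq_square algebra_simps)
  qed
  finally show np: "r\<^sup>2 / 2 \<le> (norm p)\<^sup>2" .
  show "p \<notin> \<real>\<^sub>\<le>\<^sub>0"
  proof
    assume "p \<in> \<real>\<^sub>\<le>\<^sub>0"
    then have "Re p \<le> 0" "Im p = 0" by (auto simp: complex_nonpos_Reals_iff)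
    with \<open>0 \<le> Re p\<close> have "p = 0" by (simp add: complex_eq_iff)
    with np r show False by simp
  qed
qed

lemma chord_length:
  assumes w: "0 \<le> Re w" "norm w = r"
  shows "norm (w - of_real r) \<le> 2 * r"
  using norm_triangle_ineq4[of w "of_real r"] w norm_ge_zero[of w] by simp

text \<open>The chord rises by Im w in total, which is the whole exponential growth. On it the
  potential is at most 2|m|/r^2 with m = \<nu>^2 - 1/4, and its length is at most 2r, whence the
  error 4|m|/r.\<close>

lemma bU_energy_chord:
  assumes nu: "\<nu> > -1" and w: "0 \<le> Re w" "0 \<le> Im w" "norm w = r" and r: "r > 0"
  shows "(norm (bU' \<nu> w))\<^sup>2 + (norm (bU \<nu> w))\<^sup>2 \<le>
     ((norm (bU' \<nu> (of_real r)))\<^sup>2 + (norm (bU \<nu> (of_real r)))\<^sup>2) * exp (2 * Im w + 4 * \<bar>\<nu>\<^sup>2 - 1/4\<bar> / r)"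
proof (cases "w = of_real r")
  case True
  have "1 \<le> exp (2 * Im w + 4 * \<bar>\<nu>\<^sup>2 - 1/4\<bar> / r)" using w r by simp
  then show ?thesis using mult_left_mono[of 1 _ "(norm (bU' \<nu> w))\<^sup>2 + (norm (bU \<nu> w))\<^sup>2"] True by simp
next
  case False
  define d where "d = norm (w - of_real r)"
  define e where "e = (w - of_real r) / of_real d"
  define m where "m = \<nu>\<^sup>2 - 1/4"
  define \<gamma> where "\<gamma> = (\<lambda>t. of_real r + of_real t * e)"
  have d: "d > 0" using False by (simp add: d_def)
  have ne: "norm e = 1" using d by (simp add: e_def d_def norm_divide)
  have seg: "\<gamma> t \<in> closed_segment (of_real r) w" if "0 \<le> t" "t \<le> d" for t
    unfolding in_segment using that d
    by (intro exI[of _ "t / d"]) (simp add: \<gamma>_def e_def scaleR_conv_of_real field_simps)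
  note cb = chord_bounds[OF w r seg]
  have dg: "(\<gamma> has_vector_derivative e) (at t)" for t
    unfolding \<gamma>_def has_vector_derivative_def
    by (auto intro!: derivative_eq_intros simp: scaleR_conv_of_real)
  have du: "((\<lambda>t. bU \<nu> (\<gamma> t)) has_vector_derivative e * bU' \<nu> (\<gamma> t)) (at t)" if "0 \<le> t" "t \<le> d" for t
    using field_vector_diff_chain_at[OF dg bU_has_field_derivative[OF nu cb(5)[OF that]]] by (simp add: o_def)
  have du1: "((\<lambda>t. bU' \<nu> (\<gamma> t)) has_vector_derivative e * ((of_real m / (\<gamma> t)\<^sup>2 - 1\<^sup>2) * bU \<nu> (\<gamma> t))) (at t)" if "0 \<le> t" "t \<le> d" for t
    using field_vector_diff_chain_at[OF dg bU'_has_field_derivative[OF nu cb(5)[OF that]]] by (simp add: o_def m_def)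
  have "(norm (bU' \<nu> (\<gamma> d)))\<^sup>2 + (norm (1::complex))\<^sup>2 * (norm (bU \<nu> (\<gamma> d)))\<^sup>2 \<le>
     ((norm (bU' \<nu> (\<gamma> 0)))\<^sup>2 + (norm (1::complex))\<^sup>2 * (norm (bU \<nu> (\<gamma> 0)))\<^sup>2) *
       exp (2 * \<bar>Im (e * 1)\<bar> * (d - 0) + (2 * \<bar>m\<bar> / r\<^sup>2 * d - 2 * \<bar>m\<bar> / r\<^sup>2 * 0))"
  proof (rule energy_bound(1)[where Q = "\<lambda>t. of_real m / (\<gamma> t)\<^sup>2" and G = "\<lambda>t. 2 * \<bar>m\<bar> / r\<^sup>2 * t" and g = "\<lambda>t. 2 * \<bar>m\<bar> / r\<^sup>2"])
    show "continuous_on {0..d} (\<lambda>t. bU \<nu> (\<gamma> t))"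
      by (auto intro!: continuous_at_imp_continuous_on has_vector_derivative_continuous[OF du])
    show "continuous_on {0..d} (\<lambda>t. bU' \<nu> (\<gamma> t))"
      by (auto intro!: continuous_at_imp_continuous_on has_vector_derivative_continuous[OF du1])
    fix t assume t: "0 < t" "t < d"
    show "((\<lambda>t. bU \<nu> (\<gamma> t)) has_vector_derivative e * bU' \<nu> (\<gamma> t)) (at t)" using du t by simp
    show "((\<lambda>t. bU' \<nu> (\<gamma> t)) has_vector_derivative e * (of_real m / (\<gamma> t)\<^sup>2 - 1\<^sup>2) * bU \<nu> (\<gamma> t)) (at t)"
      using du1 t by (simp add: mult.assoc)
    show "((\<lambda>t. 2 * \<bar>m\<bar> / r\<^sup>2 * t) has_real_derivative 2 * \<bar>m\<bar> / r\<^sup>2) (at t)"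
      by (rule DERIV_cmult_Id)
    have "norm (of_real m / (\<gamma> t)\<^sup>2) = \<bar>m\<bar> / (norm (\<gamma> t))\<^sup>2" by (simp add: norm_divide norm_power)
    also have "\<dots> \<le> \<bar>m\<bar> / (r\<^sup>2 / 2)" using cb(1)[of t] t r by (intro divide_left_mono mult_pos_pos) (auto intro: less_le_trans[of _ "r\<^sup>2/2"])
    finally show "norm (of_real m / (\<gamma> t)\<^sup>2) \<le> norm (1::complex) * (2 * \<bar>m\<bar> / r\<^sup>2)" by (simp add: mult.commute)
  qed (use d ne r in \<open>auto intro!: continuous_intros\<close>)
  moreover have "\<gamma> d = w" "\<gamma> 0 = of_real r" using d by (simp_all add: \<gamma>_def e_def)
  moreover have "2 * \<bar>Im e\<bar> * d = 2 * Im w" using d w by (simp add: e_def abs_divide)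
  moreover have "2 * \<bar>m\<bar> / r\<^sup>2 * d - 2 * \<bar>m\<bar> / r\<^sup>2 * 0 \<le> 4 * \<bar>m\<bar> / r"
  proof -
    have "2 * \<bar>m\<bar> / r\<^sup>2 * d \<le> 2 * \<bar>m\<bar> / r\<^sup>2 * (2 * r)"
      unfolding d_def by (rule mult_left_mono[OF chord_length[OF w(1,3)]]) auto
    also have "\<dots> = 4 * \<bar>m\<bar> / r" using r by (simp add: power2_eq_square)
    finally show ?thesis by simp
  qed
  ultimately have "(norm (bU' \<nu> w))\<^sup>2 + (norm (bU \<nu> w))\<^sup>2 \<le>
     ((norm (bU' \<nu> (of_real r)))\<^sup>2 + (norm (bU \<nu> (of_real r)))\<^sup>2) * exp (2 * Im w + (2 * \<bar>m\<bar> / r\<^sup>2 * d - 2 * \<bar>m\<bar> / r\<^sup>2 * 0))"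
    by simp
  also have "\<dots> \<le> ((norm (bU' \<nu> (of_real r)))\<^sup>2 + (norm (bU \<nu> (of_real r)))\<^sup>2) * exp (2 * Im w + 4 * \<bar>m\<bar> / r)"
    by (rule mult_left_mono) (use \<open>2 * \<bar>m\<bar> / r\<^sup>2 * d - 2 * \<bar>m\<bar> / r\<^sup>2 * 0 \<le> 4 * \<bar>m\<bar> / r\<close> in auto)
  finally show ?thesis by (simp add: m_def)
qed

lemma of_real_notin_nonpos: "a > 0 \<Longrightarrow> complex_of_real a \<notin> \<real>\<^sub>\<le>\<^sub>0"
  by (simp add: complex_nonpos_Reals_iff)

lemma bU_real_vector_derivative:
  assumes nu: "\<nu> > -1" and t: "t > 0"
  shows "((\<lambda>t. bU \<nu> (of_real t)) has_vector_derivative bU' \<nu> (of_real t)) (at t)"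
    and "((\<lambda>t. bU' \<nu> (of_real t)) has_vector_derivative (of_real (\<nu>\<^sup>2 - 1/4) / (of_real t)\<^sup>2 - 1) * bU \<nu> (of_real t)) (at t)"
  using has_vector_derivative_real_field[OF bU_has_field_derivative[OF nu of_real_notin_nonpos[OF t]]]
    has_vector_derivative_real_field[OF bU'_has_field_derivative[OF nu of_real_notin_nonpos[OF t]]] by simp_all

text \<open>On the real axis nothing grows and 1/t^2 is integrable at infinity: the energies at all
  points beyond b are comparable with one constant.\<close>

lemma bU_energy_real:
  assumes nu: "\<nu> > -1" and b: "0 < b" "b \<le> a"
  shows "(norm (bU' \<nu> (of_real a)))\<^sup>2 + (norm (bU \<nu> (of_real a)))\<^sup>2 \<le>
     ((norm (bU' \<nu> (of_real b)))\<^sup>2 + (norm (bU \<nu> (of_real b)))\<^sup>2) * exp (\<bar>\<nu>\<^sup>2 - 1/4\<bar> / b)"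
    and "(norm (bU' \<nu> (of_real b)))\<^sup>2 + (norm (bU \<nu> (of_real b)))\<^sup>2 \<le>
     ((norm (bU' \<nu> (of_real a)))\<^sup>2 + (norm (bU \<nu> (of_real a)))\<^sup>2) * exp (\<bar>\<nu>\<^sup>2 - 1/4\<bar> / b)"
proof -
  define m where "m = \<nu>\<^sup>2 - 1/4"
  have c1: "continuous_on {b..a} (\<lambda>t. bU \<nu> (of_real t))"
    using b by (auto intro!: continuous_at_imp_continuous_on has_vector_derivative_continuous[OF bU_real_vector_derivative(1)[OF nu]])
  have c2: "continuous_on {b..a} (\<lambda>t. bU' \<nu> (of_real t))"
    using b by (auto intro!: continuous_at_imp_continuous_on has_vector_derivative_continuous[OF bU_real_vector_derivative(2)[OF nu]])
  have c3: "continuous_on {b..a} (\<lambda>t. - \<bar>m\<bar> / t)" using b by (auto intro!: continuous_intros)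
  have d1: "((\<lambda>t. bU \<nu> (of_real t)) has_vector_derivative 1 * bU' \<nu> (of_real t)) (at t)" if "b < t" for t
    using bU_real_vector_derivative(1)[OF nu, of t] b that by simp
  have d2: "((\<lambda>t. bU' \<nu> (of_real t)) has_vector_derivative 1 * (of_real m / (of_real t)\<^sup>2 - 1\<^sup>2) * bU \<nu> (of_real t)) (at t)" if "b < t" for t
    using bU_real_vector_derivative(2)[OF nu, of t] b that by (simp add: m_def)
  have d3: "((\<lambda>t. - \<bar>m\<bar> / t) has_real_derivative \<bar>m\<bar> / t\<^sup>2) (at t)" if "b < t" for t
    using b that by (auto intro!: derivative_eq_intros simp: power2_eq_square)
  have d4: "norm (complex_of_real m / (of_real t)\<^sup>2) \<le> norm (1::complex) * (\<bar>m\<bar> / t\<^sup>2)" if "b < t" for t :: real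
    by (simp add: norm_divide norm_power)
  have le: "exp (2 * \<bar>Im (1 * 1)\<bar> * (a - b) + (- \<bar>m\<bar> / a - - \<bar>m\<bar> / b)) \<le> exp (\<bar>m\<bar> / b)" using b by simp
  have n1: "norm (1::complex) = 1" "(1::complex) \<noteq> 0" by simp_all
  show "(norm (bU' \<nu> (of_real a)))\<^sup>2 + (norm (bU \<nu> (of_real a)))\<^sup>2 \<le>
     ((norm (bU' \<nu> (of_real b)))\<^sup>2 + (norm (bU \<nu> (of_real b)))\<^sup>2) * exp (\<bar>\<nu>\<^sup>2 - 1/4\<bar> / b)"
    using energy_bound(1)[OF b(2) n1 c1 c2 c3 d1 d2 d3 d4]
      mult_left_mono[OF le, of "(norm (bU' \<nu> (of_real b)))\<^sup>2 + (norm (bU \<nu> (of_real b)))\<^sup>2"]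
    by (simp add: m_def)
  show "(norm (bU' \<nu> (of_real b)))\<^sup>2 + (norm (bU \<nu> (of_real b)))\<^sup>2 \<le>
     ((norm (bU' \<nu> (of_real a)))\<^sup>2 + (norm (bU \<nu> (of_real a)))\<^sup>2) * exp (\<bar>\<nu>\<^sup>2 - 1/4\<bar> / b)"
    using energy_bound(2)[OF b(2) n1 c1 c2 c3 d1 d2 d3 d4]
      mult_left_mono[OF le, of "(norm (bU' \<nu> (of_real a)))\<^sup>2 + (norm (bU \<nu> (of_real a)))\<^sup>2"]
    by (simp add: m_def)
qed

text \<open>Zero energy at b would propagate backwards to all of (0,b] and force \<open>bphi\<close>
  to vanish there, although it is 1 at 0.\<close>

lemma bU_energy_real_positive:
  assumes nu: "\<nu> > -1" and b: "0 < b"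
  shows "(norm (bU' \<nu> (of_real b)))\<^sup>2 + (norm (bU \<nu> (of_real b)))\<^sup>2 > 0"
proof (rule ccontr)
  assume "\<not> ?thesis"
  then have z: "(norm (bU' \<nu> (of_real b)))\<^sup>2 + (norm (bU \<nu> (of_real b)))\<^sup>2 = 0"
    by (smt (verit) zero_le_power2)
  have phi0: "bphi \<nu> c = 0" if "0 < c" "c \<le> b" for c
  proof -
    have "(norm (bU' \<nu> (of_real c)))\<^sup>2 + (norm (bU \<nu> (of_real c)))\<^sup>2 \<le> 0"
      using bU_energy_real(2)[OF nu that] z by simp
    then have "bU \<nu> (of_real c) = 0"
      by (smt (verit) norm_eq_zero power2_less_0 zero_eq_power2 zero_le_power2)
    then show ?thesis using that bU_of_real(1)[OF nu that(1)] by simp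
  qed
  have "isCont (bphi \<nu>) (0::real)" using bphi_has_field_derivative[OF nu] by (rule DERIV_isCont)
  then have "(bphi \<nu> \<longlongrightarrow> (1::real)) (at 0)" by (simp add: isCont_def)
  then have "(bphi \<nu> \<longlongrightarrow> (1::real)) (at_right 0)" by (rule tendsto_within_subset) simp
  moreover have "eventually (\<lambda>c. bphi \<nu> c = (0::real)) (at_right 0)"
    unfolding eventually_at_right_field using phi0 b by (intro exI[of _ b]) auto
  ultimately have "((\<lambda>_::real. 0::real) \<longlongrightarrow> 1) (at_right 0)" by (rule Lim_transform_eventually[of "bphi \<nu>"])
  then show False by (simp add: tendsto_const_iff)
qed

lemma bU_energy_real_bounds:
  assumes nu: "\<nu> > -1" and b: "0 < b"
  obtains c C where "0 < c" "c \<le> C"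
    "\<And>a. b \<le> a \<Longrightarrow> c \<le> (norm (bU' \<nu> (of_real a)))\<^sup>2 + (norm (bU \<nu> (of_real a)))\<^sup>2"
    "\<And>a. b \<le> a \<Longrightarrow> (norm (bU' \<nu> (of_real a)))\<^sup>2 + (norm (bU \<nu> (of_real a)))\<^sup>2 \<le> C"
proof -
  define N where "N = (\<lambda>a. (norm (bU' \<nu> (of_real a)))\<^sup>2 + (norm (bU \<nu> (of_real a)))\<^sup>2)"
  define E where "E = exp (\<bar>\<nu>\<^sup>2 - 1/4\<bar> / b)"
  have E: "E > 0" by (simp add: E_def)
  have Nb: "N b > 0" using bU_energy_real_positive[OF nu b] by (simp add: N_def)
  have 1: "N b / E \<le> N a" "N a \<le> N b * E" if "b \<le> a" for a
    using bU_energy_real[OF nu b that] E by (simp_all add: N_def E_def field_simps)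
  show thesis
  proof (rule that[of "N b / E" "N b * E"])
    show "0 < N b / E" using Nb E by simp
    show "N b / E \<le> N b * E" using 1[of b] by linarith
  qed (use 1 in \<open>auto simp: N_def\<close>)
qed

text \<open>The radius 1/2 leaves room for chords between points of modulus at least 1, which stay
  outside radius 1 / sqrt 2.\<close>

lemma bU_exponential_bound:
  assumes nu: "\<nu> > -1"
  obtains C where "C > 0" "\<And>w. 0 \<le> Re w \<Longrightarrow> 0 \<le> Im w \<Longrightarrow> 1/2 \<le> norm w \<Longrightarrow> norm (bU \<nu> w) \<le> C * exp (Im w)"
proof -
  obtain c C where C: "0 < c" "c \<le> C" "\<And>a. 1/2 \<le> a \<Longrightarrow> (norm (bU' \<nu> (of_real a)))\<^sup>2 + (norm (bU \<nu> (of_real a)))\<^sup>2 \<le> C"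
    using bU_energy_real_bounds[OF nu, of "1/2"] by (metis half_gt_zero zero_less_one)
  define E where "E = exp (8 * \<bar>\<nu>\<^sup>2 - 1/4\<bar>)"
  have "norm (bU \<nu> w) \<le> sqrt (C * E) * exp (Im w)" if w: "0 \<le> Re w" "0 \<le> Im w" "1/2 \<le> norm w" for w
  proof -
    have "4 * \<bar>\<nu>\<^sup>2 - 1/4\<bar> / norm w \<le> 4 * \<bar>\<nu>\<^sup>2 - 1/4\<bar> / (1/2)"
      using w by (intro divide_left_mono) (auto intro!: mult_pos_pos)
    then have e: "exp (2 * Im w + 4 * \<bar>\<nu>\<^sup>2 - 1/4\<bar> / norm w) \<le> E * (exp (Im w))\<^sup>2"
      by (simp add: E_def power2_eq_square flip: exp_add)
    have "(norm (bU \<nu> w))\<^sup>2 \<le> (norm (bU' \<nu> w))\<^sup>2 + (norm (bU \<nu> w))\<^sup>2" by simp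
    also have "\<dots> \<le> ((norm (bU' \<nu> (of_real (norm w))))\<^sup>2 + (norm (bU \<nu> (of_real (norm w))))\<^sup>2) * exp (2 * Im w + 4 * \<bar>\<nu>\<^sup>2 - 1/4\<bar> / norm w)"
      using w by (intro bU_energy_chord[OF nu]) auto
    also have "\<dots> \<le> C * (E * (exp (Im w))\<^sup>2)"
      using C w e by (intro mult_mono) auto
    finally have "norm (bU \<nu> w) \<le> sqrt (C * (E * (exp (Im w))\<^sup>2))" by (rule real_le_rsqrt)
    then show ?thesis by (simp add: real_sqrt_mult mult.assoc)
  qed
  then show thesis using C by (intro that[of "sqrt (C * E)"]) (auto simp: E_def)
qed

text \<open>Cauchy's criterion with its rate kept: K/a becomes the error 1/|w| of the asymptotic
  formula.\<close>

lemma limit_of_inverse_square_derivative: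
  fixes f :: "real \<Rightarrow> complex"
  assumes d: "\<And>t. 1 \<le> t \<Longrightarrow> (f has_vector_derivative f' t) (at t)" and b: "\<And>t. 1 \<le> t \<Longrightarrow> norm (f' t) \<le> K / t\<^sup>2"
  obtains L where "\<And>a. 1 \<le> a \<Longrightarrow> norm (f a - L) \<le> K / a"
proof -
  have K: "0 \<le> K" using b[of 1] norm_ge_zero[of "f' 1"] by (simp del: norm_ge_zero)
  have inc: "norm (f b - f a) \<le> K / a" if ab: "1 \<le> a" "a \<le> b" for a b
  proof -
    have "norm (f b - f a) \<le> - K / b - - K / a"
    proof (cases "a = b")
      case False
      show ?thesis
      proof (rule differentiable_bound_general[where f' = f' and \<phi>' = "\<lambda>t. K / t\<^sup>2"])
        show "a < b" using ab False by simp
        show "continuous_on {a..b} f" using ab by (auto intro!: continuous_at_imp_continuous_on has_vector_derivative_continuous[OF d])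
        show "continuous_on {a..b} (\<lambda>t. - K / t)" using ab by (auto intro!: continuous_intros)
        fix x assume x: "a < x" "x < b"
        show "(f has_vector_derivative f' x) (at x)" using d x ab by simp
        show "((\<lambda>t. - K / t) has_vector_derivative K / x\<^sup>2) (at x)"
          unfolding has_real_derivative_iff_has_vector_derivative[symmetric]
          using x ab by (auto intro!: derivative_eq_intros simp: power2_eq_square)
        show "norm (f' x) \<le> K / x\<^sup>2" using b x ab by simp
      qed
    qed simp
    also have "\<dots> \<le> K / a" using K ab by simp
    finally show ?thesis .
  qed
  have t0: "(\<lambda>n. K / real n) \<longlonglongrightarrow> 0" by real_asymp
  have "Cauchy (\<lambda>n. f (real n))"
  proof (rule CauchyI)
    fix e :: real assume "e > 0"
    then have "eventually (\<lambda>n. K / real n < e) sequentially" using t0 by (rule order_tendstoD(2)[rotated])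
    then obtain N where N: "\<And>n. n \<ge> N \<Longrightarrow> K / real n < e" by (auto simp: eventually_sequentially)
    have key: "norm (f (real m) - f (real n)) < e" if "max N 1 \<le> n" "n \<le> m" for m n
      using inc[of "real n" "real m"] N[of n] that by (smt (verit) max.boundedE of_nat_1 of_nat_mono)
    show "\<exists>M. \<forall>m\<ge>M. \<forall>n\<ge>M. norm (f (real m) - f (real n)) < e"
      by (intro exI[of _ "max N 1"]) (metis key nle_le norm_minus_commute)
  qed
  then obtain L where L: "(\<lambda>n. f (real n)) \<longlonglongrightarrow> L" using Cauchy_convergent_iff convergent_def by blast
  have "norm (f a - L) \<le> K / a" if a: "1 \<le> a" for a
  proof (rule tendsto_upperbound)
    show "(\<lambda>n. norm (f a - f (real n))) \<longlonglongrightarrow> norm (f a - L)" by (intro tendsto_intros L)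
    show "\<forall>\<^sub>F n in sequentially. norm (f a - f (real n)) \<le> K / a"
      using eventually_ge_at_top[of "nat \<lceil>a\<rceil>"]
      by eventually_elim (metis inc[OF a] nat_ceiling_le_eq norm_minus_commute)
  qed simp
  then show thesis by (rule that)
qed

text \<open>Variation of constants. For s = i or s = -i the expression exp(-s w)(u' + s u) is
  constant for solutions of u'' = -u, so here its derivative contains the potential term
  alone.\<close>

lemma bU_rotated_derivative:
  assumes nu: "\<nu> > -1" and w: "w \<notin> \<real>\<^sub>\<le>\<^sub>0" and s: "s\<^sup>2 = -1"
  shows "((\<lambda>w. exp (- s * w) * (bU' \<nu> w + s * bU \<nu> w)) has_field_derivative
            exp (- s * w) * (of_real (\<nu>\<^sup>2 - 1/4) / w\<^sup>2 * bU \<nu> w)) (at w)"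
proof -
  have "((\<lambda>w. exp (- s * w) * (bU' \<nu> w + s * bU \<nu> w)) has_field_derivative
     (exp (- s * w) * (- s) * (bU' \<nu> w + s * bU \<nu> w) + ((of_real (\<nu>\<^sup>2 - 1/4) / w\<^sup>2 - 1) * bU \<nu> w + s * bU' \<nu> w) * exp (- s * w))) (at w)"
    by (rule DERIV_mult DERIV_add bU'_has_field_derivative bU_has_field_derivative nu w DERIV_cmult
         | (auto intro!: derivative_eq_intros)[1])+
  moreover have "(exp (- s * w) * (- s) * (bU' \<nu> w + s * bU \<nu> w) + ((of_real (\<nu>\<^sup>2 - 1/4) / w\<^sup>2 - 1) * bU \<nu> w + s * bU' \<nu> w) * exp (- s * w))
    = exp (- s * w) * (of_real (\<nu>\<^sup>2 - 1/4) / w\<^sup>2 * bU \<nu> w - (s\<^sup>2 + 1) * bU \<nu> w)"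
    by (simp add: algebra_simps power2_eq_square)
  ultimately show ?thesis using s by simp
qed

text \<open>Classically \<eta> is \<pi>/4 - \<nu>\<pi>/2 modulo 2\<pi>; here amplitude and phase
  arise as modulus and argument of a limit. The other quadrants are reached through
  \<open>norm_bphi_quadrant\<close>.\<close>

definition bessel_asymptotic :: "real \<Rightarrow> real \<Rightarrow> real \<Rightarrow> real \<Rightarrow> bool" where
  "bessel_asymptotic \<nu> A \<eta> C \<longleftrightarrow> (\<forall>w. 0 \<le> Re w \<longrightarrow> 0 \<le> Im w \<longrightarrow> 1 \<le> norm w \<longrightarrow>
     norm (bU \<nu> w - of_real A * sin (w + of_real \<eta>)) \<le> C * exp (Im w) / norm w)"

lemma bessel_asymptotic_exists:
  assumes nu: "\<nu> > -1"
  shows "\<exists>\<eta> A C. A > 0 \<and> C > 0 \<and> bessel_asymptotic \<nu> A \<eta> C"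
proof -
  define m where "m = \<bar>\<nu>\<^sup>2 - 1/4\<bar>"
  have m: "m \<ge> 0" by (simp add: m_def)
  obtain B where B: "B > 0" "\<And>w. 0 \<le> Re w \<Longrightarrow> 0 \<le> Im w \<Longrightarrow> 1/2 \<le> norm w \<Longrightarrow> norm (bU \<nu> w) \<le> B * exp (Im w)"
    using bU_exponential_bound[OF nu] by blast
  obtain c where c: "0 < c" "\<And>a. 1 \<le> a \<Longrightarrow> c \<le> (norm (bU' \<nu> (of_real a)))\<^sup>2 + (norm (bU \<nu> (of_real a)))\<^sup>2"
    using bU_energy_real_bounds[OF nu, of 1] by (metis zero_less_one)
  define F where "F = (\<lambda>s w. exp (- s * w) * (bU' \<nu> w + s * bU \<nu> w))"
  define F' where "F' = (\<lambda>s w. exp (- s * w) * (of_real (\<nu>\<^sup>2 - 1/4) / w\<^sup>2 * bU \<nu> w))"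
  have dF: "(F s has_field_derivative F' s w) (at w)" if "w \<notin> \<real>\<^sub>\<le>\<^sub>0" "s\<^sup>2 = -1" for s w
    unfolding F_def F'_def by (rule bU_rotated_derivative[OF nu that])
  obtain \<alpha> where al: "\<And>a. 1 \<le> a \<Longrightarrow> norm (F \<i> (of_real a) - \<alpha>) \<le> (m * B) / a"
  proof (rule limit_of_inverse_square_derivative[of "\<lambda>a. F \<i> (of_real a)" "\<lambda>a. F' \<i> (of_real a)" "m * B"])
    fix t :: real assume t: "1 \<le> t"
    show "((\<lambda>a. F \<i> (of_real a)) has_vector_derivative F' \<i> (of_real t)) (at t)"
      using t by (intro has_vector_derivative_real_field dF of_real_notin_nonpos) auto
    have "norm (bU \<nu> (of_real t)) \<le> B" using B(2)[of "of_real t"] t by simp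
    then have "m / t\<^sup>2 * norm (bU \<nu> (of_real t)) \<le> m / t\<^sup>2 * B" using m by (intro mult_left_mono) auto
    then show "norm (F' \<i> (of_real t)) \<le> (m * B) / t\<^sup>2"
      by (simp add: F'_def norm_mult norm_divide norm_power m_def del: of_real_diff)
  qed blast
  \<comment> \<open>U and U' are real on the positive axis, so |U' + iU|^2 is exactly the energy,
    which is bounded below; the limit cannot be 0.\<close>
  have an: "\<alpha> \<noteq> 0"
  proof
    assume "\<alpha> = 0"
    have "sqrt c \<le> m * B / a" if "1 \<le> a" for a
    proof -
      have "norm (bU' \<nu> (of_real a) + \<i> * bU \<nu> (of_real a)) = sqrt ((norm (bU' \<nu> (of_real a)))\<^sup>2 + (norm (bU \<nu> (of_real a)))\<^sup>2)"
        using that nu by (simp add: bU_of_real cmod_def del: of_real_add of_real_mult)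
      then have "norm (F \<i> (of_real a)) = sqrt ((norm (bU' \<nu> (of_real a)))\<^sup>2 + (norm (bU \<nu> (of_real a)))\<^sup>2)"
        by (simp add: F_def norm_mult)
      moreover have "norm (F \<i> (of_real a)) \<le> m * B / a" using al[OF that] \<open>\<alpha> = 0\<close> by simp
      moreover have "sqrt c \<le> sqrt ((norm (bU' \<nu> (of_real a)))\<^sup>2 + (norm (bU \<nu> (of_real a)))\<^sup>2)"
        using c(2)[OF that] by simp
      ultimately show ?thesis by linarith
    qed
    then have "eventually (\<lambda>a. sqrt c \<le> m * B / a) at_top"
      using eventually_ge_at_top by (rule eventually_mono[rotated])
    moreover have "((\<lambda>a. m * B / a) \<longlongrightarrow> 0) at_top" by real_asymp
    ultimately have "sqrt c \<le> 0" by (intro tendsto_lowerbound) auto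
    then show False using c by simp
  qed
  \<comment> \<open>\<open>E\<close> bounds the product of |exp(-s p)| with the growth exp(Im p) of
    U along the chord: exp(2 Im w) for s = i, but 1 for s = -i.\<close>
  have chord: "norm (F s w - F s (of_real (norm w))) \<le> 4 * m * B * E / norm w"
    if w: "0 \<le> Re w" "0 \<le> Im w" "1 \<le> norm w" and s: "s\<^sup>2 = -1"
      and E: "\<And>p. 0 \<le> Im p \<Longrightarrow> Im p \<le> Im w \<Longrightarrow> norm (exp (- s * p)) * exp (Im p) \<le> E" for s w E
  proof -
    define r where "r = norm w"
    have r: "r > 0" "norm w = r" "1 \<le> r" using w by (auto simp: r_def)
    note cb = chord_bounds[OF w(1,2) r(2,1)]
    have "norm (F s w - F s (of_real r)) \<le> (m * 2 / r\<^sup>2 * (B * E)) * norm (w - of_real r)"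
    proof (rule field_differentiable_bound[of "closed_segment (of_real r) w"])
      fix p assume p: "p \<in> closed_segment (of_real r) w"
      show "(F s has_field_derivative F' s p) (at p within closed_segment (of_real r) w)"
        by (rule has_field_derivative_at_within[OF dF[OF cb(5)[OF p] s]])
      have np: "1/2 \<le> norm p"
      proof -
        have "(1/2)\<^sup>2 \<le> r\<^sup>2 / 2" using r(3) power_mono[of 1 r 2] by (simp add: power2_eq_square)
        also have "\<dots> \<le> (norm p)\<^sup>2" by (rule cb(1)[OF p])
        finally show ?thesis by (rule power2_le_imp_le) simp
      qed
      have "norm (F' s p) = m / (norm p)\<^sup>2 * (norm (exp (- s * p)) * norm (bU \<nu> p))"
        by (simp add: F'_def norm_mult norm_divide norm_power m_def del: of_real_diff)
      also have "\<dots> \<le> m / (r\<^sup>2 / 2) * (norm (exp (- s * p)) * (B * exp (Im p)))"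
      proof (intro mult_mono divide_left_mono)
        show "norm (bU \<nu> p) \<le> B * exp (Im p)" using B(2) cb[OF p] np by blast
        show "r\<^sup>2 / 2 \<le> (norm p)\<^sup>2" by (rule cb(1)[OF p])
        show "0 < (norm p)\<^sup>2 * (r\<^sup>2 / 2)" using np r by (intro mult_pos_pos) auto
      qed (use m B in auto)
      also have "\<dots> = m * 2 / r\<^sup>2 * (B * (norm (exp (- s * p)) * exp (Im p)))" by simp
      also have "\<dots> \<le> m * 2 / r\<^sup>2 * (B * E)"
        using m B E[OF cb(3)[OF p] cb(4)[OF p]] by (intro mult_left_mono) auto
      finally show "norm (F' s p) \<le> m * 2 / r\<^sup>2 * (B * E)" .
    qed auto
    also have "\<dots> \<le> (m * 2 / r\<^sup>2 * (B * E)) * (2 * r)"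
    proof (rule mult_left_mono[OF chord_length[OF w(1) r(2)]])
      have "0 \<le> E" using E[of 0] w by simp
      then show "0 \<le> m * 2 / r\<^sup>2 * (B * E)" using m B by simp
    qed
    also have "\<dots> = 4 * m * B * E / r" using r by (simp add: power2_eq_square)
    finally show ?thesis by (simp add: r_def)
  qed
  define A \<eta> where "A = norm \<alpha>" and "\<eta> = Arg \<alpha>"
  have "rcis A \<eta> = \<alpha>" unfolding A_def \<eta>_def by (rule rcis_cmod_Arg)
  then have Ae: "\<alpha> = of_real A * exp (\<i> * of_real \<eta>)"
    unfolding rcis_def cis_conv_exp by (rule sym)
  have A0: "A > 0" using an by (simp add: A_def)
  have Fm: "F (-\<i>) (of_real a) = cnj (F \<i> (of_real a))" if "a > 0" for a
    using that nu by (simp add: F_def bU_of_real exp_cnj)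
  have main: "norm (bU \<nu> w - of_real A * sin (w + of_real \<eta>)) \<le> (5 * m * B + 1) * exp (Im w) / norm w"
    if w: "0 \<le> Re w" "0 \<le> Im w" "1 \<le> norm w" for w
  proof -
    define \<tau> r where "\<tau> = Im w" and "r = norm w"
    have tr: "\<tau> \<ge> 0" "r \<ge> 1" "r > 0" using w by (auto simp: \<tau>_def r_def)
    have "norm (F \<i> w - \<alpha>) \<le> 4 * m * B * exp (2 * \<tau>) / r + m * B / r"
    proof -
      have "norm (F \<i> w - F \<i> (of_real (norm w))) \<le> 4 * m * B * exp (2 * \<tau>) / norm w"
        by (rule chord[OF w]) (auto simp: \<tau>_def power2_eq_square norm_exp simp flip: exp_add)
      then show ?thesis using al[OF w(3)] norm_triangle_ineq[of "F \<i> w - F \<i> (of_real (norm w))" "F \<i> (of_real (norm w)) - \<alpha>"]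
        by (simp add: r_def)
    qed
    also have "\<dots> \<le> 5 * m * B * exp (2 * \<tau>) / r"
    proof -
      have "m * B * 1 \<le> m * B * exp (2 * \<tau>)" using m B tr by (intro mult_left_mono) auto
      then show ?thesis using tr unfolding add_divide_distrib[symmetric] by (intro divide_right_mono) (auto simp: algebra_simps)
    qed
    finally have p1: "norm (F \<i> w - \<alpha>) \<le> 5 * m * B * exp (2 * \<tau>) / r" .
    have p2: "norm (F (-\<i>) w - cnj \<alpha>) \<le> 5 * m * B / r"
    proof -
      have 1: "norm (F (-\<i>) w - F (-\<i>) (of_real (norm w))) \<le> 4 * m * B * 1 / norm w"
        by (rule chord[OF w]) (auto simp: \<tau>_def power2_eq_square norm_exp simp flip: exp_add)
      have 2: "norm (F (-\<i>) (of_real (norm w)) - cnj \<alpha>) \<le> m * B / norm w"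
        using al[OF w(3)] tr Fm[of "norm w"] by (simp add: r_def flip: complex_cnj_diff)
      have 3: "norm (F (-\<i>) w - cnj \<alpha>) \<le> norm (F (-\<i>) w - F (-\<i>) (of_real (norm w))) + norm (F (-\<i>) (of_real (norm w)) - cnj \<alpha>)"
        using norm_triangle_ineq[of "F (-\<i>) w - F (-\<i>) (of_real (norm w))" "F (-\<i>) (of_real (norm w)) - cnj \<alpha>"] by simp
      have 4: "4 * m * B * 1 / norm w + m * B / norm w = 5 * m * B / norm w"
        unfolding add_divide_distrib[symmetric] by simp
      show ?thesis using order_trans[OF 3 add_mono[OF 1 2]] unfolding 4 r_def .
    qed
    \<comment> \<open>U is a combination of the two rotated quantities. The moduli exp(-Im w) and
      exp(Im w) of their coefficients balance the two errors, so both become of size exp(Im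
      w)/|w|.\<close>
    have eU: "bU \<nu> w = (exp (\<i> * w) * F \<i> w - exp (- \<i> * w) * F (-\<i>) w) / (2 * \<i>)"
    proof -
      have "exp (\<i> * w) * F \<i> w = bU' \<nu> w + \<i> * bU \<nu> w" "exp (- \<i> * w) * F (-\<i>) w = bU' \<nu> w - \<i> * bU \<nu> w"
        by (simp_all add: F_def mult.assoc[symmetric] flip: exp_add)
      then show ?thesis by simp
    qed
    have es: "of_real A * sin (w + of_real \<eta>) = (exp (\<i> * w) * \<alpha> - exp (- \<i> * w) * cnj \<alpha>) / (2 * \<i>)"
      unfolding Ae sin_exp_eq
      by (simp add: exp_cnj algebra_simps flip: exp_add)
    have "bU \<nu> w - of_real A * sin (w + of_real \<eta>) = (exp (\<i> * w) * (F \<i> w - \<alpha>) - exp (- \<i> * w) * (F (-\<i>) w - cnj \<alpha>)) / (2 * \<i>)"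
      unfolding eU es by (simp add: diff_divide_distrib[symmetric] algebra_simps)
    then have "norm (bU \<nu> w - of_real A * sin (w + of_real \<eta>)) \<le>
        (norm (exp (\<i> * w) * (F \<i> w - \<alpha>)) + norm (exp (- \<i> * w) * (F (-\<i>) w - cnj \<alpha>))) / 2"
      using norm_triangle_ineq4[of "exp (\<i> * w) * (F \<i> w - \<alpha>)" "exp (- \<i> * w) * (F (-\<i>) w - cnj \<alpha>)"]
      by (simp add: norm_divide norm_mult)
    also have "\<dots> = (exp (- \<tau>) * norm (F \<i> w - \<alpha>) + exp \<tau> * norm (F (-\<i>) w - cnj \<alpha>)) / 2"
      by (simp add: norm_mult norm_exp \<tau>_def)
    also have "\<dots> \<le> (exp (- \<tau>) * (5 * m * B * exp (2 * \<tau>) / r) + exp \<tau> * (5 * m * B / r)) / 2"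
      using p1 p2 by (intro divide_right_mono add_mono mult_left_mono) auto
    also have "\<dots> = 5 * m * B * exp \<tau> / r"
      using tr exp_add[of "-\<tau>" "2*\<tau>"] by (simp add: field_simps)
    also have "\<dots> \<le> (5 * m * B + 1) * exp \<tau> / r" using tr by (intro divide_right_mono mult_right_mono) auto
    finally show ?thesis by (simp add: \<tau>_def r_def)
  qed
  have "5 * m * B + 1 > 0" using m B by (smt (verit) mult_nonneg_nonneg)
  with main A0 show ?thesis unfolding bessel_asymptotic_def by blast
qed

lemma powr_comparable:
  fixes x y K s :: real
  assumes "0 < x" "x \<le> y" "y \<le> K * x"
  shows "x powr s \<le> K powr \<bar>s\<bar> * y powr s" "y powr s \<le> K powr \<bar>s\<bar> * x powr s"
proof -
  have K: "K \<ge> 1" using assms by (smt (verit) mult_less_cancel_right2)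
  have K1: "1 \<le> K powr \<bar>s\<bar>" using K by (simp add: ge_one_powr_ge_zero)
  show "x powr s \<le> K powr \<bar>s\<bar> * y powr s"
  proof (cases "s \<ge> 0")
    case True
    have "x powr s \<le> 1 * y powr s" using assms True by (simp add: powr_mono2)
    also have "\<dots> \<le> K powr \<bar>s\<bar> * y powr s" by (rule mult_right_mono[OF K1]) simp
    finally show ?thesis .
  next
    case False
    then have "(K * x) powr s \<le> y powr s" using assms by (intro powr_mono2') auto
    then have "K powr (-s) * (K powr s * x powr s) \<le> K powr (-s) * y powr s"
      using K assms by (intro mult_left_mono) (auto simp: powr_mult)
    then show ?thesis using False K by (simp add: mult.assoc[symmetric] flip: powr_add)
  qed
  show "y powr s \<le> K powr \<bar>s\<bar> * x powr s"
  proof (cases "s \<ge> 0")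
    case True
    have "y powr s \<le> (K * x) powr s" using assms True by (intro powr_mono2) auto
    then show ?thesis using True K assms by (simp add: powr_mult)
  next
    case False
    have "y powr s \<le> 1 * x powr s" using assms False by (simp add: powr_mono2')
    also have "\<dots> \<le> K powr \<bar>s\<bar> * x powr s" by (rule mult_right_mono[OF K1]) simp
    finally show ?thesis .
  qed
qed

lemma norm_bphi_quadrant:
  assumes nu: "\<nu> > -1"
  shows "norm (bphi \<nu> w) = norm (bphi \<nu> (Complex \<bar>Re w\<bar> \<bar>Im w\<bar>))"
proof -
  have "norm (bphi \<nu> (cnj z)) = norm (bphi \<nu> z)" for z by (simp add: bphi_cnj[OF nu])
  moreover have "norm (bphi \<nu> (- z)) = norm (bphi \<nu> z)" for z :: complex by (simp add: bphi_minus)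
  moreover have "Complex \<bar>Re w\<bar> \<bar>Im w\<bar> \<in> {w, - w, cnj w, - cnj w}"
    by (auto simp: complex_eq_iff abs_if)
  ultimately show ?thesis by (metis (no_types, lifting) empty_iff insert_iff)
qed

lemma norm_Complex_abs: "norm (Complex \<bar>Re w\<bar> \<bar>Im w\<bar>) = norm w"
  by (simp add: cmod_def)

lemma continuous_on_bphi: "\<nu> > -1 \<Longrightarrow> continuous_on A (bphi \<nu> :: 'a::{real_normed_field,banach} \<Rightarrow> 'a)"
  by (meson DERIV_isCont bphi_has_field_derivative continuous_at_imp_continuous_on)

text \<open>Compactness handles the disc of radius 1/2 and \<open>bU_exponential_bound\<close> the
  rest; 1 + |w| in place of |w| keeps the weight finite at 0.\<close>

lemma bphi_upper_bound:
  assumes nu: "\<nu> > -1"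
  obtains C where "C > 0" "\<And>w::complex. norm (bphi \<nu> w) \<le> C * (1 + norm w) powr (- (\<nu> + 1/2)) * exp \<bar>Im w\<bar>"
proof -
  define a where "a = \<nu> + 1/2"
  obtain B where B: "B > 0" "\<And>w. 0 \<le> Re w \<Longrightarrow> 0 \<le> Im w \<Longrightarrow> 1/2 \<le> norm w \<Longrightarrow> norm (bU \<nu> w) \<le> B * exp (Im w)"
    using bU_exponential_bound[OF nu] by blast
  have "compact (bphi \<nu> ` cball (0::complex) (1/2))"
    by (intro compact_continuous_image continuous_on_bphi nu) auto
  then obtain M where M: "M > 0" "\<And>w::complex. norm w \<le> 1/2 \<Longrightarrow> norm (bphi \<nu> w) \<le> M"
    by (metis (no_types, lifting) bounded_pos compact_imp_bounded image_eqI mem_cball_0)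
  define D where "D = (B + M) * 3 powr \<bar>a\<bar>"
  have D: "D > 0" using B M by (simp add: D_def)
  have "norm (bphi \<nu> w) \<le> D * (1 + norm w) powr (- a) * exp \<bar>Im w\<bar>" for w :: complex
  proof (cases "norm w \<le> 1/2")
    case True
    have p: "1 \<le> 3 powr \<bar>a\<bar> * (1 + norm w) powr (- a)"
      using powr_comparable(1)[of 1 "1 + norm w" 3 "-a"] True by simp
    have "norm (bphi \<nu> w) \<le> M * 1 * 1" using M True by simp
    also have "\<dots> \<le> (B + M) * (3 powr \<bar>a\<bar> * (1 + norm w) powr (- a)) * exp \<bar>Im w\<bar>"
      using p M B by (intro mult_mono) auto
    finally show ?thesis by (simp add: D_def mult.assoc)
  next
    case False
    define v where "v = Complex \<bar>Re w\<bar> \<bar>Im w\<bar>"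
    have nv: "norm v = norm w" by (simp add: v_def norm_Complex_abs)
    have p: "norm w powr (- a) \<le> 3 powr \<bar>a\<bar> * (1 + norm w) powr (- a)"

    proof -
      have "0 < norm w" "norm w \<le> 1 + norm w" "1 + norm w \<le> 3 * norm w" using False by linarith+
      from powr_comparable(1)[OF this, of "-a"] show ?thesis by simp
    qed
    have "norm w powr a * norm (bphi \<nu> v) \<le> B * exp \<bar>Im w\<bar>"
      using B(2)[of v] False nv by (simp add: norm_bU a_def) (simp add: v_def)
    then have "norm w powr (- a) * (norm w powr a * norm (bphi \<nu> v)) \<le> norm w powr (- a) * (B * exp \<bar>Im w\<bar>)"
      by (rule mult_left_mono) simp
    moreover have "norm w powr (- a) * (norm w powr a * norm (bphi \<nu> v)) = norm (bphi \<nu> v)"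
    proof -
      have "norm w powr (- a) * norm w powr a = 1" using False by (subst powr_add[symmetric]) auto
      then show ?thesis by (simp only: mult.assoc[symmetric] mult_1)
    qed
    ultimately have "norm (bphi \<nu> v) \<le> norm w powr (- a) * (B * exp \<bar>Im w\<bar>)" by simp
    also have "\<dots> \<le> (3 powr \<bar>a\<bar> * (1 + norm w) powr (- a)) * ((B + M) * exp \<bar>Im w\<bar>)"
      using p B M by (intro mult_mono) auto
    finally show ?thesis using norm_bphi_quadrant[OF nu, of w] by (simp add: D_def v_def mult_ac)
  qed
  then show thesis using D that by (simp add: a_def)
qed

text \<open>With t = Im w, |sin w|^2 = (e^(2t) + e^(-2t) - 2 cos(2 Re w))/4. Either e^(2t)
  dominates, or the cosine is -1 and |sin w| = cosh t, which is the situation on the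
  contour.\<close>

lemma norm_sin_lower_bound:
  assumes t: "Im w \<ge> 0" and d: "1 \<le> Im w \<or> cos (2 * Re w) = -1"
  shows "exp (Im w) / 4 \<le> norm (sin w)"
proof (rule power2_le_imp_le)
  define E where "E = exp (Im w)"
  have E: "E \<ge> 1" using t by (simp add: E_def)
  have e: "exp (2 * Im w) = E\<^sup>2" by (simp add: E_def power2_eq_square flip: exp_add)
  have n: "(norm (sin w))\<^sup>2 = (E\<^sup>2 + inverse (E\<^sup>2) - 2 * cos (2 * Re w)) / 4"
    by (simp add: norm_sin_squared e)
  have i: "0 \<le> inverse (E\<^sup>2)" by simp
  show "(exp (Im w) / 4)\<^sup>2 \<le> (norm (sin w))\<^sup>2"
  proof (cases "1 \<le> Im w")
    case True
    have "E \<ge> 1 + Im w" unfolding E_def by simp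
    with True have "2\<^sup>2 \<le> E\<^sup>2" by (intro power_mono) auto
    then have "4 \<le> E\<^sup>2" by simp
    moreover have "x / 16 \<le> (x + y - 2 * c) / 4" if "4 \<le> x" "0 \<le> y" "c \<le> 1" for x y c :: real
      using that by (simp add: field_simps)
    ultimately have "E\<^sup>2 / 16 \<le> (E\<^sup>2 + inverse (E\<^sup>2) - 2 * cos (2 * Re w)) / 4"
      using i cos_le_one[of "2 * Re w"] by blast
    then show ?thesis unfolding n E_def[symmetric] by (simp add: power_divide)
  next
    case False
    then show ?thesis unfolding n E_def[symmetric] using i d by (simp add: power_divide)
  qed
qed simp

lemma bphi_lower_bound:
  assumes nu: "\<nu> > -1" and as: "bessel_asymptotic \<nu> A \<eta> C" "A > 0" "C > 0"
  obtains c K where "c > 0" "K \<ge> 1"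
    "\<And>w::complex. K \<le> \<bar>Im w\<bar> \<or> K \<le> norm w \<and> (\<exists>k::int. \<bar>Re w\<bar> + \<eta> = (of_int k + 1/2) * pi) \<Longrightarrow>
        c * norm w powr (- (\<nu> + 1/2)) * exp \<bar>Im w\<bar> \<le> norm (bphi \<nu> w)"
proof -
  define a where "a = \<nu> + 1/2"
  \<comment> \<open>With this \<open>K\<close> the asymptotic error is at most half of the lower
    bound A/4 exp |Im w| for the main term.\<close>
  define K where "K = max 1 (8 * C / A)"
  have K1: "K \<ge> 1" by (simp add: K_def)
  have "(A / 8) * norm w powr (- a) * exp \<bar>Im w\<bar> \<le> norm (bphi \<nu> w)"
    if H: "K \<le> \<bar>Im w\<bar> \<or> K \<le> norm w \<and> (\<exists>k::int. \<bar>Re w\<bar> + \<eta> = (of_int k + 1/2) * pi)" for w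
  proof -
    define v where "v = Complex \<bar>Re w\<bar> \<bar>Im w\<bar>"
    have nv: "norm v = norm w" by (simp add: v_def norm_Complex_abs)
    have Kw: "K \<le> norm w" using H abs_Im_le_cmod[of w] by linarith
    have "C * 8 \<le> norm w * A" using Kw as by (simp add: K_def field_simps)
    then have Cw: "C * exp \<bar>Im w\<bar> / norm w \<le> A / 8 * exp \<bar>Im w\<bar>"
      using Kw K1 as by (simp add: divide_le_eq mult_ac)
    have "exp (Im (v + of_real \<eta>)) / 4 \<le> norm (sin (v + of_real \<eta>))"
    proof (rule norm_sin_lower_bound)
      show "1 \<le> Im (v + of_real \<eta>) \<or> cos (2 * Re (v + of_real \<eta>)) = -1"
      proof (cases "K \<le> \<bar>Im w\<bar>")
        case False
        then obtain k :: int where "\<bar>Re w\<bar> + \<eta> = (of_int k + 1/2) * pi" using H by blast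
        then have "2 * Re (v + of_real \<eta>) = pi + 2 * pi * of_int k" by (simp add: v_def algebra_simps)
        then have "cos (2 * Re (v + of_real \<eta>)) = -1" by (simp add: cos_add)
        then show ?thesis ..
      qed (use K1 in \<open>simp add: v_def\<close>)
    qed (simp add: v_def)
    then have "A * (exp (Im (v + of_real \<eta>)) / 4) \<le> A * norm (sin (v + of_real \<eta>))"
      using as by (intro mult_left_mono) auto
    then have f1: "A * exp \<bar>Im w\<bar> / 4 \<le> norm (of_real A * sin (v + of_real \<eta>))"
      using as by (simp add: norm_mult v_def)
    have f2: "norm (bU \<nu> v - of_real A * sin (v + of_real \<eta>)) \<le> C * exp \<bar>Im w\<bar> / norm w"
    proof -
      have "0 \<le> Re v" "0 \<le> Im v" "1 \<le> norm v" using Kw K1 nv by (auto simp: v_def norm_Complex_abs)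
      then have "norm (bU \<nu> v - of_real A * sin (v + of_real \<eta>)) \<le> C * exp (Im v) / norm v"
        using as(1) unfolding bessel_asymptotic_def by blast
      then show ?thesis unfolding nv by (simp add: v_def)
    qed
    have f3: "norm (of_real A * sin (v + of_real \<eta>)) \<le> norm (bU \<nu> v) + norm (bU \<nu> v - of_real A * sin (v + of_real \<eta>))"
      by (metis norm_minus_commute norm_triangle_sub)
    have "P / 8 \<le> b" if "P / 4 \<le> s" "d \<le> e" "s \<le> b + d" "e \<le> P / 8" for P s d e b :: real
      using that by linarith
    from this[OF f1 f2 f3] have "A / 8 * exp \<bar>Im w\<bar> \<le> norm (bU \<nu> v)" using Cw by simp
    then have "norm w powr (-a) * (A / 8 * exp \<bar>Im w\<bar>) \<le> norm w powr (-a) * (norm w powr a * norm (bphi \<nu> v))"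
      by (intro mult_left_mono) (auto simp: norm_bU nv a_def)
    also have "\<dots> = norm (bphi \<nu> v)"
    proof -
      have "norm w powr (- a) * norm w powr a = 1" using Kw K1 by (subst powr_add[symmetric]) auto
      then show ?thesis by (simp only: mult.assoc[symmetric] mult_1)
    qed
    finally show ?thesis using norm_bphi_quadrant[OF nu, of w] by (simp add: v_def mult_ac)
  qed
  then show thesis using that[of "A / 8" K] K1 as by (simp add: a_def)
qed

section \<open>The zeros\<close>

definition bzeros :: "real \<Rightarrow> real set" where
  "bzeros \<nu> = {s. 0 < s \<and> bphi \<nu> s = 0}"

lemma besselJ_eq_0_iff:
  assumes nu: "\<nu> > -1" and x: "x > 0"
  shows "besselJ \<nu> x = 0 \<longleftrightarrow> bphi \<nu> x = 0"
proof -
  have "Gamma (\<nu> + 1) > 0" using nu by (intro Gamma_real_pos) auto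
  then show ?thesis using x by (simp add: besselJ_bphi[OF nu x])
qed

text \<open>Self-adjoint form (t^(2\<nu>+1) u')' = -w^2 t^(2\<nu>+1) u of the radial equation, with
  the density of \<open>mu_nu\<close> as weight.\<close>

lemma radial_derivative:
  fixes w :: complex
  assumes nu: "\<nu> > -1" and t: "t > 0"
  shows "((\<lambda>t. of_real (t powr (2 * \<nu> + 1)) * (w * bphi' \<nu> (of_real t * w))) has_vector_derivative
            - w\<^sup>2 * of_real (t powr (2 * \<nu> + 1)) * bphi \<nu> (of_real t * w)) (at t)"
proof (cases "w = 0")
  case False
  have tw: "of_real t * w \<noteq> 0" using False t by simp
  have d1: "((\<lambda>t. complex_of_real (t powr (2 * \<nu> + 1))) has_vector_derivative of_real ((2 * \<nu> + 1) * t powr (2 * \<nu>))) (at t)"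
  proof -
    have "((\<lambda>t. t powr (2 * \<nu> + 1)) has_real_derivative (2 * \<nu> + 1) * t powr (2 * \<nu>)) (at t)"
      using has_real_derivative_powr[OF t, of "2 * \<nu> + 1"] by simp
    then show ?thesis by (rule has_vector_derivative_of_real)
  qed
  have d0: "((\<lambda>t. of_real t * w) has_vector_derivative w) (at t)"
    by (auto intro!: derivative_eq_intros)
  have d2: "((\<lambda>t. bphi' \<nu> (of_real t * w)) has_vector_derivative w * (- bphi \<nu> (of_real t * w) - of_real (2 * \<nu> + 1) / (of_real t * w) * bphi' \<nu> (of_real t * w))) (at t)"
    using field_vector_diff_chain_at[OF d0 bphi'_has_field_derivative[OF nu tw]] by (simp add: o_def)
  have "((\<lambda>t. of_real (t powr (2 * \<nu> + 1)) * (w * bphi' \<nu> (of_real t * w))) has_vector_derivative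
      (of_real (t powr (2 * \<nu> + 1)) * (w * (w * (- bphi \<nu> (of_real t * w) - of_real (2 * \<nu> + 1) / (of_real t * w) * bphi' \<nu> (of_real t * w))))
        + of_real ((2 * \<nu> + 1) * t powr (2 * \<nu>)) * (w * bphi' \<nu> (of_real t * w)))) (at t)"
    by (rule has_vector_derivative_mult[OF d1 has_vector_derivative_mult_right[OF d2]])
  moreover have "of_real (t powr (2 * \<nu> + 1)) = (of_real t * of_real (t powr (2 * \<nu>)) :: complex)"
    using t by (simp add: powr_add powr_one)
  ultimately show ?thesis using t False by (simp add: field_simps power2_eq_square)
next
  case True
  then show ?thesis by simp
qed

lemma bphi_near_0:
  assumes nu: "\<nu> > -1"
  obtains b where "b > 0" "\<And>w::complex. norm w \<le> b \<Longrightarrow> norm (bphi \<nu> w - 1) \<le> 1/2"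
proof -
  have "isCont (bphi \<nu>) (0::complex)" using bphi_has_field_derivative[OF nu] by (rule DERIV_isCont)
  then obtain d where d: "d > 0" "\<And>w::complex. dist w 0 < d \<Longrightarrow> dist (bphi \<nu> w) (bphi \<nu> 0) < 1/2"
    unfolding continuous_at_eps_delta by (metis half_gt_zero zero_less_one)
  have "norm (bphi \<nu> w - 1) \<le> 1/2" if "norm w \<le> d/2" for w :: complex
    using d(2)[of w] d(1) that by (simp add: dist_norm)
  then show thesis using d by (intro that[of "d/2"]) auto
qed

lemma bphi_real_ge_half:
  assumes nu: "\<nu> > -1"
  obtains b where "b > 0" "\<And>x::real. \<bar>x\<bar> \<le> b \<Longrightarrow> 1/2 \<le> bphi \<nu> x"
proof -
  obtain b where b: "b > 0" "\<And>w::complex. norm w \<le> b \<Longrightarrow> norm (bphi \<nu> w - 1) \<le> 1/2"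
    using bphi_near_0[OF nu] by blast
  have "1/2 \<le> bphi \<nu> x" if "\<bar>x\<bar> \<le> b" for x :: real
  proof -
    have "norm (complex_of_real (bphi \<nu> x - 1)) \<le> 1/2"
      using b(2)[of "of_real x"] that by (simp add: bphi_of_real[OF nu])
    then have "\<bar>bphi \<nu> x - 1\<bar> \<le> 1/2" unfolding norm_of_real .
    then show ?thesis by linarith
  qed
  then show thesis using b that by blast
qed

text \<open>Green's identity for \<open>t \<mapsto> \<phi>(tw)\<close> and its conjugate: both boundary terms vanish at a zero \<open>w\<close>,
  which forces \<open>w\<^sup>2\<close> to be real.\<close>
lemma bphi_zero_real:
  fixes w :: complex
  assumes nu: "\<nu> > -1" and z: "bphi \<nu> w = 0"
  shows "Im w = 0"
proof -
  have key: False if z: "bphi \<nu> w = 0" and neg: "Im (w\<^sup>2) < 0" for w :: complex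
  proof -
    define u where "u = (\<lambda>t. bphi \<nu> (of_real t * w))"
    define v where "v = (\<lambda>t. of_real (t powr (2 * \<nu> + 1)) * (w * bphi' \<nu> (of_real t * w)))"
    \<comment> \<open>The flux of Green's identity: its derivative is -Im(w^2) |u|^2 t^(2\<nu>+1),
      which has one sign.\<close>
    define W where "W = (\<lambda>t. Im (cnj (u t) * v t))"
    have du: "(u has_vector_derivative w * bphi' \<nu> (of_real t * w)) (at t)" for t
    proof -
      have "((\<lambda>t. of_real t * w) has_vector_derivative w) (at t)" by (auto intro!: derivative_eq_intros)
      from field_vector_diff_chain_at[OF this bphi_has_field_derivative[OF nu]] show ?thesis
        by (simp add: o_def u_def)
    qed
    have dW: "(W has_real_derivative (- Im (w\<^sup>2) * (norm (u t))\<^sup>2 * t powr (2 * \<nu> + 1))) (at t)" if t: "t > 0" for t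
    proof -
      have "((\<lambda>t. cnj (u t)) has_vector_derivative cnj (w * bphi' \<nu> (of_real t * w))) (at t)"
        using has_vector_derivative_cnj[OF du] .
      from has_vector_derivative_mult[OF this radial_derivative[OF nu t, of w]]
      have "((\<lambda>t. cnj (u t) * v t) has_vector_derivative
         cnj (u t) * (- w\<^sup>2 * of_real (t powr (2 * \<nu> + 1)) * u t) + cnj (w * bphi' \<nu> (of_real t * w)) * v t) (at t)"
        by (simp add: u_def v_def)
      then have "(W has_real_derivative Im (cnj (u t) * (- w\<^sup>2 * of_real (t powr (2 * \<nu> + 1)) * u t) + cnj (w * bphi' \<nu> (of_real t * w)) * v t)) (at t)"
        unfolding W_def has_real_derivative_iff_has_vector_derivative
        by (rule bounded_linear.has_vector_derivative[OF bounded_linear_Im])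
      moreover have "Im (cnj (w * bphi' \<nu> (of_real t * w)) * v t) = 0"
      proof -
        have "Im (cnj X * (of_real r * X)) = 0" for X r by simp
        then show ?thesis unfolding v_def .
      qed
      moreover have "cnj (u t) * (- w\<^sup>2 * of_real (t powr (2 * \<nu> + 1)) * u t) = - w\<^sup>2 * of_real ((norm (u t))\<^sup>2 * t powr (2 * \<nu> + 1))"
        unfolding of_real_mult complex_norm_square by (simp only: mult_ac)
      moreover have "Im (- w\<^sup>2 * of_real r) = - Im (w\<^sup>2) * r" for r by simp
      ultimately show ?thesis by (simp only: plus_complex.sel add_0_right mult.assoc)
    qed
    \<comment> \<open>The weight t^(2\<nu>+1) blows up at 0 if \<nu> < -1/2. Pulling a factor t out
      of \<open>bphi'\<close> leaves the exponent 2\<nu>+2 > 0, so \<open>W\<close> is continuous at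
      0 with value 0.\<close>
    have W0: "W t = t powr (2 * \<nu> + 2) * Im (cnj (u t) * (- (w\<^sup>2 / of_real (2 * (\<nu> + 1))) * bphi (\<nu> + 1) (of_real t * w)))" if "t \<ge> 0" for t
    proof -
      have "v t = of_real (t powr (2 * \<nu> + 2)) * (- (w\<^sup>2 / of_real (2 * (\<nu> + 1))) * bphi (\<nu> + 1) (of_real t * w))"
      proof (cases "t = 0")
        case False
        then have "t powr (2 * \<nu> + 2) = t powr (2 * \<nu> + 1) * t" using that powr_add[of t "2 * \<nu> + 1" 1] by (simp add: add.assoc)
        then show ?thesis unfolding v_def bphi'_def by (simp add: power2_eq_square mult_ac)
      qed (simp add: v_def)
      then show ?thesis unfolding W_def by (simp only: mult.left_commute[of "cnj (u t)"] times_complex.sel Re_complex_of_real Im_complex_of_real)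
    qed
    have cW: "continuous_on {0..1} W"
    proof -
      have "continuous_on {0..1} (\<lambda>t. t powr (2 * \<nu> + 2) * Im (cnj (u t) * (- (w\<^sup>2 / of_real (2 * (\<nu> + 1))) * bphi (\<nu> + 1) (of_real t * w))))"
        unfolding u_def using nu
        by (intro continuous_intros continuous_on_powr' continuous_on_compose2[OF continuous_on_bphi[of _ UNIV]]) auto
      then show ?thesis by (rule continuous_on_eq) (simp add: W0)
    qed
    have mono: "W s \<le> W t" if "0 \<le> s" "s \<le> t" "t \<le> 1" for s t
    proof (rule DERIV_nonneg_imp_increasing_open[OF that(2)])
      show "continuous_on {s..t} W" using cW by (rule continuous_on_subset) (use that in auto)
      show "\<exists>y. (W has_real_derivative y) (at x) \<and> 0 \<le> y" if "s < x" "x < t" for x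
        using dW[of x] that \<open>0 \<le> s\<close> neg
        by (intro exI[of _ "- Im (w\<^sup>2) * (norm (u x))\<^sup>2 * x powr (2 * \<nu> + 1)"] conjI mult_nonneg_nonneg) auto
    qed
    \<comment> \<open>A monotone function with equal end values is constant, so its derivative
      vanishes; near 0 this contradicts u being close to 1.\<close>
    have "W 0 = 0" using W0[of 0] nu by simp
    moreover have "W 1 = 0" using z by (simp add: W_def u_def)
    ultimately have Wz: "W t = 0" if "0 \<le> t" "t \<le> 1" for t using mono[of 0 t] mono[of t 1] that by auto
    obtain b where b: "b > 0" "\<And>w::complex. norm w \<le> b \<Longrightarrow> norm (bphi \<nu> w - 1) \<le> 1/2"
      using bphi_near_0[OF nu] by blast
    have w0: "norm w > 0" using neg by auto
    define t where "t = min (1/2) (b / norm w)"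
    have t: "0 < t" "t < 1" using b w0 by (auto simp: t_def)
    have "norm (of_real t * w) \<le> b" using w0 t by (simp add: norm_mult t_def min_def field_simps split: if_splits)
    then have un: "u t \<noteq> 0" using b(2)[of "of_real t * w"] by (auto simp: u_def)
    have "(W has_real_derivative 0) (at t)"
    proof (rule has_field_derivative_transform_within_open[of "\<lambda>_. 0" _ _ "{0<..<1}"])
      show "0 = W x" if "x \<in> {0<..<1}" for x using Wz[of x] that by simp
    qed (use t in auto)
    then have "- Im (w\<^sup>2) * (norm (u t))\<^sup>2 * t powr (2 * \<nu> + 1) = 0" using dW[OF t(1)] DERIV_unique by blast
    then show False using neg un t by simp
  qed
  have "Im (w\<^sup>2) = 0"
  proof (rule ccontr)
    assume "Im (w\<^sup>2) \<noteq> 0"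
    then consider "Im (w\<^sup>2) < 0" | "Im ((cnj w)\<^sup>2) < 0" by (fastforce simp: power2_eq_square)
    then show False
    proof cases
      case 1 then show False using key[OF z] by simp
    next
      case 2 then show False using key[of "cnj w"] z by (simp add: bphi_cnj[OF nu])
    qed
  qed
  then have "Re w = 0 \<or> Im w = 0" by (auto simp: power2_eq_square)
  moreover have "Re w \<noteq> 0"
  proof
    assume "Re w = 0"
    then have "w = \<i> * of_real (Im w)" by (simp add: complex_eq_iff)
    then show False using bphi_imaginary_nonzero[OF nu, of "Im w"] z by simp
  qed
  ultimately show ?thesis by simp
qed

lemma bphi_eq_0_iff:
  fixes w :: complex
  assumes nu: "\<nu> > -1"
  shows "bphi \<nu> w = 0 \<longleftrightarrow> (\<exists>s\<in>bzeros \<nu>. w = of_real s \<or> w = - of_real s)"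
proof
  assume z: "bphi \<nu> w = 0"
  then have w: "w = of_real (Re w)" using bphi_zero_real[OF nu z] by (simp add: complex_eq_iff)
  then have r: "bphi \<nu> (Re w) = 0" using z bphi_of_real[OF nu, of "Re w", where 'a = complex] by simp
  then have "Re w \<noteq> 0" by auto
  then have "\<bar>Re w\<bar> \<in> bzeros \<nu>" using r by (auto simp: bzeros_def abs_if bphi_minus)
  moreover have "w = of_real \<bar>Re w\<bar> \<or> w = - of_real \<bar>Re w\<bar>" using w by (auto simp: abs_if)
  ultimately show "\<exists>s\<in>bzeros \<nu>. w = of_real s \<or> w = - of_real s" by blast
next
  assume "\<exists>s\<in>bzeros \<nu>. w = of_real s \<or> w = - of_real s"
  then show "bphi \<nu> w = 0" by (auto simp: bzeros_def bphi_minus bphi_of_real[OF nu])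
qed

lemma holomorphic_on_bphi: "\<nu> > -1 \<Longrightarrow> bphi \<nu> holomorphic_on A"
  by (meson bphi_has_field_derivative has_field_derivative_at_within holomorphic_onI field_differentiable_def)

lemma finite_bzeros_atMost:
  assumes nu: "\<nu> > -1"
  shows "finite (bzeros \<nu> \<inter> {..R})"
proof -
  have fin: "finite {z \<in> cball 0 \<bar>R\<bar>. bphi \<nu> z = (0::complex)}"
  proof (rule holomorphic_compact_finite_zeros[of "bphi \<nu>" UNIV])
    obtain b where b: "b > 0" "\<And>w::complex. norm w \<le> b \<Longrightarrow> norm (bphi \<nu> w - 1) \<le> 1/2"
      using bphi_near_0[OF nu] by blast
    \<comment> \<open>If \<open>bphi\<close> were constant its derivative would vanish, hence also
      the function of order \<nu>+1 off 0; but that one is close to 1 near 0.\<close>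
    show "\<not> (bphi \<nu> :: complex \<Rightarrow> complex) constant_on UNIV"
    proof
      assume "(bphi \<nu> :: complex \<Rightarrow> complex) constant_on UNIV"
      then obtain y where y: "\<And>w::complex. bphi \<nu> w = y" by (auto simp: constant_on_def)
      then have "y = 1" using bphi_0[of \<nu>, where 'a = complex] by metis
      then have "bphi \<nu> = (\<lambda>w::complex. 1)" using y by auto
      moreover have "(bphi \<nu> has_field_derivative bphi' \<nu> (1::complex)) (at 1)"
        "(bphi \<nu> has_field_derivative bphi' \<nu> (w::complex)) (at w)" for w by (rule bphi_has_field_derivative[OF nu])+
      ultimately have d0: "bphi' \<nu> w = 0" for w :: complex
        by (metis DERIV_const DERIV_unique)
      have "bphi (\<nu> + 1) w = 0" if "w \<noteq> 0" for w :: complex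
        using d0[of w] that nu by (simp add: bphi'_def del: of_real_add of_real_mult)
      moreover obtain b where "b > 0" "\<And>w::complex. norm w \<le> b \<Longrightarrow> norm (bphi (\<nu> + 1) w - 1) \<le> 1/2"
        using bphi_near_0[of "\<nu> + 1"] nu by auto
      then have "b > 0" "norm (bphi (\<nu> + 1) (complex_of_real b) - 1) \<le> 1/2" by auto
      ultimately show False by simp
    qed
  qed (auto intro!: holomorphic_on_bphi nu)
  have "complex_of_real ` (bzeros \<nu> \<inter> {..R}) \<subseteq> {z \<in> cball 0 \<bar>R\<bar>. bphi \<nu> z = 0}"
    by (auto simp: bzeros_def bphi_of_real[OF nu])
  from finite_subset[OF this fin] show ?thesis by (rule finite_imageD) (simp add: inj_on_def)
qed

lemma bzeros_lower_bound:
  assumes nu: "\<nu> > -1"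
  obtains b where "b > 0" "\<And>s. s \<in> bzeros \<nu> \<Longrightarrow> b \<le> s"
proof -
  obtain b where b: "b > 0" "\<And>x::real. \<bar>x\<bar> \<le> b \<Longrightarrow> 1/2 \<le> bphi \<nu> x" using bphi_real_ge_half[OF nu] by blast
  have "b \<le> s" if "s \<in> bzeros \<nu>" for s
  proof (rule ccontr)
    assume "\<not> b \<le> s"
    then show False using b(2)[of s] that by (simp add: bzeros_def)
  qed
  then show thesis using b that by blast
qed

text \<open>At a zero U vanishes, so the energy is |U'|^2 = s^(2\<nu>+1) |\<phi>'(s)|^2 and passes
  its lower bound on to \<phi>'. In particular the zeros are simple.\<close>

lemma bphi'_at_zero_bounds:
  assumes nu: "\<nu> > -1"
  obtains c where "c > 0" "\<And>s. s \<in> bzeros \<nu> \<Longrightarrow> c * s powr (- (\<nu> + 1/2)) \<le> \<bar>bphi' \<nu> s\<bar>"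
proof -
  obtain b where b: "b > 0" "\<And>s. s \<in> bzeros \<nu> \<Longrightarrow> b \<le> s" using bzeros_lower_bound[OF nu] by blast
  obtain c where c: "0 < c" "\<And>a. b \<le> a \<Longrightarrow> c \<le> (norm (bU' \<nu> (of_real a)))\<^sup>2 + (norm (bU \<nu> (of_real a)))\<^sup>2"
    using bU_energy_real_bounds[OF nu b(1)] by metis
  have "sqrt c * s powr (- (\<nu> + 1/2)) \<le> \<bar>bphi' \<nu> s\<bar>" if s: "s \<in> bzeros \<nu>" for s
  proof -
    have s0: "s > 0" "bphi \<nu> s = 0" using s by (auto simp: bzeros_def)
    have "norm (bU' \<nu> (of_real s)) = s powr (\<nu> + 1/2) * \<bar>bphi' \<nu> s\<bar>"
      using s0 bU_of_real(2)[OF nu s0(1)] by (simp add: abs_mult norm_mult)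
    moreover have "norm (bU \<nu> (of_real s)) = 0" using s0 bU_of_real(1)[OF nu s0(1)] by simp
    ultimately have "c \<le> (s powr (\<nu> + 1/2) * \<bar>bphi' \<nu> s\<bar>)\<^sup>2" using c(2)[OF b(2)[OF s]] by simp
    then have "sqrt c \<le> s powr (\<nu> + 1/2) * \<bar>bphi' \<nu> s\<bar>"
      using real_sqrt_le_mono by fastforce
    then have "sqrt c * s powr (- (\<nu> + 1/2)) \<le> (s powr (\<nu> + 1/2) * \<bar>bphi' \<nu> s\<bar>) * s powr (- (\<nu> + 1/2))"
      by (rule mult_right_mono) simp
    also have "\<dots> = \<bar>bphi' \<nu> s\<bar> * (s powr (\<nu> + 1/2) * s powr (- (\<nu> + 1/2)))" by simp
    also have "\<dots> = \<bar>bphi' \<nu> s\<bar>" using s0 by (simp only: powr_add[symmetric]) simp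
    finally show ?thesis .
  qed
  then show thesis using c by (intro that[of "sqrt c"]) auto
qed

lemma bphi'_at_zero_nonzero:
  assumes "\<nu> > -1" "s \<in> bzeros \<nu>"
  shows "bphi' \<nu> s \<noteq> 0"
proof -
  obtain c where c: "c > 0" "c * s powr (- (\<nu> + 1/2)) \<le> \<bar>bphi' \<nu> s\<bar>" using bphi'_at_zero_bounds assms by metis
  moreover have "s > 0" using assms(2) by (simp add: bzeros_def)
  ultimately have "0 < \<bar>bphi' \<nu> s\<bar>" by (smt (verit) mult_pos_pos powr_gt_zero)
  then show ?thesis by simp
qed

lemma bphi'_upper_bound_real:
  assumes nu: "\<nu> > -1"
  obtains C where "C > 0" "\<And>x::real. x > 0 \<Longrightarrow> \<bar>bphi' \<nu> x\<bar> \<le> C * x * (1 + x) powr (- (\<nu> + 3/2))"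
proof -
  obtain C where C: "C > 0" "\<And>w::complex. norm (bphi (\<nu> + 1) w) \<le> C * (1 + norm w) powr (- ((\<nu> + 1) + 1/2)) * exp \<bar>Im w\<bar>"
    using bphi_upper_bound[of "\<nu> + 1"] nu by auto
  have "\<bar>bphi' \<nu> x\<bar> \<le> (C / (2 * (\<nu> + 1))) * x * (1 + x) powr (- (\<nu> + 3/2))" if "x > 0" for x :: real
  proof -
    have "norm (complex_of_real (bphi (\<nu> + 1) x)) \<le> C * (1 + x) powr (- (\<nu> + 3/2))"
      using C(2)[of "of_real x"] that nu bphi_of_real[of "\<nu> + 1" x, where 'a = complex] by (simp add: add.commute)
    then have 1: "\<bar>bphi (\<nu> + 1) x\<bar> \<le> C * (1 + x) powr (- (\<nu> + 3/2))" unfolding norm_of_real .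
    have "\<bar>bphi' \<nu> x\<bar> = x / (2 * (\<nu> + 1)) * \<bar>bphi (\<nu> + 1) x\<bar>"
      using nu that by (simp add: bphi'_def abs_mult abs_divide)
    also have "\<dots> \<le> x / (2 * (\<nu> + 1)) * (C * (1 + x) powr (- (\<nu> + 3/2)))"
      using 1 nu that by (intro mult_left_mono) auto
    finally show ?thesis by (simp add: mult_ac)
  qed
  then show thesis using C nu by (intro that[of "C / (2 * (\<nu> + 1))"]) auto
qed

text \<open>At a zero the energy is carried by \<open>U'\<close> alone, and \<open>U'\<close> needs a fixed amount of time to reach the
  zero which Rolle's theorem provides before the next zero of \<open>U\<close>.\<close>
lemma bzeros_separated:
  assumes nu: "\<nu> > -1"
  obtains d where "d > 0" "\<And>s t. s \<in> bzeros \<nu> \<Longrightarrow> t \<in> bzeros \<nu> \<Longrightarrow> s < t \<Longrightarrow> d \<le> t - s"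
proof -
  obtain b where b: "b > 0" "\<And>s. s \<in> bzeros \<nu> \<Longrightarrow> b \<le> s" using bzeros_lower_bound[OF nu] by blast
  obtain c C where c: "0 < c" "c \<le> C" "\<And>a. b \<le> a \<Longrightarrow> c \<le> (norm (bU' \<nu> (of_real a)))\<^sup>2 + (norm (bU \<nu> (of_real a)))\<^sup>2"
    "\<And>a. b \<le> a \<Longrightarrow> (norm (bU' \<nu> (of_real a)))\<^sup>2 + (norm (bU \<nu> (of_real a)))\<^sup>2 \<le> C"
    using bU_energy_real_bounds[OF nu b(1)] by metis
  define m where "m = \<nu>\<^sup>2 - 1/4"
  define u where "u = (\<lambda>t. t powr (\<nu> + 1/2) * bphi \<nu> t)"
  define v where "v = (\<lambda>t. t powr (\<nu> + 1/2) * (bphi' \<nu> t + (\<nu> + 1/2) / t * bphi \<nu> t))"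
  \<comment> \<open>\<open>D\<close> bounds |v'| beyond \<open>b\<close>, because v' = (m/t^2 - 1) u
    and |u| \<le> sqrt C. As |v| \<ge> sqrt c at a zero of u, v needs time sqrt c / D to
    vanish.\<close>
  define D where "D = (\<bar>m\<bar> / b\<^sup>2 + 1) * sqrt C"
  have D: "D > 0" using c b by (auto simp: D_def intro!: mult_pos_pos add_nonneg_pos)
  have cu: "bU \<nu> (of_real t) = of_real (u t)" "bU' \<nu> (of_real t) = of_real (v t)" if "t > 0" for t
    using bU_of_real[OF nu that] by (auto simp: u_def v_def)
  have E: "c \<le> (v t)\<^sup>2 + (u t)\<^sup>2" "(v t)\<^sup>2 + (u t)\<^sup>2 \<le> C" if "b \<le> t" for t
    using c(3,4)[OF that] cu[of t] that b by simp_all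
  have du: "(u has_real_derivative v t) (at t)" if t: "t > 0" for t
  proof -
    have "((\<lambda>t. Re (bU \<nu> (of_real t))) has_vector_derivative Re (bU' \<nu> (of_real t))) (at t)"
      by (rule bounded_linear.has_vector_derivative[OF bounded_linear_Re bU_real_vector_derivative(1)[OF nu t]])
    then have "((\<lambda>t. Re (bU \<nu> (of_real t))) has_real_derivative v t) (at t)"
      using cu[OF t] by (simp add: has_real_derivative_iff_has_vector_derivative)
    then show ?thesis
      by (rule has_field_derivative_transform_within_open[of _ _ _ "{0<..}"]) (use t cu in auto)
  qed
  have dv: "(v has_real_derivative (m / t\<^sup>2 - 1) * u t) (at t)" if t: "t > 0" for t
  proof -
    have e: "(of_real (\<nu>\<^sup>2 - 1/4) / (of_real t)\<^sup>2 - 1) * bU \<nu> (of_real t) = of_real ((m / t\<^sup>2 - 1) * u t)"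
      using cu[OF t] by (simp add: m_def)
    have "((\<lambda>t. Re (bU' \<nu> (of_real t))) has_vector_derivative Re (of_real ((m / t\<^sup>2 - 1) * u t))) (at t)"
      using bounded_linear.has_vector_derivative[OF bounded_linear_Re bU_real_vector_derivative(2)[OF nu t]] unfolding e .
    then have "((\<lambda>t. Re (bU' \<nu> (of_real t))) has_real_derivative (m / t\<^sup>2 - 1) * u t) (at t)"
      by (simp add: has_real_derivative_iff_has_vector_derivative)
    then show ?thesis
      by (rule has_field_derivative_transform_within_open[of _ _ _ "{0<..}"]) (use t cu in auto)
  qed
  have "sqrt c / D \<le> t - s" if st: "s \<in> bzeros \<nu>" "t \<in> bzeros \<nu>" "s < t" for s t
  proof -
    have sb: "b \<le> s" "b \<le> t" using b(2) st by auto
    have z: "u s = 0" "u t = 0" using st by (auto simp: u_def bzeros_def)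
    obtain \<xi> where xi: "s < \<xi>" "\<xi> < t" "v \<xi> = 0"
    proof -
      have "\<exists>z>s. z < t \<and> u t - u s = (t - s) * v z"
        by (rule MVT2[OF st(3)]) (use du sb b in auto)
      then show thesis using that z st(3) by auto
    qed
    obtain z where zz: "s < z" "z < \<xi>" "v \<xi> - v s = (\<xi> - s) * ((m / z\<^sup>2 - 1) * u z)"
    proof -
      have "\<exists>z>s. z < \<xi> \<and> v \<xi> - v s = (\<xi> - s) * ((m / z\<^sup>2 - 1) * u z)"
        by (rule MVT2[OF xi(1)]) (use dv sb b in auto)
      then show thesis using that by auto
    qed
    have "\<bar>u z\<bar> \<le> sqrt C"
    proof (rule real_le_rsqrt)
      show "\<bar>u z\<bar>\<^sup>2 \<le> C" using E(2)[of z] sb zz zero_le_power2[of "v z"] unfolding power2_abs by linarith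
    qed
    moreover have "\<bar>m / z\<^sup>2 - 1\<bar> \<le> \<bar>m\<bar> / b\<^sup>2 + 1"
    proof -
      have "\<bar>m / z\<^sup>2\<bar> \<le> \<bar>m\<bar> / b\<^sup>2"
        using sb zz b by (auto simp: abs_divide intro!: divide_left_mono power_mono mult_pos_pos)
      then show ?thesis by linarith
    qed
    ultimately have "\<bar>(m / z\<^sup>2 - 1) * u z\<bar> \<le> D"
      unfolding abs_mult D_def using b by (intro mult_mono) auto
    moreover have "sqrt c \<le> \<bar>v s\<bar>"
      using E(1)[OF sb(1)] z real_sqrt_le_mono by fastforce
    moreover have "\<bar>v s\<bar> = (\<xi> - s) * \<bar>(m / z\<^sup>2 - 1) * u z\<bar>"
    proof -
      have "v s = - ((\<xi> - s) * ((m / z\<^sup>2 - 1) * u z))" using zz(3) xi(3) by linarith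
      then have "\<bar>v s\<bar> = \<bar>(\<xi> - s) * ((m / z\<^sup>2 - 1) * u z)\<bar>" by simp
      then show ?thesis using xi(1) by (simp only: abs_mult) simp
    qed
    ultimately have "sqrt c \<le> (\<xi> - s) * D" using xi by (smt (verit) mult_left_mono)
    also have "\<dots> \<le> (t - s) * D" using xi D by (intro mult_right_mono) auto
    finally show ?thesis using D by (simp add: field_simps)
  qed
  then show thesis using c D by (intro that[of "sqrt c / D"]) auto
qed

lemma card_separated_le:
  fixes S :: "real set"
  assumes d: "d > 0" and sep: "\<And>s t. s \<in> S \<Longrightarrow> t \<in> S \<Longrightarrow> s < t \<Longrightarrow> d \<le> t - s" and S: "S \<subseteq> {x..y}" and xy: "x \<le> y"
  shows "real (card S) \<le> (y - x) / d + 1"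
proof -
  define f where "f = (\<lambda>s. nat \<lfloor>(s - x) / d\<rfloor>)"
  have inj: "inj_on f S"
  proof (rule linorder_inj_onI)
    fix s t assume st: "s < t" "s \<in> S" "t \<in> S"
    have "1 \<le> (t - x) / d - (s - x) / d" using sep[OF st(2,3,1)] d by (simp add: field_simps)
    then have "\<lfloor>(s - x) / d\<rfloor> < \<lfloor>(t - x) / d\<rfloor>" by linarith
    moreover have "0 \<le> \<lfloor>(s - x) / d\<rfloor>" using S st d by auto
    ultimately show "f s \<noteq> f t" unfolding f_def by linarith
  qed auto
  have "f ` S \<subseteq> {..nat \<lfloor>(y - x) / d\<rfloor>}"
    using S d by (auto simp: f_def intro!: nat_mono floor_mono divide_right_mono)
  then have "card (f ` S) \<le> card {..nat \<lfloor>(y - x) / d\<rfloor>}" by (intro card_mono) auto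
  then have "card S \<le> nat \<lfloor>(y - x) / d\<rfloor> + 1" using card_image[OF inj] by simp
  moreover have "real (nat \<lfloor>(y - x) / d\<rfloor>) \<le> (y - x) / d" using xy d by (intro of_nat_floor) auto
  ultimately show ?thesis by linarith
qed

text \<open>At the two ends of the interval sin(t + \<eta>) equals sin \<epsilon> with opposite
  signs, and beyond \<open>T\<close> the asymptotic error is at most half of A sin \<epsilon>; the
  intermediate value theorem applies.\<close>

lemma bzero_near:
  assumes nu: "\<nu> > -1" and as: "bessel_asymptotic \<nu> A \<eta> C" "A > 0" "C > 0" and e: "0 < \<epsilon>" "\<epsilon> < pi / 2"
  shows "\<exists>K. \<forall>k\<ge>K. \<exists>s\<in>bzeros \<nu>. \<bar>s - (real k * pi - \<eta>)\<bar> < \<epsilon>"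
proof -
  have se: "sin \<epsilon> > 0" using e by (intro sin_gt_zero) auto
  define T where "T = max 1 (2 * C / (A * sin \<epsilon>))"
  define K where "K = nat \<lceil>(T + \<eta> + \<epsilon>) / pi\<rceil>"
  have "\<exists>s\<in>bzeros \<nu>. \<bar>s - (real k * pi - \<eta>)\<bar> < \<epsilon>" if k: "k \<ge> K" for k
  proof -
    have "(T + \<eta> + \<epsilon>) / pi \<le> real k" using k unfolding K_def by (simp add: nat_le_iff ceiling_le_iff)
    then have kT: "T \<le> real k * pi - \<eta> - \<epsilon>" by (simp add: field_simps)
    define h where "h = (\<lambda>t. t powr (\<nu> + 1/2) * bphi \<nu> t)"
    have hb: "\<bar>h t - A * sin (t + \<eta>)\<bar> < A * sin \<epsilon>" if t: "T \<le> t" for t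
    proof -
      have t1: "t \<ge> 1" using t by (simp add: T_def)
      have "norm (bU \<nu> (of_real t) - of_real A * sin (of_real t + of_real \<eta>)) \<le> C / t"
        using as(1) t1 unfolding bessel_asymptotic_def by (elim allE[of _ "of_real t"]) simp
      moreover have "bU \<nu> (of_real t) - of_real A * sin (of_real t + of_real \<eta>) = of_real (h t - A * sin (t + \<eta>))"
        using bU_of_real(1)[OF nu, of t] t1 by (simp add: h_def sin_of_real flip: of_real_add)
      ultimately have "\<bar>h t - A * sin (t + \<eta>)\<bar> \<le> C / t" by (simp only: norm_of_real)
      also have "\<dots> < A * sin \<epsilon>"
      proof -
        have "2 * C / (A * sin \<epsilon>) \<le> t" using t by (simp add: T_def)
        then have "2 * C \<le> t * (A * sin \<epsilon>)" using as se by (simp add: field_simps)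
        then show ?thesis using as t1 by (simp add: field_simps)
      qed
      finally show ?thesis .
    qed
    define a b where "a = real k * pi - \<eta> - \<epsilon>" and "b = real k * pi - \<eta> + \<epsilon>"
    have ab: "T \<le> a" "a < b" "T \<le> b" "a \<ge> 1" using kT e by (auto simp: a_def b_def T_def)
    have sa: "sin (a + \<eta>) = - ((-1) ^ k * sin \<epsilon>)" and sb: "sin (b + \<eta>) = (-1) ^ k * sin \<epsilon>"
      by (simp_all add: a_def b_def sin_diff sin_add)
    have "h a * h b < 0"
      using hb[OF ab(1)] hb[OF ab(3)] unfolding sa sb
      by (cases "even k") (auto simp: mult_less_0_iff abs_if split: if_splits)
    moreover have "h a = a powr (\<nu> + 1/2) * bphi \<nu> a" "h b = b powr (\<nu> + 1/2) * bphi \<nu> b" by (simp_all add: h_def)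
    ultimately have sgn: "bphi \<nu> a * bphi \<nu> b < 0" using ab
      by (auto simp: mult_less_0_iff zero_less_mult_iff)
    have "\<exists>x. a \<le> x \<and> x \<le> b \<and> bphi \<nu> x = 0"
    proof (cases "bphi \<nu> a < 0")
      case True
      then have "bphi \<nu> b > 0" using sgn by (simp add: mult_less_0_iff)
      then show ?thesis using True ab by (intro IVT') (auto intro!: continuous_on_bphi nu)
    next
      case False
      then have "bphi \<nu> a > 0" "bphi \<nu> b < 0" using sgn by (auto simp: mult_less_0_iff)
      then show ?thesis using ab by (intro IVT2') (auto intro!: continuous_on_bphi nu)
    qed
    then obtain x where x: "a \<le> x" "x \<le> b" "bphi \<nu> x = 0" by blast
    then have "x \<noteq> a" "x \<noteq> b" using sgn by auto
    then show ?thesis using x ab by (intro bexI[of _ x]) (auto simp: a_def b_def bzeros_def)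
  qed
  then show ?thesis by blast
qed

lemma infinite_bzeros:
  assumes nu: "\<nu> > -1"
  shows "infinite (bzeros \<nu>)"
proof
  assume fin: "finite (bzeros \<nu>)"
  obtain \<eta> A C where as: "A > 0" "C > 0" "bessel_asymptotic \<nu> A \<eta> C" using bessel_asymptotic_exists[OF nu] by blast
  obtain K where K: "\<And>k. k \<ge> K \<Longrightarrow> \<exists>s\<in>bzeros \<nu>. \<bar>s - (real k * pi - \<eta>)\<bar> < 1"
    using bzero_near[OF nu as(3,1,2), of 1] pi_gt3 by auto
  obtain M where M: "\<And>s. s \<in> bzeros \<nu> \<Longrightarrow> s \<le> M" using fin by (meson bdd_above_finite bdd_above_def)
  define k where "k = max K (nat \<lceil>M + \<eta> + 1\<rceil>)"
  obtain s where s: "s \<in> bzeros \<nu>" "\<bar>s - (real k * pi - \<eta>)\<bar> < 1" using K[of k] by (auto simp: k_def)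
  have "M + \<eta> + 1 \<le> real k" unfolding k_def by linarith
  moreover have "real k * 1 \<le> real k * pi" using pi_gt3 by (intro mult_left_mono) auto
  ultimately have "M < s" using s(2) by linarith
  with M[OF s(1)] show False by simp
qed

text \<open>The number of smaller zeros is an injective rank on the zeros that takes every value,
  which resolves the definite description. From here on sums can run over the set
  \<open>bzeros\<close> without an enumeration.\<close>

lemma bij_betw_bessel_zero:
  assumes nu: "\<nu> > -1"
  shows "bij_betw (bessel_zero \<nu>) {1..} (bzeros \<nu>)"
proof -
  define Z where "Z = bzeros \<nu>"
  define r where "r = (\<lambda>s. card {t \<in> Z. t < s})"
  have finZ: "finite {t \<in> Z. t < s}" for s
    by (rule finite_subset[OF _ finite_bzeros_atMost[OF nu, of s]]) (auto simp: Z_def)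
  have Zeq: "{t. 0 < t \<and> t < s \<and> besselJ \<nu> t = 0} = {t \<in> Z. t < s}" for s
    using besselJ_eq_0_iff[OF nu] by (auto simp: Z_def bzeros_def)
  have mono: "r s < r t" if "s \<in> Z" "s < t" for s t
    unfolding r_def by (rule psubset_card_mono[OF finZ]) (use that in auto)
  have inj: "inj_on r Z"
    by (rule linorder_inj_onI) (use mono in force)+
  have surj: "\<exists>s\<in>Z. r s = n" for n
  proof (induction n)
    case 0
    have "Z \<noteq> {}" using infinite_bzeros[OF nu] by (auto simp: Z_def)
    then obtain t where t: "t \<in> Z" by auto
    define F where "F = Z \<inter> {..t}"
    have F: "finite F" "F \<noteq> {}" using finite_bzeros_atMost[OF nu, of t] t by (auto simp: F_def Z_def)
    have "{u \<in> Z. u < Min F} = {}"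
      using Min_le[OF F(1)] Min_in[OF F] by (fastforce simp: F_def)
    moreover have "Min F \<in> Z" using Min_in[OF F] by (simp add: F_def)
    ultimately have "Min F \<in> Z" "r (Min F) = 0" unfolding r_def by (simp_all only: card.empty)
    then show ?case by blast
  next
    case (Suc n)
    then obtain s where s: "s \<in> Z" "r s = n" by blast
    have "infinite (Z - {..s})"
    proof -
      have "Z - {..s} = Z - (Z \<inter> {..s})" by blast
      then show ?thesis using infinite_bzeros[OF nu] finite_bzeros_atMost[OF nu, of s] by (simp add: Z_def Diff_infinite_finite)
    qed
    then obtain t where t: "t \<in> Z" "s < t" by (metis Diff_iff atMost_iff finite.emptyI not_le all_not_in_conv)
    define F where "F = {u \<in> Z. s < u \<and> u \<le> t}"
    have F: "finite F" "F \<noteq> {}"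
      using t finite_subset[OF _ finite_bzeros_atMost[OF nu, of t], of F] by (auto simp: F_def Z_def)
    have m: "Min F \<in> Z" "s < Min F" "\<And>u. u \<in> Z \<Longrightarrow> s < u \<Longrightarrow> Min F \<le> u"
      using Min_in[OF F] Min_le[OF F(1)] by (auto simp: F_def) (meson linorder_le_cases order_trans)
    have "{u \<in> Z. u < Min F} = insert s {u \<in> Z. u < s}"
      using m s by force
    then have "r (Min F) = Suc n" using s finZ by (simp add: r_def)
    then show ?case using m by blast
  qed
  have bz: "bessel_zero \<nu> j = s" if "s \<in> Z" "r s = j - 1" for j s
    unfolding bessel_zero_def Zeq
  proof (rule the_equality)
    show "0 < s \<and> besselJ \<nu> s = 0 \<and> card {t \<in> Z. t < s} = j - 1"
      using that besselJ_eq_0_iff[OF nu, of s] by (auto simp: Z_def bzeros_def r_def)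
    fix t assume t: "0 < t \<and> besselJ \<nu> t = 0 \<and> card {u \<in> Z. u < t} = j - 1"
    then have "t \<in> Z" "r t = j - 1" using besselJ_eq_0_iff[OF nu, of t] by (auto simp: Z_def bzeros_def r_def)
    then show "t = s" using inj that by (metis inj_onD)
  qed
  \<comment> \<open>The index 0 repeats the first zero, since j - 1 truncates to 0; hence the domain
    {1..}.\<close>
  have key: "bessel_zero \<nu> j \<in> Z \<and> r (bessel_zero \<nu> j) = j - 1" for j
    using surj[of "j - 1"] bz by blast
  show ?thesis unfolding bij_betw_def Z_def[symmetric]
  proof (intro conjI)
    show "inj_on (bessel_zero \<nu>) {1..}"
    proof (rule inj_onI)
      fix i j :: nat assume ij: "i \<in> {1..}" "j \<in> {1..}" "bessel_zero \<nu> i = bessel_zero \<nu> j"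
      then have "i - 1 = j - 1" using key by metis
      then show "i = j" using ij by auto
    qed
    show "bessel_zero \<nu> ` {1..} = Z"
    proof (intro set_eqI iffI)
      fix s assume "s \<in> Z"
      then have "bessel_zero \<nu> (Suc (r s)) = s" using bz by simp
      then show "s \<in> bessel_zero \<nu> ` {1..}" by (metis atLeast_iff imageI le_add1 plus_1_eq_Suc)
    qed (use key in auto)
  qed
qed

section \<open>The solution vanishing at the right end point\<close>

text \<open>Iterating \<open>X\<^sub>k(x) = \<integral>\<^sub>x\<^sup>1 t\<^sup>-\<^sup>2\<^sup>\<nu>\<^sup>-\<^sup>1 Y\<^sub>k(t) dt\<close> and \<open>Y\<^sub>k\<^sub>+\<^sub>1(x) = \<integral>\<^sub>x\<^sup>1 s\<^sup>2\<^sup>\<nu>\<^sup>+\<^sup>1 X\<^sub>k(s) ds\<close>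
  from \<open>Y\<^sub>0 = 1\<close> yields the coefficients of the solution, which is a power series in \<open>- z\<^sup>2\<close>.\<close>
primrec bY :: "real \<Rightarrow> nat \<Rightarrow> real \<Rightarrow> real" where
  "bY \<nu> 0 = (\<lambda>x. 1)"
| "bY \<nu> (Suc k) = (\<lambda>x. integral {x..1} (\<lambda>s. s powr (2 * \<nu> + 1) * integral {s..1} (\<lambda>t. t powr (- (2 * \<nu> + 1)) * bY \<nu> k t)))"

definition bX :: "real \<Rightarrow> nat \<Rightarrow> real \<Rightarrow> real" where
  "bX \<nu> k x = integral {x..1} (\<lambda>t. t powr (- (2 * \<nu> + 1)) * bY \<nu> k t)"

lemma bY_Suc: "bY \<nu> (Suc k) x = integral {x..1} (\<lambda>s. s powr (2 * \<nu> + 1) * bX \<nu> k s)"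
  by (simp add: bX_def)

declare bY.simps(2) [simp del]

lemma continuous_on_integral_lower:
  fixes f :: "real \<Rightarrow> real"
  assumes "continuous_on {e..1} f"
  shows "continuous_on {e..1} (\<lambda>x. integral {x..1} f)"
  unfolding continuous_on_eq_continuous_within
  using integral_has_real_derivative'[OF assms] DERIV_continuous by blast

lemma continuous_on_bY_bX:
  assumes e: "e > 0"
  shows "continuous_on {e..1} (bY \<nu> k)" and "continuous_on {e..1} (bX \<nu> k)"
proof -
  have p: "continuous_on {e..1} (\<lambda>t. t powr s)" for s :: real using e by (auto intro!: continuous_intros)
  have X: "continuous_on {e..1} (bX \<nu> k)" if "continuous_on {e..1} (bY \<nu> k)" for k
    unfolding bX_def[abs_def] by (intro continuous_on_integral_lower continuous_on_mult p that)
  have Y: "continuous_on {e..1} (bY \<nu> k)" for k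
  proof (induction k)
    case (Suc k)
    show ?case unfolding bY_Suc[abs_def] by (intro continuous_on_integral_lower continuous_on_mult p X Suc)
  qed simp
  show "continuous_on {e..1} (bY \<nu> k)" "continuous_on {e..1} (bX \<nu> k)" by (rule Y, rule X[OF Y])
qed

lemma bX_has_derivative:
  assumes "e > 0" "x \<in> {e..1}"
  shows "(bX \<nu> k has_real_derivative - (x powr (- (2 * \<nu> + 1)) * bY \<nu> k x)) (at x within {e..1})"
  unfolding bX_def[abs_def]
  by (rule integral_has_real_derivative') (use assms in \<open>auto intro!: continuous_intros continuous_on_bY_bX\<close>)

lemma bY_has_derivative:
  assumes "e > 0" "x \<in> {e..1}"
  shows "(bY \<nu> (Suc k) has_real_derivative - (x powr (2 * \<nu> + 1) * bX \<nu> k x)) (at x within {e..1})"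
  unfolding bY_Suc[abs_def]
  by (rule integral_has_real_derivative') (use assms in \<open>auto intro!: continuous_intros continuous_on_bY_bX\<close>)

text \<open>The exponent 2\<nu>+1 may have either sign; the absolute value gives one bound for it
  and for its negative.\<close>

lemma powr_le_lower_end:
  fixes e x s :: real
  assumes "0 < e" "e \<le> x" "x \<le> 1"
  shows "x powr s \<le> e powr (- \<bar>s\<bar>)" and "x powr (- s) \<le> e powr (- \<bar>s\<bar>)"
proof -
  have *: "x powr r \<le> e powr (- \<bar>r\<bar>)" for r
  proof -
    have "x powr r \<le> x powr (- \<bar>r\<bar>)" using assms by (intro powr_mono') auto
    also have "\<dots> \<le> e powr (- \<bar>r\<bar>)" using assms by (intro powr_mono2') auto
    finally show ?thesis .
  qed
  show "x powr s \<le> e powr (- \<bar>s\<bar>)" by (rule *)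
  show "x powr (- s) \<le> e powr (- \<bar>s\<bar>)" using *[of "- s"] by (simp only: abs_minus_cancel)
qed

lemma integral_power_tail:
  fixes x :: real
  assumes "x \<le> 1"
  shows "((\<lambda>t. (1 - t) ^ k / fact k) has_integral (1 - x) ^ Suc k / fact (Suc k)) {x..1}"
proof -
  have "((\<lambda>t. (1 - t) ^ k / fact k) has_integral (- ((1 - 1) ^ Suc k / fact (Suc k)) - - ((1 - x) ^ Suc k / fact (Suc k)))) {x..1}"
  proof (rule fundamental_theorem_of_calculus[OF assms])
    fix t :: real
    have "((\<lambda>t. - ((1 - t) ^ Suc k / fact (Suc k))) has_real_derivative (1 - t) ^ k / fact k) (at t within {x..1})"
      by (rule derivative_eq_intros refl | simp)+
    then show "((\<lambda>t. - ((1 - t) ^ Suc k / fact (Suc k))) has_vector_derivative (1 - t) ^ k / fact k) (at t within {x..1})"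
      by (simp add: has_real_derivative_iff_has_vector_derivative)
  qed
  then show ?thesis by simp
qed

text \<open>Each round brings in two weights bounded by e^(-|2\<nu>+1|), where e is the lower end.
  The inner integral is estimated by its length, at most 1, and only the outer one raises the power
  of 1 - x; one factorial already makes the series entire in z.\<close>

lemma bY_bX_bounds:
  assumes e: "0 < e" and x: "e \<le> x" "x \<le> 1"
  shows "\<bar>bY \<nu> k x\<bar> \<le> ((e powr (- \<bar>2 * \<nu> + 1\<bar>))\<^sup>2) ^ k * ((1 - x) ^ k / fact k)"
    and "\<bar>bX \<nu> k x\<bar> \<le> e powr (- \<bar>2 * \<nu> + 1\<bar>) * ((e powr (- \<bar>2 * \<nu> + 1\<bar>))\<^sup>2) ^ k * ((1 - x) ^ k / fact k)"
proof -
  define M where "M = e powr (- \<bar>2 * \<nu> + 1\<bar>)"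
  have M: "M > 0" using e by (simp add: M_def)
  have pM: "t powr (2 * \<nu> + 1) \<le> M" "t powr (- (2 * \<nu> + 1)) \<le> M" if "e \<le> t" "t \<le> 1" for t
    unfolding M_def by (rule powr_le_lower_end[OF e that])+
  have intg: "(\<lambda>t. t powr s * f t) integrable_on {x..1}" if "continuous_on {e..1} f" "e \<le> x" for f s x
    using that e by (intro integrable_continuous_real continuous_intros continuous_on_subset[OF that(1)]) auto
  have X: "\<bar>bX \<nu> k x\<bar> \<le> M * (M\<^sup>2) ^ k * ((1 - x) ^ k / fact k)"
    if IH: "\<And>x. e \<le> x \<Longrightarrow> x \<le> 1 \<Longrightarrow> \<bar>bY \<nu> k x\<bar> \<le> (M\<^sup>2) ^ k * ((1 - x) ^ k / fact k)" and x: "e \<le> x" "x \<le> 1" for k x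
  proof -
    define B where "B = M * (M\<^sup>2) ^ k * ((1 - x) ^ k / fact k)"
    have B: "B \<ge> 0" using M x by (simp add: B_def)
    have "norm (integral {x..1} (\<lambda>t. t powr (- (2 * \<nu> + 1)) * bY \<nu> k t)) \<le> integral {x..1} (\<lambda>t. B)"
    proof (rule integral_norm_bound_integral)
      fix t assume t: "t \<in> {x..1}"
      have "norm (t powr (- (2 * \<nu> + 1)) * bY \<nu> k t) \<le> M * ((M\<^sup>2) ^ k * ((1 - t) ^ k / fact k))"
        unfolding norm_mult using t x pM[of t] IH[of t] M by (intro mult_mono) auto
      also have "\<dots> \<le> M * ((M\<^sup>2) ^ k * ((1 - x) ^ k / fact k))"
        using t x M by (intro mult_left_mono divide_right_mono power_mono) auto
      finally show "norm (t powr (- (2 * \<nu> + 1)) * bY \<nu> k t) \<le> B" by (simp add: B_def mult.assoc)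
    qed (use x in \<open>auto intro!: intg continuous_on_bY_bX e\<close>)
    also have "\<dots> = (1 - x) * B" using x by simp
    also have "\<dots> \<le> 1 * B" using x e B by (intro mult_right_mono) auto
    finally show ?thesis by (simp add: bX_def B_def)
  qed
  have Y: "\<bar>bY \<nu> k x\<bar> \<le> (M\<^sup>2) ^ k * ((1 - x) ^ k / fact k)" if "e \<le> x" "x \<le> 1" for x
    using that
  proof (induction k arbitrary: x)
    case (Suc k)
    have "norm (integral {x..1} (\<lambda>s. s powr (2 * \<nu> + 1) * bX \<nu> k s)) \<le> integral {x..1} (\<lambda>t. (M\<^sup>2) ^ Suc k * ((1 - t) ^ k / fact k))"
    proof (rule integral_norm_bound_integral)
      fix t assume t: "t \<in> {x..1}"
      have "norm (t powr (2 * \<nu> + 1) * bX \<nu> k t) \<le> M * (M * (M\<^sup>2) ^ k * ((1 - t) ^ k / fact k))"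
        unfolding norm_mult using t Suc.prems pM[of t] X[OF Suc.IH, of t] M by (intro mult_mono) auto
      then show "norm (t powr (2 * \<nu> + 1) * bX \<nu> k t) \<le> (M\<^sup>2) ^ Suc k * ((1 - t) ^ k / fact k)"
        by (simp add: power2_eq_square mult_ac)
    next
      show "(\<lambda>t. (M\<^sup>2) ^ Suc k * ((1 - t) ^ k / fact k)) integrable_on {x..1}"
        by (intro integrable_continuous_real continuous_intros) auto
    qed (use Suc.prems in \<open>auto intro!: intg continuous_on_bY_bX e\<close>)
    also have "\<dots> = (M\<^sup>2) ^ Suc k * ((1 - x) ^ Suc k / fact (Suc k))"
      by (intro integral_unique has_integral_mult_right integral_power_tail Suc.prems)
    finally show ?case by (simp add: bY_Suc)
  qed simp
  show "\<bar>bY \<nu> k x\<bar> \<le> ((e powr (- \<bar>2 * \<nu> + 1\<bar>))\<^sup>2) ^ k * ((1 - x) ^ k / fact k)"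
    using Y[OF x] by (simp add: M_def)
  show "\<bar>bX \<nu> k x\<bar> \<le> e powr (- \<bar>2 * \<nu> + 1\<bar>) * ((e powr (- \<bar>2 * \<nu> + 1\<bar>))\<^sup>2) ^ k * ((1 - x) ^ k / fact k)"
    using X[OF Y x] by (simp add: M_def)
qed

text \<open>The solution that vanishes at x = 1. Its companion \<open>bYs\<close> is the flux
  -x^(2\<nu>+1) dZ/dx, which equals 1 at x = 1. As power series in z^2 both are even in z, and
  holomorphy for fixed x is immediate.\<close>

definition bZs :: "real \<Rightarrow> real \<Rightarrow> complex \<Rightarrow> complex" where
  "bZs \<nu> x z = (\<Sum>k. (- z\<^sup>2) ^ k * of_real (bX \<nu> k x))"

definition bYs :: "real \<Rightarrow> real \<Rightarrow> complex \<Rightarrow> complex" where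
  "bYs \<nu> x z = (\<Sum>k. (- z\<^sup>2) ^ k * of_real (bY \<nu> k x))"

lemma has_vector_derivative_series:
  fixes f f' :: "nat \<Rightarrow> real \<Rightarrow> complex"
  assumes S: "convex S" and d: "\<And>n x. x \<in> S \<Longrightarrow> (f n has_vector_derivative f' n x) (at x within S)"
    and b: "\<And>n x. x \<in> S \<Longrightarrow> norm (f' n x) \<le> B n" "summable B"
    and s: "\<And>x. x \<in> S \<Longrightarrow> summable (\<lambda>n. f n x)" and x: "x \<in> S"
  shows "((\<lambda>x. \<Sum>n. f n x) has_vector_derivative (\<Sum>n. f' n x)) (at x within S)"
proof -
  have u: "uniform_limit S (\<lambda>n x. \<Sum>i<n. f' i x) (\<lambda>x. \<Sum>i. f' i x) sequentially"
    by (rule Weierstrass_m_test[OF b])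
  have "\<exists>g. \<forall>x\<in>S. (\<lambda>n. f n x) sums g x \<and> (g has_derivative (\<lambda>h. h *\<^sub>R (\<Sum>n. f' n x))) (at x within S)"
  proof (rule has_derivative_series[OF S _ _ x])
    show "(f n has_derivative (\<lambda>h. h *\<^sub>R f' n x)) (at x within S)" if "x \<in> S" for n x
      using d[OF that] by (simp add: has_vector_derivative_def)
    show "\<forall>\<^sub>F n in sequentially. \<forall>x\<in>S. \<forall>h. norm ((\<Sum>i<n. h *\<^sub>R f' i x) - h *\<^sub>R (\<Sum>n. f' n x)) \<le> e * norm h" if "e > 0" for e
      using uniform_limitD[OF u that]
    proof eventually_elim
      case (elim n)
      show ?case
      proof (intro ballI allI)
        fix x h assume "x \<in> S"
        then have "norm ((\<Sum>i<n. f' i x) - (\<Sum>i. f' i x)) \<le> e" using elim by (auto simp: dist_norm less_imp_le)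
        then have "\<bar>h\<bar> * norm ((\<Sum>i<n. f' i x) - (\<Sum>i. f' i x)) \<le> \<bar>h\<bar> * e" by (intro mult_left_mono) auto
        then show "norm ((\<Sum>i<n. h *\<^sub>R f' i x) - h *\<^sub>R (\<Sum>n. f' n x)) \<le> e * norm h"
          by (simp add: scaleR_sum_right[symmetric] scaleR_diff_right[symmetric] mult.commute)
      qed
    qed
    show "(\<lambda>n. f n x) sums (\<Sum>n. f n x)" using s[OF x] by (rule summable_sums)
  qed
  then obtain g where g: "\<And>x. x \<in> S \<Longrightarrow> (\<lambda>n. f n x) sums g x" "\<And>x. x \<in> S \<Longrightarrow> (g has_vector_derivative (\<Sum>n. f' n x)) (at x within S)"
    unfolding has_vector_derivative_def by blast
  have "g x = (\<Sum>n. f n x)" if "x \<in> S" for x using g(1)[OF that] by (simp add: sums_iff)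
  with g(2)[OF x] show ?thesis using x by (rule_tac has_vector_derivative_transform) auto
qed

lemma summable_exp_majorant: "summable (\<lambda>k. r ^ k * (M ^ k / fact k :: real))"
proof -
  have "(\<lambda>k. r ^ k * (M ^ k / fact k)) = (\<lambda>k. (r * M) ^ k /\<^sub>R fact k)"
    by (simp add: power_mult_distrib field_simps)
  then show ?thesis using summable_exp_generic[of "r * M"] by simp
qed

lemma bX_bY_summand_bounds:
  assumes e: "0 < e" and x: "e \<le> x" "x \<le> 1"
  shows "norm (w ^ k * complex_of_real (bY \<nu> k x)) \<le> norm w ^ k * (((e powr (- \<bar>2 * \<nu> + 1\<bar>))\<^sup>2) ^ k / fact k)"
    and "norm (w ^ k * complex_of_real (bX \<nu> k x)) \<le> e powr (- \<bar>2 * \<nu> + 1\<bar>) * (norm w ^ k * (((e powr (- \<bar>2 * \<nu> + 1\<bar>))\<^sup>2) ^ k / fact k))"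
proof -
  define M where "M = e powr (- \<bar>2 * \<nu> + 1\<bar>)"
  have M: "M > 0" using e by (simp add: M_def)
  have f: "(1 - x) ^ k / fact k \<le> 1 / fact k" using e x by (intro divide_right_mono power_le_one) auto
  have "\<bar>bY \<nu> k x\<bar> \<le> (M\<^sup>2) ^ k * (1 / fact k)"
    using bY_bX_bounds(1)[OF e x, of \<nu> k] mult_left_mono[OF f, of "(M\<^sup>2) ^ k"] M unfolding M_def[symmetric] by simp
  then show "norm (w ^ k * complex_of_real (bY \<nu> k x)) \<le> norm w ^ k * (((e powr (- \<bar>2 * \<nu> + 1\<bar>))\<^sup>2) ^ k / fact k)"
    unfolding M_def[symmetric] norm_mult norm_power norm_of_real by (intro mult_left_mono) auto
  have "\<bar>bX \<nu> k x\<bar> \<le> M * ((M\<^sup>2) ^ k * (1 / fact k))"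
    using bY_bX_bounds(2)[OF e x, of \<nu> k] mult_left_mono[OF f, of "M * (M\<^sup>2) ^ k"] M unfolding M_def[symmetric] by simp
  then have "norm w ^ k * \<bar>bX \<nu> k x\<bar> \<le> norm w ^ k * (M * ((M\<^sup>2) ^ k * (1 / fact k)))"
    by (intro mult_left_mono) auto
  then show "norm (w ^ k * complex_of_real (bX \<nu> k x)) \<le> e powr (- \<bar>2 * \<nu> + 1\<bar>) * (norm w ^ k * (((e powr (- \<bar>2 * \<nu> + 1\<bar>))\<^sup>2) ^ k / fact k))"
    unfolding M_def[symmetric] norm_mult norm_power norm_of_real by (simp add: mult_ac)
qed

lemma summable_bX_bY:
  assumes x: "0 < x" "x \<le> 1"
  shows "summable (\<lambda>k. w ^ k * complex_of_real (bY \<nu> k x))" "summable (\<lambda>k. w ^ k * complex_of_real (bX \<nu> k x))"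
  by (rule summable_comparison_test'[OF summable_exp_majorant bX_bY_summand_bounds(1)[OF x(1) order_refl x(2)]],
      rule summable_comparison_test'[OF summable_mult[OF summable_exp_majorant] bX_bY_summand_bounds(2)[OF x(1) order_refl x(2)]])

lemma bZs_has_derivative:
  assumes e: "0 < e" and x: "x \<in> {e..1}"
  shows "((\<lambda>x. bZs \<nu> x z) has_vector_derivative - (of_real (x powr (- (2 * \<nu> + 1))) * bYs \<nu> x z)) (at x within {e..1})"
proof -
  define w where "w = - z\<^sup>2"
  define M where "M = e powr (- \<bar>2 * \<nu> + 1\<bar>)"
  define f' where "f' = (\<lambda>k x. w ^ k * complex_of_real (- (x powr (- (2 * \<nu> + 1)) * bY \<nu> k x)))"
  have "((\<lambda>x. \<Sum>k. w ^ k * complex_of_real (bX \<nu> k x)) has_vector_derivative (\<Sum>k. f' k x)) (at x within {e..1})"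
  proof (rule has_vector_derivative_series[OF _ _ _ _ _ x])
    fix k y assume y: "y \<in> {e..1}"
    show "((\<lambda>x. w ^ k * complex_of_real (bX \<nu> k x)) has_vector_derivative f' k y) (at y within {e..1})"
      unfolding f'_def using bX_has_derivative[OF e y, of \<nu> k]
      by (intro has_vector_derivative_mult_right has_vector_derivative_of_real)
    have "norm (f' k y) = y powr (- (2 * \<nu> + 1)) * norm (w ^ k * complex_of_real (bY \<nu> k y))"
      by (simp add: f'_def norm_mult)
    also have "\<dots> \<le> M * (norm w ^ k * ((M\<^sup>2) ^ k / fact k))"
      using bX_bY_summand_bounds(1)[of e y w k \<nu>] powr_le_lower_end(2)[of e y "2 * \<nu> + 1"] e y
      by (intro mult_mono) (auto simp: M_def)
    finally show "norm (f' k y) \<le> M * (norm w ^ k * ((M\<^sup>2) ^ k / fact k))" .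
  next
    show "summable (\<lambda>k. M * (norm w ^ k * ((M\<^sup>2) ^ k / fact k)))"
      by (intro summable_mult summable_exp_majorant)
  next
    show "summable (\<lambda>k. w ^ k * complex_of_real (bX \<nu> k y))" if "y \<in> {e..1}" for y
      using e that by (intro summable_bX_bY) auto
  qed simp
  moreover have "(\<Sum>k. f' k x) = - (of_real (x powr (- (2 * \<nu> + 1))) * (\<Sum>k. w ^ k * complex_of_real (bY \<nu> k x)))"
  proof -
    have "f' k x = - of_real (x powr (- (2 * \<nu> + 1))) * (w ^ k * complex_of_real (bY \<nu> k x))" for k
      by (simp add: f'_def)
    then show ?thesis using suminf_mult[OF summable_bX_bY(1)[of x w \<nu>], of "- of_real (x powr (- (2 * \<nu> + 1)))"] e x by simp
  qed
  ultimately show ?thesis by (simp add: bZs_def[abs_def] bYs_def w_def)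
qed

lemma bYs_has_derivative:
  assumes e: "0 < e" and x: "x \<in> {e..1}"
  shows "((\<lambda>x. bYs \<nu> x z) has_vector_derivative z\<^sup>2 * of_real (x powr (2 * \<nu> + 1)) * bZs \<nu> x z) (at x within {e..1})"
proof -
  define w where "w = - z\<^sup>2"
  define M where "M = e powr (- \<bar>2 * \<nu> + 1\<bar>)"
  have M: "M > 0" using e by (simp add: M_def)
  define f' where "f' = (\<lambda>k x. w ^ Suc k * complex_of_real (- (x powr (2 * \<nu> + 1) * bX \<nu> k x)))"
  have "((\<lambda>x. \<Sum>k. w ^ Suc k * complex_of_real (bY \<nu> (Suc k) x)) has_vector_derivative (\<Sum>k. f' k x)) (at x within {e..1})"
  proof (rule has_vector_derivative_series[OF _ _ _ _ _ x])
    fix k y assume y: "y \<in> {e..1}"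
    show "((\<lambda>x. w ^ Suc k * complex_of_real (bY \<nu> (Suc k) x)) has_vector_derivative f' k y) (at y within {e..1})"
      unfolding f'_def using bY_has_derivative[OF e y, of \<nu> k]
      by (intro has_vector_derivative_mult_right has_vector_derivative_of_real)
    have "norm (f' k y) = norm w * (y powr (2 * \<nu> + 1) * norm (w ^ k * complex_of_real (bX \<nu> k y)))"
      by (simp add: f'_def norm_mult)
    also have "\<dots> \<le> norm w * (M * (M * (norm w ^ k * ((M\<^sup>2) ^ k / fact k))))"
      using bX_bY_summand_bounds(2)[of e y w k \<nu>] powr_le_lower_end(1)[of e y "2 * \<nu> + 1"] e y M
      by (intro mult_left_mono mult_mono) (auto simp: M_def)
    finally show "norm (f' k y) \<le> norm w * (M * (M * (norm w ^ k * ((M\<^sup>2) ^ k / fact k))))" .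
    show "summable (\<lambda>n. w ^ Suc n * complex_of_real (bY \<nu> (Suc n) y))"
      using summable_bX_bY(1)[of y w \<nu>] e y by (subst summable_Suc_iff) auto
  next
    show "summable (\<lambda>k. norm w * (M * (M * (norm w ^ k * ((M\<^sup>2) ^ k / fact k)))))"
      by (intro summable_mult summable_exp_majorant)
  qed simp
  moreover have "(\<Sum>k. f' k x) = z\<^sup>2 * of_real (x powr (2 * \<nu> + 1)) * (\<Sum>k. w ^ k * complex_of_real (bX \<nu> k x))"
  proof -
    have "f' k x = (z\<^sup>2 * of_real (x powr (2 * \<nu> + 1))) * (w ^ k * complex_of_real (bX \<nu> k x))" for k
      by (simp add: f'_def w_def)
    then show ?thesis using suminf_mult[OF summable_bX_bY(2)[of x w \<nu>], of "z\<^sup>2 * of_real (x powr (2 * \<nu> + 1))"] e x by simp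
  qed
  moreover have "bYs \<nu> y z = (\<Sum>k. w ^ Suc k * complex_of_real (bY \<nu> (Suc k) y)) + 1" if "y \<in> {e..1}" for y
    using suminf_split_head[OF summable_bX_bY(1)[of y w \<nu>]] e that by (simp add: bYs_def w_def)
  ultimately have "((\<lambda>y. (\<Sum>k. w ^ Suc k * complex_of_real (bY \<nu> (Suc k) y)) + 1) has_vector_derivative z\<^sup>2 * of_real (x powr (2 * \<nu> + 1)) * bZs \<nu> x z) (at x within {e..1})"
    and eq: "\<And>y. y \<in> {e..1} \<Longrightarrow> bYs \<nu> y z = (\<Sum>k. w ^ Suc k * complex_of_real (bY \<nu> (Suc k) y)) + 1"
    by (auto simp: bZs_def w_def intro!: has_vector_derivative_add_const[THEN iffD2])
  from has_vector_derivative_transform[OF x eq this(1)] show ?thesis .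
qed

lemma bZs_at_1: "bZs \<nu> 1 z = 0" "bYs \<nu> 1 z = 1"
proof -
  have "bX \<nu> k 1 = 0" for k by (simp add: bX_def)
  then show "bZs \<nu> 1 z = 0" by (simp add: bZs_def)
  have "bY \<nu> k 1 = (if k = 0 then 1 else 0)" for k by (cases k) (simp_all add: bY_Suc)
  then have "(\<lambda>k. (- z\<^sup>2) ^ k * complex_of_real (bY \<nu> k 1)) = (\<lambda>k. if k = 0 then 1 else 0)" by auto
  then show "bYs \<nu> 1 z = 1" using sums_single[of 0 "\<lambda>_. 1::complex"] by (simp add: bYs_def sums_iff)
qed

lemma bZs_minus: "bZs \<nu> x (- z) = bZs \<nu> x z"
  by (simp add: bZs_def)

lemma holomorphic_on_bZs:
  assumes x: "0 < x" "x \<le> 1"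
  shows "bZs \<nu> x holomorphic_on A"
proof -
  define P where "P = (\<lambda>t. \<Sum>k. complex_of_real (bX \<nu> k x) * t ^ k)"
  have s: "summable (\<lambda>k. complex_of_real (bX \<nu> k x) * t ^ k)" for t
    using summable_bX_bY(2)[OF x, of t \<nu>] by (simp add: mult.commute)
  have "P field_differentiable (at t)" for t
    unfolding P_def field_differentiable_def using termdiffs_strong_converges_everywhere[OF s] by blast
  then have "P holomorphic_on UNIV" by (simp add: holomorphic_on_def field_differentiable_at_within)
  then have "(P \<circ> (\<lambda>z. - z\<^sup>2)) holomorphic_on A"
    by (intro holomorphic_on_compose_gen[of _ _ _ UNIV]) (auto intro!: holomorphic_intros)
  moreover have "P \<circ> (\<lambda>z. - z\<^sup>2) = bZs \<nu> x" by (auto simp: P_def bZs_def mult.commute)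
  ultimately show ?thesis by simp
qed

text \<open>The system \<open>Z' = - x\<^sup>-\<^sup>2\<^sup>\<nu>\<^sup>-\<^sup>1 Y\<close>, \<open>Y' = z\<^sup>2 x\<^sup>2\<^sup>\<nu>\<^sup>+\<^sup>1 Z\<close> is the Bessel equation for \<open>Z\<close>, so the energy
  of \<open>x\<^sup>\<nu>\<^sup>+\<^sup>1\<^sup>/\<^sup>2 Z\<close> is controlled.\<close>
lemma radial_energy:
  fixes Z Y :: "real \<Rightarrow> complex"
  assumes e: "0 < e" "e \<le> 1" and z: "z \<noteq> 0"
    and dZ: "\<And>x. x \<in> {e..1} \<Longrightarrow> (Z has_vector_derivative - (of_real (x powr (- (2 * \<nu> + 1))) * Y x)) (at x within {e..1})"
    and dY: "\<And>x. x \<in> {e..1} \<Longrightarrow> (Y has_vector_derivative z\<^sup>2 * of_real (x powr (2 * \<nu> + 1)) * Z x) (at x within {e..1})"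
    and Z1: "Z 1 = 0"
  shows "norm z * (e powr (\<nu> + 1/2) * norm (Z e)) \<le> norm (Y 1) * exp (\<bar>Im z\<bar> * (1 - e) + \<bar>\<nu>\<^sup>2 - 1/4\<bar> / (2 * norm z * e))"
proof -
  define a where "a = \<nu> + 1/2"
  define m where "m = \<nu>\<^sup>2 - 1/4"
  have ma: "m = a * (a - 1)" by (simp add: m_def a_def power2_eq_square algebra_simps)
  have a2: "2 * \<nu> + 1 = 2 * a" by (simp add: a_def)
  \<comment> \<open>u = x^a Z satisfies u'' = (m/x^2 - z^2) u, and v is u' written through Z and Y,
    so \<open>energy_bound\<close> applies on the real segment with \<zeta> = z.\<close>
  define u where "u = (\<lambda>x. of_real (x powr a) * Z x)"
  define v where "v = (\<lambda>x. of_real (a * x powr (a - 1)) * Z x - of_real (x powr (- a)) * Y x)"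
  have cZ: "continuous_on {e..1} Z" and cY: "continuous_on {e..1} Y"
    unfolding continuous_on_eq_continuous_within
    using has_vector_derivative_continuous[OF dZ] has_vector_derivative_continuous[OF dY] by blast+
  have dp: "((\<lambda>x. complex_of_real (x powr s)) has_vector_derivative of_real (s * x powr (s - 1))) (at x)" if "x > 0" for x s
    by (intro has_vector_derivative_of_real has_real_derivative_powr that)
  have intr: "at x within {e..1} = at x" if "e < x" "x < 1" for x
    using that by (intro at_within_interior) auto
  have dZ': "(Z has_vector_derivative - (of_real (x powr (- (2 * a))) * Y x)) (at x)" if "e < x" "x < 1" for x
    using dZ[of x] that intr[OF that] by (simp add: a2)
  have dY': "(Y has_vector_derivative z\<^sup>2 * of_real (x powr (2 * a)) * Z x) (at x)" if "e < x" "x < 1" for x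
    using dY[of x] that intr[OF that] by (simp add: a2)
  have pw: "x powr a * x powr (- (2 * a)) = x powr (- a)" "x powr (a - 1) * x powr (- (2 * a)) = x powr (- a - 1)"
     "x powr (- a) * x powr (2 * a) = x powr a" "x powr (a - 2) = x powr a / x\<^sup>2" if "x > 0" for x
    using that by (simp_all add: powr_diff flip: powr_add)
  have du: "(u has_vector_derivative 1 * v x) (at x)" if x: "e < x" "x < 1" for x
  proof -
    have x0: "x > 0" using x e by simp
    have "(u has_vector_derivative of_real (x powr a) * (- (of_real (x powr (- (2 * a))) * Y x)) + of_real (a * x powr (a - 1)) * Z x) (at x)"
      unfolding u_def by (rule has_vector_derivative_mult[OF dp[OF x0] dZ'[OF x]])
    moreover have "complex_of_real (x powr a) * (- (of_real (x powr (- (2 * a))) * Y x)) = - (of_real (x powr (- a)) * Y x)"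
      unfolding pw(1)[OF x0, symmetric] of_real_mult by (simp only: mult.assoc mult_minus_right)
    ultimately show ?thesis unfolding v_def by (simp only: add.commute[of "- _"] diff_conv_add_uminus mult_1)
  qed
  have dv: "(v has_vector_derivative 1 * (of_real (m / x\<^sup>2) - z\<^sup>2) * u x) (at x)" if x: "e < x" "x < 1" for x
  proof -
    have x0: "x > 0" using x e by simp
    have "((\<lambda>x. of_real (a * x powr (a - 1))) has_vector_derivative of_real (a * ((a - 1) * x powr (a - 1 - 1)))) (at x)"
      by (intro has_vector_derivative_of_real DERIV_cmult has_real_derivative_powr x0)
    from has_vector_derivative_diff[OF has_vector_derivative_mult[OF this dZ'[OF x]] has_vector_derivative_mult[OF dp[OF x0, of "-a"] dY'[OF x]]]
    have "(v has_vector_derivative of_real (a * x powr (a - 1)) * (- (of_real (x powr (- (2 * a))) * Y x))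
          + of_real (a * ((a - 1) * x powr (a - 2))) * Z x
          - (of_real (x powr (- a)) * (z\<^sup>2 * of_real (x powr (2 * a)) * Z x) + of_real (- a * x powr (- a - 1)) * Y x)) (at x)"
      unfolding v_def by (simp add: diff_diff_eq)
    also have "of_real (a * x powr (a - 1)) * (- (of_real (x powr (- (2 * a))) * Y x)) = of_real (- a * x powr (- a - 1)) * Y x"
      unfolding pw(2)[OF x0, symmetric] by simp
    also have "of_real (x powr (- a)) * (z\<^sup>2 * of_real (x powr (2 * a)) * Z x) = z\<^sup>2 * (of_real (x powr a) * Z x)"
      unfolding pw(3)[OF x0, symmetric] by simp
    also have "of_real (a * ((a - 1) * x powr (a - 2))) * Z x = of_real (m / x\<^sup>2) * (of_real (x powr a) * Z x)"
      unfolding pw(4)[OF x0] ma by simp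
    also have "X1 + q * (p * Z x) - (z\<^sup>2 * (p * Z x) + X1) = 1 * (q - z\<^sup>2) * (p * Z x)" for X1 q p
      by (simp add: algebra_simps)
    finally show ?thesis unfolding u_def .
  qed
  define G where "G = (\<lambda>x. - (\<bar>m\<bar> / norm z / x))"
  have "(norm (v e))\<^sup>2 + (norm z)\<^sup>2 * (norm (u e))\<^sup>2 \<le> ((norm (v 1))\<^sup>2 + (norm z)\<^sup>2 * (norm (u 1))\<^sup>2) *
      exp (2 * \<bar>Im (1 * z)\<bar> * (1 - e) + (G 1 - G e))"
  proof (rule energy_bound(2)[OF e(2) _ z])
    show "continuous_on {e..1} u" unfolding u_def using e by (intro continuous_intros cZ) auto
    show "continuous_on {e..1} v" unfolding v_def using e by (intro continuous_intros cZ cY) auto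
    show "continuous_on {e..1} G" unfolding G_def using e z by (intro continuous_intros) auto
    fix x assume x: "e < x" "x < 1"
    show "(u has_vector_derivative 1 * v x) (at x)" by (rule du[OF x])
    show "(v has_vector_derivative 1 * (of_real (m / x\<^sup>2) - z\<^sup>2) * u x) (at x)" by (rule dv[OF x])
    show "(G has_real_derivative \<bar>m\<bar> / norm z / x\<^sup>2) (at x)"
      unfolding G_def using x e z by (auto intro!: derivative_eq_intros simp: power2_eq_square)
    show "norm (complex_of_real (m / x\<^sup>2)) \<le> norm z * (\<bar>m\<bar> / norm z / x\<^sup>2)"
      using z unfolding norm_of_real by (simp add: abs_divide)
  qed simp
  \<comment> \<open>Z vanishes at 1, so the energy there is carried by the flux alone.\<close>
  also have "(norm (v 1))\<^sup>2 + (norm z)\<^sup>2 * (norm (u 1))\<^sup>2 = (norm (Y 1))\<^sup>2"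
    by (simp add: v_def u_def Z1)
  finally have "(norm (v e))\<^sup>2 + (norm z)\<^sup>2 * (norm (u e))\<^sup>2 \<le> (norm (Y 1))\<^sup>2 * exp (2 * \<bar>Im (1 * z)\<bar> * (1 - e) + (G 1 - G e))" .
  moreover have "(norm z)\<^sup>2 * (norm (u e))\<^sup>2 = (norm z * norm (u e))\<^sup>2" by (simp add: power_mult_distrib)
  moreover have "exp (2 * \<bar>Im (1 * z)\<bar> * (1 - e) + (G 1 - G e)) \<le> (exp (\<bar>Im z\<bar> * (1 - e) + \<bar>m\<bar> / (2 * norm z * e)))\<^sup>2"
  proof -
    have "G 1 - G e \<le> \<bar>m\<bar> / (norm z * e)" using e z by (simp add: G_def)
    also have "\<dots> = 2 * (\<bar>m\<bar> / (2 * norm z * e))" by simp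
    finally have "2 * \<bar>Im (1 * z)\<bar> * (1 - e) + (G 1 - G e) \<le> 2 * (\<bar>Im z\<bar> * (1 - e) + \<bar>m\<bar> / (2 * norm z * e))"
      by simp
    then show ?thesis unfolding exp_double[symmetric] by (simp only: exp_le_cancel_iff)
  qed
  ultimately have "(norm z * norm (u e))\<^sup>2 \<le> (norm (Y 1) * exp (\<bar>Im z\<bar> * (1 - e) + \<bar>m\<bar> / (2 * norm z * e)))\<^sup>2"
    by (smt (verit) mult_left_mono power_mult_distrib zero_le_power2)
  then have "norm z * norm (u e) \<le> norm (Y 1) * exp (\<bar>Im z\<bar> * (1 - e) + \<bar>m\<bar> / (2 * norm z * e))"
    by (rule power2_le_imp_le) simp
  then show ?thesis by (simp add: u_def norm_mult m_def a_def)
qed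

text \<open>The energy at 1 is the squared flux, which is 1 for every z. Since the energy contains
  |z|^2 |Z|^2, the value of Z gains a factor 1/|z|.\<close>

lemma bZs_bound:
  assumes x0: "0 < x0" "x0 \<le> 1"
  obtains C where "C > 0" "\<And>x z. x0 \<le> x \<Longrightarrow> x \<le> 1 \<Longrightarrow> 1 \<le> norm z \<Longrightarrow> norm z * norm (bZs \<nu> x z) \<le> C * exp (\<bar>Im z\<bar> * (1 - x))"
proof -
  define m where "m = \<bar>\<nu>\<^sup>2 - 1/4\<bar>"
  define C where "C = x0 powr (- \<bar>\<nu> + 1/2\<bar>) * exp (m / (2 * x0))"
  have "norm z * norm (bZs \<nu> x z) \<le> C * exp (\<bar>Im z\<bar> * (1 - x))" if x: "x0 \<le> x" "x \<le> 1" "1 \<le> norm z" for x z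
  proof -
    have xp: "0 < x" using x x0 by simp
    have "norm z * (x powr (\<nu> + 1/2) * norm (bZs \<nu> x z)) \<le> norm (bYs \<nu> 1 z) * exp (\<bar>Im z\<bar> * (1 - x) + \<bar>\<nu>\<^sup>2 - 1/4\<bar> / (2 * norm z * x))"
      using x by (intro radial_energy bZs_has_derivative bYs_has_derivative xp bZs_at_1) auto
    also have "\<dots> \<le> exp (m / (2 * x0)) * exp (\<bar>Im z\<bar> * (1 - x))"
    proof -
      have "1 * x0 \<le> norm z * x" using x x0 by (intro mult_mono) auto
      then have "m / (2 * norm z * x) \<le> m / (2 * x0)"
        using x x0 xp by (intro divide_left_mono) (auto simp: m_def intro!: mult_pos_pos)
      then show ?thesis unfolding m_def[symmetric] by (simp add: bZs_at_1 flip: exp_add)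
    qed
    finally have "x powr (- (\<nu> + 1/2)) * (norm z * (x powr (\<nu> + 1/2) * norm (bZs \<nu> x z))) \<le> x powr (- (\<nu> + 1/2)) * (exp (m / (2 * x0)) * exp (\<bar>Im z\<bar> * (1 - x)))"
      by (intro mult_left_mono) auto
    moreover have "x powr (- (\<nu> + 1/2)) * (norm z * (x powr (\<nu> + 1/2) * norm (bZs \<nu> x z))) = norm z * norm (bZs \<nu> x z)"
    proof -
      have "x powr (- (\<nu> + 1/2)) * x powr (\<nu> + 1/2) = 1" using xp by (subst powr_add[symmetric]) auto
      moreover have "p * (n * (q * Z)) = (p * q) * (n * Z)" for p q n Z :: real by simp
      ultimately show ?thesis by (metis mult_1)
    qed
    moreover have "x powr (- (\<nu> + 1/2)) * (exp (m / (2 * x0)) * exp (\<bar>Im z\<bar> * (1 - x))) \<le> C * exp (\<bar>Im z\<bar> * (1 - x))"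
      unfolding C_def mult.assoc
      using powr_le_lower_end(2)[OF x0(1) x(1,2), of "\<nu> + 1/2"] by (intro mult_right_mono) auto
    ultimately show ?thesis by linarith
  qed
  then show thesis using x0 by (intro that[of C]) (auto simp: C_def)
qed

text \<open>At a zero s the function x \<mapsto> \<phi>(xs) also vanishes at 1, so it must be a
  multiple of Z, and the multiple is read off from the flux at 1. The combination with both Cauchy
  data zero is killed by \<open>radial_energy\<close>, used as a uniqueness theorem.\<close>

lemma bZs_at_bzero:
  assumes nu: "\<nu> > -1" and s: "s \<in> bzeros \<nu>" and x: "0 < x" "x \<le> 1"
  shows "bZs \<nu> x (of_real s) = - of_real (bphi \<nu> (x * s) / (s * bphi' \<nu> s))"
proof -
  have s0: "s > 0" "bphi \<nu> s = 0" and s1: "bphi' \<nu> s \<noteq> 0" using s bphi'_at_zero_nonzero[OF nu s] by (auto simp: bzeros_def)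
  define c where "c = 1 / (complex_of_real s * bphi' \<nu> (of_real s))"
  define Z where "Z = (\<lambda>x. bZs \<nu> x (of_real s) + c * bphi \<nu> (of_real x * of_real s))"
  define Y where "Y = (\<lambda>x. bYs \<nu> x (of_real s) - c * (of_real (x powr (2 * \<nu> + 1)) * (of_real s * bphi' \<nu> (of_real x * of_real s))))"
  have "norm (complex_of_real s) * (x powr (\<nu> + 1/2) * norm (Z x)) \<le> norm (Y 1) * exp (\<bar>Im (of_real s)\<bar> * (1 - x) + \<bar>\<nu>\<^sup>2 - 1/4\<bar> / (2 * norm (complex_of_real s) * x))"
  proof (rule radial_energy[OF x])
    show "Z 1 = 0" using s0 bphi_of_real[OF nu, of s, where 'a = complex] by (simp add: Z_def bZs_at_1)
    fix y assume y: "y \<in> {x..1}"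
    then have y0: "y > 0" using x by simp
    have "((\<lambda>t. of_real t * of_real s) has_vector_derivative complex_of_real s) (at y)" by (auto intro!: derivative_eq_intros)
    from field_vector_diff_chain_at[OF this bphi_has_field_derivative[OF nu]]
    have d: "((\<lambda>t. bphi \<nu> (of_real t * complex_of_real s)) has_vector_derivative of_real s * bphi' \<nu> (of_real y * of_real s)) (at y within {x..1})"
      by (auto simp: o_def intro: has_vector_derivative_at_within)
    have "(Z has_vector_derivative (- (of_real (y powr (- (2 * \<nu> + 1))) * bYs \<nu> y (of_real s)) + c * (of_real s * bphi' \<nu> (of_real y * of_real s)))) (at y within {x..1})"
      unfolding Z_def by (intro has_vector_derivative_add bZs_has_derivative has_vector_derivative_mult_right x y d)
    moreover have "of_real (y powr (- (2 * \<nu> + 1))) * Y y = of_real (y powr (- (2 * \<nu> + 1))) * bYs \<nu> y (of_real s) - c * (of_real s * bphi' \<nu> (of_real y * of_real s))"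
    proof -
      have "complex_of_real (y powr (- (2 * \<nu> + 1))) * of_real (y powr (2 * \<nu> + 1)) = 1"
        unfolding of_real_mult[symmetric] powr_add[symmetric] using y0 by simp
      moreover have "p * (B - c * (q * W)) = p * B - (p * q) * (c * W)" for p q B W :: complex by (simp add: algebra_simps)
      ultimately show ?thesis unfolding Y_def by (metis mult_1)
    qed
    ultimately show "(Z has_vector_derivative - (of_real (y powr (- (2 * \<nu> + 1))) * Y y)) (at y within {x..1})" by simp
    have "(Y has_vector_derivative ((of_real s)\<^sup>2 * of_real (y powr (2 * \<nu> + 1)) * bZs \<nu> y (of_real s)
        - c * (- (of_real s)\<^sup>2 * of_real (y powr (2 * \<nu> + 1)) * bphi \<nu> (of_real y * of_real s)))) (at y within {x..1})"
      unfolding Y_def by (intro has_vector_derivative_diff bYs_has_derivative has_vector_derivative_mult_right x y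
          has_vector_derivative_at_within[OF radial_derivative[OF nu y0]])
    then show "(Y has_vector_derivative (of_real s)\<^sup>2 * of_real (y powr (2 * \<nu> + 1)) * Z y) (at y within {x..1})"
      by (simp add: Z_def algebra_simps)
  qed (use s0 in auto)
  moreover have "Y 1 = 0"
    using s0 s1 bphi'_of_real[OF nu, of s, where 'a = complex] by (simp add: Y_def bZs_at_1 c_def)
  ultimately have "s * (x powr (\<nu> + 1/2) * norm (Z x)) \<le> 0" using s0 by simp
  then have "Z x = 0" using s0 x by (simp add: mult_le_0_iff)
  then have "bZs \<nu> x (of_real s) = - (c * bphi \<nu> (of_real (x * s)))" by (simp add: Z_def eq_neg_iff_add_eq_0)
  then show ?thesis unfolding c_def by (simp add: bphi_of_real[OF nu] bphi'_of_real[OF nu] del: of_real_mult) (simp)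
qed

section \<open>Riesz sums as contour integrals\<close>

text \<open>The arctangent bounds the integral of the majorant by K \<pi>/c whatever the height T.
  In the near estimate c is the distance of the two points, and this supplies one power of 1/|x -
  y|.\<close>

lemma vertical_segment_integral_bound:
  assumes T: "T > 0" and c: "c > 0" and K: "K \<ge> 0"
    and f: "continuous_on (closed_segment (Complex \<rho> (-T)) (Complex \<rho> T)) f"
    and b: "\<And>t. - T \<le> t \<Longrightarrow> t \<le> T \<Longrightarrow> norm (f (Complex \<rho> t)) \<le> K / (1 + (c * t)\<^sup>2)"
  shows "norm (contour_integral (linepath (Complex \<rho> (-T)) (Complex \<rho> T)) f) \<le> K * pi / c"
proof -
  have cf: "continuous_on {-T..T} (\<lambda>t. f (Complex \<rho> t))"
    by (rule continuous_on_compose2[OF f])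
       (auto simp: Complex_eq closed_segment_same_Re closed_segment_eq_real_ivl intro!: continuous_intros)
  have "contour_integral (linepath (Complex \<rho> (-T)) (Complex \<rho> T)) f = \<i> * integral {-T..T} (\<lambda>t. f (Complex \<rho> t))"
    using T by (intro contour_integral_linepath_same_Re) auto
  then have "norm (contour_integral (linepath (Complex \<rho> (-T)) (Complex \<rho> T)) f) = norm (integral {-T..T} (\<lambda>t. f (Complex \<rho> t)))"
    by (simp add: norm_mult)
  also have "\<dots> \<le> integral {-T..T} (\<lambda>t. K / (1 + (c * t)\<^sup>2))"
  proof (rule integral_norm_bound_integral)
    have "1 + (c * t)\<^sup>2 \<noteq> 0" for t by (smt (verit) zero_le_power2)
    then show "(\<lambda>t. K / (1 + (c * t)\<^sup>2)) integrable_on {-T..T}"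
      by (intro integrable_continuous_real continuous_intros) auto
  qed (use b in \<open>auto intro!: integrable_continuous_real cf\<close>)
  also have "\<dots> = K / c * arctan (c * T) - K / c * arctan (c * (-T))"
  proof (rule integral_unique, rule fundamental_theorem_of_calculus)
    fix t
    have "((\<lambda>t. arctan (c * t)) has_real_derivative inverse (1 + (c * t)\<^sup>2) * c) (at t within {-T..T})"
      by (auto intro!: derivative_eq_intros)
    moreover have "K / c * (inverse D * c) = K / D" for D using c by (cases "D = 0") (auto simp: field_simps)
    ultimately have "((\<lambda>t. K / c * arctan (c * t)) has_real_derivative K / (1 + (c * t)\<^sup>2)) (at t within {-T..T})"
      using DERIV_cmult[of _ _ _ _ "K / c"] by metis
    then show "((\<lambda>t. K / c * arctan (c * t)) has_vector_derivative K / (1 + (c * t)\<^sup>2)) (at t within {-T..T})"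
      by (simp add: has_real_derivative_iff_has_vector_derivative)
  qed (use T in auto)
  also have "\<dots> = K / c * (2 * arctan (c * T))" by (simp add: arctan_minus algebra_simps)
  also have "\<dots> \<le> K / c * pi"
    using K c arctan_ubound[of "c * T"] by (intro mult_left_mono) auto
  finally show ?thesis by simp
qed

lemma rectangle_integral_bound:
  assumes T: "T > 0" and \<rho>: "\<rho> > 0" and c: "c > 0" and K: "K \<ge> 0" and e: "e \<ge> 0"
    and f: "continuous_on (path_image (rectpath (Complex (-\<rho>) (-T)) (Complex \<rho> T))) f"
    and side: "\<And>x t. \<bar>x\<bar> = \<rho> \<Longrightarrow> \<bar>t\<bar> \<le> T \<Longrightarrow> norm (f (Complex x t)) \<le> K / (1 + (c * t)\<^sup>2)"
    and top: "\<And>x t. \<bar>x\<bar> \<le> \<rho> \<Longrightarrow> \<bar>t\<bar> = T \<Longrightarrow> norm (f (Complex x t)) \<le> e"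
  shows "norm (contour_integral (rectpath (Complex (-\<rho>) (-T)) (Complex \<rho> T)) f) \<le> 2 * (K * pi / c) + 4 * \<rho> * e"
proof -
  define a1 a2 a3 a4 where "a1 = Complex (-\<rho>) (-T)" and "a2 = Complex \<rho> (-T)" and "a3 = Complex \<rho> T" and "a4 = Complex (-\<rho>) T"
  note a = a1_def a2_def a3_def a4_def
  have img: "path_image (rectpath a1 a3) = closed_segment a1 a2 \<union> closed_segment a2 a3 \<union> closed_segment a3 a4 \<union> closed_segment a4 a1"
    by (simp add: rectpath_def Let_def path_image_join a Un_assoc)
  have cs: "continuous_on (closed_segment a1 a2) f" "continuous_on (closed_segment a2 a3) f"
    "continuous_on (closed_segment a3 a4) f" "continuous_on (closed_segment a4 a1) f"
    by (rule continuous_on_subset[OF f[folded a]], use img in blast)+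
  have "contour_integral (rectpath a1 a3) f = contour_integral (linepath a1 a2) f + (contour_integral (linepath a2 a3) f
     + (contour_integral (linepath a3 a4) f + contour_integral (linepath a4 a1) f))"
  proof -
    have "rectpath a1 a3 = linepath a1 a2 +++ linepath a2 a3 +++ linepath a3 a4 +++ linepath a4 a1"
      by (simp add: rectpath_def Let_def a)
    then show ?thesis using cs by (simp add: contour_integrable_continuous_linepath contour_integrable_join)
  qed
  moreover have "norm (contour_integral (linepath a2 a3) f) \<le> K * pi / c"
    unfolding a using cs(2) side \<rho> by (intro vertical_segment_integral_bound T c K) (auto simp: a)
  moreover have "norm (contour_integral (linepath a4 a1) f) \<le> K * pi / c"
  proof -
    have cs4: "continuous_on (closed_segment a1 a4) f" using cs(4) by (simp add: closed_segment_commute)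
    have "contour_integral (linepath a4 a1) f = - contour_integral (linepath a1 a4) f"
      by (rule contour_integral_reverse_linepath[OF cs(4)])
    moreover have "norm (contour_integral (linepath a1 a4) f) \<le> K * pi / c"
      unfolding a using cs4 side \<rho> by (intro vertical_segment_integral_bound T c K) (auto simp: a)
    ultimately show ?thesis by simp
  qed
  moreover have "norm (contour_integral (linepath a1 a2) f) \<le> e * norm (a2 - a1)"
  proof (rule contour_integral_bound_linepath[OF contour_integrable_continuous_linepath[OF cs(1)] e])
    fix x assume "x \<in> closed_segment a1 a2"
    then have "Im x = - T" "\<bar>Re x\<bar> \<le> \<rho>" using \<rho> by (auto simp: a closed_segment_same_Im closed_segment_eq_real_ivl)
    then show "norm (f x) \<le> e" using top[of "Re x" "Im x", unfolded complex_surj] T by simp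
  qed
  moreover have "norm (contour_integral (linepath a3 a4) f) \<le> e * norm (a4 - a3)"
  proof (rule contour_integral_bound_linepath[OF contour_integrable_continuous_linepath[OF cs(3)] e])
    fix x assume "x \<in> closed_segment a3 a4"
    then have "Im x = T" "\<bar>Re x\<bar> \<le> \<rho>" using \<rho> by (auto simp: a closed_segment_same_Im closed_segment_eq_real_ivl)
    then show "norm (f x) \<le> e" using top[of "Re x" "Im x", unfolded complex_surj] T by simp
  qed
  moreover have "norm (a2 - a1) = 2 * \<rho>" "norm (a4 - a3) = 2 * \<rho>"
  proof -
    have "a2 - a1 = of_real (2 * \<rho>)" "a4 - a3 = - of_real (2 * \<rho>)" by (simp_all add: a complex_eq_iff)
    then show "norm (a2 - a1) = 2 * \<rho>" "norm (a4 - a3) = 2 * \<rho>" using \<rho> by (simp_all only: norm_minus_cancel norm_of_real)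
  qed
  ultimately have "norm (contour_integral (rectpath a1 a3) f) \<le> e * (2 * \<rho>) + (K * pi / c + (e * (2 * \<rho>) + K * pi / c))"
    by (metis norm_triangle_mono)
  then show ?thesis unfolding a by (simp add: algebra_simps)
qed

text \<open>The branch points are R and -R. In the open strip |Re z| < R the base avoids the
  nonpositive reals, so contours are confined to that strip; on [0,R) this is the Riesz
  multiplier.\<close>

definition riesz_factor :: "real \<Rightarrow> real \<Rightarrow> complex \<Rightarrow> complex" where
  "riesz_factor \<delta> R z = (1 - z\<^sup>2 / of_real (R\<^sup>2)) powr of_real \<delta>"

lemma riesz_factor_of_real:
  assumes "0 \<le> s" "s < R"
  shows "riesz_factor \<delta> R (of_real s) = of_real ((1 - s\<^sup>2 / R\<^sup>2) powr \<delta>)"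
proof -
  have "s\<^sup>2 \<le> R\<^sup>2" using assms by (intro power_mono) auto
  then have "0 \<le> 1 - s\<^sup>2 / R\<^sup>2" using assms by (auto simp: divide_le_eq)
  then have "complex_of_real ((1 - s\<^sup>2 / R\<^sup>2) powr \<delta>) = of_real (1 - s\<^sup>2 / R\<^sup>2) powr of_real \<delta>"
    by (rule powr_of_real[symmetric])
  moreover have "complex_of_real (1 - s\<^sup>2 / R\<^sup>2) = 1 - (of_real s)\<^sup>2 / of_real (R\<^sup>2)" by simp
  ultimately show ?thesis unfolding riesz_factor_def by (simp only:)
qed

lemma riesz_factor_minus: "riesz_factor \<delta> R (- z) = riesz_factor \<delta> R z"
  by (simp add: riesz_factor_def)

lemma riesz_factor_base_notin:
  assumes R: "R > 0" and z: "\<bar>Re z\<bar> < R"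
  shows "1 - z\<^sup>2 / of_real (R\<^sup>2) \<notin> \<real>\<^sub>\<le>\<^sub>0"
proof
  assume "1 - z\<^sup>2 / of_real (R\<^sup>2) \<in> \<real>\<^sub>\<le>\<^sub>0"
  then have "Re (1 - z\<^sup>2 / of_real (R\<^sup>2)) \<le> 0" "Im (1 - z\<^sup>2 / of_real (R\<^sup>2)) = 0"
    unfolding complex_nonpos_Reals_iff by auto
  then have 1: "R\<^sup>2 \<le> Re (z\<^sup>2)" and 2: "Im (z\<^sup>2) = 0"
    using R unfolding minus_complex.sel Re_divide_of_real Im_divide_of_real by (simp_all add: field_simps)
  have "(Re z)\<^sup>2 < R\<^sup>2" using power_strict_mono[of "\<bar>Re z\<bar>" R 2] z by simp
  moreover have "Re (z\<^sup>2) \<le> (Re z)\<^sup>2" by (simp add: power2_eq_square)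
  ultimately show False using 1 by simp
qed

lemma holomorphic_on_riesz_factor:
  assumes R: "R > 0"
  shows "riesz_factor \<delta> R holomorphic_on {z. \<bar>Re z\<bar> < R}"
  unfolding riesz_factor_def[abs_def]
  by (intro holomorphic_intros) (use riesz_factor_base_notin[OF R] R in auto)

lemma norm_riesz_factor: "norm (riesz_factor \<delta> R z) = norm (1 - z\<^sup>2 / of_real (R\<^sup>2)) powr \<delta>"
  by (simp add: riesz_factor_def norm_powr_real_powr')

lemma residue_quotient_simple_zero:
  assumes S: "open S" "p \<in> S" and f: "f holomorphic_on S" and g: "g holomorphic_on S"
    and g0: "g p = 0" "\<And>w. w \<in> S \<Longrightarrow> w \<noteq> p \<Longrightarrow> g w \<noteq> 0"
    and d: "(g has_field_derivative d) (at p)" "d \<noteq> 0"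
  shows "residue (\<lambda>w. f w / g w) p = f p / d"
proof (rule residue_simple'[OF S])
  show "(\<lambda>w. f w / g w) holomorphic_on S - {p}"
    by (intro holomorphic_on_divide holomorphic_on_subset[OF f] holomorphic_on_subset[OF g]) (use g0 in auto)
  have "(\<lambda>w. (g w - g p) / (w - p)) \<midarrow>p\<rightarrow> d" using d(1) by (simp add: has_field_derivative_iff)
  moreover have "f \<midarrow>p\<rightarrow> f p"
    using holomorphic_on_imp_continuous_on[OF f] S by (simp add: continuous_on_eq_continuous_at isCont_def)
  ultimately have "(\<lambda>w. f w / ((g w - g p) / (w - p))) \<midarrow>p\<rightarrow> f p / d" using d(2) by (intro tendsto_divide)
  then show "(\<lambda>w. f w / g w * (w - p)) \<midarrow>p\<rightarrow> f p / d" by (simp add: g0)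
qed

text \<open>The integrand is odd, because A is odd and the other factors are even: residues at s and
  -s agree, and the left side of the rectangle is covered by the right one. The horizontal sides
  disappear as the height grows. A pole of A at 0 is allowed, so that the expansion of the constant
  1 is included.\<close>

lemma contour_residue_bound:
  assumes nu: "\<nu> > -1" and \<rho>: "0 < \<rho>" "\<rho> < R" and c: "c > 0" and K: "K \<ge> 0"
    and A: "A holomorphic_on - {0}" "\<And>z. A (- z) = - A z"
    and nz: "\<rho> \<notin> bzeros \<nu>"
    and line: "\<And>z. Re z = \<rho> \<Longrightarrow> norm (riesz_factor \<delta> R z * A z / bphi \<nu> z) \<le> K / (1 + (c * Im z)\<^sup>2)"
    and top: "\<And>e. e > 0 \<Longrightarrow> \<exists>T0. \<forall>z. 0 \<le> Re z \<longrightarrow> Re z \<le> \<rho> \<longrightarrow> T0 \<le> \<bar>Im z\<bar> \<longrightarrow> norm (riesz_factor \<delta> R z * A z / bphi \<nu> z) \<le> e"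
  shows "norm (2 * (\<Sum>s\<in>bzeros \<nu> \<inter> {..<\<rho>}. of_real ((1 - s\<^sup>2 / R\<^sup>2) powr \<delta>) * A (of_real s) / of_real (bphi' \<nu> s))
     + residue (\<lambda>z. riesz_factor \<delta> R z * A z / bphi \<nu> z) 0) \<le> K / c" (is "norm ?S \<le> _")
proof -
  define I where "I = (\<lambda>z. riesz_factor \<delta> R z * A z / bphi \<nu> z)"
  have R: "R > 0" using \<rho> by simp
  define S where "S = {z. \<bar>Re z\<bar> < R}"
  have oS: "open S" and convS: "convex S"
  proof -
    have S2: "S = {z. Re z < R} \<inter> {z. - R < Re z}" by (auto simp: S_def)
    show "open S" unfolding S2 by (intro open_Int open_halfspace_Re_lt open_halfspace_Re_gt)
    show "convex S" unfolding S2 by (intro convex_Int convex_halfspace_Re_lt convex_halfspace_Re_gt)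
  qed
  define Z where "Z = bzeros \<nu> \<inter> {..<R}"
  have finZ: "finite Z" by (rule finite_subset[OF _ finite_bzeros_atMost[OF nu, of R]]) (auto simp: Z_def)
  define P where "P = of_real ` Z \<union> (\<lambda>s. - complex_of_real s) ` Z \<union> {0}"
  have finP: "finite P" using finZ by (simp add: P_def)
  have zeroP: "bphi \<nu> z \<noteq> 0" if "z \<in> S" "z \<notin> P" for z
    using that bphi_eq_0_iff[OF nu, of z] by (auto simp: P_def Z_def S_def)
  have num: "(\<lambda>z. riesz_factor \<delta> R z * A z) holomorphic_on S - {0}"
    by (intro holomorphic_intros holomorphic_on_subset[OF holomorphic_on_riesz_factor[OF R]] holomorphic_on_subset[OF A(1)]) (auto simp: S_def)
  have hI: "I holomorphic_on S - P"
    unfolding I_def by (intro holomorphic_on_divide holomorphic_on_subset[OF num] holomorphic_on_bphi nu) (use zeroP in \<open>auto simp: P_def\<close>)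
  have lineI: "norm (I z) \<le> K / (1 + (c * Im z)\<^sup>2)" if "Re z = \<rho>" for z using line[OF that] by (simp add: I_def)
  have Iminus: "I (- z) = - I z" for z by (simp add: I_def riesz_factor_minus A(2) bphi_minus)
  have res: "residue I p = riesz_factor \<delta> R p * A p / bphi' \<nu> p" if p: "p \<in> P" "p \<noteq> 0" for p
    unfolding I_def
  proof (rule residue_quotient_simple_zero[where S = "S - (P - {p})"])
    show "open (S - (P - {p}))" using oS finP by (intro open_Diff finite_imp_closed) auto
    show "p \<in> S - (P - {p})" using p \<rho> by (auto simp: P_def Z_def S_def bzeros_def)
    show "(\<lambda>z. riesz_factor \<delta> R z * A z) holomorphic_on S - (P - {p})"
      by (rule holomorphic_on_subset[OF num]) (use p in \<open>auto simp: P_def\<close>)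
    show "bphi \<nu> p = 0" using p bphi_eq_0_iff[OF nu, of p] by (auto simp: P_def Z_def)
    show "bphi \<nu> w \<noteq> 0" if "w \<in> S - (P - {p})" "w \<noteq> p" for w using that zeroP by auto
    show "bphi' \<nu> p \<noteq> 0" using p bphi'_at_zero_nonzero[OF nu] by (auto simp: P_def Z_def bphi'_minus bphi'_of_real[OF nu])
  qed (auto intro: bphi_has_field_derivative holomorphic_on_bphi nu)
  have "norm ?S \<le> K / c + e" if e: "e > 0" for e
  proof -
    \<comment> \<open>The horizontal sides have total length 4\<rho>, so with this choice they
      contribute at most 4e \<le> 2\<pi>e.\<close>
    define e' where "e' = e / \<rho>"
    have e': "e' > 0" using e \<rho> by (simp add: e'_def)
    obtain T0 where T0: "\<And>z. 0 \<le> Re z \<Longrightarrow> Re z \<le> \<rho> \<Longrightarrow> T0 \<le> \<bar>Im z\<bar> \<Longrightarrow> norm (I z) \<le> e'"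
      using top[OF e'] unfolding I_def by blast
    define T where "T = max 1 T0"
    have T: "T > 0" "T0 \<le> T" by (auto simp: T_def)
    define a1 a3 where "a1 = Complex (-\<rho>) (-T)" and "a3 = Complex \<rho> T"
    have img: "path_image (rectpath a1 a3) = {z. Re z \<in> {-\<rho>, \<rho>} \<and> Im z \<in> {-T..T}} \<union> {z. Im z \<in> {-T, T} \<and> Re z \<in> {-\<rho>..\<rho>}}"
      using \<rho> T by (subst path_image_rectpath) (auto simp: a1_def a3_def)
    have Pimg: "path_image (rectpath a1 a3) \<subseteq> S - P"
    proof
      fix z assume z: "z \<in> path_image (rectpath a1 a3)"
      then have "z \<in> S" using \<rho> by (auto simp: img S_def)
      moreover have "z \<notin> P"
      proof
        assume "z \<in> P"
        then obtain s where s: "s = 0 \<or> s \<in> bzeros \<nu>" "z = of_real s \<or> z = - of_real s" by (auto simp: P_def Z_def)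
        then have "Im z = 0" "\<bar>Re z\<bar> = s" by (auto simp: bzeros_def)
        then have "s = \<rho>" using z T \<rho> by (auto simp: img)
        then show False using s nz \<rho> by auto
      qed
      ultimately show "z \<in> S - P" by blast
    qed
    have cI: "continuous_on (path_image (rectpath a1 a3)) I"
      by (rule continuous_on_subset[OF holomorphic_on_imp_continuous_on[OF hI] Pimg])
    have half: "norm (I (Complex x t)) = norm (I (Complex \<bar>x\<bar> t)) \<or> norm (I (Complex x t)) = norm (I (Complex \<bar>x\<bar> (- t)))" for x t
    proof -
      have "I (Complex x t) = - I (Complex (-x) (-t))" using Iminus[of "Complex (-x) (-t)"] by (simp add: uminus_complex.code)
      then show ?thesis by (cases "x \<ge> 0") auto
    qed
    have "norm (contour_integral (rectpath a1 a3) I) \<le> 2 * (K * pi / c) + 4 * \<rho> * e'"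
      unfolding a1_def a3_def
    proof (rule rectangle_integral_bound[OF T(1) \<rho>(1) c K])
      fix x t :: real assume "\<bar>x\<bar> = \<rho>"
      then show "norm (I (Complex x t)) \<le> K / (1 + (c * t)\<^sup>2)"
        using half[of x t] lineI[of "Complex \<rho> t"] lineI[of "Complex \<rho> (-t)"] by auto
    next
      fix x t :: real assume "\<bar>x\<bar> \<le> \<rho>" "\<bar>t\<bar> = T"
      then show "norm (I (Complex x t)) \<le> e'"
        using half[of x t] T0[of "Complex \<bar>x\<bar> t"] T0[of "Complex \<bar>x\<bar> (-t)"] T by auto
    qed (use e' cI in \<open>auto simp: a1_def a3_def\<close>)
    moreover have "contour_integral (rectpath a1 a3) I = 2 * pi * \<i> * (\<Sum>p\<in>P. winding_number (rectpath a1 a3) p * residue I p)"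
    proof (rule Residue_theorem[OF oS convex_connected[OF convS] finP hI])
      show "\<forall>z. z \<notin> S \<longrightarrow> winding_number (rectpath a1 a3) z = 0"
        using \<rho> T by (auto intro!: winding_number_rectpath_outside simp: a1_def a3_def in_cbox_complex_iff S_def)
    qed (use Pimg in auto)
    moreover have "(\<Sum>p\<in>P. winding_number (rectpath a1 a3) p * residue I p) = ?S"
    proof -
      define Z1 where "Z1 = bzeros \<nu> \<inter> {..<\<rho>}"
      have Z1Z: "Z1 \<subseteq> Z" using \<rho> by (auto simp: Z1_def Z_def)
      have finZ1: "finite Z1" by (rule finite_subset[OF Z1Z finZ])
      have pos: "s > 0" if "s \<in> Z" for s using that by (auto simp: Z_def bzeros_def)
      define h where "h = (\<lambda>p. winding_number (rectpath a1 a3) p * residue I p)"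
      have w: "winding_number (rectpath a1 a3) z = 1" if "\<bar>Re z\<bar> < \<rho>" "Im z = 0" for z
        using that T by (intro winding_number_rectpath) (auto simp: a1_def a3_def in_box_complex_iff)
      have w0: "winding_number (rectpath a1 a3) z = 0" if "\<bar>Re z\<bar> > \<rho>" for z
        using that T \<rho> by (intro winding_number_rectpath_outside) (auto simp: a1_def a3_def in_cbox_complex_iff)
      define q where "q = (\<lambda>s. of_real ((1 - s\<^sup>2 / R\<^sup>2) powr \<delta>) * A (of_real s) / of_real (bphi' \<nu> s))"
      have hs: "h (of_real s) = (if s \<in> Z1 then q s else 0)" "h (- of_real s) = (if s \<in> Z1 then q s else 0)" if s: "s \<in> Z" for s
      proof -
        have sP: "of_real s \<in> P" "- of_real s \<in> P" "s > 0" "s < R" using s pos[OF s] by (auto simp: P_def Z_def)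
        have r: "residue I (of_real s) = q s" "residue I (- of_real s) = q s"
          using res[OF sP(1)] res[OF sP(2)] sP
          by (simp_all add: q_def riesz_factor_minus riesz_factor_of_real A(2) bphi'_minus bphi'_of_real[OF nu])
        consider "s < \<rho>" | "s > \<rho>" using nz s by (cases s \<rho> rule: linorder_cases) (auto simp: Z_def)
        then show "h (of_real s) = (if s \<in> Z1 then q s else 0)" "h (- of_real s) = (if s \<in> Z1 then q s else 0)"
          using s sP r by (cases; auto simp: h_def w w0 Z1_def Z_def)+
      qed
      have "(\<Sum>p\<in>P. h p) = (\<Sum>p\<in>of_real ` Z. h p) + (\<Sum>p\<in>(\<lambda>s. - complex_of_real s) ` Z. h p) + h 0"
      proof -
        have "of_real ` Z \<inter> (\<lambda>s. - complex_of_real s) ` Z = {}"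
          using pos by (auto simp: complex_eq_iff) (metis add_less_same_cancel1 less_asym neg_0_less_iff_less)
        moreover have "(of_real ` Z \<union> (\<lambda>s. - complex_of_real s) ` Z) \<inter> {0} = {}" using pos by fastforce
        ultimately show ?thesis unfolding P_def using finZ by (subst sum.union_disjoint; simp)+
      qed
      also have "(\<Sum>p\<in>of_real ` Z. h p) = (\<Sum>s\<in>Z. if s \<in> Z1 then q s else 0)"
        by (subst sum.reindex) (auto simp: inj_on_def hs)
      also have "(\<Sum>p\<in>(\<lambda>s. - complex_of_real s) ` Z. h p) = (\<Sum>s\<in>Z. if s \<in> Z1 then q s else 0)"
        by (subst sum.reindex) (auto simp: inj_on_def hs)
      also have "(\<Sum>s\<in>Z. if s \<in> Z1 then q s else 0) = sum q Z1"
        using finZ Z1Z by (simp add: sum.If_cases Int_absorb1 flip: Int_def)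
      also have "h 0 = residue I 0" using w[of 0] \<rho> by (simp add: h_def)
      finally show ?thesis by (simp add: h_def Z1_def q_def I_def)
    qed
    ultimately have "norm (2 * pi * \<i> * ?S) \<le> 2 * (K * pi / c) + 4 * \<rho> * e'" by simp
    then have "2 * pi * norm ?S \<le> 2 * (K * pi / c) + 4 * \<rho> * e'" by (simp add: norm_mult)
    also have "4 * \<rho> * e' = 4 * e" using \<rho> by (simp add: e'_def)
    also have "4 * e \<le> 2 * pi * e" using pi_gt3 e by simp
    finally have "2 * pi * norm ?S \<le> 2 * pi * (K / c + e)" by (simp add: algebra_simps)
    then show ?thesis by (simp only: mult_le_cancel_left_pos pi_gt_zero zero_less_numeral mult_pos_pos)
  qed
  then show ?thesis by (rule field_le_epsilon)
qed

section \<open>Estimates on the contour\<close>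

text \<open>Rests on ln x \<le> x at x = c(1 + u)/r. The target 1/(1 + u^2) is the integrable
  majorant used along the contour.\<close>

lemma power_times_exp_bound:
  fixes q c :: real
  assumes c: "c > 0"
  obtains C where "C > 0" "\<And>u. 0 \<le> u \<Longrightarrow> (1 + u) powr q * exp (- c * u) \<le> C / (1 + u\<^sup>2)"
proof -
  define r where "r = max 1 (q + 2)"
  have r: "r > 0" by (simp add: r_def)
  define C where "C = (r / c) powr r * exp c"
  have "(1 + u) powr q * exp (- c * u) \<le> C / (1 + u\<^sup>2)" if u: "0 \<le> u" for u
  proof -
    define x where "x = c * (1 + u) / r"
    have x: "x > 0" using c u r by (auto simp: x_def intro!: mult_pos_pos divide_pos_pos)
    have "ln x \<le> x" using ln_le_minus_one[OF x] by simp
    then have "exp (r * ln x) \<le> exp (r * x)" using r by simp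
    then have "x powr r \<le> exp (c * (1 + u))" using x r by (simp add: powr_def x_def)
    then have "(r / c) powr r * x powr r \<le> (r / c) powr r * exp (c * (1 + u))" by (intro mult_left_mono) auto
    moreover have "(r / c) powr r * x powr r = (1 + u) powr r"
      using c r u by (simp add: x_def powr_divide powr_mult)
    ultimately have 1: "(1 + u) powr r \<le> C * exp (c * u)" by (simp add: C_def distrib_left exp_add)
    have "(1 + u) powr q * (1 + u\<^sup>2) \<le> (1 + u) powr q * (1 + u) powr 2"
      using u by (intro mult_left_mono) (auto simp: powr_numeral power2_eq_square algebra_simps)
    also have "\<dots> = (1 + u) powr (q + 2)" by (simp add: powr_add)
    also have "\<dots> \<le> (1 + u) powr r" using u by (intro powr_mono) (auto simp: r_def)
    also note 1
    finally have "(1 + u) powr q * (1 + u\<^sup>2) * exp (- c * u) \<le> C * exp (c * u) * exp (- c * u)"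
      by (intro mult_right_mono) auto
    also have "\<dots> = C" by (simp add: mult.assoc flip: exp_add)
    finally show ?thesis by (simp add: pos_le_divide_eq mult_ac add_pos_nonneg)
  qed
  moreover have "C > 0" using r c by (simp add: C_def)
  ultimately show thesis by (rule that[rotated])
qed

lemma riesz_base_bound:
  assumes R: "R > 0"
  shows "norm (1 - z\<^sup>2 / of_real (R\<^sup>2)) \<le> (\<bar>R - Re z\<bar> + \<bar>Im z\<bar>) * (\<bar>R + Re z\<bar> + \<bar>Im z\<bar>) / R\<^sup>2"
proof -
  have "1 - z\<^sup>2 / of_real (R\<^sup>2) = (of_real R - z) * (of_real R + z) / of_real (R\<^sup>2)"
    using R by (simp add: field_simps power2_eq_square)
  then have "norm (1 - z\<^sup>2 / of_real (R\<^sup>2)) = norm (of_real R - z) * norm (of_real R + z) / R\<^sup>2"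
    by (simp add: norm_divide norm_mult norm_power)
  also have "\<dots> \<le> (\<bar>R - Re z\<bar> + \<bar>Im z\<bar>) * (\<bar>R + Re z\<bar> + \<bar>Im z\<bar>) / R\<^sup>2"
    using cmod_le[of "of_real R - z"] cmod_le[of "of_real R + z"] by (intro divide_right_mono mult_mono) auto
  finally show ?thesis .
qed

text \<open>Put t = Im z. Within \<pi> of R the factor R - z has size 1 + |t| and R + z has size R +
  |t|; division by R^2 leaves the gain R^-\<delta>. The quotient |t|/R is kept apart so that the
  near estimate can absorb it when |x - y| \<ge> 1/R.\<close>

lemma riesz_factor_line_bound:
  assumes \<delta>: "\<delta> > 0" and R: "R \<ge> 1" and \<rho>: "R - pi \<le> Re z" "Re z < R" "0 \<le> Re z"
  shows "norm (riesz_factor \<delta> R z) \<le> (8 / R) powr \<delta> * ((1 + \<bar>Im z\<bar>) powr \<delta> * (1 + \<bar>Im z\<bar> / R) powr \<delta>)"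
proof -
  define t where "t = \<bar>Im z\<bar>"
  have t: "t \<ge> 0" by (simp add: t_def)
  have "norm (1 - z\<^sup>2 / of_real (R\<^sup>2)) \<le> (\<bar>R - Re z\<bar> + t) * (\<bar>R + Re z\<bar> + t) / R\<^sup>2"
    unfolding t_def using R by (intro riesz_base_bound) auto
  also have "\<dots> \<le> (4 * (1 + t)) * (2 * R * (1 + t / R)) / R\<^sup>2"
  proof (intro divide_right_mono mult_mono)
    show "\<bar>R - Re z\<bar> + t \<le> 4 * (1 + t)" using \<rho> t pi_less_4 by simp
    have "2 * R * (1 + t / R) = 2 * R + 2 * t" using R by (simp add: field_simps)
    then show "\<bar>R + Re z\<bar> + t \<le> 2 * R * (1 + t / R)" using \<rho> t R by simp
  qed (use t R in auto)
  also have "\<dots> = 8 / R * ((1 + t) * (1 + t / R))" using R by (simp add: field_simps power2_eq_square)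
  finally have "norm (riesz_factor \<delta> R z) \<le> (8 / R * ((1 + t) * (1 + t / R))) powr \<delta>"
    unfolding norm_riesz_factor using \<delta> by (intro powr_mono2) auto
  also have "\<dots> = (8 / R) powr \<delta> * ((1 + t) powr \<delta> * (1 + t / R) powr \<delta>)"
    using powr_mult[of "8 / R" "(1 + t) * (1 + t / R)" \<delta>] powr_mult[of "1 + t" "1 + t / R" \<delta>] t R by simp
  finally show ?thesis by (simp add: t_def)
qed

text \<open>Meant for the high horizontal sides, where exponential decay beats any power of Im
  z.\<close>

lemma riesz_factor_crude_bound:
  assumes \<delta>: "\<delta> > 0" and R: "R \<ge> 1" and z: "0 \<le> Re z" "Re z < R"
  shows "norm (riesz_factor \<delta> R z) \<le> 2 powr \<delta> * (1 + \<bar>Im z\<bar>) powr (2 * \<delta>)"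
proof -
  define t where "t = \<bar>Im z\<bar>"
  have t: "t \<ge> 0" by (simp add: t_def)
  have "norm (1 - z\<^sup>2 / of_real (R\<^sup>2)) \<le> (\<bar>R - Re z\<bar> + t) * (\<bar>R + Re z\<bar> + t) / R\<^sup>2"
    unfolding t_def using R by (intro riesz_base_bound) auto
  also have "\<dots> \<le> (R * (1 + t)) * (2 * R * (1 + t)) / R\<^sup>2"
  proof (intro divide_right_mono mult_mono)
    have Rt: "t \<le> R * t" using R t by (simp add: mult_le_cancel_right1)
    show "\<bar>R - Re z\<bar> + t \<le> R * (1 + t)" using z Rt by (simp add: algebra_simps)
    show "\<bar>R + Re z\<bar> + t \<le> 2 * R * (1 + t)" using z Rt t R by (simp add: algebra_simps)
  qed (use t R in auto)
  also have "\<dots> = 2 * ((1 + t) * (1 + t))" using R by (simp add: field_simps power2_eq_square)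
  finally have "norm (riesz_factor \<delta> R z) \<le> (2 * ((1 + t) * (1 + t))) powr \<delta>"
    unfolding norm_riesz_factor using \<delta> by (intro powr_mono2) auto
  also have "\<dots> = 2 powr \<delta> * (1 + t) powr (2 * \<delta>)" using t by (simp add: powr_mult flip: powr_add)
  finally show ?thesis by (simp add: t_def)
qed

text \<open>On Re z = \<rho> the modulus of sin(z + \<eta>) is cosh(Im z), so \<open>bphi\<close> is
  bounded below there; consecutive candidates for \<rho> are \<pi> apart.\<close>

lemma exists_contour_abscissa:
  fixes R \<eta> :: real
  obtains \<rho> and k :: int where "R - pi \<le> \<rho>" "\<rho> < R" "\<rho> + \<eta> = (of_int k + 1/2) * pi"
proof -
  define k where "k = \<lceil>(R + \<eta>) / pi - 1/2\<rceil> - 1"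
  have "of_int k < (R + \<eta>) / pi - 1/2" "(R + \<eta>) / pi - 1/2 \<le> of_int k + 1" unfolding k_def by linarith+
  then have "of_int k * pi < R + \<eta> - 1/2 * pi" "R + \<eta> - 1/2 * pi \<le> (of_int k + 1) * pi"
    using pi_gt_zero by (simp_all add: field_simps)
  then show thesis by (intro that[of "(of_int k + 1/2) * pi - \<eta>" k]) (simp_all add: algebra_simps)
qed

section \<open>Kernel estimates\<close>

lemma powr_between:
  fixes l q u a :: real
  assumes "0 < l" "l \<le> q" "q \<le> u"
  shows "q powr a \<le> l powr a + u powr a"
proof (cases "a \<ge> 0")
  case True
  have "q powr a \<le> u powr a" using assms True by (intro powr_mono2) auto
  then show ?thesis by (simp add: add_increasing)
next
  case False
  have "q powr a \<le> l powr a" using assms False by (intro powr_mono2') auto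
  then show ?thesis by (simp add: add_increasing2)
qed

text \<open>Moves the weight from r = |z| on the contour to R at the cost of a power of 1 + t. For a
  < 0 the quotient is at least 1/2 and the weight is bounded by a constant, which is the origin of
  the exponent max(a, 0) in the far estimate.\<close>

lemma weight_bound:
  fixes r R t lo a :: real
  assumes r: "1 \<le> r" "r \<le> R * (1 + t)" and t: "0 \<le> t" and R: "1 \<le> R" and lo: "0 \<le> lo" "lo \<le> 1"
  shows "(r / (1 + lo * r)) powr a \<le> 2 powr \<bar>a\<bar> * ((1 + t) powr max a 0 * (R / (1 + lo * R)) powr max a 0)"
proof -
  define q where "q = r / (1 + lo * r)"
  have pos: "1 + lo * r > 0" "1 + lo * R > 0" using r R lo by (auto intro: add_pos_nonneg)
  have q1: "1/2 \<le> q"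
  proof -
    have "1 + lo * r \<le> 1 * r + 1 * r" using r lo by (intro add_mono mult_right_mono) auto
    then show ?thesis using pos by (simp add: q_def pos_le_divide_eq)
  qed
  have q2: "q \<le> (1 + t) * (R / (1 + lo * R))"
  proof -
    have "r * (1 + lo * R) = r + lo * r * R" by (simp add: algebra_simps)
    also have "\<dots> \<le> R * (1 + t) + lo * r * (R * (1 + t))"
    proof (rule add_mono[OF r(2)])
      have "R * 1 \<le> R * (1 + t)" using R t by (intro mult_left_mono) auto
      then show "lo * r * R \<le> lo * r * (R * (1 + t))" using lo r by (intro mult_left_mono) auto
    qed
    also have "\<dots> = (1 + t) * R * (1 + lo * r)" by (simp add: algebra_simps)
    finally show ?thesis using pos by (simp add: q_def divide_le_eq pos_le_divide_eq mult_ac)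
  qed
  show ?thesis
  proof (cases "a \<ge> 0")
    case True
    have "q powr a \<le> ((1 + t) * (R / (1 + lo * R))) powr a" using q1 q2 True by (intro powr_mono2) auto
    also have "\<dots> = 1 * ((1 + t) powr a * (R / (1 + lo * R)) powr a)" using t R pos by (simp add: powr_mult del: times_divide_eq_right)
    also have "\<dots> \<le> 2 powr \<bar>a\<bar> * ((1 + t) powr a * (R / (1 + lo * R)) powr a)"
      by (intro mult_right_mono) (auto simp: ge_one_powr_ge_zero)
    finally show ?thesis using True by (simp add: q_def max_def)
  next
    case False
    have "q powr a \<le> (1/2) powr a" using q1 False by (intro powr_mono2') auto
    also have "\<dots> = 2 powr \<bar>a\<bar>" using False by (simp add: powr_divide powr_minus_divide)
    finally show ?thesis using False t R pos by (simp add: q_def max_def)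
  qed
qed

definition bkernel :: "real \<Rightarrow> real \<Rightarrow> real \<Rightarrow> real \<Rightarrow> real \<Rightarrow> real" where
  "bkernel \<nu> \<delta> R x y = (\<Sum>s\<in>bzeros \<nu> \<inter> {..<R}. (1 - s\<^sup>2 / R\<^sup>2) powr \<delta> * (2 / (bphi' \<nu> s)\<^sup>2 * bphi \<nu> (s * x) * bphi \<nu> (s * y)))"

lemma bkernel_commute: "bkernel \<nu> \<delta> R x y = bkernel \<nu> \<delta> R y x"
  by (simp add: bkernel_def mult_ac)

text \<open>The admissible points are those where the lower bound for \<open>\<phi>\<close> is available.\<close>
definition adm :: "real \<Rightarrow> real \<Rightarrow> complex \<Rightarrow> bool" where
  "adm \<eta> K z \<longleftrightarrow> K \<le> \<bar>Im z\<bar> \<or> K \<le> norm z \<and> (\<exists>k::int. \<bar>Re z\<bar> + \<eta> = (of_int k + 1/2) * pi)"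

lemma bphi_ratio_bound:
  assumes nu: "\<nu> > -1" and as: "bessel_asymptotic \<nu> A \<eta> C0" "A > 0" "C0 > 0"
  obtains C K where "C > 0" "K \<ge> 1"
    "\<And>lo z. 0 \<le> lo \<Longrightarrow> adm \<eta> K z \<Longrightarrow> bphi \<nu> z \<noteq> 0 \<and>
       norm (bphi \<nu> (of_real lo * z) / bphi \<nu> z) \<le> C * (norm z / (1 + lo * norm z)) powr (\<nu> + 1/2) * exp (- ((1 - lo) * \<bar>Im z\<bar>))"
proof -
  define a where "a = \<nu> + 1/2"
  obtain C1 where C1: "C1 > 0" "\<And>w::complex. norm (bphi \<nu> w) \<le> C1 * (1 + norm w) powr (- a) * exp \<bar>Im w\<bar>"
    using bphi_upper_bound[OF nu] unfolding a_def by blast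
  obtain c K where c: "c > 0" "K \<ge> 1"
    "\<And>w::complex. adm \<eta> K w \<Longrightarrow> c * norm w powr (- a) * exp \<bar>Im w\<bar> \<le> norm (bphi \<nu> w)"
    using bphi_lower_bound[OF nu as] unfolding a_def adm_def by blast
  have "bphi \<nu> z \<noteq> 0 \<and> norm (bphi \<nu> (of_real lo * z) / bphi \<nu> z) \<le> (C1 / c) * (norm z / (1 + lo * norm z)) powr a * exp (- ((1 - lo) * \<bar>Im z\<bar>))"
    if lo: "0 \<le> lo" and z: "adm \<eta> K z" for lo z
  proof -
    have nz: "norm z > 0" using z c(2) abs_Im_le_cmod[of z] unfolding adm_def by linarith
    have low: "0 < c * norm z powr (- a) * exp \<bar>Im z\<bar>" using c nz by simp
    note lb = c(3)[OF z]
    have "norm (bphi \<nu> (of_real lo * z)) \<le> C1 * (1 + lo * norm z) powr (- a) * exp (lo * \<bar>Im z\<bar>)"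
      using C1(2)[of "of_real lo * z"] lo by (simp add: norm_mult abs_mult)
    then have "norm (bphi \<nu> (of_real lo * z)) / norm (bphi \<nu> z) \<le> C1 * (1 + lo * norm z) powr (- a) * exp (lo * \<bar>Im z\<bar>) / (c * norm z powr (- a) * exp \<bar>Im z\<bar>)"
      using low lb C1 by (intro frac_le) auto
    also have "\<dots> = (C1 / c) * (norm z / (1 + lo * norm z)) powr a * exp (- ((1 - lo) * \<bar>Im z\<bar>))"
    proof -
      have "exp (lo * \<bar>Im z\<bar>) / exp \<bar>Im z\<bar> = exp (- ((1 - lo) * \<bar>Im z\<bar>))" by (simp add: left_diff_distrib flip: exp_diff)
      moreover have "(1 + lo * norm z) powr (- a) / norm z powr (- a) = (norm z / (1 + lo * norm z)) powr a"
        using nz lo by (simp add: powr_divide powr_minus_divide)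
      moreover have "C1 * p * q / (c * r * s) = (C1 / c) * (p / r) * (q / s)" for p q r s :: real by simp
      ultimately show ?thesis by (simp only:)
    qed
    finally show ?thesis using low lb by (auto simp: norm_divide)
  qed
  then show thesis using that[of "C1 / c" K] C1 c by (simp add: a_def)
qed

text \<open>Up to normalisation this is the Green function of the Bessel operator on (0,1) at the
  spectral parameter z^2. The growth rates lo and 1 - hi of the numerator and 1 of the denominator
  add up to -(hi - lo), and the factor z uses up the gain 1/|z| of \<open>bZs_bound\<close>.\<close>

lemma green_bound:
  assumes nu: "\<nu> > -1" and as: "bessel_asymptotic \<nu> A \<eta> C0" "A > 0" "C0 > 0" and x0: "0 < x0" "x0 \<le> 1"
  obtains C K where "C > 0" "K \<ge> 1"
    "\<And>lo hi z. 0 \<le> lo \<Longrightarrow> x0 \<le> hi \<Longrightarrow> hi \<le> 1 \<Longrightarrow> adm \<eta> K z \<Longrightarrow>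
       norm (z * bphi \<nu> (of_real lo * z) * bZs \<nu> hi z / bphi \<nu> z) \<le> C * (norm z / (1 + lo * norm z)) powr (\<nu> + 1/2) * exp (- ((hi - lo) * \<bar>Im z\<bar>))"
proof -
  obtain C1 K where 1: "C1 > 0" "K \<ge> 1"
    "\<And>lo z. 0 \<le> lo \<Longrightarrow> adm \<eta> K z \<Longrightarrow> bphi \<nu> z \<noteq> 0 \<and>
       norm (bphi \<nu> (of_real lo * z) / bphi \<nu> z) \<le> C1 * (norm z / (1 + lo * norm z)) powr (\<nu> + 1/2) * exp (- ((1 - lo) * \<bar>Im z\<bar>))"
    using bphi_ratio_bound[OF nu as] by blast
  obtain C2 where 2: "C2 > 0" "\<And>x z. x0 \<le> x \<Longrightarrow> x \<le> 1 \<Longrightarrow> 1 \<le> norm z \<Longrightarrow> norm z * norm (bZs \<nu> x z) \<le> C2 * exp (\<bar>Im z\<bar> * (1 - x))"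
    using bZs_bound[OF x0] by blast
  have "norm (z * bphi \<nu> (of_real lo * z) * bZs \<nu> hi z / bphi \<nu> z) \<le> (C1 * C2) * (norm z / (1 + lo * norm z)) powr (\<nu> + 1/2) * exp (- ((hi - lo) * \<bar>Im z\<bar>))"
    if h: "0 \<le> lo" "x0 \<le> hi" "hi \<le> 1" "adm \<eta> K z" for lo hi z
  proof -
    have nz: "1 \<le> norm z" using h(4) 1(2) abs_Im_le_cmod[of z] unfolding adm_def by linarith
    have "norm (z * bphi \<nu> (of_real lo * z) * bZs \<nu> hi z / bphi \<nu> z) = norm (bphi \<nu> (of_real lo * z) / bphi \<nu> z) * (norm z * norm (bZs \<nu> hi z))"
      by (simp add: norm_mult norm_divide)
    also have "\<dots> \<le> (C1 * (norm z / (1 + lo * norm z)) powr (\<nu> + 1/2) * exp (- ((1 - lo) * \<bar>Im z\<bar>))) * (C2 * exp (\<bar>Im z\<bar> * (1 - hi)))"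
      using 1(1) by (intro mult_mono[OF conjunct2[OF 1(3)[OF h(1,4)]] 2(2)[OF h(2,3) nz]]) auto
    also have "\<dots> = (C1 * C2) * (norm z / (1 + lo * norm z)) powr (\<nu> + 1/2) * (exp (- ((1 - lo) * \<bar>Im z\<bar>)) * exp (\<bar>Im z\<bar> * (1 - hi)))"
      by (simp add: mult_ac)
    also have "exp (- ((1 - lo) * \<bar>Im z\<bar>)) * exp (\<bar>Im z\<bar> * (1 - hi)) = exp (- ((hi - lo) * \<bar>Im z\<bar>))"
      unfolding exp_add[symmetric] by (rule arg_cong[where f = exp]) (simp add: algebra_simps)
    finally show ?thesis .
  qed
  then show thesis using 1 2 by (intro that[of "C1 * C2" K]) auto
qed

lemma exponential_decay_top:
  fixes I :: "complex \<Rightarrow> complex"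
  assumes d: "d > 0" and M: "M \<ge> 0"
    and b: "\<And>z. 0 \<le> Re z \<Longrightarrow> Re z \<le> \<rho> \<Longrightarrow> K \<le> \<bar>Im z\<bar> \<Longrightarrow> norm (I z) \<le> M * ((1 + \<bar>Im z\<bar>) powr q * exp (- (d * \<bar>Im z\<bar>)))"
    and e: "e > 0"
  shows "\<exists>T0. \<forall>z. 0 \<le> Re z \<longrightarrow> Re z \<le> \<rho> \<longrightarrow> T0 \<le> \<bar>Im z\<bar> \<longrightarrow> norm (I z) \<le> e"
proof -
  obtain C where C: "C > 0" "\<And>u. 0 \<le> u \<Longrightarrow> (1 + u) powr q * exp (- d * u) \<le> C / (1 + u\<^sup>2)"
    using power_times_exp_bound[OF d] by blast
  define T0 where "T0 = max (max K 1) (M * C / e)"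
  have "norm (I z) \<le> e" if z: "0 \<le> Re z" "Re z \<le> \<rho>" "T0 \<le> \<bar>Im z\<bar>" for z
  proof -
    define t where "t = \<bar>Im z\<bar>"
    have t: "1 \<le> t" "K \<le> t" "M * C / e \<le> t" using z by (auto simp: T0_def t_def)
    have "norm (I z) \<le> M * ((1 + t) powr q * exp (- d * t))" using b[OF z(1,2)] t by (simp add: t_def)
    also have "\<dots> \<le> M * (C / (1 + t\<^sup>2))" using C(2)[of t] t M by (intro mult_left_mono) auto
    also have "\<dots> = M * C / (1 + t\<^sup>2)" by simp
    also have "\<dots> \<le> M * C / t"
    proof (rule divide_left_mono)
      have "t * 1 \<le> t * t" using t by (intro mult_left_mono) auto
      then show "t \<le> 1 + t\<^sup>2" by (simp add: power2_eq_square)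
      show "0 < (1 + t\<^sup>2) * t" using t by (intro mult_pos_pos add_pos_nonneg) auto
    qed (use M C in auto)
    also have "\<dots> \<le> e" using t e by (simp add: field_simps)
    finally show ?thesis .
  qed
  then show ?thesis by blast
qed

text \<open>The part of the kernel with \<open>\<rho> \<le> s < R\<close>, where \<open>\<rho>\<close> is within \<open>\<pi>\<close> of \<open>R\<close>, has boundedly many terms, each with
  Riesz factor of size \<open>R\<^sup>-\<^sup>\<delta>\<close>.\<close>
lemma riesz_tail_bound:
  assumes nu: "\<nu> > -1" and \<delta>: "\<delta> > 0"
  obtains N where "N > 0"
    "\<And>R \<rho> h B. R \<ge> 4 \<Longrightarrow> R - pi \<le> \<rho> \<Longrightarrow> \<rho> < R \<Longrightarrow>
       (\<And>s. s \<in> bzeros \<nu> \<Longrightarrow> R - pi \<le> s \<Longrightarrow> s < R \<Longrightarrow> \<bar>h s\<bar> \<le> B) \<Longrightarrow> 0 \<le> B \<Longrightarrow>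
       \<bar>(\<Sum>s\<in>bzeros \<nu> \<inter> {..<R}. (1 - s\<^sup>2 / R\<^sup>2) powr \<delta> * h s) - (\<Sum>s\<in>bzeros \<nu> \<inter> {..<\<rho>}. (1 - s\<^sup>2 / R\<^sup>2) powr \<delta> * h s)\<bar> \<le> N * R powr (- \<delta>) * B"
proof -
  obtain d where d: "d > 0" "\<And>s t. s \<in> bzeros \<nu> \<Longrightarrow> t \<in> bzeros \<nu> \<Longrightarrow> s < t \<Longrightarrow> d \<le> t - s"
    using bzeros_separated[OF nu] by blast
  define N where "N = (pi / d + 1) * 8 powr \<delta>"
  have N: "N > 0" using d pi_gt_zero by (simp add: N_def add_pos_pos)
  have "\<bar>(\<Sum>s\<in>bzeros \<nu> \<inter> {..<R}. (1 - s\<^sup>2 / R\<^sup>2) powr \<delta> * h s) - (\<Sum>s\<in>bzeros \<nu> \<inter> {..<\<rho>}. (1 - s\<^sup>2 / R\<^sup>2) powr \<delta> * h s)\<bar> \<le> N * R powr (- \<delta>) * B"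
    if R: "R \<ge> 4" and \<rho>: "R - pi \<le> \<rho>" "\<rho> < R" and h: "\<And>s. s \<in> bzeros \<nu> \<Longrightarrow> R - pi \<le> s \<Longrightarrow> s < R \<Longrightarrow> \<bar>h s\<bar> \<le> B" and B: "0 \<le> B"
    for R \<rho> h B
  proof -
    define f where "f = (\<lambda>s. (1 - s\<^sup>2 / R\<^sup>2) powr \<delta> * h s)"
    define S where "S = bzeros \<nu> \<inter> {\<rho>..<R}"
    have fin: "finite (bzeros \<nu> \<inter> {..<R})"
      by (rule finite_subset[OF _ finite_bzeros_atMost[OF nu, of R]]) auto
    have "bzeros \<nu> \<inter> {..<R} = (bzeros \<nu> \<inter> {..<\<rho>}) \<union> S" using \<rho> by (auto simp: S_def)
    moreover have "finite (bzeros \<nu> \<inter> {..<\<rho>})" "finite S" by (rule finite_subset[OF _ fin], use \<rho> in \<open>auto simp: S_def\<close>)+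
    ultimately have i0: "sum f (bzeros \<nu> \<inter> {..<R}) = sum f (bzeros \<nu> \<inter> {..<\<rho>}) + sum f S"
      using sum.union_disjoint[of "bzeros \<nu> \<inter> {..<\<rho>}" S f] by (force simp: S_def)
    \<comment> \<open>At a real point the imaginary part is 0, so
      \<open>riesz_factor_line_bound\<close> reduces to the factor (8/R)^\<delta>.\<close>
    have i1: "\<bar>sum f S\<bar> \<le> real (card S) * ((8 / R) powr \<delta> * B)"
    proof -
      have "\<bar>f s\<bar> \<le> (8 / R) powr \<delta> * B" if s: "s \<in> S" for s
      proof -
        have sR: "R - pi \<le> s" "s < R" "0 < s" using s \<rho> by (auto simp: S_def bzeros_def)
        have "norm (riesz_factor \<delta> R (of_real s)) \<le> (8 / R) powr \<delta> * ((1 + \<bar>Im (of_real s)\<bar>) powr \<delta> * (1 + \<bar>Im (of_real s)\<bar> / R) powr \<delta>)"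
          using sR R \<delta> by (intro riesz_factor_line_bound) auto
        then have "(1 - s\<^sup>2 / R\<^sup>2) powr \<delta> \<le> (8 / R) powr \<delta>"
          using sR by (simp add: riesz_factor_of_real)
        moreover have "\<bar>h s\<bar> \<le> B" using h s sR by (auto simp: S_def)
        ultimately show ?thesis unfolding f_def abs_mult using B by (intro mult_mono) auto
      qed
      then show ?thesis using sum_norm_bound[of S f "(8 / R) powr \<delta> * B"] by simp
    qed
        have i2: "real (card S) \<le> pi / d + 1"
    proof -
      have "real (card S) \<le> (R - \<rho>) / d + 1"
        using d \<rho> by (intro card_separated_le) (auto simp: S_def)
      also have "\<dots> \<le> pi / d + 1" using \<rho> d by (intro add_right_mono divide_right_mono) auto
      finally show ?thesis .
    qed
    have i3: "(pi / d + 1) * ((8 / R) powr \<delta> * B) = N * R powr (- \<delta>) * B"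
      using R by (simp add: N_def powr_divide powr_minus_divide mult_ac)
    have "\<bar>sum f S\<bar> \<le> N * R powr (- \<delta>) * B"
      unfolding i3[symmetric] using B by (intro order_trans[OF i1] mult_right_mono[OF i2]) auto
    then show ?thesis unfolding f_def[symmetric] i0 by simp
  qed
  then show thesis using N that by blast
qed

lemma bphi_upper_bound_real:
  assumes nu: "\<nu> > -1"
  obtains C where "C > 0" "\<And>x::real. 0 \<le> x \<Longrightarrow> \<bar>bphi \<nu> x\<bar> \<le> C * (1 + x) powr (- (\<nu> + 1/2))"
proof -
  obtain C where C: "C > 0" "\<And>w::complex. norm (bphi \<nu> w) \<le> C * (1 + norm w) powr (- (\<nu> + 1/2)) * exp \<bar>Im w\<bar>"
    using bphi_upper_bound[OF nu] by blast
  have "\<bar>bphi \<nu> x\<bar> \<le> C * (1 + x) powr (- (\<nu> + 1/2))" if "0 \<le> x" for x :: real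
  proof -
    have "norm (complex_of_real (bphi \<nu> x)) \<le> C * (1 + x) powr (- (\<nu> + 1/2))"
      using C(2)[of "of_real x"] that by (simp add: bphi_of_real[OF nu])
    then show ?thesis unfolding norm_of_real .
  qed
  then show thesis using C that by blast
qed

text \<open>A normalised eigenfunction is bounded by a multiple of (s/(1 + xs))^(\<nu>+1/2): the
  numerator comes from the normaliser, the denominator from the decay of
  \<open>bphi\<close>.\<close>

lemma bkernel_summand_bound:
  assumes nu: "\<nu> > -1"
  obtains C where "C > 0" "\<And>s x y. s \<in> bzeros \<nu> \<Longrightarrow> 0 \<le> x \<Longrightarrow> 0 \<le> y \<Longrightarrow>
     \<bar>2 / (bphi' \<nu> s)\<^sup>2 * bphi \<nu> (s * x) * bphi \<nu> (s * y)\<bar> \<le> C * (s / (1 + x * s)) powr (\<nu> + 1/2) * (s / (1 + y * s)) powr (\<nu> + 1/2)"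
proof -
  define a where "a = \<nu> + 1/2"
  obtain C1 where C1: "C1 > 0" "\<And>x::real. 0 \<le> x \<Longrightarrow> \<bar>bphi \<nu> x\<bar> \<le> C1 * (1 + x) powr (- a)"
    using bphi_upper_bound_real[OF nu] unfolding a_def by blast
  obtain c where c: "c > 0" "\<And>s. s \<in> bzeros \<nu> \<Longrightarrow> c * s powr (- a) \<le> \<bar>bphi' \<nu> s\<bar>"
    using bphi'_at_zero_bounds[OF nu] unfolding a_def by blast
  have one: "\<bar>bphi \<nu> (s * x)\<bar> / \<bar>bphi' \<nu> s\<bar> \<le> (C1 / c) * (s / (1 + x * s)) powr a" if s: "s \<in> bzeros \<nu>" and x: "0 \<le> x" for s x
  proof -
    have s0: "s > 0" using s by (simp add: bzeros_def)
    have "\<bar>bphi \<nu> (s * x)\<bar> \<le> C1 * (1 + x * s) powr (- a)"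
      using C1(2)[of "s * x"] s0 x by (simp add: mult.commute)
    then have "\<bar>bphi \<nu> (s * x)\<bar> / \<bar>bphi' \<nu> s\<bar> \<le> C1 * (1 + x * s) powr (- a) / (c * s powr (- a))"
      using c(2)[OF s] c(1) s0 by (intro frac_le) auto
    also have "\<dots> = (C1 / c) * ((1 + x * s) powr (- a) / s powr (- a))" by simp
    also have "(1 + x * s) powr (- a) / s powr (- a) = (s / (1 + x * s)) powr a"
      using s0 x by (simp add: powr_divide powr_minus_divide)
    finally show ?thesis .
  qed
  have "\<bar>2 / (bphi' \<nu> s)\<^sup>2 * bphi \<nu> (s * x) * bphi \<nu> (s * y)\<bar> \<le> (2 * (C1 / c)\<^sup>2) * (s / (1 + x * s)) powr a * (s / (1 + y * s)) powr a"
    if s: "s \<in> bzeros \<nu>" and x: "0 \<le> x" "0 \<le> y" for s x y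
  proof -
    have "\<bar>2 / (bphi' \<nu> s)\<^sup>2 * bphi \<nu> (s * x) * bphi \<nu> (s * y)\<bar> = 2 * ((\<bar>bphi \<nu> (s * x)\<bar> / \<bar>bphi' \<nu> s\<bar>) * (\<bar>bphi \<nu> (s * y)\<bar> / \<bar>bphi' \<nu> s\<bar>))"
      by (simp add: abs_mult power2_eq_square)
    also have "\<dots> \<le> 2 * (((C1 / c) * (s / (1 + x * s)) powr a) * ((C1 / c) * (s / (1 + y * s)) powr a))"
      using one[OF s x(1)] one[OF s x(2)] C1 c by (intro mult_left_mono mult_mono) auto
    finally show ?thesis by (simp add: power2_eq_square mult_ac)
  qed
  then show thesis using C1 c by (intro that[of "2 * (C1 / c)\<^sup>2"]) (auto simp: a_def)
qed

lemma ratio_powr_bounded: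
  fixes b x0 a :: real
  assumes b: "b > 0" and x0: "0 < x0" "x0 \<le> 1"
  obtains C where "C > 0" "\<And>r x. b \<le> r \<Longrightarrow> x0 \<le> x \<Longrightarrow> x \<le> 1 \<Longrightarrow> (r / (1 + x * r)) powr a \<le> C"
proof -
  have "(r / (1 + x * r)) powr a \<le> (b / (1 + b)) powr a + (1 / x0) powr a" if r: "b \<le> r" and x: "x0 \<le> x" "x \<le> 1" for r x
  proof (rule powr_between)
    have p: "0 < 1 + x * r" using r x x0 b by (intro add_pos_nonneg) auto
    show "0 < b / (1 + b)" using b by simp
    have "b * (x * r) \<le> b * (1 * r)" using r x x0 b by (intro mult_left_mono mult_right_mono) auto
    then have "b * (1 + x * r) \<le> r * (1 + b)" using r by (simp add: algebra_simps)
    then show "b / (1 + b) \<le> r / (1 + x * r)" using p b by (simp add: divide_le_eq pos_le_divide_eq mult_ac)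
    have "x0 * r \<le> x * r" using r x b by (intro mult_right_mono) auto
    then show "r / (1 + x * r) \<le> 1 / x0" using p x0 by (simp add: divide_le_eq pos_le_divide_eq mult_ac)
  qed
  moreover have "0 < (b / (1 + b)) powr a + (1 / x0) powr a" using b x0 by (intro add_pos_pos) auto
  ultimately show thesis using that by blast
qed

text \<open>By separation there are O(R) zeros below R, and away from 0 each contributes a bounded
  summand. This serves the range |x - y| < 1/R, which the contour bound does not cover.\<close>

lemma bkernel_linear_bound:
  assumes nu: "\<nu> > -1" and \<delta>: "\<delta> > 0" and x0: "0 < x0" "x0 \<le> 1"
  obtains C where "C > 0" "\<And>R x y. R \<ge> 1 \<Longrightarrow> x0 \<le> x \<Longrightarrow> x \<le> 1 \<Longrightarrow> x0 \<le> y \<Longrightarrow> y \<le> 1 \<Longrightarrow> \<bar>bkernel \<nu> \<delta> R x y\<bar> \<le> C * R"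
proof -
  obtain C1 where C1: "C1 > 0" "\<And>s x y. s \<in> bzeros \<nu> \<Longrightarrow> 0 \<le> x \<Longrightarrow> 0 \<le> y \<Longrightarrow>
     \<bar>2 / (bphi' \<nu> s)\<^sup>2 * bphi \<nu> (s * x) * bphi \<nu> (s * y)\<bar> \<le> C1 * (s / (1 + x * s)) powr (\<nu> + 1/2) * (s / (1 + y * s)) powr (\<nu> + 1/2)"
    using bkernel_summand_bound[OF nu] by blast
  obtain b where b: "b > 0" "\<And>s. s \<in> bzeros \<nu> \<Longrightarrow> b \<le> s" using bzeros_lower_bound[OF nu] by blast
  obtain C2 where C2: "C2 > 0" "\<And>r x. b \<le> r \<Longrightarrow> x0 \<le> x \<Longrightarrow> x \<le> 1 \<Longrightarrow> (r / (1 + x * r)) powr (\<nu> + 1/2) \<le> C2"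
    using ratio_powr_bounded[OF b(1) x0] by blast
  obtain d where d: "d > 0" "\<And>s t. s \<in> bzeros \<nu> \<Longrightarrow> t \<in> bzeros \<nu> \<Longrightarrow> s < t \<Longrightarrow> d \<le> t - s"
    using bzeros_separated[OF nu] by blast
  have "\<bar>bkernel \<nu> \<delta> R x y\<bar> \<le> ((1 / d + 1) * (C1 * C2 * C2)) * R"
    if R: "R \<ge> 1" and x: "x0 \<le> x" "x \<le> 1" and y: "x0 \<le> y" "y \<le> 1" for R x y
  proof -
    define S where "S = bzeros \<nu> \<inter> {..<R}"
    have "\<bar>(1 - s\<^sup>2 / R\<^sup>2) powr \<delta> * (2 / (bphi' \<nu> s)\<^sup>2 * bphi \<nu> (s * x) * bphi \<nu> (s * y))\<bar> \<le> C1 * C2 * C2" if s: "s \<in> S" for s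
    proof -
      have s0: "s \<in> bzeros \<nu>" "0 < s" "s < R" using s by (auto simp: S_def bzeros_def)
      have "s\<^sup>2 \<le> R\<^sup>2" using s0 by (intro power_mono) auto
      then have "0 \<le> 1 - s\<^sup>2 / R\<^sup>2" "1 - s\<^sup>2 / R\<^sup>2 \<le> 1" using s0 by (auto simp: divide_le_eq)
      then have g: "(1 - s\<^sup>2 / R\<^sup>2) powr \<delta> \<le> 1" using \<delta> by (intro powr_le1) auto
      have "\<bar>2 / (bphi' \<nu> s)\<^sup>2 * bphi \<nu> (s * x) * bphi \<nu> (s * y)\<bar> \<le> C1 * (s / (1 + x * s)) powr (\<nu> + 1/2) * (s / (1 + y * s)) powr (\<nu> + 1/2)"
        using C1(2)[OF s0(1)] x y x0 by simp
      also have "\<dots> \<le> C1 * C2 * C2"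
        using C2(2)[OF b(2)[OF s0(1)] x] C2(2)[OF b(2)[OF s0(1)] y] C1 C2 by (intro mult_mono) auto
      finally have "(1 - s\<^sup>2 / R\<^sup>2) powr \<delta> * \<bar>2 / (bphi' \<nu> s)\<^sup>2 * bphi \<nu> (s * x) * bphi \<nu> (s * y)\<bar> \<le> 1 * (C1 * C2 * C2)"
        using g by (intro mult_mono) auto
      then show ?thesis unfolding abs_mult by simp
    qed
    then have "\<bar>bkernel \<nu> \<delta> R x y\<bar> \<le> real (card S) * (C1 * C2 * C2)"
      unfolding bkernel_def S_def[symmetric] real_norm_def[symmetric] by (rule sum_norm_bound)
    also have "\<dots> \<le> ((1 / d + 1) * R) * (C1 * C2 * C2)"
    proof (rule mult_right_mono)
      have "real (card S) \<le> (R - 0) / d + 1"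
        using d R by (intro card_separated_le) (auto simp: S_def bzeros_def)
      also have "\<dots> \<le> R / d + R" using R by simp
      also have "\<dots> = (1 / d + 1) * R" by (simp add: algebra_simps)
      finally show "real (card S) \<le> (1 / d + 1) * R" .
    qed (use C1 C2 in auto)
    finally show ?thesis by (simp add: mult_ac)
  qed
  moreover have "(1 / d + 1) * (C1 * C2 * C2) > 0" using d C1 C2 by (simp add: add_pos_pos)
  ultimately show thesis using that by blast
qed

text \<open>The contour representation, with the factor \<open>\<Phi>(lo z) Z(hi, z)\<close> turning into \<open>- \<Phi>(lo s) \<Phi>(hi s) / (s \<Phi>'(s))\<close>
  at the zeros.\<close>
lemma truncated_bkernel_bound:
  assumes nu: "\<nu> > -1" and \<rho>: "0 < \<rho>" "\<rho> < R" and c: "c > 0" and K: "K \<ge> 0" and hi: "0 < hi" "hi \<le> 1"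
    and nz: "\<rho> \<notin> bzeros \<nu>"
    and line: "\<And>z. Re z = \<rho> \<Longrightarrow> norm (riesz_factor \<delta> R z * (z * bphi \<nu> (of_real lo * z) * bZs \<nu> hi z / bphi \<nu> z)) \<le> K / (1 + (c * Im z)\<^sup>2)"
    and top: "\<And>e. e > 0 \<Longrightarrow> \<exists>T0. \<forall>z. 0 \<le> Re z \<longrightarrow> Re z \<le> \<rho> \<longrightarrow> T0 \<le> \<bar>Im z\<bar> \<longrightarrow>
         norm (riesz_factor \<delta> R z * (z * bphi \<nu> (of_real lo * z) * bZs \<nu> hi z / bphi \<nu> z)) \<le> e"
  shows "\<bar>\<Sum>s\<in>bzeros \<nu> \<inter> {..<\<rho>}. (1 - s\<^sup>2 / R\<^sup>2) powr \<delta> * (2 / (bphi' \<nu> s)\<^sup>2 * bphi \<nu> (s * lo) * bphi \<nu> (s * hi))\<bar> \<le> K / c"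
proof -
  define A where "A = (\<lambda>z. z * bphi \<nu> (of_real lo * z) * bZs \<nu> hi z)"
  have hA: "A holomorphic_on U" for U
  proof -
    have "(\<lambda>z. bphi \<nu> (of_real lo * z)) holomorphic_on U"
      using holomorphic_on_compose_gen[of "\<lambda>z. of_real lo * z" U "bphi \<nu>" UNIV] holomorphic_on_bphi[OF nu]
      by (auto simp: o_def intro!: holomorphic_intros)
    then show ?thesis unfolding A_def by (intro holomorphic_intros holomorphic_on_bZs hi)
  qed
  have Am: "A (- z) = - A z" for z by (simp add: A_def bphi_minus bZs_minus)
  define S where "S = bzeros \<nu> \<inter> {..<\<rho>}"
  have "norm (2 * (\<Sum>s\<in>S. of_real ((1 - s\<^sup>2 / R\<^sup>2) powr \<delta>) * A (of_real s) / of_real (bphi' \<nu> s))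
     + residue (\<lambda>z. riesz_factor \<delta> R z * A z / bphi \<nu> z) 0) \<le> K / c"
    unfolding S_def
    by (rule contour_residue_bound[OF nu \<rho> c K hA Am nz]) (use line top in \<open>simp_all add: A_def\<close>)
  \<comment> \<open>The numerator has no pole and \<open>bphi\<close> is 1 at 0, so the integrand is
    holomorphic near 0.\<close>
  moreover have "residue (\<lambda>z. riesz_factor \<delta> R z * A z / bphi \<nu> z) 0 = 0"
  proof -
    obtain b where b: "b > 0" "\<And>w::complex. norm w \<le> b \<Longrightarrow> norm (bphi \<nu> w - 1) \<le> 1/2"
      using bphi_near_0[OF nu] by blast
    define r where "r = min b R"
    have r: "r > 0" "r \<le> b" "r \<le> R" using b \<rho> by (auto simp: r_def)
    have "bphi \<nu> w \<noteq> 0" if "w \<in> ball 0 r" for w :: complex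
      using b(2)[of w] that r by (auto simp: dist_norm)
    moreover have "ball 0 r \<subseteq> {z. \<bar>Re z\<bar> < R}" using r by (auto simp: dist_norm intro: le_less_trans[OF abs_Re_le_cmod])
    ultimately have "(\<lambda>z. riesz_factor \<delta> R z * A z / bphi \<nu> z) holomorphic_on ball 0 r"
      using \<rho> by (intro holomorphic_intros hA holomorphic_on_bphi nu holomorphic_on_subset[OF holomorphic_on_riesz_factor]) auto
    then show ?thesis by (rule residue_holo[rotated 2]) (use r in auto)
  qed
  moreover have "2 * (\<Sum>s\<in>S. of_real ((1 - s\<^sup>2 / R\<^sup>2) powr \<delta>) * A (of_real s) / of_real (bphi' \<nu> s))
      = - complex_of_real (\<Sum>s\<in>S. (1 - s\<^sup>2 / R\<^sup>2) powr \<delta> * (2 / (bphi' \<nu> s)\<^sup>2 * bphi \<nu> (s * lo) * bphi \<nu> (s * hi)))"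
    unfolding sum_distrib_left of_real_sum sum_negf[symmetric]
  proof (rule sum.cong[OF refl])
    fix s assume "s \<in> S"
    then have s: "s \<in> bzeros \<nu>" "s \<noteq> 0" "bphi' \<nu> s \<noteq> 0" using bphi'_at_zero_nonzero[OF nu] by (auto simp: S_def bzeros_def)
    have "A (of_real s) = of_real (- (bphi \<nu> (s * lo) * bphi \<nu> (s * hi) / bphi' \<nu> s))"
    proof -
      have "complex_of_real lo * of_real s = of_real (s * lo)" by simp
      then have "A (of_real s) = of_real s * of_real (bphi \<nu> (s * lo)) * (- of_real (bphi \<nu> (hi * s) / (s * bphi' \<nu> s)))"
        unfolding A_def bZs_at_bzero[OF nu s(1) hi] by (simp only: bphi_of_real[OF nu])
      then show ?thesis using s by (simp add: mult.commute)
    qed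
    then show "2 * (of_real ((1 - s\<^sup>2 / R\<^sup>2) powr \<delta>) * A (of_real s) / of_real (bphi' \<nu> s)) =
        - complex_of_real ((1 - s\<^sup>2 / R\<^sup>2) powr \<delta> * (2 / (bphi' \<nu> s)\<^sup>2 * bphi \<nu> (s * lo) * bphi \<nu> (s * hi)))"
      by (simp add: power2_eq_square)
  qed
  ultimately show ?thesis unfolding S_def[symmetric] by (simp only: add_0_right norm_minus_cancel norm_of_real)
qed

text \<open>The size of R keeps the line beyond the threshold K even after a shift to the left by
  \<pi>.\<close>

lemma contour_setup:
  assumes nu: "\<nu> > -1" and R: "R \<ge> 2 * K + 2 * pi" "K \<ge> 1"
    and adm0: "\<And>z. adm \<eta> K z \<Longrightarrow> bphi \<nu> z \<noteq> 0"
  obtains \<rho> where "R - pi \<le> \<rho>" "\<rho> < R" "K \<le> \<rho>" "\<rho> \<notin> bzeros \<nu>" "\<And>z. Re z = \<rho> \<Longrightarrow> adm \<eta> K z"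
proof -
  obtain \<rho> and k :: int where \<rho>: "R - pi \<le> \<rho>" "\<rho> < R" "\<rho> + \<eta> = (of_int k + 1/2) * pi"
    by (rule exists_contour_abscissa)
  have K: "K \<le> \<rho>" using \<rho> R pi_gt_zero by linarith
  have ad: "adm \<eta> K z" if "Re z = \<rho>" for z
    unfolding adm_def using that \<rho> K R(2) complex_Re_le_cmod[of z] by (intro disjI2 conjI exI[of _ k]) auto
  have "bphi \<nu> (complex_of_real \<rho>) \<noteq> 0" using ad[of "of_real \<rho>"] adm0 by simp
  then have "\<rho> \<notin> bzeros \<nu>" by (simp add: bphi_of_real[OF nu] bzeros_def)
  with \<rho> K ad that show thesis by blast
qed

lemma bkernel_near_bound:
  assumes nu: "\<nu> > -1" and \<delta>: "\<delta> > 0" and x0: "0 < x0" "x0 \<le> 1"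
  obtains C R0 where "C > 0" "R0 \<ge> 1" "\<And>R lo hi. R \<ge> R0 \<Longrightarrow> x0 \<le> lo \<Longrightarrow> hi \<le> 1 \<Longrightarrow> 1 / R \<le> hi - lo \<Longrightarrow>
     \<bar>bkernel \<nu> \<delta> R lo hi\<bar> \<le> C * R powr (- \<delta>) * (hi - lo) powr (- 1 - \<delta>)"
proof -
  define a where "a = \<nu> + 1/2"
  obtain \<eta> A C0 where as: "A > 0" "C0 > 0" "bessel_asymptotic \<nu> A \<eta> C0" using bessel_asymptotic_exists[OF nu] by blast
  obtain C1 K where 1: "C1 > 0" "K \<ge> 1"
    "\<And>lo hi z. 0 \<le> lo \<Longrightarrow> x0 \<le> hi \<Longrightarrow> hi \<le> 1 \<Longrightarrow> adm \<eta> K z \<Longrightarrow>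
       norm (z * bphi \<nu> (of_real lo * z) * bZs \<nu> hi z / bphi \<nu> z) \<le> C1 * (norm z / (1 + lo * norm z)) powr a * exp (- ((hi - lo) * \<bar>Im z\<bar>))"
    using green_bound[OF nu as(3,1,2) x0] unfolding a_def by blast
  obtain K' where K': "K' \<ge> 1" "\<And>z. adm \<eta> K' z \<Longrightarrow> bphi \<nu> z \<noteq> 0"
    using bphi_ratio_bound[OF nu as(3,1,2)] by (metis order_refl)
  obtain C2 where C2: "C2 > 0" "\<And>r x. 1 \<le> r \<Longrightarrow> x0 \<le> x \<Longrightarrow> x \<le> 1 \<Longrightarrow> (r / (1 + x * r)) powr a \<le> C2"
    using ratio_powr_bounded[OF _ x0, of 1] by auto
  obtain C3 where C3: "C3 > 0" "\<And>s x y. s \<in> bzeros \<nu> \<Longrightarrow> 0 \<le> x \<Longrightarrow> 0 \<le> y \<Longrightarrow>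
     \<bar>2 / (bphi' \<nu> s)\<^sup>2 * bphi \<nu> (s * x) * bphi \<nu> (s * y)\<bar> \<le> C3 * (s / (1 + x * s)) powr a * (s / (1 + y * s)) powr a"
    using bkernel_summand_bound[OF nu] unfolding a_def by blast
  obtain N where N: "N > 0"
    "\<And>R \<rho> h B. R \<ge> 4 \<Longrightarrow> R - pi \<le> \<rho> \<Longrightarrow> \<rho> < R \<Longrightarrow>
       (\<And>s. s \<in> bzeros \<nu> \<Longrightarrow> R - pi \<le> s \<Longrightarrow> s < R \<Longrightarrow> \<bar>h s\<bar> \<le> B) \<Longrightarrow> 0 \<le> B \<Longrightarrow>
       \<bar>(\<Sum>s\<in>bzeros \<nu> \<inter> {..<R}. (1 - s\<^sup>2 / R\<^sup>2) powr \<delta> * h s) - (\<Sum>s\<in>bzeros \<nu> \<inter> {..<\<rho>}. (1 - s\<^sup>2 / R\<^sup>2) powr \<delta> * h s)\<bar> \<le> N * R powr (- \<delta>) * B"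
    using riesz_tail_bound[OF nu \<delta>] by blast
  obtain C4 where C4: "C4 > 0" "\<And>u. 0 \<le> u \<Longrightarrow> (1 + u) powr (2 * \<delta>) * exp (- 1 * u) \<le> C4 / (1 + u\<^sup>2)"
    using power_times_exp_bound[of 1] by (metis zero_less_one)
  define KK where "KK = max K K'"
  have adKK: "adm \<eta> K z \<and> adm \<eta> K' z" if "adm \<eta> KK z" for z using that unfolding adm_def KK_def by auto
  define C where "C = 8 powr \<delta> * C1 * C2 * C4 + N * (C3 * C2 * C2)"
  define R0 where "R0 = 2 * KK + 2 * pi"
  have KK: "KK \<ge> 1" using 1 by (simp add: KK_def)
  have R0: "R0 \<ge> 8" using KK pi_gt3 by (simp add: R0_def)
  have "\<bar>bkernel \<nu> \<delta> R lo hi\<bar> \<le> C * R powr (- \<delta>) * (hi - lo) powr (- 1 - \<delta>)"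
    if R: "R \<ge> R0" and lo: "x0 \<le> lo" and hi: "hi \<le> 1" and dd: "1 / R \<le> hi - lo" for R lo hi
  proof -
    define d where "d = hi - lo"
    have R1: "R \<ge> 8" using R R0 by simp
    have "0 < 1 / R" using R1 by simp
    then have d: "0 < d" "d \<le> 1" "1 / R \<le> d" using dd lo hi x0 unfolding d_def by linarith+
    have hl: "0 \<le> lo" "x0 \<le> hi" "lo \<le> 1" "0 < hi" "0 \<le> hi" using lo hi x0 d by (auto simp: d_def)
    obtain \<rho> where \<rho>: "R - pi \<le> \<rho>" "\<rho> < R" "KK \<le> \<rho>" "\<rho> \<notin> bzeros \<nu>" "\<And>z. Re z = \<rho> \<Longrightarrow> adm \<eta> KK z"
      using contour_setup[OF nu, of KK R \<eta>] R KK K'(2) adKK unfolding R0_def by metis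
    define Kc where "Kc = 8 powr \<delta> * C1 * C2 * C4 * R powr (- \<delta>) * d powr (- \<delta>)"
    have I: "norm (riesz_factor \<delta> R z * (z * bphi \<nu> (of_real lo * z) * bZs \<nu> hi z / bphi \<nu> z)) \<le>
         norm (riesz_factor \<delta> R z) * (C1 * C2 * exp (- (d * \<bar>Im z\<bar>)))" if z: "adm \<eta> KK z" for z
    proof -
      have "1 \<le> norm z" using z KK abs_Im_le_cmod[of z] unfolding adm_def by linarith
      then have "C1 * (norm z / (1 + lo * norm z)) powr a * exp (- (d * \<bar>Im z\<bar>)) \<le> C1 * C2 * exp (- (d * \<bar>Im z\<bar>))"
        using C2 lo hl 1 by (intro mult_right_mono mult_left_mono) auto
      then have "norm (z * bphi \<nu> (of_real lo * z) * bZs \<nu> hi z / bphi \<nu> z) \<le> C1 * C2 * exp (- (d * \<bar>Im z\<bar>))"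
        using 1(3)[OF hl(1,2) hi conjunct1[OF adKK[OF z]]] unfolding d_def by linarith
      then show ?thesis unfolding norm_mult[of "riesz_factor \<delta> R z"] by (intro mult_left_mono) auto
    qed
    have "\<bar>\<Sum>s\<in>bzeros \<nu> \<inter> {..<\<rho>}. (1 - s\<^sup>2 / R\<^sup>2) powr \<delta> * (2 / (bphi' \<nu> s)\<^sup>2 * bphi \<nu> (s * lo) * bphi \<nu> (s * hi))\<bar> \<le> Kc / d"
    proof (rule truncated_bkernel_bound[OF nu _ \<rho>(2) d(1) _ hl(4) hi \<rho>(4)])
      show "0 < \<rho>" using \<rho> KK by simp
      show "0 \<le> Kc" using 1 C2 C4 by (simp add: Kc_def)
      fix z assume z: "Re z = \<rho>"
      define t where "t = \<bar>Im z\<bar>"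
      have t: "0 \<le> t" by (simp add: t_def)
      have "norm (riesz_factor \<delta> R z) \<le> (8 / R) powr \<delta> * ((1 + t) powr \<delta> * (1 + t / R) powr \<delta>)"
        unfolding t_def using z \<rho> R1 KK by (intro riesz_factor_line_bound \<delta>) auto
      \<comment> \<open>Both factors become functions of dt: the first because d \<le> 1, the second
        because 1/R \<le> d.\<close>
      also have "\<dots> \<le> (8 / R) powr \<delta> * (((1 + d * t) / d) powr \<delta> * (1 + d * t) powr \<delta>)"
      proof (intro mult_left_mono mult_mono powr_mono2)
        show "1 + t \<le> (1 + d * t) / d" using d by (simp add: field_simps)
        have "(1 / R) * t \<le> d * t" using d t by (intro mult_right_mono) auto
        then show "1 + t / R \<le> 1 + d * t" by simp
      qed (use t d R1 \<delta> in auto)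
      also have "\<dots> = (8 / R) powr \<delta> * d powr (- \<delta>) * (1 + d * t) powr (2 * \<delta>)"
      proof -
        have "(1 + d * t) powr (2 * \<delta>) = (1 + d * t) powr \<delta> * (1 + d * t) powr \<delta>" by (simp flip: powr_add)
        then show ?thesis using d t by (simp add: powr_divide powr_minus_divide)
      qed
      finally have g: "norm (riesz_factor \<delta> R z) \<le> (8 / R) powr \<delta> * d powr (- \<delta>) * (1 + d * t) powr (2 * \<delta>)" .
      have "norm (riesz_factor \<delta> R z * (z * bphi \<nu> (of_real lo * z) * bZs \<nu> hi z / bphi \<nu> z)) \<le>
          ((8 / R) powr \<delta> * d powr (- \<delta>) * (1 + d * t) powr (2 * \<delta>)) * (C1 * C2 * exp (- (d * t)))"
        unfolding t_def using 1(1) C2(1) by (intro order_trans[OF I[OF \<rho>(5)[OF z]] mult_right_mono[OF g[unfolded t_def]]]) auto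
      also have "\<dots> = ((8 / R) powr \<delta> * d powr (- \<delta>) * C1 * C2) * ((1 + d * t) powr (2 * \<delta>) * exp (- 1 * (d * t)))"
        by (simp add: mult_ac)
      also have "\<dots> \<le> ((8 / R) powr \<delta> * d powr (- \<delta>) * C1 * C2) * (C4 / (1 + (d * t)\<^sup>2))"
        using C4(2)[of "d * t"] d t 1 C2 by (intro mult_left_mono) auto
      also have "(d * t)\<^sup>2 = (d * Im z)\<^sup>2" by (simp add: t_def power_mult_distrib)
      also have "((8 / R) powr \<delta> * d powr (- \<delta>) * C1 * C2) * (C4 / (1 + (d * Im z)\<^sup>2)) = Kc / (1 + (d * Im z)\<^sup>2)"
        using R1 by (simp add: Kc_def powr_divide powr_minus_divide)
      finally show "norm (riesz_factor \<delta> R z * (z * bphi \<nu> (of_real lo * z) * bZs \<nu> hi z / bphi \<nu> z)) \<le> Kc / (1 + (d * Im z)\<^sup>2)" .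
    next
      fix e :: real assume e: "e > 0"
      show "\<exists>T0. \<forall>z. 0 \<le> Re z \<longrightarrow> Re z \<le> \<rho> \<longrightarrow> T0 \<le> \<bar>Im z\<bar> \<longrightarrow>
         norm (riesz_factor \<delta> R z * (z * bphi \<nu> (of_real lo * z) * bZs \<nu> hi z / bphi \<nu> z)) \<le> e"
      proof (rule exponential_decay_top[OF d(1) _ _ e])
        show "0 \<le> 2 powr \<delta> * (C1 * C2)" using 1 C2 by simp
        fix z assume z: "0 \<le> Re z" "Re z \<le> \<rho>" "KK \<le> \<bar>Im z\<bar>"
        have "norm (riesz_factor \<delta> R z * (z * bphi \<nu> (of_real lo * z) * bZs \<nu> hi z / bphi \<nu> z)) \<le>
           norm (riesz_factor \<delta> R z) * (C1 * C2 * exp (- (d * \<bar>Im z\<bar>)))" by (rule I) (simp add: adm_def z)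
        also have "\<dots> \<le> (2 powr \<delta> * (1 + \<bar>Im z\<bar>) powr (2 * \<delta>)) * (C1 * C2 * exp (- (d * \<bar>Im z\<bar>)))"
          using z \<rho> R1 1 C2 by (intro mult_right_mono riesz_factor_crude_bound \<delta>) auto
        finally show "norm (riesz_factor \<delta> R z * (z * bphi \<nu> (of_real lo * z) * bZs \<nu> hi z / bphi \<nu> z)) \<le>
           2 powr \<delta> * (C1 * C2) * ((1 + \<bar>Im z\<bar>) powr (2 * \<delta>) * exp (- (d * \<bar>Im z\<bar>)))" by (simp add: mult_ac)
      qed
    qed
    moreover have "\<bar>(\<Sum>s\<in>bzeros \<nu> \<inter> {..<R}. (1 - s\<^sup>2 / R\<^sup>2) powr \<delta> * (2 / (bphi' \<nu> s)\<^sup>2 * bphi \<nu> (s * lo) * bphi \<nu> (s * hi)))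
       - (\<Sum>s\<in>bzeros \<nu> \<inter> {..<\<rho>}. (1 - s\<^sup>2 / R\<^sup>2) powr \<delta> * (2 / (bphi' \<nu> s)\<^sup>2 * bphi \<nu> (s * lo) * bphi \<nu> (s * hi)))\<bar> \<le> N * R powr (- \<delta>) * (C3 * C2 * C2)"
    proof (rule N(2)[OF _ \<rho>(1,2)])
      fix s assume s: "s \<in> bzeros \<nu>" "R - pi \<le> s" "s < R"
      have s1: "1 \<le> s" using s R1 pi_less_4 by linarith
      have "\<bar>2 / (bphi' \<nu> s)\<^sup>2 * bphi \<nu> (s * lo) * bphi \<nu> (s * hi)\<bar> \<le> C3 * (s / (1 + lo * s)) powr a * (s / (1 + hi * s)) powr a"
        by (rule C3(2)[OF s(1) hl(1,5)])
      also have "\<dots> \<le> C3 * C2 * C2" using C2(2)[OF s1 lo hl(3)] C2(2)[OF s1 hl(2) hi] C3 C2 by (intro mult_mono) auto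
      finally show "\<bar>2 / (bphi' \<nu> s)\<^sup>2 * bphi \<nu> (s * lo) * bphi \<nu> (s * hi)\<bar> \<le> C3 * C2 * C2" .
    qed (use R1 C2 C3 in auto)
    moreover have "Kc / d = 8 powr \<delta> * C1 * C2 * C4 * R powr (- \<delta>) * d powr (- 1 - \<delta>)"
      using d by (simp add: Kc_def powr_diff powr_minus_divide)
    \<comment> \<open>The tail carries no power of d; since d \<le> 1 it is absorbed into the main
      bound.\<close>
    moreover have "N * R powr (- \<delta>) * (C3 * C2 * C2) \<le> N * (C3 * C2 * C2) * R powr (- \<delta>) * d powr (- 1 - \<delta>)"
    proof -
      have "1 \<le> d powr (- 1 - \<delta>)" using powr_mono2'[of "- 1 - \<delta>" d 1] d \<delta> by simp
      then have "N * (C3 * C2 * C2) * R powr (- \<delta>) * 1 \<le> N * (C3 * C2 * C2) * R powr (- \<delta>) * d powr (- 1 - \<delta>)"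
        using N C3 C2 by (intro mult_left_mono) auto
      then show ?thesis by (simp add: mult_ac)
    qed
    moreover have "C * R powr (- \<delta>) * d powr (- 1 - \<delta>) = 8 powr \<delta> * C1 * C2 * C4 * R powr (- \<delta>) * d powr (- 1 - \<delta>)
       + N * (C3 * C2 * C2) * R powr (- \<delta>) * d powr (- 1 - \<delta>)" by (simp add: C_def algebra_simps)
    ultimately show ?thesis unfolding bkernel_def d_def[symmetric] by linarith
  qed
  moreover have "C > 0" using 1 C2 C4 N C3 by (simp add: C_def add_pos_pos)
  ultimately show thesis using R0 by (intro that[of C R0]) auto
qed

text \<open>The points are at least x/2 apart, so the exponential decay is uniform and only the
  weight at y remains. The constants may depend on x, which is fixed throughout the convergence
  argument.\<close>

lemma bkernel_far_bound:
  assumes nu: "\<nu> > -1" and \<delta>: "\<delta> > 0" and x: "0 < x" "x \<le> 1"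
  obtains C R0 where "C > 0" "R0 \<ge> 1" "\<And>R y. R \<ge> R0 \<Longrightarrow> 0 \<le> y \<Longrightarrow> y \<le> x / 2 \<Longrightarrow>
     \<bar>bkernel \<nu> \<delta> R y x\<bar> \<le> C * R powr (- \<delta>) * (R / (1 + y * R)) powr max (\<nu> + 1/2) 0"
proof -
  define a where "a = \<nu> + 1/2"
  define \<beta> where "\<beta> = max a 0"
  obtain \<eta> A C0 where as: "A > 0" "C0 > 0" "bessel_asymptotic \<nu> A \<eta> C0" using bessel_asymptotic_exists[OF nu] by blast
  obtain C1 K where 1: "C1 > 0" "K \<ge> 1"
    "\<And>lo hi z. 0 \<le> lo \<Longrightarrow> x \<le> hi \<Longrightarrow> hi \<le> 1 \<Longrightarrow> adm \<eta> K z \<Longrightarrow>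
       norm (z * bphi \<nu> (of_real lo * z) * bZs \<nu> hi z / bphi \<nu> z) \<le> C1 * (norm z / (1 + lo * norm z)) powr a * exp (- ((hi - lo) * \<bar>Im z\<bar>))"
    using green_bound[OF nu as(3,1,2) x] unfolding a_def by blast
  obtain K' where K': "K' \<ge> 1" "\<And>z. adm \<eta> K' z \<Longrightarrow> bphi \<nu> z \<noteq> 0"
    using bphi_ratio_bound[OF nu as(3,1,2)] by (metis order_refl)
  obtain C2 where C2: "C2 > 0" "\<And>r y. 1 \<le> r \<Longrightarrow> x \<le> y \<Longrightarrow> y \<le> 1 \<Longrightarrow> (r / (1 + y * r)) powr a \<le> C2"
    using ratio_powr_bounded[OF _ x, of 1] by auto
  obtain C3 where C3: "C3 > 0" "\<And>s x y. s \<in> bzeros \<nu> \<Longrightarrow> 0 \<le> x \<Longrightarrow> 0 \<le> y \<Longrightarrow>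
     \<bar>2 / (bphi' \<nu> s)\<^sup>2 * bphi \<nu> (s * x) * bphi \<nu> (s * y)\<bar> \<le> C3 * (s / (1 + x * s)) powr a * (s / (1 + y * s)) powr a"
    using bkernel_summand_bound[OF nu] unfolding a_def by blast
  obtain N where N: "N > 0"
    "\<And>R \<rho> h B. R \<ge> 4 \<Longrightarrow> R - pi \<le> \<rho> \<Longrightarrow> \<rho> < R \<Longrightarrow>
       (\<And>s. s \<in> bzeros \<nu> \<Longrightarrow> R - pi \<le> s \<Longrightarrow> s < R \<Longrightarrow> \<bar>h s\<bar> \<le> B) \<Longrightarrow> 0 \<le> B \<Longrightarrow>
       \<bar>(\<Sum>s\<in>bzeros \<nu> \<inter> {..<R}. (1 - s\<^sup>2 / R\<^sup>2) powr \<delta> * h s) - (\<Sum>s\<in>bzeros \<nu> \<inter> {..<\<rho>}. (1 - s\<^sup>2 / R\<^sup>2) powr \<delta> * h s)\<bar> \<le> N * R powr (- \<delta>) * B"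
    using riesz_tail_bound[OF nu \<delta>] by blast
  have x2: "x / 2 > 0" using x by simp
  obtain C4 where C4: "C4 > 0" "\<And>u. 0 \<le> u \<Longrightarrow> (1 + u) powr (2 * \<delta> + \<beta>) * exp (- (x / 2) * u) \<le> C4 / (1 + u\<^sup>2)"
    using power_times_exp_bound[OF x2] by blast
  define KK where "KK = max K K'"
  have adKK: "adm \<eta> K z \<and> adm \<eta> K' z" if "adm \<eta> KK z" for z using that unfolding adm_def KK_def by auto
  define C where "C = 8 powr \<delta> * C1 * 2 powr \<bar>a\<bar> * C4 + N * (C3 * 2 powr \<bar>a\<bar> * C2)"
  define R0 where "R0 = 2 * KK + 2 * pi"
  have KK: "KK \<ge> 1" using 1 by (simp add: KK_def)
  have R0: "R0 \<ge> 8" using KK pi_gt3 by (simp add: R0_def)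
  have "\<bar>bkernel \<nu> \<delta> R y x\<bar> \<le> C * R powr (- \<delta>) * (R / (1 + y * R)) powr \<beta>"
    if R: "R \<ge> R0" and y: "0 \<le> y" "y \<le> x / 2" for R y
  proof -
    define W where "W = (R / (1 + y * R)) powr \<beta>"
    have W: "W \<ge> 0" by (simp add: W_def)
    have R1: "R \<ge> 8" using R R0 by simp
    have y1: "y \<le> 1" using y x by simp
    obtain \<rho> where \<rho>: "R - pi \<le> \<rho>" "\<rho> < R" "KK \<le> \<rho>" "\<rho> \<notin> bzeros \<nu>" "\<And>z. Re z = \<rho> \<Longrightarrow> adm \<eta> KK z"
      using contour_setup[OF nu, of KK R \<eta>] R KK K'(2) adKK unfolding R0_def by metis
    have I: "norm (riesz_factor \<delta> R z * (z * bphi \<nu> (of_real y * z) * bZs \<nu> x z / bphi \<nu> z)) \<le>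
         norm (riesz_factor \<delta> R z) * (C1 * 2 powr \<bar>a\<bar> * W * ((1 + \<bar>Im z\<bar>) powr \<beta> * exp (- (x / 2 * \<bar>Im z\<bar>))))"
      if z: "adm \<eta> KK z" "0 \<le> Re z" "Re z \<le> \<rho>" for z
    proof -
      define t where "t = \<bar>Im z\<bar>"
      have t: "t \<ge> 0" by (simp add: t_def)
      have n1: "1 \<le> norm z" using z KK abs_Im_le_cmod[of z] unfolding adm_def by linarith
      have "norm z \<le> \<bar>Re z\<bar> + \<bar>Im z\<bar>" by (rule cmod_le)
      also have "\<dots> \<le> R + t" using z \<rho> by (simp add: t_def)
      also have "\<dots> \<le> R * (1 + t)" using R1 t by (simp add: algebra_simps mult_le_cancel_right1)
      finally have "(norm z / (1 + y * norm z)) powr a \<le> 2 powr \<bar>a\<bar> * ((1 + t) powr \<beta> * W)"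
        unfolding W_def \<beta>_def using n1 t R1 y y1 by (intro weight_bound) auto
      moreover have "x / 2 * t \<le> (x - y) * t" using t y by (intro mult_right_mono) auto
      then have "exp (- ((x - y) * t)) \<le> exp (- (x / 2 * t))" by simp
      ultimately have "(norm z / (1 + y * norm z)) powr a * exp (- ((x - y) * t)) \<le> 2 powr \<bar>a\<bar> * ((1 + t) powr \<beta> * W) * exp (- (x / 2 * t))"
        using W by (intro mult_mono) auto
      then have "C1 * ((norm z / (1 + y * norm z)) powr a * exp (- ((x - y) * t))) \<le> C1 * (2 powr \<bar>a\<bar> * ((1 + t) powr \<beta> * W) * exp (- (x / 2 * t)))"
        using 1 by (intro mult_left_mono) auto
      then have "norm (z * bphi \<nu> (of_real y * z) * bZs \<nu> x z / bphi \<nu> z) \<le> C1 * 2 powr \<bar>a\<bar> * W * ((1 + t) powr \<beta> * exp (- (x / 2 * t)))"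
        using 1(3)[OF y(1) order_refl x(2) conjunct1[OF adKK[OF z(1)]]] unfolding t_def by (simp add: mult_ac)
      then show ?thesis unfolding norm_mult[of "riesz_factor \<delta> R z"] t_def by (intro mult_left_mono) auto
    qed
    define Kc where "Kc = 8 powr \<delta> * C1 * 2 powr \<bar>a\<bar> * C4 * R powr (- \<delta>) * W"
    have "\<bar>\<Sum>s\<in>bzeros \<nu> \<inter> {..<\<rho>}. (1 - s\<^sup>2 / R\<^sup>2) powr \<delta> * (2 / (bphi' \<nu> s)\<^sup>2 * bphi \<nu> (s * y) * bphi \<nu> (s * x))\<bar> \<le> Kc / 1"
    proof (rule truncated_bkernel_bound[OF nu _ \<rho>(2) zero_less_one _ x \<rho>(4)])
      show "0 < \<rho>" using \<rho> KK by simp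
      show "0 \<le> Kc" using 1 C4 W by (simp add: Kc_def)
      fix z assume z: "Re z = \<rho>"
      define t where "t = \<bar>Im z\<bar>"
      have t: "0 \<le> t" by (simp add: t_def)
      have z0: "0 \<le> Re z" "Re z \<le> \<rho>" using z \<rho> KK by auto
      have "norm (riesz_factor \<delta> R z) \<le> (8 / R) powr \<delta> * ((1 + t) powr \<delta> * (1 + t / R) powr \<delta>)"
        unfolding t_def using z \<rho> R1 KK by (intro riesz_factor_line_bound \<delta>) auto
      also have "\<dots> \<le> (8 / R) powr \<delta> * ((1 + t) powr \<delta> * (1 + t) powr \<delta>)"
        using t R1 \<delta> by (intro mult_left_mono mult_mono powr_mono2) (auto simp: divide_le_eq mult_le_cancel_left1)
      finally have g: "norm (riesz_factor \<delta> R z) \<le> (8 / R) powr \<delta> * (1 + t) powr (2 * \<delta>)" by (simp flip: powr_add)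
      define q where "q = C1 * 2 powr \<bar>a\<bar> * W * ((1 + t) powr \<beta> * exp (- (x / 2 * t)))"
      have q0: "0 \<le> q" using 1 W by (simp add: q_def)
      have "norm (riesz_factor \<delta> R z * (z * bphi \<nu> (of_real y * z) * bZs \<nu> x z / bphi \<nu> z)) \<le> norm (riesz_factor \<delta> R z) * q"
        unfolding q_def t_def by (rule I[OF \<rho>(5)[OF z] z0])
      also have "\<dots> \<le> ((8 / R) powr \<delta> * (1 + t) powr (2 * \<delta>)) * q" by (rule mult_right_mono[OF g q0])
      also have "\<dots> = ((8 / R) powr \<delta> * C1 * 2 powr \<bar>a\<bar> * W) * ((1 + t) powr (2 * \<delta> + \<beta>) * exp (- (x / 2) * t))"
        by (simp add: q_def powr_add mult_ac)
      also have "\<dots> \<le> ((8 / R) powr \<delta> * C1 * 2 powr \<bar>a\<bar> * W) * (C4 / (1 + t\<^sup>2))"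
        using C4(2)[OF t] 1 W by (intro mult_left_mono) auto
      also have "t\<^sup>2 = (1 * Im z)\<^sup>2" by (simp add: t_def)
      also have "((8 / R) powr \<delta> * C1 * 2 powr \<bar>a\<bar> * W) * (C4 / (1 + (1 * Im z)\<^sup>2)) = Kc / (1 + (1 * Im z)\<^sup>2)"
        using R1 by (simp add: Kc_def powr_divide powr_minus_divide)
      finally show "norm (riesz_factor \<delta> R z * (z * bphi \<nu> (of_real y * z) * bZs \<nu> x z / bphi \<nu> z)) \<le> Kc / (1 + (1 * Im z)\<^sup>2)" .
    next
      fix e :: real assume e: "e > 0"
      show "\<exists>T0. \<forall>z. 0 \<le> Re z \<longrightarrow> Re z \<le> \<rho> \<longrightarrow> T0 \<le> \<bar>Im z\<bar> \<longrightarrow>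
         norm (riesz_factor \<delta> R z * (z * bphi \<nu> (of_real y * z) * bZs \<nu> x z / bphi \<nu> z)) \<le> e"
      proof (rule exponential_decay_top[OF x2 _ _ e])
        show "0 \<le> 2 powr \<delta> * (C1 * 2 powr \<bar>a\<bar> * W)" using 1 W by simp
        fix z assume z: "0 \<le> Re z" "Re z \<le> \<rho>" "KK \<le> \<bar>Im z\<bar>"
        define q where "q = C1 * 2 powr \<bar>a\<bar> * W * ((1 + \<bar>Im z\<bar>) powr \<beta> * exp (- (x / 2 * \<bar>Im z\<bar>)))"
        have q0: "0 \<le> q" using 1 W by (simp add: q_def)
        have "norm (riesz_factor \<delta> R z * (z * bphi \<nu> (of_real y * z) * bZs \<nu> x z / bphi \<nu> z)) \<le> norm (riesz_factor \<delta> R z) * q"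
          unfolding q_def by (rule I[OF _ z(1,2)]) (simp add: adm_def z)
        also have "\<dots> \<le> (2 powr \<delta> * (1 + \<bar>Im z\<bar>) powr (2 * \<delta>)) * q"
          using z \<rho> R1 by (intro mult_right_mono riesz_factor_crude_bound \<delta> q0) auto
        finally show "norm (riesz_factor \<delta> R z * (z * bphi \<nu> (of_real y * z) * bZs \<nu> x z / bphi \<nu> z)) \<le>
           2 powr \<delta> * (C1 * 2 powr \<bar>a\<bar> * W) * ((1 + \<bar>Im z\<bar>) powr (2 * \<delta> + \<beta>) * exp (- (x / 2 * \<bar>Im z\<bar>)))"
          by (simp add: q_def powr_add mult_ac)
      qed
    qed
    moreover have "\<bar>(\<Sum>s\<in>bzeros \<nu> \<inter> {..<R}. (1 - s\<^sup>2 / R\<^sup>2) powr \<delta> * (2 / (bphi' \<nu> s)\<^sup>2 * bphi \<nu> (s * y) * bphi \<nu> (s * x)))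
       - (\<Sum>s\<in>bzeros \<nu> \<inter> {..<\<rho>}. (1 - s\<^sup>2 / R\<^sup>2) powr \<delta> * (2 / (bphi' \<nu> s)\<^sup>2 * bphi \<nu> (s * y) * bphi \<nu> (s * x)))\<bar> \<le> N * R powr (- \<delta>) * (C3 * (2 powr \<bar>a\<bar> * W) * C2)"
    proof (rule N(2)[OF _ \<rho>(1,2)])
      fix s assume s: "s \<in> bzeros \<nu>" "R - pi \<le> s" "s < R"
      have s1: "1 \<le> s" using s R1 pi_less_4 by linarith
      have w: "(s / (1 + y * s)) powr a \<le> 2 powr \<bar>a\<bar> * W"
        using weight_bound[of s R 0 y a] s s1 R1 y y1 unfolding W_def \<beta>_def by simp
      have "\<bar>2 / (bphi' \<nu> s)\<^sup>2 * bphi \<nu> (s * y) * bphi \<nu> (s * x)\<bar> \<le> C3 * (s / (1 + y * s)) powr a * (s / (1 + x * s)) powr a"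
        using x y by (intro C3(2)[OF s(1)]) auto
      also have "\<dots> \<le> C3 * (2 powr \<bar>a\<bar> * W) * C2" using C2(2)[OF s1 order_refl x(2)] w C3 C2 W by (intro mult_mono) auto
      finally show "\<bar>2 / (bphi' \<nu> s)\<^sup>2 * bphi \<nu> (s * y) * bphi \<nu> (s * x)\<bar> \<le> C3 * (2 powr \<bar>a\<bar> * W) * C2" .
    qed (use R1 C2 C3 W in auto)
    moreover have "Kc / 1 + N * R powr (- \<delta>) * (C3 * (2 powr \<bar>a\<bar> * W) * C2) = C * R powr (- \<delta>) * W"
      by (simp add: Kc_def C_def algebra_simps)
    ultimately show ?thesis unfolding bkernel_def W_def[symmetric] by linarith
  qed
  moreover have "C > 0" using 1 C2 C4 N C3 by (simp add: C_def add_pos_pos)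
  ultimately show thesis using R0 by (intro that[of C R0]) (auto simp: \<beta>_def a_def)
qed

text \<open>The kernel does not integrate to 1 exactly, so the constant 1 gets its own contour
  argument. With A(z) = \<phi>(xz)/z the residue at 0 is 1 and the doubled residues at the zeros are
  minus the terms of the sum, which is therefore 1 + O(R^-\<delta>).\<close>

lemma riesz_means_of_one:
  assumes nu: "\<nu> > -1" and \<delta>: "\<delta> > 0" and x: "0 < x" "x < 1"
  shows "((\<lambda>R. \<Sum>s\<in>bzeros \<nu> \<inter> {..<R}. (1 - s\<^sup>2 / R\<^sup>2) powr \<delta> * (- 2 * bphi \<nu> (s * x) / (s * bphi' \<nu> s))) \<longlongrightarrow> 1) at_top"
proof -
  define a where "a = \<nu> + 1/2"
  obtain \<eta> A0 C0 where as: "A0 > 0" "C0 > 0" "bessel_asymptotic \<nu> A0 \<eta> C0" using bessel_asymptotic_exists[OF nu] by blast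
  obtain C1 K where 1: "C1 > 0" "K \<ge> 1"
    "\<And>lo z. 0 \<le> lo \<Longrightarrow> adm \<eta> K z \<Longrightarrow> bphi \<nu> z \<noteq> 0 \<and>
       norm (bphi \<nu> (of_real lo * z) / bphi \<nu> z) \<le> C1 * (norm z / (1 + lo * norm z)) powr a * exp (- ((1 - lo) * \<bar>Im z\<bar>))"
    using bphi_ratio_bound[OF nu as(3,1,2)] unfolding a_def by blast
  obtain C2 where C2: "C2 > 0" "\<And>r y. 1 \<le> r \<Longrightarrow> x \<le> y \<Longrightarrow> y \<le> 1 \<Longrightarrow> (r / (1 + y * r)) powr a \<le> C2"
    using ratio_powr_bounded[of 1 x] x by auto
  obtain C3 where C3: "C3 > 0" "\<And>s x y. s \<in> bzeros \<nu> \<Longrightarrow> 0 \<le> x \<Longrightarrow> 0 \<le> y \<Longrightarrow>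
     \<bar>2 / (bphi' \<nu> s)\<^sup>2 * bphi \<nu> (s * x) * bphi \<nu> (s * y)\<bar> \<le> C3 * (s / (1 + x * s)) powr a * (s / (1 + y * s)) powr a"
    using bkernel_summand_bound[OF nu] unfolding a_def by blast
  obtain N where N: "N > 0"
    "\<And>R \<rho> h B. R \<ge> 4 \<Longrightarrow> R - pi \<le> \<rho> \<Longrightarrow> \<rho> < R \<Longrightarrow>
       (\<And>s. s \<in> bzeros \<nu> \<Longrightarrow> R - pi \<le> s \<Longrightarrow> s < R \<Longrightarrow> \<bar>h s\<bar> \<le> B) \<Longrightarrow> 0 \<le> B \<Longrightarrow>
       \<bar>(\<Sum>s\<in>bzeros \<nu> \<inter> {..<R}. (1 - s\<^sup>2 / R\<^sup>2) powr \<delta> * h s) - (\<Sum>s\<in>bzeros \<nu> \<inter> {..<\<rho>}. (1 - s\<^sup>2 / R\<^sup>2) powr \<delta> * h s)\<bar> \<le> N * R powr (- \<delta>) * B"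
    using riesz_tail_bound[OF nu \<delta>] by blast
  define d where "d = 1 - x"
  have d: "d > 0" using x by (simp add: d_def)
  obtain C4 where C4: "C4 > 0" "\<And>u. 0 \<le> u \<Longrightarrow> (1 + u) powr (2 * \<delta>) * exp (- d * u) \<le> C4 / (1 + u\<^sup>2)"
    using power_times_exp_bound[OF d] by blast
  obtain c5 C5 where C5: "c5 > 0" "\<And>s. s \<in> bzeros \<nu> \<Longrightarrow> c5 * s powr (- a) \<le> \<bar>bphi' \<nu> s\<bar>" "C5 > 0"
     "\<And>x::real. 0 \<le> x \<Longrightarrow> \<bar>bphi \<nu> x\<bar> \<le> C5 * (1 + x) powr (- a)"
    using bphi'_at_zero_bounds[OF nu] bphi_upper_bound_real[OF nu] unfolding a_def by metis
  define h where "h = (\<lambda>s. - 2 * bphi \<nu> (s * x) / (s * bphi' \<nu> s))"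
  define R0 where "R0 = 2 * K + 2 * pi"
  define C where "C = 8 powr \<delta> * C1 * C2 * C4 + N * (2 * (C5 / c5 * C2))"
  have main: "\<bar>(\<Sum>s\<in>bzeros \<nu> \<inter> {..<R}. (1 - s\<^sup>2 / R\<^sup>2) powr \<delta> * h s) - 1\<bar> \<le> C * R powr (- \<delta>)" if R: "R \<ge> R0" for R
  proof -
    have R1: "R \<ge> 8" using R 1 pi_gt3 by (simp add: R0_def)
    obtain \<rho> where \<rho>: "R - pi \<le> \<rho>" "\<rho> < R" "K \<le> \<rho>" "\<rho> \<notin> bzeros \<nu>" "\<And>z. Re z = \<rho> \<Longrightarrow> adm \<eta> K z"
      using contour_setup[OF nu, of K R \<eta>] R 1 unfolding R0_def by (metis order_refl)
    define A :: "complex \<Rightarrow> complex" where "A = (\<lambda>z. bphi \<nu> (of_real x * z) / z)"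
    have hphi: "(\<lambda>z. bphi \<nu> (of_real x * z)) holomorphic_on U" for U :: "complex set"
      using holomorphic_on_compose_gen[of "\<lambda>z. of_real x * z" U "bphi \<nu>" UNIV] holomorphic_on_bphi[OF nu]
      by (auto simp: o_def intro!: holomorphic_intros)
    have I: "norm (riesz_factor \<delta> R z * A z / bphi \<nu> z) \<le> norm (riesz_factor \<delta> R z) * (C1 * C2 * exp (- (d * \<bar>Im z\<bar>)))" if z: "adm \<eta> K z" for z
    proof -
      have n1: "1 \<le> norm z" using z 1 abs_Im_le_cmod[of z] unfolding adm_def by linarith
      then have "C1 * (norm z / (1 + x * norm z)) powr a * exp (- (d * \<bar>Im z\<bar>)) \<le> C1 * C2 * exp (- (d * \<bar>Im z\<bar>))"
        using C2 x 1 by (intro mult_right_mono mult_left_mono) auto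
      then have "norm (bphi \<nu> (of_real x * z) / bphi \<nu> z) \<le> C1 * C2 * exp (- (d * \<bar>Im z\<bar>))"
        using conjunct2[OF 1(3)[OF _ z, of x]] x unfolding d_def by simp
      moreover have "norm (A z / bphi \<nu> z) \<le> norm (bphi \<nu> (of_real x * z) / bphi \<nu> z)"
      proof -
        have "norm (A z / bphi \<nu> z) = norm (bphi \<nu> (of_real x * z) / bphi \<nu> z) / norm z" by (simp add: A_def norm_divide norm_mult)
        also have "\<dots> \<le> norm (bphi \<nu> (of_real x * z) / bphi \<nu> z) / 1" using n1 by (intro divide_left_mono) auto
        finally show ?thesis by simp
      qed
      ultimately have "norm (A z / bphi \<nu> z) \<le> C1 * C2 * exp (- (d * \<bar>Im z\<bar>))" by linarith
      then show ?thesis unfolding times_divide_eq_right[symmetric] norm_mult[of "riesz_factor \<delta> R z"] by (intro mult_left_mono) auto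
    qed
    define Kc where "Kc = 8 powr \<delta> * C1 * C2 * C4 * R powr (- \<delta>)"
    have "norm (2 * (\<Sum>s\<in>bzeros \<nu> \<inter> {..<\<rho>}. of_real ((1 - s\<^sup>2 / R\<^sup>2) powr \<delta>) * A (of_real s) / of_real (bphi' \<nu> s))
       + residue (\<lambda>z. riesz_factor \<delta> R z * A z / bphi \<nu> z) 0) \<le> Kc / 1"
    proof (rule contour_residue_bound[OF nu _ \<rho>(2) zero_less_one _ _ _ \<rho>(4)])
      show "0 < \<rho>" using \<rho> 1 by simp
      show "0 \<le> Kc" using 1 C2 C4 by (simp add: Kc_def)
      show "A holomorphic_on - {0}" unfolding A_def by (intro holomorphic_intros hphi) auto
      show "A (- z) = - A z" for z by (simp add: A_def bphi_minus)
      fix z assume z: "Re z = \<rho>"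
      define t where "t = \<bar>Im z\<bar>"
      have t: "0 \<le> t" by (simp add: t_def)
      have "norm (riesz_factor \<delta> R z) \<le> (8 / R) powr \<delta> * ((1 + t) powr \<delta> * (1 + t / R) powr \<delta>)"
        unfolding t_def using z \<rho> R1 1 by (intro riesz_factor_line_bound \<delta>) auto
      also have "\<dots> \<le> (8 / R) powr \<delta> * ((1 + t) powr \<delta> * (1 + t) powr \<delta>)"
        using t R1 \<delta> by (intro mult_left_mono mult_mono powr_mono2) (auto simp: divide_le_eq mult_le_cancel_left1)
      finally have g: "norm (riesz_factor \<delta> R z) \<le> (8 / R) powr \<delta> * (1 + t) powr (2 * \<delta>)" by (simp flip: powr_add)
      have "norm (riesz_factor \<delta> R z * A z / bphi \<nu> z) \<le> ((8 / R) powr \<delta> * (1 + t) powr (2 * \<delta>)) * (C1 * C2 * exp (- (d * t)))"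
        unfolding t_def using 1(1) C2(1) by (intro order_trans[OF I[OF \<rho>(5)[OF z]] mult_right_mono[OF g[unfolded t_def]]]) auto
      also have "\<dots> = ((8 / R) powr \<delta> * C1 * C2) * ((1 + t) powr (2 * \<delta>) * exp (- d * t))" by (simp add: mult_ac)
      also have "\<dots> \<le> ((8 / R) powr \<delta> * C1 * C2) * (C4 / (1 + t\<^sup>2))" using C4(2)[OF t] 1 C2 by (intro mult_left_mono) auto
      also have "t\<^sup>2 = (1 * Im z)\<^sup>2" by (simp add: t_def)
      also have "((8 / R) powr \<delta> * C1 * C2) * (C4 / (1 + (1 * Im z)\<^sup>2)) = Kc / (1 + (1 * Im z)\<^sup>2)"
        using R1 by (simp add: Kc_def powr_divide powr_minus_divide)
      finally show "norm (riesz_factor \<delta> R z * A z / bphi \<nu> z) \<le> Kc / (1 + (1 * Im z)\<^sup>2)" .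
    next
      fix e :: real assume e: "e > 0"
      show "\<exists>T0. \<forall>z. 0 \<le> Re z \<longrightarrow> Re z \<le> \<rho> \<longrightarrow> T0 \<le> \<bar>Im z\<bar> \<longrightarrow> norm (riesz_factor \<delta> R z * A z / bphi \<nu> z) \<le> e"
      proof (rule exponential_decay_top[OF d _ _ e])
        show "0 \<le> 2 powr \<delta> * (C1 * C2)" using 1 C2 by simp
        fix z assume z: "0 \<le> Re z" "Re z \<le> \<rho>" "K \<le> \<bar>Im z\<bar>"
        have "norm (riesz_factor \<delta> R z * A z / bphi \<nu> z) \<le> norm (riesz_factor \<delta> R z) * (C1 * C2 * exp (- (d * \<bar>Im z\<bar>)))"
          by (rule I) (simp add: adm_def z)
        also have "\<dots> \<le> (2 powr \<delta> * (1 + \<bar>Im z\<bar>) powr (2 * \<delta>)) * (C1 * C2 * exp (- (d * \<bar>Im z\<bar>)))"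
          using z \<rho> R1 1 C2 by (intro mult_right_mono riesz_factor_crude_bound \<delta>) auto
        finally show "norm (riesz_factor \<delta> R z * A z / bphi \<nu> z) \<le> 2 powr \<delta> * (C1 * C2) * ((1 + \<bar>Im z\<bar>) powr (2 * \<delta>) * exp (- (d * \<bar>Im z\<bar>)))"
          by (simp add: mult_ac)
      qed
    qed
    moreover have "residue (\<lambda>z. riesz_factor \<delta> R z * A z / bphi \<nu> z) 0 = 1"
    proof -
      obtain b where b: "b > 0" "\<And>w::complex. norm w \<le> b \<Longrightarrow> norm (bphi \<nu> w - 1) \<le> 1/2"
        using bphi_near_0[OF nu] by blast
      define r where "r = min b R"
      have r: "r > 0" "r \<le> b" "r \<le> R" using b R1 by (auto simp: r_def)
      have nz: "bphi \<nu> w \<noteq> 0" if "w \<in> ball 0 r" for w :: complex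
        using b(2)[of w] that r by (auto simp: dist_norm)
      have sub: "ball 0 r \<subseteq> {z. \<bar>Re z\<bar> < R}" using r by (auto simp: dist_norm intro: le_less_trans[OF abs_Re_le_cmod])
      have "residue (\<lambda>z. (riesz_factor \<delta> R z * bphi \<nu> (of_real x * z) / bphi \<nu> z) / z) 0 = (riesz_factor \<delta> R 0 * bphi \<nu> (of_real x * 0) / bphi \<nu> 0) / 1"
      proof (rule residue_quotient_simple_zero[of "ball 0 r"])
        show "(\<lambda>z. riesz_factor \<delta> R z * bphi \<nu> (of_real x * z) / bphi \<nu> z) holomorphic_on ball 0 r"
          using nz R1 by (intro holomorphic_intros hphi holomorphic_on_bphi nu holomorphic_on_subset[OF holomorphic_on_riesz_factor sub]) auto
      qed (use r in \<open>auto intro!: holomorphic_intros derivative_eq_intros\<close>)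
      moreover have "riesz_factor \<delta> R 0 = 1" by (simp add: riesz_factor_def)
      ultimately show ?thesis by (simp add: A_def mult_ac)
    qed
    moreover have "2 * (\<Sum>s\<in>bzeros \<nu> \<inter> {..<\<rho>}. of_real ((1 - s\<^sup>2 / R\<^sup>2) powr \<delta>) * A (of_real s) / of_real (bphi' \<nu> s))
       = - complex_of_real (\<Sum>s\<in>bzeros \<nu> \<inter> {..<\<rho>}. (1 - s\<^sup>2 / R\<^sup>2) powr \<delta> * h s)"
      unfolding sum_distrib_left of_real_sum sum_negf[symmetric]
    proof (rule sum.cong[OF refl])
      fix s
      have "complex_of_real x * of_real s = of_real (s * x)" by simp
      then have "A (of_real s) = of_real (bphi \<nu> (s * x) / s)" unfolding A_def by (simp only: bphi_of_real[OF nu] of_real_divide)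
      then show "2 * (of_real ((1 - s\<^sup>2 / R\<^sup>2) powr \<delta>) * A (of_real s) / of_real (bphi' \<nu> s)) = - complex_of_real ((1 - s\<^sup>2 / R\<^sup>2) powr \<delta> * h s)"
        by (simp add: h_def)
    qed
    ultimately have "norm (- complex_of_real ((\<Sum>s\<in>bzeros \<nu> \<inter> {..<\<rho>}. (1 - s\<^sup>2 / R\<^sup>2) powr \<delta> * h s) - 1)) \<le> Kc" by simp
    then have "\<bar>(\<Sum>s\<in>bzeros \<nu> \<inter> {..<\<rho>}. (1 - s\<^sup>2 / R\<^sup>2) powr \<delta> * h s) - 1\<bar> \<le> Kc" unfolding norm_minus_cancel norm_of_real .
    moreover have "\<bar>(\<Sum>s\<in>bzeros \<nu> \<inter> {..<R}. (1 - s\<^sup>2 / R\<^sup>2) powr \<delta> * h s) - (\<Sum>s\<in>bzeros \<nu> \<inter> {..<\<rho>}. (1 - s\<^sup>2 / R\<^sup>2) powr \<delta> * h s)\<bar>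
       \<le> N * R powr (- \<delta>) * (2 * (C5 / c5 * C2))"
    proof (rule N(2)[OF _ \<rho>(1,2)])
      fix s assume s: "s \<in> bzeros \<nu>" "R - pi \<le> s" "s < R"
      have s1: "1 \<le> s" using s R1 pi_less_4 by linarith
      have "\<bar>bphi \<nu> (s * x)\<bar> \<le> C5 * (1 + x * s) powr (- a)"
        using C5(4)[of "s * x"] s1 x by (simp add: mult.commute)
      then have "\<bar>bphi \<nu> (s * x)\<bar> / \<bar>bphi' \<nu> s\<bar> \<le> C5 * (1 + x * s) powr (- a) / (c5 * s powr (- a))"
        using C5 s s1 by (intro frac_le) auto
      also have "\<dots> = C5 / c5 * ((1 + x * s) powr (- a) / s powr (- a))" by simp
      also have "(1 + x * s) powr (- a) / s powr (- a) = (s / (1 + x * s)) powr a"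
        using s1 x by (simp add: powr_divide powr_minus_divide)
      also have "C5 / c5 * (s / (1 + x * s)) powr a \<le> C5 / c5 * C2" using C2(2)[OF s1 order_refl] x C5 by (intro mult_left_mono) auto
      finally have "\<bar>bphi \<nu> (s * x)\<bar> / \<bar>bphi' \<nu> s\<bar> \<le> C5 / c5 * C2" .
      moreover have "\<bar>h s\<bar> = 2 * (\<bar>bphi \<nu> (s * x)\<bar> / \<bar>bphi' \<nu> s\<bar> / s)" using s1 by (simp add: h_def abs_mult abs_divide)
      moreover have "\<bar>bphi \<nu> (s * x)\<bar> / \<bar>bphi' \<nu> s\<bar> / s \<le> \<bar>bphi \<nu> (s * x)\<bar> / \<bar>bphi' \<nu> s\<bar> / 1"
        using s1 by (intro divide_left_mono) auto
      ultimately show "\<bar>h s\<bar> \<le> 2 * (C5 / c5 * C2)" by simp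
    qed (use R1 C2 C5 in auto)
    moreover have "Kc + N * R powr (- \<delta>) * (2 * (C5 / c5 * C2)) = C * R powr (- \<delta>)" by (simp add: Kc_def C_def algebra_simps)
    ultimately show ?thesis by linarith
  qed
  have "((\<lambda>R. C * R powr (- \<delta>)) \<longlongrightarrow> C * 0) at_top"
    by (intro tendsto_intros tendsto_neg_powr) (use \<delta> in \<open>auto simp: filterlim_ident\<close>)
  then have lim: "((\<lambda>R. C * R powr (- \<delta>)) \<longlongrightarrow> 0) at_top" by simp
  have "((\<lambda>R. (\<Sum>s\<in>bzeros \<nu> \<inter> {..<R}. (1 - s\<^sup>2 / R\<^sup>2) powr \<delta> * h s) - 1) \<longlongrightarrow> 0) at_top"
  proof (rule Lim_null_comparison[OF _ lim])
    show "\<forall>\<^sub>F R in at_top. norm ((\<Sum>s\<in>bzeros \<nu> \<inter> {..<R}. (1 - s\<^sup>2 / R\<^sup>2) powr \<delta> * h s) - 1) \<le> C * R powr (- \<delta>)"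
      using eventually_ge_at_top[of R0] by eventually_elim (simp add: main)
  qed
  then show ?thesis unfolding h_def by (simp add: LIM_zero_iff)
qed

section \<open>Lebesgue points\<close>

lemma integrable_indicator_lmeasurable:
  assumes "S \<in> lmeasurable"
  shows "integrable lebesgue (indicat_real S)"
  by (intro integrable_real_indicator fmeasurableD[OF assms]) (metis assms fmeasurableD2 top.not_eq_extremum infinity_ennreal_def)

text \<open>Truncation at a height n: the excess over n has small integral by dominated convergence,
  and the truncated part contributes at most n times the measure.\<close>

lemma set_integral_small_of_measure_small:
  fixes g :: "real \<Rightarrow> real"
  assumes g: "integrable lebesgue g" "\<And>x. 0 \<le> g x" and e: "e > 0"
  obtains d where "d > 0" "\<And>S. S \<in> lmeasurable \<Longrightarrow> measure lebesgue S < d \<Longrightarrow> (LINT x:S|lebesgue. g x) < e"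
proof -
  have "(\<lambda>n. LINT x|lebesgue. g x - min (g x) (real n)) \<longlonglongrightarrow> (LINT x|(lebesgue :: real measure). 0)"
  proof (rule integral_dominated_convergence[where w = g])
    show "AE x in lebesgue. (\<lambda>n. g x - min (g x) (real n)) \<longlonglongrightarrow> 0"
    proof (rule AE_I2)
      fix x
      have "\<forall>\<^sub>F n in sequentially. g x - min (g x) (real n) = 0"
        using eventually_ge_at_top[of "nat \<lceil>g x\<rceil>"] by eventually_elim (simp add: nat_ceiling_le_eq)
      then show "(\<lambda>n. g x - min (g x) (real n)) \<longlonglongrightarrow> 0" by (rule tendsto_eventually)
    qed
  qed (use g in auto)
  then have "\<forall>\<^sub>F n in sequentially. (LINT x|lebesgue. g x - min (g x) (real n)) < e / 2"
    using e by (intro order_tendstoD(2)) auto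
  then obtain n where n: "(LINT x|lebesgue. g x - min (g x) (real n)) < e / 2" by (auto simp: eventually_sequentially)
  have im: "integrable lebesgue (\<lambda>x. g x - min (g x) (real n))"
    by (rule Bochner_Integration.integrable_bound[OF g(1)]) (use g in auto)
  define d where "d = e / (2 * (real n + 1))"
  have "(LINT x:S|lebesgue. g x) < e" if S: "S \<in> lmeasurable" "measure lebesgue S < d" for S
  proof -
    have Ss: "S \<in> sets lebesgue" using S(1) by auto
    have i1: "integrable lebesgue (\<lambda>x. indicator S x * real n)"
      by (intro integrable_mult_left integrable_indicator_lmeasurable S)
    have "(LINT x:S|lebesgue. g x) \<le> (LINT x|lebesgue. (g x - min (g x) (real n)) + indicator S x * real n)"
      unfolding set_lebesgue_integral_def
    proof (rule integral_mono)
      show "integrable lebesgue (\<lambda>x. indicat_real S x *\<^sub>R g x)"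
        using integrable_mult_indicator[OF Ss g(1)] by simp
      show "indicat_real S x *\<^sub>R g x \<le> (g x - min (g x) (real n)) + indicator S x * real n" for x
        using g(2)[of x] by (auto simp: indicator_def)
    qed (use im i1 in auto)
    also have "\<dots> = (LINT x|lebesgue. g x - min (g x) (real n)) + measure lebesgue S * real n"
      using im i1 by (subst Bochner_Integration.integral_add) auto
    also have "measure lebesgue S * real n \<le> d * (real n + 1)"
      using S(2) e by (intro mult_mono) (auto simp: d_def)
    also have "d * (real n + 1) = e / 2" by (simp add: d_def field_simps)
    finally show ?thesis using n by simp
  qed
  then show thesis using e by (intro that[of d]) (auto simp: d_def)
qed

lemma set_integral_sum_disjoint_le:
  fixes g :: "'i \<Rightarrow> real" and f :: "real \<Rightarrow> real"
  assumes f: "integrable lebesgue f" and I: "finite I" and A: "\<And>i. i \<in> I \<Longrightarrow> A i \<in> sets lebesgue" "disjoint_family_on A I"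
  shows "(\<Sum>i\<in>I. LINT x:A i|lebesgue. f x) = (LINT x:(\<Union>i\<in>I. A i)|lebesgue. f x)"
proof -
  have "set_integrable lebesgue (A i) f" if "i \<in> I" for i
    unfolding set_integrable_def using integrable_mult_indicator[OF A(1)[OF that] f] by simp
  then show ?thesis using set_integral_finite_Union[OF I A(2), of lebesgue f] A(1) by simp
qed

text \<open>Where \<open>g < a\<close>, the averages of \<open>g\<close> over small balls can exceed \<open>b > a\<close> only on a null set: a disjoint Vitali
  family of such balls inside a tight open superset of \<open>{g < a}\<close> has total length \<open>\<le> \<epsilon>/(b - a)\<close>.\<close>
lemma large_averages_negligible:
  fixes g :: "real \<Rightarrow> real"
  assumes g: "integrable lebesgue g" "\<And>x. 0 \<le> g x" and ab: "a < b"
  shows "negligible {x \<in> {l..u}. g x < a \<and> (\<forall>\<eta>>0. \<exists>r>0. r < \<eta> \<and> b * (2 * r) < (LINT y:ball x r|lebesgue. g y))}" (is "negligible ?E")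
proof (cases "a \<le> 0")
  case True
  have "?E = {}"
  proof -
    have "\<not> g x < a" for x using True g(2)[of x] by linarith
    then show ?thesis by simp
  qed
  then show ?thesis by (simp only: negligible_empty)
next
  case False
  define A where "A = {x \<in> {l..u}. g x < a}"
  have Am: "A \<in> lmeasurable"
  proof -
    have "{x \<in> space lebesgue. g x < a} \<in> sets lebesgue"
      using g(1) by (intro borel_measurable_less) auto
    then have "{l..u} \<inter> {x. g x < a} \<in> sets lebesgue" by (intro sets.Int) auto
    moreover have "A = {l..u} \<inter> {x. g x < a}" by (auto simp: A_def)
    moreover have "{l..u} \<in> lmeasurable" using lmeasurable_cbox[of l u] by simp
    ultimately show ?thesis using fmeasurableI2[of "{l..u}" lebesgue A] by auto
  qed
  show ?thesis unfolding negligible_outer_le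
  proof (intro allI impI)
    fix e :: real assume e: "e > 0"
    have e2: "e * (b - a) > 0" using e ab by simp
    obtain d where d: "d > 0" "\<And>S. S \<in> lmeasurable \<Longrightarrow> measure lebesgue S < d \<Longrightarrow> (LINT x:S|lebesgue. g x) < e * (b - a)"
      using set_integral_small_of_measure_small[OF g e2] by blast
    \<comment> \<open>The open superset is so tight that g integrates to less than e(b - a) over U -
      A, the part where g may be large.\<close>
    obtain U where U: "open U" "A \<subseteq> U" "U \<in> lmeasurable" "U - A \<in> lmeasurable" "measure lebesgue (U - A) < d"
    proof -
      obtain U where U: "open U" "A \<subseteq> U" "(U - A) \<in> lmeasurable" "emeasure lebesgue (U - A) < ennreal d"
        using sets_lebesgue_outer_open[OF _ d(1), of A] Am by (metis fmeasurableD)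
      have "U = A \<union> (U - A)" using U(2) by blast
      then have "U \<in> lmeasurable" using Am U(3) by (metis fmeasurable.Un)
      moreover have "measure lebesgue (U - A) < d" using U(4) emeasure_eq_measure2[OF U(3)] by (simp add: ennreal_less_iff)
      ultimately show thesis using that U by blast
    qed
    define K where "K = {(x, r). 0 < r \<and> ball x r \<subseteq> U \<and> b * (2 * r) < (LINT y:ball x r|lebesgue. g y)}"
    obtain C where C: "countable C" "C \<subseteq> K" "pairwise (\<lambda>i j. disjnt (ball (fst i) (snd i)) (ball (fst j) (snd j))) C"
      "negligible (?E - (\<Union>i\<in>C. ball (fst i) (snd i)))"
    proof (rule Vitali_covering_theorem_balls[of ?E K fst snd])
      fix x d :: real assume x: "x \<in> ?E" and d: "0 < d"
      then have "x \<in> U" using U(2) by (auto simp: A_def)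
      then obtain s where s: "s > 0" "ball x s \<subseteq> U" using U(1) openE by blast
      obtain r where r: "r > 0" "r < min s d" "b * (2 * r) < (LINT y:ball x r|lebesgue. g y)"
        using x d s(1) by (auto simp del: min_less_iff_conj) (metis min_less_iff_conj)
      then have "(x, r) \<in> K" using s by (auto simp: K_def)
      then show "\<exists>i. i \<in> K \<and> x \<in> ball (fst i) (snd i) \<and> snd i < d"
        using r by (intro exI[of _ "(x, r)"]) auto
    qed
    define D where "D = (\<Union>i\<in>C. ball (fst i) (snd i))"
    have fin: "measure lebesgue (\<Union>i\<in>I. ball (fst i) (snd i)) \<le> e" if I: "I \<subseteq> C" "finite I" for I
    proof -
      define V where "V = (\<Union>i\<in>I. ball (fst i) (snd i))"
      have IK: "I \<subseteq> K" using I C by blast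
      have dis: "disjoint_family_on (\<lambda>i. ball (fst i) (snd i)) I"
        using C(3) I unfolding pairwise_def disjoint_family_on_def disjnt_def by blast
      have Vm: "V \<in> lmeasurable" unfolding V_def using I by (intro fmeasurable.finite_UN) auto
      have mV: "measure lebesgue V = (\<Sum>i\<in>I. 2 * snd i)"
      proof -
        have "measure lebesgue V = (\<Sum>i\<in>I. measure lebesgue (ball (fst i) (snd i)))"
          unfolding V_def
        proof (rule measure_finite_Union[OF I(2) _ dis])
          show "emeasure lebesgue (ball (fst i) (snd i)) \<noteq> \<infinity>" for i :: "real \<times> real"
            unfolding infinity_ennreal_def by (rule fmeasurableD2[OF lmeasurable_ball])
        qed auto
        also have "\<dots> = (\<Sum>i\<in>I. 2 * snd i)"
          by (rule sum.cong) (use IK in \<open>auto simp: K_def ball_eq_greaterThanLessThan\<close>)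
        finally show ?thesis .
      qed
      \<comment> \<open>The chain reads b|V| \<le> a|V| + e(b - a): g < a on A, and the rest of V
        lies in U - A. Hence |V| \<le> e.\<close>
      have "b * measure lebesgue V = (\<Sum>i\<in>I. b * (2 * snd i))" by (simp add: mV sum_distrib_left)
      also have "\<dots> \<le> (\<Sum>i\<in>I. LINT y:ball (fst i) (snd i)|lebesgue. g y)"
        by (rule sum_mono) (use IK in \<open>auto simp: K_def\<close>)
      also have "\<dots> = (LINT y:V|lebesgue. g y)"
        unfolding V_def by (rule set_integral_sum_disjoint_le[OF g(1) I(2) _ dis]) auto
      also have "\<dots> \<le> (LINT y|lebesgue. a * indicator V y + indicator (U - A) y * g y)"
        unfolding set_lebesgue_integral_def
      proof (rule integral_mono)
        have Vs: "V \<in> sets lebesgue" using Vm by auto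
        show "integrable lebesgue (\<lambda>y. indicat_real V y *\<^sub>R g y)" using integrable_mult_indicator[OF Vs g(1)] by simp
        show "integrable lebesgue (\<lambda>y. a * indicator V y + indicator (U - A) y * g y)"
          using Vm U(4) integrable_mult_indicator[OF _ g(1), of "U - A"]
          by (intro Bochner_Integration.integrable_add integrable_mult_right integrable_indicator_lmeasurable) auto
        have "ball (fst i) (snd i) \<subseteq> U" if "i \<in> I" for i using subsetD[OF IK that] by (simp add: K_def case_prod_beta)
        then have "V \<subseteq> U" unfolding V_def by blast
        then show "indicat_real V y *\<^sub>R g y \<le> a * indicator V y + indicator (U - A) y * g y" for y
          using g(2)[of y] False by (auto simp: indicator_def A_def)
      qed
      also have "\<dots> = a * measure lebesgue V + (LINT y:U - A|lebesgue. g y)"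
        using Vm U(4) integrable_mult_indicator[OF _ g(1), of "U - A"]
        by (subst Bochner_Integration.integral_add) (auto simp: set_lebesgue_integral_def intro!: integrable_mult_right integrable_indicator_lmeasurable)
      also have "(LINT y:U - A|lebesgue. g y) \<le> e * (b - a)" using d(2)[OF U(4,5)] by simp
      finally have "(b - a) * measure lebesgue V \<le> (b - a) * e" by (simp add: algebra_simps)
      then show ?thesis using ab by (simp add: V_def)
    qed
    have D: "D \<in> lmeasurable" "measure lebesgue D \<le> e"
      unfolding D_def by (rule fmeasurable_UN_bound[OF C(1) _ fin] measure_UN_bound[OF C(1) _ fin]; simp)+
    define Z where "Z = ?E - D"
    have "negligible Z" using C(4) by (simp add: Z_def D_def)
    then have Z: "Z \<in> lmeasurable" "measure lebesgue Z = 0"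
      by (auto intro: negligible_imp_measurable negligible_imp_measure0)
    have "measure lebesgue (D \<union> Z) \<le> measure lebesgue D + measure lebesgue Z"
      by (rule measure_Un_le[OF fmeasurableD[OF D(1)] fmeasurableD[OF Z(1)]])
    then have "measure lebesgue (D \<union> Z) \<le> e" using D(2) Z(2) by linarith
    moreover have "?E \<subseteq> D \<union> Z" unfolding Z_def by blast
    ultimately show "\<exists>T. ?E \<subseteq> T \<and> T \<in> lmeasurable \<and> measure lebesgue T \<le> e"
      using fmeasurable.Un[OF D(1) Z(1)] by blast
  qed
qed

text \<open>Lebesgue points in the strong sense, with |f - f x| averaged; dividing by r instead of
  2r changes only constants. The notion is local, so values of f outside (0,1) have no influence at
  points of (0,1).\<close>

definition lebesgue_point :: "(real \<Rightarrow> real) \<Rightarrow> real \<Rightarrow> bool" where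
  "lebesgue_point f x \<longleftrightarrow> (\<forall>\<kappa>>0. \<exists>\<eta>>0. \<forall>r. 0 < r \<and> r < \<eta> \<longrightarrow> (LINT y:ball x r|lebesgue. \<bar>f y - f x\<bar>) \<le> \<kappa> * r)"

text \<open>\<open>large_averages_negligible\<close> is applied to |f - q| for rational q and
  rational a < b, a countable union of null sets. Outside it a rational q within \<kappa>/8 of f x
  makes the averages of |f - q| small, and |f - f x| \<le> |f - q| + \<kappa>/8.\<close>

lemma AE_lebesgue_point:
  fixes f :: "real \<Rightarrow> real"
  assumes f: "set_integrable lebesgue {l..u} f"
  shows "AE x in lebesgue. x \<in> {l<..<u} \<longrightarrow> lebesgue_point f x"
proof -
  define h where "h = (\<lambda>q x. indicator {l..u} x *\<^sub>R \<bar>f x - q\<bar> :: real)"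
  have hi: "integrable lebesgue (h q)" for q
  proof -
    have "set_integrable lebesgue {l..u} (\<lambda>x. q)"
      using integrable_indicator_lmeasurable[OF lmeasurable_cbox[of l u]] by (simp add: set_integrable_def)
    from set_integrable_abs[OF set_integral_diff(1)[OF f this]] show ?thesis
      unfolding h_def set_integrable_def .
  qed
  have h0: "0 \<le> h q x" for q x by (simp add: h_def)
  define E where "E = (\<lambda>(q, a, b). {x \<in> {l..u}. h q x < a \<and> (\<forall>\<eta>>0. \<exists>r>0. r < \<eta> \<and> b * (2 * r) < (LINT y:ball x r|lebesgue. h q y))})"
  define Q :: "(real \<times> real \<times> real) set" where "Q = {(q, a, b). a < b} \<inter> (\<rat> \<times> \<rat> \<times> \<rat>)"
  have "countable Q" unfolding Q_def by (intro countable_Int2 countable_SIGMA countable_rat)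
  have "negligible (\<Union>(E ` Q))"
  proof (rule negligible_countable_Union)
    show "countable (E ` Q)" using \<open>countable Q\<close> by simp
    show "negligible S" if "S \<in> E ` Q" for S
      using that large_averages_negligible[OF hi h0] by (auto simp: E_def Q_def)
  qed
  then have "\<Union>(E ` Q) \<in> null_sets lebesgue" by (simp add: negligible_iff_null_sets)
  moreover have "lebesgue_point f x" if x: "x \<in> {l<..<u}" "x \<notin> \<Union>(E ` Q)" for x
    unfolding lebesgue_point_def
  proof (intro allI impI)
    fix \<kappa> :: real assume \<kappa>: "\<kappa> > 0"
    obtain q where q: "q \<in> \<rat>" "f x - \<kappa> / 8 < q" "q < f x + \<kappa> / 8"
      using Rats_dense_in_real[of "f x - \<kappa> / 8" "f x + \<kappa> / 8"] \<kappa> by auto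
    then have qx: "\<bar>f x - q\<bar> < \<kappa> / 8" by linarith
    obtain b where b: "b \<in> \<rat>" "\<bar>f x - q\<bar> < b" "b < \<kappa> / 8" using Rats_dense_in_real[OF qx] by blast
    obtain a where a: "a \<in> \<rat>" "\<bar>f x - q\<bar> < a" "a < b" using Rats_dense_in_real[OF b(2)] by blast
    have "(q, a, b) \<in> Q" using q a b by (auto simp: Q_def)
    then have "x \<notin> E (q, a, b)" using x by blast
    then have "\<not> (x \<in> {l..u} \<and> h q x < a \<and> (\<forall>\<eta>>0. \<exists>r>0. r < \<eta> \<and> b * (2 * r) < (LINT y:ball x r|lebesgue. h q y)))"
      by (simp only: E_def prod.case mem_Collect_eq not_False_eq_True)
    moreover have "h q x < a" "x \<in> {l..u}" using a x(1) by (simp_all add: h_def)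
    ultimately obtain \<eta> where eta: "\<eta> > 0" "\<And>r. 0 < r \<Longrightarrow> r < \<eta> \<Longrightarrow> (LINT y:ball x r|lebesgue. h q y) \<le> b * (2 * r)"
      unfolding not_less[symmetric] by blast
    define \<eta>' where "\<eta>' = min \<eta> (min (x - l) (u - x))"
    have "(LINT y:ball x r|lebesgue. \<bar>f y - f x\<bar>) \<le> \<kappa> * r" if r: "0 < r" "r < \<eta>'" for r
    proof -
      have sub: "ball x r \<subseteq> {l..u}" using r by (auto simp: \<eta>'_def dist_real_def abs_if split: if_splits)
      have bl: "ball x r \<in> sets lebesgue" by simp
      have m: "measure lebesgue (ball x r) = 2 * r" using r by (simp add: ball_eq_greaterThanLessThan)
      have ib: "integrable lebesgue (indicat_real (ball x r))" by (intro integrable_indicator_lmeasurable) simp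
      have "(LINT y:ball x r|lebesgue. \<bar>f y - f x\<bar>) \<le> (LINT y|lebesgue. indicator (ball x r) y *\<^sub>R h q y + indicator (ball x r) y * (\<kappa> / 8))"
        unfolding set_lebesgue_integral_def
      proof (rule integral_mono)
        have "integrable lebesgue (\<lambda>y. indicator (ball x r) y *\<^sub>R h (f x) y)" by (rule integrable_mult_indicator[OF bl hi])
        also have "(\<lambda>y. indicator (ball x r) y *\<^sub>R h (f x) y) = (\<lambda>y. indicator (ball x r) y *\<^sub>R \<bar>f y - f x\<bar>)"
        proof
          fix y show "indicator (ball x r) y *\<^sub>R h (f x) y = indicator (ball x r) y *\<^sub>R \<bar>f y - f x\<bar>"
            using sub by (cases "y \<in> ball x r") (auto simp: h_def)
        qed
        finally show "integrable lebesgue (\<lambda>y. indicat_real (ball x r) y *\<^sub>R \<bar>f y - f x\<bar>)" .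
        show "integrable lebesgue (\<lambda>y. indicator (ball x r) y *\<^sub>R h q y + indicator (ball x r) y * (\<kappa> / 8))"
          by (intro Bochner_Integration.integrable_add integrable_mult_indicator[OF bl hi] integrable_mult_left ib)
        show "indicat_real (ball x r) y *\<^sub>R \<bar>f y - f x\<bar> \<le> indicator (ball x r) y *\<^sub>R h q y + indicator (ball x r) y * (\<kappa> / 8)" for y
        proof (cases "y \<in> ball x r")
          case True
          then have "h q y = \<bar>f y - q\<bar>" using sub by (auto simp: h_def)
          moreover have "\<bar>f y - f x\<bar> \<le> \<bar>f y - q\<bar> + \<kappa> / 8" using qx by linarith
          ultimately show ?thesis using True by simp
        qed simp
      qed
      also have "\<dots> = (LINT y:ball x r|lebesgue. h q y) + 2 * r * (\<kappa> / 8)"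
        unfolding set_lebesgue_integral_def using m ib integrable_mult_indicator[OF bl hi, of q]
        by (subst Bochner_Integration.integral_add) auto
      also have "\<dots> \<le> b * (2 * r) + 2 * r * (\<kappa> / 8)" using eta(2)[of r] r by (simp add: \<eta>'_def)
      also have "\<dots> \<le> (\<kappa> / 8) * (2 * r) + 2 * r * (\<kappa> / 8)" using b r by (intro add_right_mono mult_right_mono) auto
      also have "\<dots> \<le> \<kappa> * r" using \<kappa> r by simp
      finally show ?thesis .
    qed
    moreover have "\<eta>' > 0" using eta x by (simp add: \<eta>'_def)
    ultimately show "\<exists>\<eta>>0. \<forall>r. 0 < r \<and> r < \<eta> \<longrightarrow> (LINT y:ball x r|lebesgue. \<bar>f y - f x\<bar>) \<le> \<kappa> * r" by blast
  qed
  ultimately show ?thesis by (intro AE_I'[of "\<Union>(E ` Q)"]) auto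
qed

section \<open>The measure and the expansion\<close>

lemma space_mu_nu [simp]: "space (mu_nu \<nu>) = {0<..<1}"
  by (simp add: mu_nu_def)

lemma borel_measurable_mu_nu:
  assumes "f \<in> borel_measurable borel"
  shows "f \<in> borel_measurable (mu_nu \<nu>)"
proof -
  have "f \<in> borel_measurable lebesgue" using assms by (intro measurable_completion) auto
  then show ?thesis unfolding mu_nu_def by (simp add: measurable_restrict_space1)
qed

lemma weight_measurable: "(\<lambda>x. x powr s) \<in> borel_measurable (lebesgue_on {0<..<1::real})"
  by (intro measurable_restrict_space1 measurable_completion) auto

lemma integrable_mu_nu_iff:
  fixes f :: "real \<Rightarrow> real"
  assumes f: "f \<in> borel_measurable (mu_nu \<nu>)"
  shows "integrable (mu_nu \<nu>) f \<longleftrightarrow> set_integrable lebesgue {0<..<1} (\<lambda>y. y powr (2 * \<nu> + 1) * f y)"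
proof -
  have "f \<in> borel_measurable (lebesgue_on {0<..<1})" using f by (simp add: mu_nu_def)
  then have "integrable (mu_nu \<nu>) f \<longleftrightarrow> integrable (lebesgue_on {0<..<1}) (\<lambda>y. y powr (2 * \<nu> + 1) *\<^sub>R f y)"
    unfolding mu_nu_def by (intro integrable_density weight_measurable) auto
  then show ?thesis by (simp add: integrable_restrict_space set_integrable_def)
qed

lemma integral_mu_nu:
  fixes f :: "real \<Rightarrow> real"
  assumes f: "f \<in> borel_measurable (mu_nu \<nu>)"
  shows "integral\<^sup>L (mu_nu \<nu>) f = (LINT y:{0<..<1}|lebesgue. y powr (2 * \<nu> + 1) * f y)"
proof -
  have "f \<in> borel_measurable (lebesgue_on {0<..<1})" using f by (simp add: mu_nu_def)
  then have "integral\<^sup>L (mu_nu \<nu>) f = integral\<^sup>L (lebesgue_on {0<..<1}) (\<lambda>y. y powr (2 * \<nu> + 1) *\<^sub>R f y)"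
    unfolding mu_nu_def by (intro integral_density weight_measurable) auto
  then show ?thesis by (simp add: integral_restrict_space set_lebesgue_integral_def)
qed

lemma set_integrable_powr_unit:
  fixes s :: real
  assumes "s > -1"
  shows "set_integrable lebesgue {0<..<1} (\<lambda>y. y powr s)"
proof -
  have "(\<lambda>y. y powr s) integrable_on {0..1}" using integrable_on_powr_from_0[of s 1] assms by simp
  then have "(\<lambda>y. y powr s) absolutely_integrable_on {0..1}"
    by (intro nonnegative_absolutely_integrable_1) auto
  then show ?thesis by (rule set_integrable_subset) auto
qed

lemma mu_nu_finite:
  assumes nu: "\<nu> > -1"
  shows "integrable (mu_nu \<nu>) (\<lambda>y. c :: real)"
proof (subst integrable_mu_nu_iff)
  show "set_integrable lebesgue {0<..<1} (\<lambda>y. y powr (2 * \<nu> + 1) * c)"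
    using set_integrable_powr_unit[of "2 * \<nu> + 1"] nu by (intro set_integrable_mult_left) auto
qed simp

lemma integrable_mu_nu_bounded:
  fixes g :: "real \<Rightarrow> real"
  assumes f: "integrable (mu_nu \<nu>) f" and g: "g \<in> borel_measurable (mu_nu \<nu>)" "\<And>y. 0 < y \<Longrightarrow> y < 1 \<Longrightarrow> \<bar>g y\<bar> \<le> B"
  shows "integrable (mu_nu \<nu>) (\<lambda>y. g y * f y)"
proof (rule Bochner_Integration.integrable_bound[of _ "\<lambda>y. B * f y"])
  show "integrable (mu_nu \<nu>) (\<lambda>y. B * f y)" using f by simp
  show "(\<lambda>y. g y * f y) \<in> borel_measurable (mu_nu \<nu>)" using f g by auto
  show "AE y in mu_nu \<nu>. norm (g y * f y) \<le> norm (B * f y)"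
  proof (rule AE_I2)
    fix y assume "y \<in> space (mu_nu \<nu>)"
    then have "\<bar>g y\<bar> \<le> B" using g(2)[of y] by simp
    then have "\<bar>g y\<bar> * \<bar>f y\<bar> \<le> \<bar>B\<bar> * \<bar>f y\<bar>" by (intro mult_right_mono) auto
    then show "norm (g y * f y) \<le> norm (B * f y)" by (simp add: abs_mult)
  qed
qed

lemma borel_measurable_bphi [measurable]:
  assumes "\<nu> > -1" shows "bphi \<nu> \<in> borel_measurable (borel :: real measure)"
  by (intro borel_measurable_continuous_onI continuous_on_bphi assms)

lemma bphi_bounded_unit:
  assumes nu: "\<nu> > -1"
  obtains B where "B > 0" "\<And>y. 0 \<le> y \<Longrightarrow> y \<le> 1 \<Longrightarrow> \<bar>bphi \<nu> (s * y)\<bar> \<le> (B :: real)"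
proof -
  have "compact ((\<lambda>y. bphi \<nu> (s * y)) ` {0..1::real})"
    by (intro compact_continuous_image continuous_on_compose2[OF continuous_on_bphi[OF nu, of UNIV]] continuous_intros) auto
  then obtain B where B: "B > 0" "\<And>x. x \<in> (\<lambda>y. bphi \<nu> (s * y)) ` {0..1::real} \<Longrightarrow> norm x \<le> B"
    using compact_imp_bounded bounded_pos by metis
  have "\<bar>bphi \<nu> (s * y)\<bar> \<le> B" if "0 \<le> y" "y \<le> 1" for y
    using B(2)[OF imageI[of y]] that by simp
  then show thesis using B that by blast
qed

lemma integrable_bphi_times:
  assumes nu: "\<nu> > -1" and f: "integrable (mu_nu \<nu>) f"
  shows "integrable (mu_nu \<nu>) (\<lambda>y. bphi \<nu> (s * y) * f y)"
proof -
  obtain B where B: "B > 0" "\<And>y. 0 \<le> y \<Longrightarrow> y \<le> 1 \<Longrightarrow> \<bar>bphi \<nu> (s * y)\<bar> \<le> B" using bphi_bounded_unit[OF nu] by blast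
  have "(\<lambda>y. bphi \<nu> (s * y)) \<in> borel_measurable borel"
    using measurable_compose[of "\<lambda>y. s * y" borel borel "bphi \<nu>" borel] borel_measurable_bphi[OF nu] by simp
  then show ?thesis by (intro integrable_mu_nu_bounded[OF f, of _ B] borel_measurable_mu_nu) (use B in auto)
qed

lemma fb_psi_bphi:
  assumes nu: "\<nu> > -1" and j: "bessel_zero \<nu> j \<in> bzeros \<nu>" and x: "0 < x"
  shows "fb_psi \<nu> j x = sqrt 2 / \<bar>bphi' \<nu> (bessel_zero \<nu> j)\<bar> * bphi \<nu> (bessel_zero \<nu> j * x)"
proof -
  define s where "s = bessel_zero \<nu> j"
  have s: "s > 0" "bphi' \<nu> s \<noteq> 0" using j bphi'_at_zero_nonzero[OF nu] by (auto simp: s_def bzeros_def)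
  define \<kappa> where "\<kappa> = 2 powr \<nu> * Gamma (\<nu> + 1)"
  have k: "\<kappa> > 0" using nu by (simp add: \<kappa>_def Gamma_real_pos)
  have 1: "\<bar>besselJ (\<nu> + 1) s\<bar> = s powr \<nu> / \<kappa> * \<bar>bphi' \<nu> s\<bar>"
    unfolding besselJ_Suc_bphi'[OF nu s(1)] using k s by (simp add: \<kappa>_def[symmetric] abs_mult)
  have 2: "besselJ \<nu> (s * x) = s powr \<nu> * x powr \<nu> / \<kappa> * bphi \<nu> (s * x)"
    using besselJ_bphi[OF nu, of "s * x"] s x by (simp add: \<kappa>_def powr_mult)
  have "fb_psi \<nu> j x = sqrt 2 / (s powr \<nu> / \<kappa> * \<bar>bphi' \<nu> s\<bar>) * x powr (- \<nu>) * (s powr \<nu> * x powr \<nu> / \<kappa> * bphi \<nu> (s * x))"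
    unfolding fb_psi_def s_def[symmetric] 1 2 ..
  also have "\<dots> = sqrt 2 / \<bar>bphi' \<nu> s\<bar> * bphi \<nu> (s * x)"
    using s k x by (simp add: powr_minus divide_simps)
  finally show ?thesis by (simp add: s_def)
qed

lemma fb_coeff_bphi:
  assumes nu: "\<nu> > -1" and j: "bessel_zero \<nu> j \<in> bzeros \<nu>"
  shows "fb_coeff \<nu> f j = sqrt 2 / \<bar>bphi' \<nu> (bessel_zero \<nu> j)\<bar> * (\<integral>y. bphi \<nu> (bessel_zero \<nu> j * y) * f y \<partial>mu_nu \<nu>)"
proof -
  have "fb_coeff \<nu> f j = (\<integral>y. sqrt 2 / \<bar>bphi' \<nu> (bessel_zero \<nu> j)\<bar> * (bphi \<nu> (bessel_zero \<nu> j * y) * f y) \<partial>mu_nu \<nu>)"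
    unfolding fb_coeff_def by (rule Bochner_Integration.integral_cong) (auto simp: fb_psi_bphi[OF nu j])
  then show ?thesis by simp
qed

lemma bochner_riesz_bzeros:
  assumes nu: "\<nu> > -1" and R: "R > 0" and x: "0 < x"
  shows "bochner_riesz \<nu> \<delta> R f x = (\<Sum>s\<in>bzeros \<nu> \<inter> {..<R}. (1 - s\<^sup>2 / R\<^sup>2) powr \<delta> *
            (2 / (bphi' \<nu> s)\<^sup>2 * bphi \<nu> (s * x) * (\<integral>y. bphi \<nu> (s * y) * f y \<partial>mu_nu \<nu>)))"
proof -
  have bij: "bij_betw (bessel_zero \<nu>) {j. 1 \<le> j \<and> bessel_zero \<nu> j < R} (bzeros \<nu> \<inter> {..<R})"
  proof -
    have "bij_betw (bessel_zero \<nu>) {j. 1 \<le> j \<and> bessel_zero \<nu> j < R} (bessel_zero \<nu> ` {j. 1 \<le> j \<and> bessel_zero \<nu> j < R})"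
      by (rule bij_betw_subset[OF bij_betw_bessel_zero[OF nu]]) auto
    moreover have "bessel_zero \<nu> ` {j. 1 \<le> j \<and> bessel_zero \<nu> j < R} = bzeros \<nu> \<inter> {..<R}"
      using bij_betw_imp_surj_on[OF bij_betw_bessel_zero[OF nu]] by force
    ultimately show ?thesis by simp
  qed
  show ?thesis unfolding bochner_riesz_def
  proof (subst sum.reindex_bij_betw[OF bij, symmetric], rule sum.cong[OF refl])
    fix j assume j: "j \<in> {j. 1 \<le> j \<and> bessel_zero \<nu> j < R}"
    define s where "s = bessel_zero \<nu> j"
    have s: "s \<in> bzeros \<nu>" "s < R" "0 < s" using j bij_betwE[OF bij] by (auto simp: s_def bzeros_def)
    have "s\<^sup>2 \<le> R\<^sup>2" using s by (intro power_mono) auto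
    then have m: "max (1 - s\<^sup>2 / R\<^sup>2) 0 = 1 - s\<^sup>2 / R\<^sup>2" using R by (simp add: max_def divide_le_eq)
    have sq: "sqrt 2 / \<bar>b\<bar> * X * (sqrt 2 / \<bar>b\<bar> * Y) = 2 / b\<^sup>2 * Y * X" for b X Y :: real
      by (simp add: power2_eq_square)
    show "(max (1 - (bessel_zero \<nu> j)\<^sup>2 / R\<^sup>2) 0) powr \<delta> * fb_coeff \<nu> f j * fb_psi \<nu> j x =
      (1 - (bessel_zero \<nu> j)\<^sup>2 / R\<^sup>2) powr \<delta> * (2 / (bphi' \<nu> (bessel_zero \<nu> j))\<^sup>2 * bphi \<nu> (bessel_zero \<nu> j * x) * (\<integral>y. bphi \<nu> (bessel_zero \<nu> j * y) * f y \<partial>mu_nu \<nu>))"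
      unfolding fb_coeff_bphi[OF nu s(1)[unfolded s_def]] fb_psi_bphi[OF nu s(1)[unfolded s_def] x] s_def[symmetric] m mult.assoc[of "(1 - s\<^sup>2 / R\<^sup>2) powr \<delta>"] sq ..
  qed
qed

text \<open>For fixed R and x the kernel is a finite sum of bounded functions of y, so integrability
  of f against \<open>mu_nu\<close> is enough.\<close>

lemma bochner_riesz_kernel:
  assumes nu: "\<nu> > -1" and R: "R > 0" and x: "0 < x" and f: "integrable (mu_nu \<nu>) f"
  shows "integrable (mu_nu \<nu>) (\<lambda>y. bkernel \<nu> \<delta> R x y * f y)"
    and "bochner_riesz \<nu> \<delta> R f x = (\<integral>y. bkernel \<nu> \<delta> R x y * f y \<partial>mu_nu \<nu>)"
proof -
  define S where "S = bzeros \<nu> \<inter> {..<R}"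
  define c where "c = (\<lambda>s. (1 - s\<^sup>2 / R\<^sup>2) powr \<delta> * (2 / (bphi' \<nu> s)\<^sup>2 * bphi \<nu> (s * x)))"
  have k: "bkernel \<nu> \<delta> R x y * f y = (\<Sum>s\<in>S. c s * (bphi \<nu> (s * y) * f y))" for y
    unfolding bkernel_def S_def[symmetric] sum_distrib_right by (rule sum.cong) (auto simp: c_def)
  have i: "integrable (mu_nu \<nu>) (\<lambda>y. c s * (bphi \<nu> (s * y) * f y))" for s
    by (intro integrable_mult_right integrable_bphi_times nu f)
  show "integrable (mu_nu \<nu>) (\<lambda>y. bkernel \<nu> \<delta> R x y * f y)" unfolding k by (intro Bochner_Integration.integrable_sum i)
  show "bochner_riesz \<nu> \<delta> R f x = (\<integral>y. bkernel \<nu> \<delta> R x y * f y \<partial>mu_nu \<nu>)"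
    unfolding k bochner_riesz_bzeros[OF nu R x] S_def[symmetric]
    by (subst Bochner_Integration.integral_sum[OF i]) (simp add: c_def mult.assoc)
qed

text \<open>By the self-adjoint form of the equation the flux -y^(2\<nu>+1) \<phi>'(sy)/s is a
  primitive of the weighted integrand. Coefficients of indicators of initial intervals are therefore
  explicit.\<close>

lemma bphi_integral:
  assumes nu: "\<nu> > -1" and s: "s > 0" and r: "0 < r" "r \<le> 1"
  shows "(\<integral>y. bphi \<nu> (s * y) * indicator {..<r} y \<partial>mu_nu \<nu>) = - (r powr (2 * \<nu> + 1) * bphi' \<nu> (s * r) / s)"
proof -
  \<comment> \<open>The flux rewritten through order \<nu>+1: the exponent 2\<nu>+2 is positive, so
    G is continuous at 0 even when y^(2\<nu>+1) is not.\<close>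
  define G where "G = (\<lambda>y. y powr (2 * \<nu> + 2) / (2 * (\<nu> + 1)) * bphi (\<nu> + 1) (s * y))"
  have nu1: "\<nu> + 1 > -1" using nu by simp
  have G: "G y = - (y powr (2 * \<nu> + 1) * bphi' \<nu> (s * y) / s)" if "y > 0" for y
  proof -
    have "y powr (2 * \<nu> + 2) = y powr (2 * \<nu> + 1) * y" using that powr_add[of y "2 * \<nu> + 1" 1] by (simp add: add.assoc)
    moreover have "2 * (\<nu> + 1) \<noteq> 0" using nu by simp
    ultimately show ?thesis using s by (simp add: G_def bphi'_def)
  qed
  have "((\<lambda>y. y powr (2 * \<nu> + 1) * bphi \<nu> (s * y)) has_integral G r - G 0) {0..r}"
  proof (rule fundamental_theorem_of_calculus_interior)
    show "continuous_on {0..r} G" unfolding G_def using nu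
      by (intro continuous_intros continuous_on_powr' continuous_on_compose2[OF continuous_on_bphi[OF nu1, of UNIV]]) auto
    fix y assume y: "y \<in> {0<..<r}"
    then have y0: "y > 0" "s * y \<noteq> 0" using s by auto
    have d1: "((\<lambda>y. y powr (2 * \<nu> + 1)) has_real_derivative (2 * \<nu> + 1) * y powr (2 * \<nu> + 1 - 1)) (at y)"
      by (rule has_real_derivative_powr[OF y0(1)])
    have d2: "((\<lambda>y. bphi' \<nu> (s * y)) has_real_derivative (- bphi \<nu> (s * y) - of_real (2 * \<nu> + 1) / (s * y) * bphi' \<nu> (s * y)) * s) (at y)"
      by (rule DERIV_chain2[OF bphi'_has_field_derivative[OF nu y0(2)] DERIV_cmult_Id])
    have "((\<lambda>y. - (y powr (2 * \<nu> + 1) * bphi' \<nu> (s * y) / s)) has_real_derivative y powr (2 * \<nu> + 1) * bphi \<nu> (s * y)) (at y)"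
    proof -
      have "((\<lambda>y. - (y powr (2 * \<nu> + 1) * bphi' \<nu> (s * y) / s)) has_real_derivative
         - (((2 * \<nu> + 1) * y powr (2 * \<nu> + 1 - 1) * bphi' \<nu> (s * y) + (- bphi \<nu> (s * y) - of_real (2 * \<nu> + 1) / (s * y) * bphi' \<nu> (s * y)) * s * y powr (2 * \<nu> + 1)) / s)) (at y)"
        by (intro DERIV_minus DERIV_cdivide DERIV_mult d1 d2)
      moreover have "y powr (2 * \<nu> + 1) = y powr (2 * \<nu>) * y" using y0 by (simp add: powr_add)
      ultimately show ?thesis using s y0 by (simp add: field_simps)
    qed
    then have "(G has_real_derivative y powr (2 * \<nu> + 1) * bphi \<nu> (s * y)) (at y)"
      by (rule has_field_derivative_transform_within_open[of _ _ _ "{0<..}"]) (use y0 G in auto)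
    then show "(G has_vector_derivative y powr (2 * \<nu> + 1) * bphi \<nu> (s * y)) (at y)"
      by (simp add: has_real_derivative_iff_has_vector_derivative)
  qed (use r in simp)
  then have hk: "integral {0..r} (\<lambda>y. y powr (2 * \<nu> + 1) * bphi \<nu> (s * y)) = G r"
    using nu by (simp add: G_def integral_unique)
  have m: "(\<lambda>y. bphi \<nu> (s * y)) \<in> borel_measurable borel"
    using measurable_compose[of "\<lambda>y. s * y" borel borel "bphi \<nu>" borel] borel_measurable_bphi[OF nu] by simp
  have one: "integrable (mu_nu \<nu>) (\<lambda>y. bphi \<nu> (s * y) * 1)" by (rule integrable_bphi_times[OF nu mu_nu_finite[OF nu]])
  then have si: "set_integrable lebesgue {0<..<1} (\<lambda>y. y powr (2 * \<nu> + 1) * bphi \<nu> (s * y))"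
    using integrable_mu_nu_iff[of "\<lambda>y. bphi \<nu> (s * y)" \<nu>] borel_measurable_mu_nu[OF m] by simp
  have "(\<integral>y. bphi \<nu> (s * y) * indicator {..<r} y \<partial>mu_nu \<nu>) = (LINT y:{0<..<1}|lebesgue. y powr (2 * \<nu> + 1) * (bphi \<nu> (s * y) * indicator {..<r} y))"
    using m by (intro integral_mu_nu borel_measurable_mu_nu) auto
  also have "\<dots> = (LINT y:{0<..<r}|lebesgue. y powr (2 * \<nu> + 1) * bphi \<nu> (s * y))"
    unfolding set_lebesgue_integral_def using r by (intro Bochner_Integration.integral_cong) (auto simp: indicator_def)
  also have "\<dots> = integral {0<..<r} (\<lambda>y. y powr (2 * \<nu> + 1) * bphi \<nu> (s * y))"
    by (rule set_lebesgue_integral_eq_integral(2)[OF set_integrable_subset[OF si]]) (use r in auto)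
  also have "\<dots> = integral {0..r} (\<lambda>y. y powr (2 * \<nu> + 1) * bphi \<nu> (s * y))"
    by (simp add: integral_open_interval_real)
  also note hk
  finally show ?thesis using G[OF r(1)] by simp
qed

text \<open>The case r = 1 of \<open>bphi_integral\<close> gives the coefficients of the constant 1,
  so the total mass of the kernel is the Riesz mean treated in
  \<open>riesz_means_of_one\<close>.\<close>

lemma bkernel_integral:
  assumes nu: "\<nu> > -1" and R: "R > 0" and x: "0 < x"
  shows "(\<integral>y. bkernel \<nu> \<delta> R x y \<partial>mu_nu \<nu>) = (\<Sum>s\<in>bzeros \<nu> \<inter> {..<R}. (1 - s\<^sup>2 / R\<^sup>2) powr \<delta> * (- 2 * bphi \<nu> (s * x) / (s * bphi' \<nu> s)))"
proof -
  have "(\<integral>y. bkernel \<nu> \<delta> R x y \<partial>mu_nu \<nu>) = bochner_riesz \<nu> \<delta> R (\<lambda>_. 1) x"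
    using bochner_riesz_kernel(2)[OF nu R x mu_nu_finite[OF nu], of \<delta> 1] by simp
  also have "\<dots> = (\<Sum>s\<in>bzeros \<nu> \<inter> {..<R}. (1 - s\<^sup>2 / R\<^sup>2) powr \<delta> * (- 2 * bphi \<nu> (s * x) / (s * bphi' \<nu> s)))"
    unfolding bochner_riesz_bzeros[OF nu R x]
  proof (rule sum.cong[OF refl])
    fix s assume "s \<in> bzeros \<nu> \<inter> {..<R}"
    then have s: "s > 0" "bphi' \<nu> s \<noteq> 0" using bphi'_at_zero_nonzero[OF nu] by (auto simp: bzeros_def)
    have "(\<integral>y. bphi \<nu> (s * y) * 1 \<partial>mu_nu \<nu>) = (\<integral>y. bphi \<nu> (s * y) * indicator {..<1} y \<partial>mu_nu \<nu>)"
      by (rule Bochner_Integration.integral_cong) auto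
    also have "\<dots> = - (bphi' \<nu> s / s)" using bphi_integral[OF nu s(1), of 1] by simp
    finally show "(1 - s\<^sup>2 / R\<^sup>2) powr \<delta> * (2 / (bphi' \<nu> s)\<^sup>2 * bphi \<nu> (s * x) * (\<integral>y. bphi \<nu> (s * y) * 1 \<partial>mu_nu \<nu>)) =
       (1 - s\<^sup>2 / R\<^sup>2) powr \<delta> * (- 2 * bphi \<nu> (s * x) / (s * bphi' \<nu> s))"
      using s by (simp add: power2_eq_square)
  qed
  finally show ?thesis .
qed

section \<open>Convergence at Lebesgue points\<close>

text \<open>Dyadic decomposition: the kernel is dominated by \<open>\<Sum>\<^sub>k R 2\<^sup>-\<^sup>k\<^sup>(\<^sup>1\<^sup>+\<^sup>\<delta>\<^sup>)\<close> times indicators of balls of radius \<open>2\<^sup>k/R\<close>.\<close>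
lemma approximate_identity_bound:
  fixes F K :: "real \<Rightarrow> real"
  assumes F: "set_integrable lebesgue (ball x \<eta>) F" "\<And>y. 0 \<le> F y"
    and avg: "\<And>r. 0 < r \<Longrightarrow> r < \<eta> \<Longrightarrow> (LINT y:ball x r|lebesgue. F y) \<le> \<kappa> * r" and \<kappa>: "\<kappa> \<ge> 0"
    and R: "R > 0" "1 / R < \<eta>" and \<delta>: "\<delta> > 0" and C: "C \<ge> 0"
    and K0: "\<And>y. y \<in> ball x (\<eta> / 2) \<Longrightarrow> \<bar>K y\<bar> \<le> C * R"
    and K1: "\<And>y. y \<in> ball x (\<eta> / 2) \<Longrightarrow> 1 / R \<le> \<bar>x - y\<bar> \<Longrightarrow> \<bar>K y\<bar> \<le> C * R powr (- \<delta>) * \<bar>x - y\<bar> powr (- 1 - \<delta>)"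
    and KF: "set_integrable lebesgue (ball x (\<eta> / 2)) (\<lambda>y. \<bar>K y\<bar> * F y)"
  shows "(LINT y:ball x (\<eta> / 2)|lebesgue. \<bar>K y\<bar> * F y) \<le> C * 2 powr (1 + \<delta>) / (1 - 2 powr (- \<delta>)) * \<kappa>"
proof -
  \<comment> \<open>The dyadic multiples of 1/R below \<eta>; on balls of these radii the averages
    of F are controlled.\<close>
  define Ks where "Ks = {k::nat. 2 ^ k / R < \<eta>}"
  have finK: "finite Ks"
  proof (rule finite_subset)
    show "Ks \<subseteq> {..nat \<lceil>\<eta> * R\<rceil>}"
    proof
      fix k assume "k \<in> Ks"
      then have "(2::real) ^ k < \<eta> * R" using R by (simp add: Ks_def divide_less_eq)
      moreover have "real k < 2 ^ k" by (rule of_nat_less_two_power)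
      ultimately have "real k < \<eta> * R" by linarith
      then show "k \<in> {..nat \<lceil>\<eta> * R\<rceil>}" by (simp add: nat_le_iff le_nat_iff) linarith
    qed
  qed simp
  define b where "b = (\<lambda>k::nat. C * 2 powr (1 + \<delta>) * R * 2 powr (- (real k * (1 + \<delta>))))"
  have b0: "b k \<ge> 0" for k using C R by (simp add: b_def)
  have pw: "\<bar>K y\<bar> \<le> (\<Sum>k\<in>Ks. b k * indicator (ball x (2 ^ k / R)) y)" if y: "y \<in> ball x (\<eta> / 2)" for y
  proof -
    have single: "b k \<le> (\<Sum>k\<in>Ks. b k * indicator (ball x (2 ^ k / R)) y)" if "k \<in> Ks" "y \<in> ball x (2 ^ k / R)" for k
      using member_le_sum[of k Ks "\<lambda>k. b k * indicator (ball x (2 ^ k / R)) y"] that b0 finK by simp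
    have yd: "\<bar>x - y\<bar> < \<eta> / 2" using y by (simp add: dist_real_def)
    show ?thesis
    proof (cases "\<bar>x - y\<bar> < 1 / R")
      case True
      have "C * R * 1 \<le> C * R * 2 powr (1 + \<delta>)" using C R \<delta> by (intro mult_left_mono ge_one_powr_ge_zero) auto
      then have "\<bar>K y\<bar> \<le> b 0" using K0[OF y] by (simp add: b_def mult_ac)
      also have "\<dots> \<le> (\<Sum>k\<in>Ks. b k * indicator (ball x (2 ^ k / R)) y)" using True R by (intro single) (auto simp: Ks_def dist_real_def)
      finally show ?thesis .
    next
      case False
      then have xyR: "1 \<le> \<bar>x - y\<bar> * R" using R by (simp add: field_simps)
      \<comment> \<open>The least dyadic radius exceeding |x - y|. It is at most 2|x - y|, hence
        below \<eta> because y lies in the half ball, and |x - y| \<ge> 2^(k-1)/R turns the decay of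
        the kernel into the bound \<open>b k\<close>.\<close>
      define k where "k = (LEAST k::nat. \<bar>x - y\<bar> * R < 2 ^ k)"
      have ex: "\<exists>k::nat. \<bar>x - y\<bar> * R < 2 ^ k" using real_arch_pow[of 2] by simp
      have k1: "\<bar>x - y\<bar> * R < 2 ^ k" unfolding k_def by (rule LeastI_ex[OF ex])
      have k0: "k \<noteq> 0" using k1 xyR by (intro notI) simp
      then obtain l where l: "k = Suc l" by (cases k) auto
      have k2: "2 ^ l \<le> \<bar>x - y\<bar> * R" using not_less_Least[of l "\<lambda>k. \<bar>x - y\<bar> * R < 2 ^ k"] l by (simp add: k_def not_less)
      have "2 ^ k / R < \<eta>"
      proof -
        have "2 ^ k \<le> 2 * (\<bar>x - y\<bar> * R)" using k2 l by simp
        also have "\<dots> < \<eta> * R" using yd R by simp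
        finally show ?thesis using R by (simp add: divide_less_eq)
      qed
      then have kK: "k \<in> Ks" by (simp add: Ks_def)
      have yk: "y \<in> ball x (2 ^ k / R)" using k1 R by (simp add: dist_real_def pos_less_divide_eq)
      have "\<bar>x - y\<bar> powr (- 1 - \<delta>) \<le> (2 ^ l / R) powr (- 1 - \<delta>)"
        using k2 R \<delta> by (intro powr_mono2') (auto simp: divide_le_eq)
      also have "(2 ^ l / R) powr (- 1 - \<delta>) = 2 powr (1 + \<delta>) * 2 powr (- (real k * (1 + \<delta>))) * R powr (1 + \<delta>)"
      proof -
        have "(2::real) ^ l = 2 powr real l" by (simp add: powr_realpow)
        then have "(2 ^ l) powr (- 1 - \<delta>) = (2::real) powr (real l * (- 1 - \<delta>))" by (simp add: powr_powr)
        also have "real l * (- 1 - \<delta>) = (1 + \<delta>) + (- (real k * (1 + \<delta>)))" using l by (simp add: algebra_simps)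
        finally have "(2 ^ l) powr (- 1 - \<delta>) = (2::real) powr (1 + \<delta>) * 2 powr (- (real k * (1 + \<delta>)))" by (simp only: powr_add)
        moreover have "R powr (1 + \<delta>) = 1 / R powr (- 1 - \<delta>)" using powr_minus_divide[of R "- 1 - \<delta>"] by (simp add: add.commute)
        ultimately show ?thesis using R by (simp add: powr_divide)
      qed
      finally have p: "\<bar>x - y\<bar> powr (- 1 - \<delta>) \<le> 2 powr (1 + \<delta>) * 2 powr (- (real k * (1 + \<delta>))) * R powr (1 + \<delta>)" .
      have "\<bar>K y\<bar> \<le> C * R powr (- \<delta>) * \<bar>x - y\<bar> powr (- 1 - \<delta>)" using K1[OF y] False by simp
      also have "\<dots> \<le> C * R powr (- \<delta>) * (2 powr (1 + \<delta>) * 2 powr (- (real k * (1 + \<delta>))) * R powr (1 + \<delta>))"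
        using C by (intro mult_left_mono p) auto
      also have "\<dots> = C * 2 powr (1 + \<delta>) * (R powr (- \<delta>) * R powr (1 + \<delta>)) * 2 powr (- (real k * (1 + \<delta>)))" by simp
      also have "R powr (- \<delta>) * R powr (1 + \<delta>) = R" using R by (simp flip: powr_add)
      finally have "\<bar>K y\<bar> \<le> b k" by (simp add: b_def)
      also have "\<dots> \<le> (\<Sum>k\<in>Ks. b k * indicator (ball x (2 ^ k / R)) y)" by (rule single[OF kK yk])
      finally show ?thesis .
    qed
  qed
  have iF: "integrable lebesgue (\<lambda>y. indicator (ball x (2 ^ k / R)) y * F y)" if "k \<in> Ks" for k
  proof -
    have "set_integrable lebesgue (ball x (2 ^ k / R)) F"
      by (rule set_integrable_subset[OF F(1)]) (use that in \<open>auto simp: Ks_def\<close>)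
    then show ?thesis by (simp add: set_integrable_def)
  qed
  have "(LINT y:ball x (\<eta> / 2)|lebesgue. \<bar>K y\<bar> * F y) \<le> (LINT y|lebesgue. (\<Sum>k\<in>Ks. b k * (indicator (ball x (2 ^ k / R)) y * F y)))"
    unfolding set_lebesgue_integral_def
  proof (rule integral_mono)
    show "integrable lebesgue (\<lambda>y. indicat_real (ball x (\<eta> / 2)) y *\<^sub>R (\<bar>K y\<bar> * F y))" using KF by (simp add: set_integrable_def)
    show "integrable lebesgue (\<lambda>y. \<Sum>k\<in>Ks. b k * (indicator (ball x (2 ^ k / R)) y * F y))"
      by (intro Bochner_Integration.integrable_sum integrable_mult_right iF)
    fix y
    have eq: "(\<Sum>k\<in>Ks. b k * (indicator (ball x (2 ^ k / R)) y * F y)) = (\<Sum>k\<in>Ks. b k * indicator (ball x (2 ^ k / R)) y) * F y"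
      by (simp add: sum_distrib_right mult.assoc)
    show "indicat_real (ball x (\<eta> / 2)) y *\<^sub>R (\<bar>K y\<bar> * F y) \<le> (\<Sum>k\<in>Ks. b k * (indicator (ball x (2 ^ k / R)) y * F y))"
    proof (cases "y \<in> ball x (\<eta> / 2)")
      case True
      then show ?thesis unfolding eq using mult_right_mono[OF pw[OF True] F(2)[of y]] by simp
    next
      case False
      have "0 \<le> (\<Sum>k\<in>Ks. b k * indicator (ball x (2 ^ k / R)) y) * F y"
        using b0 F(2)[of y] by (intro mult_nonneg_nonneg sum_nonneg) auto
      then show ?thesis unfolding eq using False by simp
    qed
  qed
  also have "\<dots> = (\<Sum>k\<in>Ks. b k * (LINT y:ball x (2 ^ k / R)|lebesgue. F y))"
    unfolding set_lebesgue_integral_def by (subst Bochner_Integration.integral_sum) (auto intro!: integrable_mult_right iF)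
  also have "\<dots> \<le> (\<Sum>k\<in>Ks. b k * (\<kappa> * (2 ^ k / R)))"
    using R by (intro sum_mono mult_left_mono b0 avg) (auto simp: Ks_def)
  \<comment> \<open>The radius 2^k/R cancels the factor R and one power of 2^k. A geometric series
    of ratio 2^(-\<delta>) remains, and \<delta> > 0 makes it converge.\<close>
  also have "\<dots> = (\<Sum>k\<in>Ks. C * 2 powr (1 + \<delta>) * \<kappa> * (2 powr (- \<delta>)) ^ k)"
  proof (rule sum.cong[OF refl])
    fix k
    have "2 powr (- (real k * (1 + \<delta>))) * 2 ^ k = (2 powr (- \<delta>)) ^ k"
    proof -
      have "2 powr (- (real k * (1 + \<delta>))) * 2 ^ k = 2 powr (- (real k * (1 + \<delta>)) + real k)" unfolding powr_add by (simp add: powr_realpow)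
      also have "- (real k * (1 + \<delta>)) + real k = - \<delta> * real k" by (simp add: algebra_simps)
      also have "2 powr (- \<delta> * real k) = (2 powr (- \<delta>)) ^ k" by (simp add: powr_powr flip: powr_realpow)
      finally show ?thesis .
    qed
    moreover have "b k * (\<kappa> * (2 ^ k / R)) = C * 2 powr (1 + \<delta>) * \<kappa> * (2 powr (- (real k * (1 + \<delta>))) * 2 ^ k)"
      using R by (simp add: b_def)
    ultimately show "b k * (\<kappa> * (2 ^ k / R)) = C * 2 powr (1 + \<delta>) * \<kappa> * (2 powr (- \<delta>)) ^ k" by simp
  qed
  also have "\<dots> = C * 2 powr (1 + \<delta>) * \<kappa> * (\<Sum>k\<in>Ks. (2 powr (- \<delta>)) ^ k)" by (simp add: sum_distrib_left)
  also have "\<dots> \<le> C * 2 powr (1 + \<delta>) * \<kappa> * (1 / (1 - 2 powr (- \<delta>)))"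
  proof (rule mult_left_mono)
    have q: "norm (2 powr (- \<delta>) :: real) < 1" using \<delta> by (simp add: powr_less_one)
    have "(\<Sum>k\<in>Ks. (2 powr (- \<delta>)) ^ k) \<le> (\<Sum>k. (2 powr (- \<delta>)) ^ k)"
      by (rule sum_le_suminf[OF summable_geometric[OF q] finK]) auto
    then show "(\<Sum>k\<in>Ks. (2 powr (- \<delta>)) ^ k) \<le> 1 / (1 - 2 powr (- \<delta>))" using suminf_geometric[OF q] by simp
  qed (use C \<kappa> in auto)
  finally show ?thesis by (simp add: mult_ac)
qed

text \<open>Away from 0 the density has a bounded inverse, whatever the sign of 2\<nu>+1.\<close>

lemma set_integrable_of_mu_nu:
  fixes f :: "real \<Rightarrow> real"
  assumes f: "integrable (mu_nu \<nu>) f" and l: "0 < l" and S: "S \<in> sets lebesgue" "S \<subseteq> {l..<1}"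
  shows "set_integrable lebesgue S f"
proof -
  have fm: "f \<in> borel_measurable (mu_nu \<nu>)" using f by simp
  have "set_integrable lebesgue {0<..<1} (\<lambda>y. y powr (2 * \<nu> + 1) * f y)" using f integrable_mu_nu_iff[OF fm] by simp
  then have i: "set_integrable lebesgue S (\<lambda>y. y powr (2 * \<nu> + 1) * f y)"
    by (rule set_integrable_subset) (use S l in auto)
  define M where "M = l powr (- \<bar>2 * \<nu> + 1\<bar>)"
  have eq: "indicat_real S y * f y = y powr (- (2 * \<nu> + 1)) * (indicat_real S y * (y powr (2 * \<nu> + 1) * f y))" for y
  proof (cases "y \<in> S")
    case True
    then have "y > 0" using S l by auto
    then have "y powr (- (2 * \<nu> + 1)) * y powr (2 * \<nu> + 1) = 1" by (subst powr_add[symmetric]) auto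
    moreover have "p * (1 * (q * r)) = (p * q) * r" for p q r :: real by simp
    ultimately show ?thesis using True by (metis indicator_simps(1) mult_1)
  qed simp
  show ?thesis unfolding set_integrable_def real_scaleR_def
  proof (rule Bochner_Integration.integrable_bound[of _ "\<lambda>y. M * (indicat_real S y * (y powr (2 * \<nu> + 1) * f y))"])
    show "integrable lebesgue (\<lambda>y. M * (indicat_real S y * (y powr (2 * \<nu> + 1) * f y)))"
      using i unfolding set_integrable_def by simp
    have "(\<lambda>y. indicat_real S y * (y powr (2 * \<nu> + 1) * f y)) \<in> borel_measurable lebesgue"
      using i unfolding set_integrable_def real_scaleR_def by (rule borel_measurable_integrable)
    moreover have "(\<lambda>y::real. y powr (- (2 * \<nu> + 1))) \<in> borel_measurable lebesgue" by (intro measurable_completion) auto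
    ultimately show "(\<lambda>y. indicat_real S y * f y) \<in> borel_measurable lebesgue" unfolding eq by (rule borel_measurable_times[rotated])
    show "AE y in lebesgue. norm (indicat_real S y * f y) \<le> norm (M * (indicat_real S y * (y powr (2 * \<nu> + 1) * f y)))"
    proof (rule AE_I2)
      fix y
      show "norm (indicat_real S y * f y) \<le> norm (M * (indicat_real S y * (y powr (2 * \<nu> + 1) * f y)))"
      proof (cases "y \<in> S")
        case True
        then have "y powr (- (2 * \<nu> + 1)) \<le> M" unfolding M_def using S l by (intro powr_le_lower_end(2)) auto
        then show ?thesis unfolding eq norm_mult by (intro mult_right_mono) (auto simp: M_def)
      qed simp
    qed
  qed
qed

text \<open>The difference of the mean and f x is the integral of K (f - f x) plus f x times the
  defect of the mass of K. The integral is split into a small ball about x, a middle region where K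
  is O(R^-\<delta>), and a neighbourhood of 0. Only the last depends on p, and it is isolated in the
  hypothesis \<open>near0\<close>.\<close>

lemma convergence_at_lebesgue_point:
  assumes nu: "\<nu> > -1" and \<delta>: "\<delta> > 0" and x: "0 < x" "x < 1" and f: "integrable (mu_nu \<nu>) f" and lp: "lebesgue_point f x"
    and near0: "\<And>e. e > 0 \<Longrightarrow> \<exists>\<rho> R1. 0 < \<rho> \<and> (\<forall>R\<ge>R1. (\<integral>y. indicator {..<\<rho>} y * (R powr (- \<delta>) * (R / (1 + y * R)) powr max (\<nu> + 1/2) 0) * \<bar>f y - f x\<bar> \<partial>mu_nu \<nu>) \<le> e)"
  shows "((\<lambda>R. bochner_riesz \<nu> \<delta> R f x) \<longlongrightarrow> f x) at_top"
proof (rule tendstoI)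
  fix e :: real assume e: "e > 0"
  define \<beta> where "\<beta> = max (\<nu> + 1/2) 0"
  define G where "G = (\<lambda>y. \<bar>f y - f x\<bar>)"
  have G0: "0 \<le> G y" for y by (simp add: G_def)
  have iG: "integrable (mu_nu \<nu>) G" unfolding G_def by (intro integrable_abs Bochner_Integration.integrable_diff f mu_nu_finite nu)
  define x0 where "x0 = x / 2"
  have x0: "0 < x0" "x0 \<le> 1" "x0 < x" using x by (auto simp: x0_def)
  obtain C1 where C1: "C1 > 0" "\<And>R x y. R \<ge> 1 \<Longrightarrow> x0 \<le> x \<Longrightarrow> x \<le> 1 \<Longrightarrow> x0 \<le> y \<Longrightarrow> y \<le> 1 \<Longrightarrow> \<bar>bkernel \<nu> \<delta> R x y\<bar> \<le> C1 * R"
    using bkernel_linear_bound[OF nu \<delta> x0(1,2)] by blast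
  obtain C2 R2 where C2: "C2 > 0" "\<And>R lo hi. R \<ge> R2 \<Longrightarrow> x0 \<le> lo \<Longrightarrow> hi \<le> 1 \<Longrightarrow> 1 / R \<le> hi - lo \<Longrightarrow>
     \<bar>bkernel \<nu> \<delta> R lo hi\<bar> \<le> C2 * R powr (- \<delta>) * (hi - lo) powr (- 1 - \<delta>)"
    using bkernel_near_bound[OF nu \<delta> x0(1,2)] by metis
  obtain C3 R3 where C3: "C3 > 0" "\<And>R y. R \<ge> R3 \<Longrightarrow> 0 \<le> y \<Longrightarrow> y \<le> x / 2 \<Longrightarrow>
     \<bar>bkernel \<nu> \<delta> R y x\<bar> \<le> C3 * R powr (- \<delta>) * (R / (1 + y * R)) powr \<beta>"
    using bkernel_far_bound[OF nu \<delta> x(1)] x unfolding \<beta>_def by (metis less_imp_le)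
  define C where "C = max C1 C2"
  have C: "C > 0" "C1 \<le> C" "C2 \<le> C" using C1 by (auto simp: C_def)
  define cx where "cx = x0 powr (- \<bar>2 * \<nu> + 1\<bar>)"
  define D where "D = C * 2 powr (1 + \<delta>) / (1 - 2 powr (- \<delta>))"
  have cx: "cx > 0" using x0 by (simp add: cx_def)
  have D: "D > 0" using C \<delta> by (simp add: D_def powr_less_one)
  \<comment> \<open>The ball may contribute e/8: \<open>cx\<close> bounds the density there and
    \<open>D\<close> is the constant of \<open>approximate_identity_bound\<close>.\<close>
  define \<kappa> where "\<kappa> = e / (8 * (cx * D))"
  have \<kappa>: "\<kappa> > 0" using e cx D by (simp add: \<kappa>_def)
  have "\<exists>\<eta>0>0. \<forall>r. 0 < r \<and> r < \<eta>0 \<longrightarrow> (LINT y:ball x r|lebesgue. G y) \<le> \<kappa> * r"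
    unfolding G_def by (rule lp[unfolded lebesgue_point_def, rule_format, OF \<kappa>])
  then obtain \<eta>0 where eta0: "\<eta>0 > 0" "\<And>r. 0 < r \<Longrightarrow> r < \<eta>0 \<Longrightarrow> (LINT y:ball x r|lebesgue. G y) \<le> \<kappa> * r"
    by metis
  define \<eta> where "\<eta> = min \<eta>0 (min (x / 2) (1 - x))"
  have \<eta>: "\<eta> > 0" "\<eta> \<le> \<eta>0" "\<eta> \<le> x / 2" "\<eta> \<le> 1 - x"
    unfolding \<eta>_def min_def using eta0 x by auto
  have ball_sub: "ball x \<eta> \<subseteq> {x0..<1}" using \<eta> x0 by (auto simp: dist_real_def x0_def)
  have ball_sub2: "ball x (\<eta> / 2) \<subseteq> ball x \<eta>" using \<eta> by auto
  have e3: "e / (8 * C3) > 0" using e C3 by simp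
  obtain \<rho> R1 where \<rho>: "0 < \<rho>" "\<And>R. R \<ge> R1 \<Longrightarrow> (\<integral>y. indicator {..<\<rho>} y * (R powr (- \<delta>) * (R / (1 + y * R)) powr \<beta>) * G y \<partial>mu_nu \<nu>) \<le> e / (8 * C3)"
    using near0[OF e3] unfolding \<beta>_def G_def by blast
  \<comment> \<open>\<open>c'\<close> bounds R^\<delta> |K| on the middle region: the first term at
    distance at least \<eta>/2 from x, the second for y between \<rho> and x/2.\<close>
  define c' where "c' = C * (\<eta> / 2) powr (- 1 - \<delta>) + C3 * (1 / \<rho>) powr \<beta>"
  have c': "c' \<ge> 0" using C C3 by (simp add: c'_def)
  define I where "I = integral\<^sup>L (mu_nu \<nu>) G"
  have "((\<lambda>R. R powr (- \<delta>) * (c' * I)) \<longlongrightarrow> 0 * (c' * I)) at_top"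
    by (intro tendsto_intros tendsto_neg_powr) (use \<delta> in \<open>auto simp: filterlim_ident\<close>)
  then have ev1: "\<forall>\<^sub>F R in at_top. R powr (- \<delta>) * (c' * I) < e / 8" using e by (intro order_tendstoD(2)) auto
  define S where "S = (\<lambda>R. \<Sum>s\<in>bzeros \<nu> \<inter> {..<R}. (1 - s\<^sup>2 / R\<^sup>2) powr \<delta> * (- 2 * bphi \<nu> (s * x) / (s * bphi' \<nu> s)))"
  have "((\<lambda>R. \<bar>f x\<bar> * \<bar>S R - 1\<bar>) \<longlongrightarrow> \<bar>f x\<bar> * \<bar>1 - 1\<bar>) at_top"
    unfolding S_def by (intro tendsto_intros riesz_means_of_one nu \<delta> x)
  then have ev2: "\<forall>\<^sub>F R in at_top. \<bar>f x\<bar> * \<bar>S R - 1\<bar> < e / 8" using e by (intro order_tendstoD(2)) auto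
  show "\<forall>\<^sub>F R in at_top. dist (bochner_riesz \<nu> \<delta> R f x) (f x) < e"
    using ev1 ev2 eventually_ge_at_top[of "max (max 1 R1) (max R2 R3)"] eventually_gt_at_top[of "2 / \<eta>"]
  proof eventually_elim
    case (elim R)
    have R: "R \<ge> 1" "R \<ge> R1" "R \<ge> R2" "R \<ge> R3" "R > 0" using elim(3) by auto
    have R\<eta>: "1 / R < \<eta> / 2" using elim(4) \<eta> R by (simp add: field_simps)
    define K where "K = bkernel \<nu> \<delta> R x"
    have iKf: "integrable (mu_nu \<nu>) (\<lambda>y. K y * f y)" and iK1: "integrable (mu_nu \<nu>) (\<lambda>y. K y)"
      using bochner_riesz_kernel(1)[OF nu R(5) x(1) f, of \<delta>] bochner_riesz_kernel(1)[OF nu R(5) x(1) mu_nu_finite[OF nu], of \<delta> 1] by (simp_all add: K_def)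
    have iKG: "integrable (mu_nu \<nu>) (\<lambda>y. \<bar>K y\<bar> * G y)"
      using integrable_abs[OF bochner_riesz_kernel(1)[OF nu R(5) x(1) iG, of \<delta>]] by (simp add: K_def abs_mult G_def)
    have nearK: "\<bar>K y\<bar> \<le> C * R powr (- \<delta>) * \<bar>x - y\<bar> powr (- 1 - \<delta>)" if y: "x0 \<le> y" "y \<le> 1" "1 / R \<le> \<bar>x - y\<bar>" for y
    proof -
      have "\<bar>K y\<bar> \<le> C2 * R powr (- \<delta>) * \<bar>x - y\<bar> powr (- 1 - \<delta>)"
      proof (cases "y \<le> x")
        case True
        then show ?thesis using C2(2)[OF R(3) y(1), of x] x y by (simp add: K_def bkernel_commute[of \<nu> \<delta> R x y])
      next
        case False
        then show ?thesis using C2(2)[OF R(3) less_imp_le[OF x0(3)] y(2)] y by (simp add: K_def abs_minus_commute)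
      qed
      also have "\<dots> \<le> C * R powr (- \<delta>) * \<bar>x - y\<bar> powr (- 1 - \<delta>)" using C by (intro mult_right_mono) auto
      finally show ?thesis .
    qed
    define W where "W = (\<lambda>y. R powr (- \<delta>) * (R / (1 + y * R)) powr \<beta>)"
    have W0: "0 \<le> W y" for y by (simp add: W_def)
    have farK: "\<bar>K y\<bar> \<le> C3 * W y" if y: "0 < y" "y \<le> x0" for y
      using C3(2)[OF R(4), of y] y by (simp add: K_def bkernel_commute[of \<nu> \<delta> R x y] W_def x0_def mult.assoc)
    have pw: "\<bar>K y\<bar> * G y \<le> indicator (ball x (\<eta> / 2)) y * (\<bar>K y\<bar> * G y) + R powr (- \<delta>) * c' * G y + C3 * (indicator {..<\<rho>} y * W y * G y)"
      if y: "0 < y" "y < 1" for y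
    proof -
      have n: "0 \<le> \<bar>K y\<bar> * G y" "0 \<le> R powr (- \<delta>) * c' * G y" "0 \<le> C3 * (indicator {..<\<rho>} y * W y * G y)"
        using G0[of y] c' C3 W0[of y] by auto
      show ?thesis
      proof (cases "y \<in> ball x (\<eta> / 2)")
        case True
        then show ?thesis using n by simp
      next
        case nb: False
        have "\<bar>K y\<bar> * G y \<le> R powr (- \<delta>) * c' * G y + C3 * (indicator {..<\<rho>} y * W y * G y)"
        proof (cases "x0 \<le> y")
          case True
          have d: "\<eta> / 2 \<le> \<bar>x - y\<bar>" using nb by (simp add: dist_real_def)
          have "\<bar>K y\<bar> \<le> C * R powr (- \<delta>) * \<bar>x - y\<bar> powr (- 1 - \<delta>)" using True y d R\<eta> by (intro nearK) auto
          also have "\<dots> \<le> C * R powr (- \<delta>) * (\<eta> / 2) powr (- 1 - \<delta>)"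
            using d \<eta> \<delta> C by (intro mult_left_mono powr_mono2') auto
          also have "\<dots> \<le> R powr (- \<delta>) * c'" using C3 by (simp add: c'_def algebra_simps)
          finally have "\<bar>K y\<bar> * G y \<le> R powr (- \<delta>) * c' * G y" using G0 by (intro mult_right_mono)
          then show ?thesis using n by linarith
        next
          case False
          then have KW: "\<bar>K y\<bar> \<le> C3 * W y" using y by (intro farK) auto
          show ?thesis
          proof (cases "y < \<rho>")
            case True
            have "\<bar>K y\<bar> * G y \<le> C3 * W y * G y" using KW G0 by (intro mult_right_mono)
            then show ?thesis using True n by (simp add: mult.assoc)
          next
            case False
            have "R / (1 + y * R) \<le> 1 / \<rho>"
            proof -
              have "\<rho> * R \<le> y * R" using False R by (intro mult_right_mono) auto
              then have "R * \<rho> \<le> 1 + y * R" by (simp add: mult.commute)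
              moreover have "0 < 1 + y * R" using y R by (intro add_pos_pos) auto
              ultimately show ?thesis using \<rho>(1) by (simp add: divide_le_eq pos_le_divide_eq)
            qed
            then have "(R / (1 + y * R)) powr \<beta> \<le> (1 / \<rho>) powr \<beta>" using y R by (intro powr_mono2) (auto simp: \<beta>_def)
            then have "C3 * W y \<le> C3 * (R powr (- \<delta>) * (1 / \<rho>) powr \<beta>)" unfolding W_def using C3 by (intro mult_left_mono) auto
            also have "\<dots> \<le> R powr (- \<delta>) * c'" using C by (simp add: c'_def algebra_simps)
            finally have "\<bar>K y\<bar> \<le> R powr (- \<delta>) * c'" using KW by linarith
            then have "\<bar>K y\<bar> * G y \<le> R powr (- \<delta>) * c' * G y" using G0 by (intro mult_right_mono)
            then show ?thesis using n by linarith
          qed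
        qed
        then show ?thesis using n nb by simp
      qed
    qed
    have bb: "(\<lambda>y. indicat_real (ball x (\<eta> / 2)) y) \<in> borel_measurable (mu_nu \<nu>)"
      by (intro borel_measurable_mu_nu borel_measurable_indicator) auto
    have i1: "integrable (mu_nu \<nu>) (\<lambda>y. indicator (ball x (\<eta> / 2)) y * (\<bar>K y\<bar> * G y))"
      by (rule integrable_mu_nu_bounded[OF iKG bb, of 1]) (simp add: indicator_def)
    have i3: "integrable (mu_nu \<nu>) (\<lambda>y. indicator {..<\<rho>} y * W y * G y)"
    proof (rule integrable_mu_nu_bounded[OF iG, of _ "R powr (- \<delta>) * R powr \<beta>"])
      show "(\<lambda>y. indicator {..<\<rho>} y * W y) \<in> borel_measurable (mu_nu \<nu>)"
        unfolding W_def by (intro borel_measurable_mu_nu) auto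
      fix y :: real assume y: "0 < y" "y < 1"
      have "R / (1 + y * R) \<le> R" using y R by (simp add: divide_le_eq mult_le_cancel_left1)
      then have "(R / (1 + y * R)) powr \<beta> \<le> R powr \<beta>" using y R by (intro powr_mono2) (auto simp: \<beta>_def)
      then have "W y \<le> R powr (- \<delta>) * R powr \<beta>" unfolding W_def by (intro mult_left_mono) auto
      then show "\<bar>indicator {..<\<rho>} y * W y\<bar> \<le> R powr (- \<delta>) * R powr \<beta>" using W0[of y] by (simp add: indicator_def)
    qed
    have T1: "(\<integral>y. indicator (ball x (\<eta> / 2)) y * (\<bar>K y\<bar> * G y) \<partial>mu_nu \<nu>) \<le> e / 8"
    proof -
      have sKF: "set_integrable lebesgue (ball x (\<eta> / 2)) (\<lambda>y. \<bar>K y\<bar> * G y)"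
        by (rule set_integrable_of_mu_nu[OF iKG x0(1)]) (use ball_sub ball_sub2 in auto)
      have m1: "(\<lambda>y. indicator (ball x (\<eta> / 2)) y * (\<bar>K y\<bar> * G y)) \<in> borel_measurable (mu_nu \<nu>)" using i1 by simp
      have "(\<integral>y. indicator (ball x (\<eta> / 2)) y * (\<bar>K y\<bar> * G y) \<partial>mu_nu \<nu>) =
          (LINT y:{0<..<1}|lebesgue. y powr (2 * \<nu> + 1) * (indicator (ball x (\<eta> / 2)) y * (\<bar>K y\<bar> * G y)))"
        by (rule integral_mu_nu[OF m1])
      also have "\<dots> \<le> (LINT y|lebesgue. cx * (indicator (ball x (\<eta> / 2)) y *\<^sub>R (\<bar>K y\<bar> * G y)))"
        unfolding set_lebesgue_integral_def
      proof (rule integral_mono)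
        show "integrable lebesgue (\<lambda>y. indicat_real {0<..<1} y *\<^sub>R (y powr (2 * \<nu> + 1) * (indicator (ball x (\<eta> / 2)) y * (\<bar>K y\<bar> * G y))))"
          using integrable_mu_nu_iff[OF m1] i1 by (simp add: set_integrable_def)
        show "integrable lebesgue (\<lambda>y. cx * (indicator (ball x (\<eta> / 2)) y *\<^sub>R (\<bar>K y\<bar> * G y)))"
          using sKF by (simp add: set_integrable_def)
        fix y
        show "indicat_real {0<..<1} y *\<^sub>R (y powr (2 * \<nu> + 1) * (indicator (ball x (\<eta> / 2)) y * (\<bar>K y\<bar> * G y))) \<le> cx * (indicator (ball x (\<eta> / 2)) y *\<^sub>R (\<bar>K y\<bar> * G y))"
        proof (cases "y \<in> ball x (\<eta> / 2)")
          case True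
          then have y: "x0 \<le> y" "y < 1" using subsetD[OF ball_sub subsetD[OF ball_sub2 True]] by simp_all
          then have "y powr (2 * \<nu> + 1) \<le> cx" unfolding cx_def using x0 by (intro powr_le_lower_end(1)) auto
          then have "y powr (2 * \<nu> + 1) * (\<bar>K y\<bar> * G y) \<le> cx * (\<bar>K y\<bar> * G y)" using G0 by (intro mult_right_mono) auto
          then show ?thesis using True y x0 by simp
        qed simp
      qed
      also have "\<dots> = cx * (LINT y:ball x (\<eta> / 2)|lebesgue. \<bar>K y\<bar> * G y)" by (simp add: set_lebesgue_integral_def)
      also have "\<dots> \<le> cx * (C * 2 powr (1 + \<delta>) / (1 - 2 powr (- \<delta>)) * \<kappa>)"
      proof (rule mult_left_mono[OF approximate_identity_bound])
        show "set_integrable lebesgue (ball x \<eta>) G"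
          by (rule set_integrable_of_mu_nu[OF iG x0(1)]) (use ball_sub in auto)
        show "(LINT y:ball x r|lebesgue. G y) \<le> \<kappa> * r" if "0 < r" "r < \<eta>" for r using eta0(2)[of r] that \<eta> by simp
        show "\<bar>K y\<bar> \<le> C * R" if "y \<in> ball x (\<eta> / 2)" for y
        proof -
          have "x0 \<le> y" "y \<le> 1" using that ball_sub ball_sub2 by fastforce+
          then have "\<bar>K y\<bar> \<le> C1 * R" unfolding K_def using C1(2)[OF R(1), of x y] x x0 by simp
          also have "\<dots> \<le> C * R" using C R by (intro mult_right_mono) auto
          finally show ?thesis .
        qed
        show "\<bar>K y\<bar> \<le> C * R powr (- \<delta>) * \<bar>x - y\<bar> powr (- 1 - \<delta>)" if "y \<in> ball x (\<eta> / 2)" "1 / R \<le> \<bar>x - y\<bar>" for y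
        proof -
          have "x0 \<le> y" "y \<le> 1" using that(1) ball_sub ball_sub2 by fastforce+
          then show ?thesis using nearK that(2) by blast
        qed
      qed (use G0 \<kappa> R R\<eta> \<eta> \<delta> C sKF cx in auto)
      also have "\<dots> = cx * D * \<kappa>" by (simp add: D_def)
      also have "\<dots> = e / 8" using cx D by (simp add: \<kappa>_def)
      finally show ?thesis .
    qed
    have "(\<integral>y. \<bar>K y\<bar> * G y \<partial>mu_nu \<nu>) \<le> (\<integral>y. indicator (ball x (\<eta> / 2)) y * (\<bar>K y\<bar> * G y) + R powr (- \<delta>) * c' * G y + C3 * (indicator {..<\<rho>} y * W y * G y) \<partial>mu_nu \<nu>)"
    proof (rule integral_mono_AE)
      show "AE y in mu_nu \<nu>. \<bar>K y\<bar> * G y \<le> indicator (ball x (\<eta> / 2)) y * (\<bar>K y\<bar> * G y) + R powr (- \<delta>) * c' * G y + C3 * (indicator {..<\<rho>} y * W y * G y)"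
        by (rule AE_I2) (use pw in auto)
    qed (intro iKG Bochner_Integration.integrable_add i1 integrable_mult_right iG i3)+
    also have "\<dots> = (\<integral>y. indicator (ball x (\<eta> / 2)) y * (\<bar>K y\<bar> * G y) \<partial>mu_nu \<nu>) + R powr (- \<delta>) * c' * I + C3 * (\<integral>y. indicator {..<\<rho>} y * W y * G y \<partial>mu_nu \<nu>)"
      using i1 i3 iG by (subst Bochner_Integration.integral_add; simp add: I_def)+
    \<comment> \<open>Ball, middle region and neighbourhood of 0; a fourth e/8 goes to the defect of
      the mass.\<close>
    also have "\<dots> \<le> e / 8 + e / 8 + e / 8"
    proof (intro add_mono T1)
      show "R powr (- \<delta>) * c' * I \<le> e / 8" using elim(1) by (simp add: mult.assoc)
      have "C3 * (\<integral>y. indicator {..<\<rho>} y * W y * G y \<partial>mu_nu \<nu>) \<le> C3 * (e / (8 * C3))"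
        using \<rho>(2)[OF R(2)] C3(1) unfolding W_def by (intro mult_left_mono) auto
      then show "C3 * (\<integral>y. indicator {..<\<rho>} y * W y * G y \<partial>mu_nu \<nu>) \<le> e / 8" using C3 by simp
    qed
    finally have KG: "(\<integral>y. \<bar>K y\<bar> * G y \<partial>mu_nu \<nu>) \<le> 3 * (e / 8)" by simp
    have SR: "(\<integral>y. K y \<partial>mu_nu \<nu>) = S R" unfolding K_def S_def by (rule bkernel_integral[OF nu R(5) x(1)])
    have "(\<integral>y. K y * (f y - f x) \<partial>mu_nu \<nu>) = bochner_riesz \<nu> \<delta> R f x - f x * S R"
    proof -
      have "(\<integral>y. K y * (f y - f x) \<partial>mu_nu \<nu>) = (\<integral>y. K y * f y - f x * K y \<partial>mu_nu \<nu>)" by (simp add: algebra_simps)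
      also have "\<dots> = (\<integral>y. K y * f y \<partial>mu_nu \<nu>) - f x * (\<integral>y. K y \<partial>mu_nu \<nu>)" using iKf iK1 by simp
      finally show ?thesis using SR bochner_riesz_kernel(2)[OF nu R(5) x(1) f] by (simp add: K_def)
    qed
    moreover have "\<bar>\<integral>y. K y * (f y - f x) \<partial>mu_nu \<nu>\<bar> \<le> (\<integral>y. \<bar>K y\<bar> * G y \<partial>mu_nu \<nu>)"
      using integral_norm_bound[of "mu_nu \<nu>" "\<lambda>y. K y * (f y - f x)"] by (simp add: G_def abs_mult)
    moreover have "bochner_riesz \<nu> \<delta> R f x - f x = (bochner_riesz \<nu> \<delta> R f x - f x * S R) + f x * (S R - 1)" by (simp add: algebra_simps)
    moreover have "\<bar>f x * (S R - 1)\<bar> < e / 8" using elim(2) by (simp add: abs_mult)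
    ultimately show ?case using KG e unfolding dist_real_def by linarith
  qed
qed

section \<open>Smallness of the weighted error near the origin, uniformly in R\<close>

lemma mu_nu_small_near_0:
  assumes G: "integrable (mu_nu \<nu>) (G :: real \<Rightarrow> real)" and e: "e > 0"
  shows "\<exists>\<rho>>0. (\<integral>y. indicator {..<\<rho>} y * G y \<partial>mu_nu \<nu>) < e"
proof -
  have "(\<lambda>n. \<integral>y. indicator {..<1 / real (Suc n)} y * G y \<partial>mu_nu \<nu>) \<longlonglongrightarrow> (\<integral>y. 0 \<partial>mu_nu \<nu>)"
  proof (rule integral_dominated_convergence[where w = "\<lambda>y. \<bar>G y\<bar>"])
    show "(\<lambda>y. indicator {..<1 / real (Suc n)} y * G y) \<in> borel_measurable (mu_nu \<nu>)" for n
      using borel_measurable_mu_nu[of "indicator {..<1 / real (Suc n)}" \<nu>] by (intro borel_measurable_times borel_measurable_integrable[OF G]) auto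
    show "AE y in mu_nu \<nu>. (\<lambda>n. indicator {..<1 / real (Suc n)} y * G y) \<longlonglongrightarrow> 0"
    proof (rule AE_I2)
      fix y assume "y \<in> space (mu_nu \<nu>)"
      then have y: "y > 0" by simp
      have "(\<lambda>n. 1 / real (Suc n)) \<longlonglongrightarrow> 0" by real_asymp
      then have "\<forall>\<^sub>F n in sequentially. 1 / real (Suc n) < y" using y by (rule order_tendstoD(2))
      then have "\<forall>\<^sub>F n in sequentially. indicator {..<1 / real (Suc n)} y * G y = 0" by eventually_elim simp
      then show "(\<lambda>n. indicator {..<1 / real (Suc n)} y * G y) \<longlonglongrightarrow> 0" by (rule tendsto_eventually)
    qed
  qed (use G in \<open>auto simp: indicator_def\<close>)
  then have "\<forall>\<^sub>F n in sequentially. (\<integral>y. indicator {..<1 / real (Suc n)} y * G y \<partial>mu_nu \<nu>) < e"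
    using e by (intro order_tendstoD(2)) auto
  then obtain n where "(\<integral>y. indicator {..<1 / real (Suc n)} y * G y \<partial>mu_nu \<nu>) < e" by (auto simp: eventually_sequentially)
  then show ?thesis by (intro exI[of _ "1 / real (Suc n)"]) auto
qed

text \<open>For \<beta> \<le> \<delta> and R \<ge> 1 the weight is at most R^(\<beta>-\<delta>)
  \<le> 1, so absolute continuity of the integral of G suffices.\<close>

lemma weighted_near_0_supercritical:
  assumes \<delta>: "\<beta> \<le> \<delta>" "0 \<le> \<beta>" and G: "integrable (mu_nu \<nu>) G" "\<And>y. 0 \<le> G y" and e: "e > 0"
  shows "\<exists>\<rho> R1. 0 < \<rho> \<and> (\<forall>R\<ge>R1. (\<integral>y. indicator {..<\<rho>} y * (R powr (- \<delta>) * (R / (1 + y * R)) powr \<beta>) * G y \<partial>mu_nu \<nu>) \<le> e)"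
proof -
  obtain \<rho> where \<rho>: "\<rho> > 0" "(\<integral>y. indicator {..<\<rho>} y * G y \<partial>mu_nu \<nu>) < e"
    using mu_nu_small_near_0[OF G(1) e] by blast
  have "(\<integral>y. indicator {..<\<rho>} y * (R powr (- \<delta>) * (R / (1 + y * R)) powr \<beta>) * G y \<partial>mu_nu \<nu>) \<le> e" if R: "R \<ge> 1" for R
  proof -
    have w: "R powr (- \<delta>) * (R / (1 + y * R)) powr \<beta> \<le> 1" if y: "0 < y" "y < 1" for y
    proof -
      have "R / (1 + y * R) \<le> R" using y R by (simp add: divide_le_eq mult_le_cancel_left1)
      then have "(R / (1 + y * R)) powr \<beta> \<le> R powr \<beta>" using y R \<delta> by (intro powr_mono2) auto
      then have "R powr (- \<delta>) * (R / (1 + y * R)) powr \<beta> \<le> R powr (- \<delta>) * R powr \<beta>" by (intro mult_left_mono) auto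
      also have "\<dots> = R powr (\<beta> - \<delta>)" by (simp add: add.commute flip: powr_add)
      also have "\<dots> \<le> R powr 0" using R \<delta> by (intro powr_mono) auto
      finally show ?thesis using R by simp
    qed
    have m: "(\<lambda>y. indicat_real {..<\<rho>} y * (R powr (- \<delta>) * (R / (1 + y * R)) powr \<beta>)) \<in> borel_measurable (mu_nu \<nu>)"
      by (intro borel_measurable_mu_nu) auto
    have m2: "indicat_real {..<\<rho>} \<in> borel_measurable (mu_nu \<nu>)" by (intro borel_measurable_mu_nu) auto
    have "(\<integral>y. indicator {..<\<rho>} y * (R powr (- \<delta>) * (R / (1 + y * R)) powr \<beta>) * G y \<partial>mu_nu \<nu>) \<le> (\<integral>y. indicator {..<\<rho>} y * G y \<partial>mu_nu \<nu>)"
    proof (rule integral_mono_AE)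
      show "integrable (mu_nu \<nu>) (\<lambda>y. indicator {..<\<rho>} y * (R powr (- \<delta>) * (R / (1 + y * R)) powr \<beta>) * G y)"
        by (rule integrable_mu_nu_bounded[OF G(1) m, of 1]) (use w in \<open>auto simp: indicator_def\<close>)
      show "integrable (mu_nu \<nu>) (\<lambda>y. indicator {..<\<rho>} y * G y)"
        by (rule integrable_mu_nu_bounded[OF G(1) m2, of 1]) (auto simp: indicator_def)
      show "AE y in mu_nu \<nu>. indicator {..<\<rho>} y * (R powr (- \<delta>) * (R / (1 + y * R)) powr \<beta>) * G y \<le> indicator {..<\<rho>} y * G y"
      proof (rule AE_I2)
        fix y assume "y \<in> space (mu_nu \<nu>)"
        then have "R powr (- \<delta>) * (R / (1 + y * R)) powr \<beta> * G y \<le> 1 * G y" using w[of y] G(2)[of y] by (intro mult_right_mono) auto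
        then show "indicator {..<\<rho>} y * (R powr (- \<delta>) * (R / (1 + y * R)) powr \<beta>) * G y \<le> indicator {..<\<rho>} y * G y"
          by (simp add: indicator_def)
      qed
    qed
    then show ?thesis using \<rho> by linarith
  qed
  then show ?thesis using \<rho> by blast
qed

text \<open>The substitution y = u/R shows scale invariance up to the cut at 1. The integral is
  split at y = 1/R: below, the quotient is at most R and the power integral gives 1/(2\<nu>+2);
  above, it is at most 1/y and the tail gives 1/E.\<close>

lemma weight_integral_bound:
  assumes nu: "\<nu> > -1" and E: "E > 0"
  shows "\<exists>C>0. \<forall>R\<ge>1. integrable (mu_nu \<nu>) (\<lambda>y. R powr (- E) * (R / (1 + y * R)) powr (2 * \<nu> + 2 + E)) \<and>
     (\<integral>y. R powr (- E) * (R / (1 + y * R)) powr (2 * \<nu> + 2 + E) \<partial>mu_nu \<nu>) \<le> C"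
proof -
  define \<sigma> where "\<sigma> = 2 * \<nu> + 2"
  have \<sigma>: "\<sigma> > 0" using nu by (simp add: \<sigma>_def)
  have "integrable (mu_nu \<nu>) (\<lambda>y. R powr (- E) * (R / (1 + y * R)) powr (\<sigma> + E)) \<and>
     (\<integral>y. R powr (- E) * (R / (1 + y * R)) powr (\<sigma> + E) \<partial>mu_nu \<nu>) \<le> 1 / \<sigma> + 1 / E" if R: "R \<ge> 1" for R
  proof
    define g where "g = (\<lambda>y. R powr (- E) * (R / (1 + y * R)) powr (\<sigma> + E))"
    have gR: "(R / (1 + y * R)) powr (\<sigma> + E) \<le> R powr (\<sigma> + E)" if "y \<ge> 0" for y
    proof -
      have "R / (1 + y * R) \<le> R" using that R by (simp add: divide_le_eq mult_le_cancel_left1 add_pos_nonneg)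
      then show ?thesis using that R \<sigma> E by (intro powr_mono2) auto
    qed
    have gm: "g \<in> borel_measurable (mu_nu \<nu>)" unfolding g_def by (intro borel_measurable_mu_nu) auto
    have "\<bar>g y\<bar> \<le> R powr (- E) * R powr (\<sigma> + E)" if "0 < y" "y < 1" for y
      unfolding g_def abs_mult using gR[of y] that by (intro mult_mono) auto
    from integrable_mu_nu_bounded[OF mu_nu_finite[OF nu, of 1] gm this]
    have ig: "integrable (mu_nu \<nu>) g" by simp
    then show "integrable (mu_nu \<nu>) (\<lambda>y. R powr (- E) * (R / (1 + y * R)) powr (\<sigma> + E))" by (simp add: g_def)
    define h where "h = (\<lambda>y. y powr (2 * \<nu> + 1) * g y)"
    have sh: "set_integrable lebesgue {0<..<1} h" using ig integrable_mu_nu_iff[OF gm] by (simp add: h_def)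
    have h01: "h integrable_on {0..1}"
      using set_lebesgue_integral_eq_integral(1)[OF sh] by (simp add: integrable_on_open_interval_real)
    have "(\<integral>y. g y \<partial>mu_nu \<nu>) = integral {0..1} h"
      unfolding integral_mu_nu[OF gm] h_def[symmetric]
      using set_lebesgue_integral_eq_integral(2)[OF sh] by (simp add: integral_open_interval_real h_def)
    also have "\<dots> = integral {0..1/R} h + integral {1/R..1} h"
      using R by (intro Henstock_Kurzweil_Integration.integral_combine[symmetric] h01) auto
    also have "\<dots> \<le> 1 / \<sigma> + 1 / E"
    proof (rule add_mono)
      have hi: "((\<lambda>y. R powr \<sigma> * y powr (2 * \<nu> + 1)) has_integral R powr \<sigma> * ((1 / R) powr (2 * \<nu> + 1 + 1) / (2 * \<nu> + 1 + 1))) {0..1/R}"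
        using R nu by (intro has_integral_mult_right has_integral_powr_from_0) auto
      have "integral {0..1/R} h \<le> integral {0..1/R} (\<lambda>y. R powr \<sigma> * y powr (2 * \<nu> + 1))"
      proof (rule integral_le)
        show "h integrable_on {0..1/R}" by (rule integrable_on_subinterval[OF h01]) (use R in auto)
        show "(\<lambda>y. R powr \<sigma> * y powr (2 * \<nu> + 1)) integrable_on {0..1/R}" using hi by blast
        fix y assume y: "y \<in> {0..1/R}"
        have "g y \<le> R powr (- E) * R powr (\<sigma> + E)" unfolding g_def using gR[of y] y by (intro mult_left_mono) auto
        also have "\<dots> = R powr \<sigma>" by (simp flip: powr_add)
        finally have "y powr (2 * \<nu> + 1) * g y \<le> y powr (2 * \<nu> + 1) * R powr \<sigma>" by (intro mult_left_mono) auto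
        then show "h y \<le> R powr \<sigma> * y powr (2 * \<nu> + 1)" by (simp add: h_def mult.commute)
      qed
      also have "\<dots> = R powr \<sigma> * ((1 / R) powr \<sigma> / \<sigma>)" using integral_unique[OF hi] by (simp add: \<sigma>_def add.assoc)
      also have "\<dots> = 1 / \<sigma>" using R by (simp add: powr_divide)
      finally show "integral {0..1/R} h \<le> 1 / \<sigma>" .
    next
      have hi: "((\<lambda>y. R powr (- E) * y powr (- E - 1)) has_integral (- (R powr (- E) * 1 powr (- E) / E) - - (R powr (- E) * (1 / R) powr (- E) / E))) {1/R..1}"
      proof (rule fundamental_theorem_of_calculus)
        fix y assume "y \<in> {1/R..1}"
        then have y: "y > 0" using R by (auto intro: less_le_trans[of 0 "1/R"])
        have "((\<lambda>y. - (R powr (- E) * y powr (- E) / E)) has_real_derivative - (R powr (- E) * (- E * y powr (- E - 1)) / E)) (at y)"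
          by (intro DERIV_minus DERIV_cdivide DERIV_cmult has_real_derivative_powr y)
        then have "((\<lambda>y. - (R powr (- E) * y powr (- E) / E)) has_real_derivative R powr (- E) * y powr (- E - 1)) (at y)"
          using E by simp
        then show "((\<lambda>y. - (R powr (- E) * y powr (- E) / E)) has_vector_derivative R powr (- E) * y powr (- E - 1)) (at y within {1/R..1})"
          by (rule has_vector_derivative_at_within[OF has_real_derivative_iff_has_vector_derivative[THEN iffD1]])
      qed (use R in simp)
      have "integral {1/R..1} h \<le> integral {1/R..1} (\<lambda>y. R powr (- E) * y powr (- E - 1))"
      proof (rule integral_le)
        show "h integrable_on {1/R..1}" by (rule integrable_on_subinterval[OF h01]) (use R in auto)
        show "(\<lambda>y. R powr (- E) * y powr (- E - 1)) integrable_on {1/R..1}" using hi by blast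
        fix y assume "y \<in> {1/R..1}"
        then have y: "y > 0" using R by (auto intro: less_le_trans[of 0 "1/R"])
        have "0 < 1 + y * R" using y R by (intro add_pos_pos) auto
        then have "R / (1 + y * R) \<le> 1 / y" using y by (simp add: divide_le_eq pos_le_divide_eq mult.commute)
        then have "(R / (1 + y * R)) powr (\<sigma> + E) \<le> (1 / y) powr (\<sigma> + E)" using y R \<sigma> E by (intro powr_mono2) auto
        also have "\<dots> = y powr (- (\<sigma> + E))" unfolding powr_minus_divide using y by (simp add: powr_divide)
        finally have "h y \<le> y powr (2 * \<nu> + 1) * (R powr (- E) * y powr (- (\<sigma> + E)))"
          unfolding h_def g_def by (intro mult_left_mono) auto
        also have "\<dots> = R powr (- E) * y powr ((2 * \<nu> + 1) + (- (\<sigma> + E)))" unfolding powr_add by simp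
        also have "(2 * \<nu> + 1) + (- (\<sigma> + E)) = - E - 1" by (simp add: \<sigma>_def)
        finally show "h y \<le> R powr (- E) * y powr (- E - 1)" .
      qed
      also have "\<dots> = (- (R powr (- E) / E) + R powr (- E) * (1 / R) powr (- E) / E)" using integral_unique[OF hi] by simp
      also have "R powr (- E) * (1 / R) powr (- E) = 1" using R by (simp add: powr_divide powr_minus_divide)
      also have "- (R powr (- E) / E) + 1 / E \<le> 1 / E" using E by simp
      finally show "integral {1/R..1} h \<le> 1 / E" .
    qed
    finally show "(\<integral>y. R powr (- E) * (R / (1 + y * R)) powr (\<sigma> + E) \<partial>mu_nu \<nu>) \<le> 1 / \<sigma> + 1 / E" by (simp add: g_def)
  qed
  then show ?thesis using \<sigma> E unfolding \<sigma>_def by (intro exI[of _ "1 / (2 * \<nu> + 2) + 1 / E"]) (auto intro!: add_pos_pos)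
qed

text \<open>Below the critical index, the exponent \<open>p\<^sub>0\<close> is the one for which the weight is uniformly bounded in the dual
  space; Young's inequality with a small parameter replaces Hoelder's.\<close>
lemma weighted_near_0_subcritical:
  assumes nu: "\<nu> > -1" and \<delta>: "0 < \<delta>" "\<delta> < \<nu> + 1/2" and G0: "\<And>y. 0 \<le> G y"
    and G: "integrable (mu_nu \<nu>) G" "integrable (mu_nu \<nu>) (\<lambda>y. G y powr (4 * (\<nu> + 1) / (2 * \<nu> + 3 + 2 * \<delta>)))" and e: "e > 0"
  shows "\<exists>\<rho> R1. 0 < \<rho> \<and> (\<forall>R\<ge>R1. (\<integral>y. indicator {..<\<rho>} y * (R powr (- \<delta>) * (R / (1 + y * R)) powr (\<nu> + 1/2)) * G y \<partial>mu_nu \<nu>) \<le> e)"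
proof -
  define \<beta> where "\<beta> = \<nu> + 1/2"
  define p where "p = 4 * (\<nu> + 1) / (2 * \<nu> + 3 + 2 * \<delta>)"
  \<comment> \<open>q = (2\<nu>+2)/(\<beta>-\<delta>) is the exponent that makes the q-th power of
    the weight scale invariant; p is its conjugate.\<close>
  define q where "q = 4 * (\<nu> + 1) / (2 * \<nu> + 1 - 2 * \<delta>)"
  have p1: "p > 1" using nu \<delta> by (simp add: p_def pos_less_divide_eq)
  have q1: "q > 1" using nu \<delta> by (simp add: q_def pos_less_divide_eq)
  have pq: "1 / p + 1 / q = 1"
  proof -
    have "1 / p + 1 / q = ((2 * \<nu> + 3 + 2 * \<delta>) + (2 * \<nu> + 1 - 2 * \<delta>)) / (4 * (\<nu> + 1))"
      unfolding p_def q_def add_divide_distrib[of "2 * \<nu> + 3 + 2 * \<delta>" "2 * \<nu> + 1 - 2 * \<delta>"]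
      by (simp only: divide_divide_eq_right mult_1_left)
    also have "\<dots> = 1" using nu by simp
    finally show ?thesis .
  qed
  define E where "E = \<delta> * q"
  have E: "E > 0" using \<delta> q1 by (simp add: E_def)
  have \<beta>q: "\<beta> * q = 2 * \<nu> + 2 + E"
  proof -
    have "(\<beta> - \<delta>) * q = 2 * \<nu> + 2" using \<delta> by (simp add: \<beta>_def q_def field_simps)
    then show ?thesis by (simp add: E_def algebra_simps)
  qed
  obtain Cq where Cq: "Cq > 0" "\<And>R. R \<ge> 1 \<Longrightarrow> integrable (mu_nu \<nu>) (\<lambda>y. R powr (- E) * (R / (1 + y * R)) powr (2 * \<nu> + 2 + E))"
     "\<And>R. R \<ge> 1 \<Longrightarrow> (\<integral>y. R powr (- E) * (R / (1 + y * R)) powr (2 * \<nu> + 2 + E) \<partial>mu_nu \<nu>) \<le> Cq"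
    using weight_integral_bound[OF nu E] by blast
  \<comment> \<open>Young's inequality is applied to \<theta>W and G/\<theta>. This \<theta> makes
    the first part at most e/2 uniformly in R; only then is \<rho> chosen to make the second one
    less than e/2.\<close>
  define \<theta> where "\<theta> = (e / (2 * Cq)) powr (1 / q)"
  have \<theta>: "\<theta> > 0" using e Cq by (simp add: \<theta>_def)
  have \<theta>q: "\<theta> powr q = e / (2 * Cq)" using e Cq q1 by (simp add: \<theta>_def powr_powr)
  have "e / 2 * \<theta> powr p > 0" using e \<theta> by simp
  then obtain \<rho> where \<rho>: "\<rho> > 0" "(\<integral>y. indicator {..<\<rho>} y * G y powr p \<partial>mu_nu \<nu>) < e / 2 * \<theta> powr p"
    using mu_nu_small_near_0[OF G(2)[folded p_def]] by blast
  have m2: "indicat_real {..<\<rho>} \<in> borel_measurable (mu_nu \<nu>)" by (intro borel_measurable_mu_nu) auto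
  have "(\<integral>y. indicator {..<\<rho>} y * (R powr (- \<delta>) * (R / (1 + y * R)) powr \<beta>) * G y \<partial>mu_nu \<nu>) \<le> e" if R: "R \<ge> 1" for R
  proof -
    define W where "W = (\<lambda>y. R powr (- \<delta>) * (R / (1 + y * R)) powr \<beta>)"
    define H where "H = (\<lambda>y. R powr (- E) * (R / (1 + y * R)) powr (2 * \<nu> + 2 + E))"
    have W0: "0 \<le> W y" for y by (simp add: W_def)
    have WH: "W y powr q = H y" for y
      using R by (simp add: W_def H_def powr_mult powr_powr \<beta>q E_def)
    have pw: "indicator {..<\<rho>} y * W y * G y \<le> \<theta> powr q * H y + (1 / \<theta> powr p) * (indicator {..<\<rho>} y * G y powr p)" if y: "0 < y" "y < 1" for y
    proof -
      have "(\<theta> * W y) * (G y / \<theta>) \<le> (\<theta> * W y) powr q / q + (G y / \<theta>) powr p / p"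
        using \<theta> W0 G0 pq by (intro Youngs_inequality p1 q1) (auto simp: add.commute)
      also have "\<dots> \<le> (\<theta> * W y) powr q / 1 + (G y / \<theta>) powr p / 1"
        using p1 q1 by (intro add_mono divide_left_mono) auto
      also have "\<dots> = \<theta> powr q * H y + (1 / \<theta> powr p) * G y powr p"
        using \<theta> W0 G0 by (simp add: powr_mult powr_divide WH)
      finally have 1: "W y * G y \<le> \<theta> powr q * H y + (1 / \<theta> powr p) * G y powr p" using \<theta> by simp
      have "0 \<le> \<theta> powr q * H y" by (simp add: H_def)
      then show ?thesis using 1 by (auto simp: indicator_def)
    qed
    have mW: "(\<lambda>y. indicator {..<\<rho>} y * W y) \<in> borel_measurable (mu_nu \<nu>)" unfolding W_def by (intro borel_measurable_mu_nu) auto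
    have iH: "integrable (mu_nu \<nu>) H" unfolding H_def by (rule Cq(2)[OF R])
    have iGp: "integrable (mu_nu \<nu>) (\<lambda>y. indicator {..<\<rho>} y * G y powr p)"
      by (rule integrable_mu_nu_bounded[OF G(2)[folded p_def] m2, of 1]) (auto simp: indicator_def)
    have "(\<integral>y. indicator {..<\<rho>} y * W y * G y \<partial>mu_nu \<nu>) \<le> (\<integral>y. \<theta> powr q * H y + (1 / \<theta> powr p) * (indicator {..<\<rho>} y * G y powr p) \<partial>mu_nu \<nu>)"
    proof (rule integral_mono_AE)
      show "integrable (mu_nu \<nu>) (\<lambda>y. indicator {..<\<rho>} y * W y * G y)"
      proof (rule integrable_mu_nu_bounded[OF G(1) mW])
        fix y :: real assume y: "0 < y" "y < 1"
        have "R / (1 + y * R) \<le> R" using y R by (simp add: divide_le_eq mult_le_cancel_left1)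
        then have "(R / (1 + y * R)) powr \<beta> \<le> R powr \<beta>" using y R \<delta> by (intro powr_mono2) (auto simp: \<beta>_def)
        then have "W y \<le> R powr (- \<delta>) * R powr \<beta>" unfolding W_def by (intro mult_left_mono) auto
        then show "\<bar>indicator {..<\<rho>} y * W y\<bar> \<le> R powr (- \<delta>) * R powr \<beta>" using W0[of y] by (simp add: indicator_def)
      qed
      show "AE y in mu_nu \<nu>. indicator {..<\<rho>} y * W y * G y \<le> \<theta> powr q * H y + (1 / \<theta> powr p) * (indicator {..<\<rho>} y * G y powr p)"
        by (rule AE_I2) (use pw in auto)
    qed (intro Bochner_Integration.integrable_add integrable_mult_right iH iGp)
    also have "\<dots> = \<theta> powr q * (\<integral>y. H y \<partial>mu_nu \<nu>) + (1 / \<theta> powr p) * (\<integral>y. indicator {..<\<rho>} y * G y powr p \<partial>mu_nu \<nu>)"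
      using iH iGp by (subst Bochner_Integration.integral_add) auto
    also have "\<dots> \<le> \<theta> powr q * Cq + (1 / \<theta> powr p) * (e / 2 * \<theta> powr p)"
      using Cq(3)[OF R] \<rho>(2) unfolding H_def by (intro add_mono mult_left_mono) auto
    also have "\<dots> = e" using Cq \<theta> by (simp add: \<theta>q)
    finally show ?thesis by (simp add: W_def)
  qed
  then show ?thesis using \<rho>(1) unfolding \<beta>_def by blast
qed

section \<open>Almost everywhere convergence for p at least p0\<close>

lemma in_Lp_mu_mono:
  assumes nu: "\<nu> > -1" and f: "in_Lp_mu \<nu> p f" and r: "0 < r" "r \<le> p"
  shows "integrable (mu_nu \<nu>) (\<lambda>x. \<bar>f x\<bar> powr r)"
proof (rule Bochner_Integration.integrable_bound[of _ "\<lambda>x. 1 + \<bar>f x\<bar> powr p"])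
  show "integrable (mu_nu \<nu>) (\<lambda>x. 1 + \<bar>f x\<bar> powr p)"
    using f by (intro Bochner_Integration.integrable_add mu_nu_finite nu) (simp add: in_Lp_mu_def)
  have [measurable]: "f \<in> borel_measurable (mu_nu \<nu>)" using f by (simp add: in_Lp_mu_def)
  show "(\<lambda>x. \<bar>f x\<bar> powr r) \<in> borel_measurable (mu_nu \<nu>)" by measurable
  have "t powr r \<le> 1 + t powr p" if "t \<ge> 0" for t :: real
  proof (cases "t \<le> 1")
    case True
    then have "t powr r \<le> 1" using that r by (intro powr_le1) auto
    then show ?thesis by (simp add: add_increasing2)
  next
    case False
    then have "t powr r \<le> t powr p" using r by (intro powr_mono) auto
    then show ?thesis by simp
  qed
  then show "AE x in mu_nu \<nu>. norm (\<bar>f x\<bar> powr r) \<le> norm (1 + \<bar>f x\<bar> powr p)" by (intro AE_I2) simp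
qed

lemma p0_ge_1: "\<nu> > -1 \<Longrightarrow> \<delta> > 0 \<Longrightarrow> 1 \<le> p0 \<nu> \<delta>"
  by (auto simp: p0_def pos_le_divide_eq)

lemma almost_everywhere_convergence:
  assumes nu: "\<nu> > -1" and \<delta>: "\<delta> > 0" and p: "p0 \<nu> \<delta> \<le> p" "1 \<le> p" and f: "in_Lp_mu \<nu> p f"
  shows "AE x in lebesgue_on {0<..<1}. ((\<lambda>R. bochner_riesz \<nu> \<delta> R f x) \<longlongrightarrow> f x) at_top"
proof -
  have fm: "f \<in> borel_measurable (mu_nu \<nu>)" using f by (simp add: in_Lp_mu_def)
  have f1: "integrable (mu_nu \<nu>) f"
    using in_Lp_mu_mono[OF nu f, of 1] p fm by (simp add: integrable_abs_iff)
  have conv: "((\<lambda>R. bochner_riesz \<nu> \<delta> R f x) \<longlongrightarrow> f x) at_top" if x: "0 < x" "x < 1" and lp: "lebesgue_point f x" for x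
  proof (rule convergence_at_lebesgue_point[OF nu \<delta> x f1 lp])
    fix e :: real assume e: "e > 0"
    define G where "G = (\<lambda>y. \<bar>f y - f x\<bar>)"
    have G1: "integrable (mu_nu \<nu>) G" unfolding G_def by (intro integrable_abs Bochner_Integration.integrable_diff f1 mu_nu_finite nu)
    have G0: "0 \<le> G y" for y by (simp add: G_def)
    show "\<exists>\<rho> R1. 0 < \<rho> \<and> (\<forall>R\<ge>R1. (\<integral>y. indicator {..<\<rho>} y * (R powr (- \<delta>) * (R / (1 + y * R)) powr max (\<nu> + 1/2) 0) * \<bar>f y - f x\<bar> \<partial>mu_nu \<nu>) \<le> e)"
    proof (cases "max (\<nu> + 1/2) 0 \<le> \<delta>")
      case True
      then show ?thesis using weighted_near_0_supercritical[OF True _ G1 G0 e] by (simp add: G_def)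
    next
      case False
      then have d: "\<delta> < \<nu> + 1/2" and m: "max (\<nu> + 1/2) 0 = \<nu> + 1/2" using \<delta> by (auto simp: max_def split: if_splits)
      \<comment> \<open>Here p0 \<le> p enters: the measure is finite, so f also lies in the space
        of exponent p0, the one dual to the weight.\<close>
      define r where "r = 4 * (\<nu> + 1) / (2 * \<nu> + 3 + 2 * \<delta>)"
      have r: "r = p0 \<nu> \<delta>" using d \<delta> by (simp add: p0_def r_def)
      have r1: "1 \<le> r" "r \<le> p" using r p p0_ge_1[OF nu \<delta>] by auto
      have "integrable (mu_nu \<nu>) (\<lambda>y. G y powr r)"
      proof (rule Bochner_Integration.integrable_bound[of _ "\<lambda>y. 2 powr r * (\<bar>f y\<bar> powr r + \<bar>f x\<bar> powr r)"])
        show "integrable (mu_nu \<nu>) (\<lambda>y. 2 powr r * (\<bar>f y\<bar> powr r + \<bar>f x\<bar> powr r))"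
          using r1 by (intro integrable_mult_right Bochner_Integration.integrable_add in_Lp_mu_mono[OF nu f] mu_nu_finite nu) auto
        show "(\<lambda>y. G y powr r) \<in> borel_measurable (mu_nu \<nu>)" unfolding G_def using fm by auto
        show "AE y in mu_nu \<nu>. norm (G y powr r) \<le> norm (2 powr r * (\<bar>f y\<bar> powr r + \<bar>f x\<bar> powr r))"
        proof (rule AE_I2)
          fix y
          define t where "t = max \<bar>f y\<bar> \<bar>f x\<bar>"
          have "G y powr r \<le> (2 * t) powr r" using r1 by (intro powr_mono2) (auto simp: G_def t_def)
          also have "\<dots> = 2 powr r * t powr r" by (simp add: powr_mult t_def)
          also have "\<dots> \<le> 2 powr r * (\<bar>f y\<bar> powr r + \<bar>f x\<bar> powr r)"
            by (intro mult_left_mono) (auto simp: t_def max_def)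
          finally show "norm (G y powr r) \<le> norm (2 powr r * (\<bar>f y\<bar> powr r + \<bar>f x\<bar> powr r))" by simp
        qed
      qed
      then show ?thesis unfolding m using weighted_near_0_subcritical[OF nu \<delta> d G0 G1 _ e] by (simp add: G_def r_def)
    qed
  qed
  \<comment> \<open>The density may degenerate at 0, so f need not be Lebesgue integrable up to 0;
    (0,1) is exhausted by intervals on which it is.\<close>
  have "AE x in lebesgue. \<forall>n::nat. x \<in> {1 / real (n + 2)<..<1 - 1 / real (n + 2)} \<longrightarrow> lebesgue_point f x"
  proof (subst AE_all_countable, intro allI)
    fix n :: nat
    have n: "1 / real (n + 2) > 0" by simp
    have "{1 / real (n + 2)..1 - 1 / real (n + 2)} \<subseteq> {1 / real (n + 2)..<1}"
    proof
      fix x assume "x \<in> {1 / real (n + 2)..1 - 1 / real (n + 2)}"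
      then have "1 / real (n + 2) \<le> x" "x \<le> 1 - 1 / real (n + 2)" by (simp_all only: atLeastAtMost_iff)
      with n have "1 / real (n + 2) \<le> x" "x < 1" by linarith+
      then show "x \<in> {1 / real (n + 2)..<1}" by (simp only: atLeastLessThan_iff)
    qed
    then have "set_integrable lebesgue {1 / real (n + 2)..1 - 1 / real (n + 2)} f"
      by (intro set_integrable_of_mu_nu[OF f1 n]) auto
    from AE_lebesgue_point[OF this] show "AE x in lebesgue. x \<in> {1 / real (n + 2)<..<1 - 1 / real (n + 2)} \<longrightarrow> lebesgue_point f x" .
  qed
  then have "AE x in lebesgue. x \<in> {0<..<1} \<longrightarrow> ((\<lambda>R. bochner_riesz \<nu> \<delta> R f x) \<longlongrightarrow> f x) at_top"
  proof eventually_elim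
    case (elim x)
    show ?case
    proof
      assume x: "x \<in> {0<..<1}"
      have "(\<lambda>n. 1 / real (n + 2)) \<longlonglongrightarrow> 0" by real_asymp
      then have "\<forall>\<^sub>F n in sequentially. 1 / real (n + 2) < min x (1 - x)" using x by (intro order_tendstoD(2)) auto
      then obtain n where "1 / real (n + 2) < min x (1 - x)" by (auto simp: eventually_sequentially)
      then have "x \<in> {1 / real (n + 2)<..<1 - 1 / real (n + 2)}" by auto
      then show "((\<lambda>R. bochner_riesz \<nu> \<delta> R f x) \<longlongrightarrow> f x) at_top" using elim conv x by auto
    qed
  qed
  then show ?thesis by (simp add: AE_restrict_space_iff)
qed

section \<open>A limitation theorem for Riesz means\<close>

lemma alternating_binomial_sum_Suc:
  fixes g :: "nat \<Rightarrow> real"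
  shows "(\<Sum>i\<le>Suc m. (-1) ^ i * real (Suc m choose i) * g i) = (\<Sum>i\<le>m. (-1) ^ i * real (m choose i) * (g i - g (Suc i)))"
proof -
  have 1: "(\<Sum>i\<le>Suc m. (-1) ^ i * real (m choose i) * g i) = (\<Sum>i\<le>m. (-1) ^ i * real (m choose i) * g i)"
    by simp
  have 2: "(\<Sum>i\<le>Suc m. (-1) ^ i * real (m choose i) * g i) = g 0 + (\<Sum>i\<le>m. (-1) ^ Suc i * real (m choose Suc i) * g (Suc i))"
    by (subst sum.atMost_Suc_shift) simp
  have 3: "(\<Sum>i\<le>Suc m. (-1) ^ i * real (Suc m choose i) * g i) = g 0 + (\<Sum>i\<le>m. (-1) ^ Suc i * real (Suc m choose Suc i) * g (Suc i))"
    by (subst sum.atMost_Suc_shift) simp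
  have 4: "(\<Sum>i\<le>m. (-1) ^ Suc i * real (Suc m choose Suc i) * g (Suc i)) =
      (\<Sum>i\<le>m. (-1) ^ Suc i * real (m choose Suc i) * g (Suc i)) - (\<Sum>i\<le>m. (-1) ^ i * real (m choose i) * g (Suc i))"
    unfolding sum_subtractf[symmetric] by (rule sum.cong) (auto simp: algebra_simps)
  show ?thesis unfolding right_diff_distrib sum_subtractf using 1 2 3 4 by linarith
qed

text \<open>Induction through G(x) - G(x - 1), followed by one application of the mean value
  theorem. The family G stands for a function together with its successive derivatives.\<close>

lemma finite_difference_mean_value:
  fixes G :: "nat \<Rightarrow> real \<Rightarrow> real"
  assumes "\<And>j x. j < m \<Longrightarrow> t - real m \<le> x \<Longrightarrow> (G j has_real_derivative G (Suc j) x) (at x)"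
  shows "\<exists>\<xi>\<ge>t - real m. (\<Sum>i\<le>m. (-1) ^ i * real (m choose i) * G 0 (t - real i)) = G m \<xi>"
  using assms
proof (induction m arbitrary: G)
  case 0
  then show ?case by (intro exI[of _ t]) auto
next
  case (Suc m)
  define H where "H = (\<lambda>j x. G j x - G j (x - 1))"
  have "(H j has_real_derivative H (Suc j) x) (at x)" if "j < m" "t - real m \<le> x" for j x
  proof -
    have 1: "(G j has_real_derivative G (Suc j) x) (at x)" using that by (intro Suc.prems) auto
    have "(G j has_real_derivative G (Suc j) (x + - 1)) (at (x + - 1))" using that by (intro Suc.prems) auto
    then have "((\<lambda>x. G j (x + - 1)) has_real_derivative G (Suc j) (x + - 1)) (at x)" by (simp only: DERIV_shift)
    with 1 show ?thesis unfolding H_def by (auto intro: DERIV_diff)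
  qed
  from Suc.IH[of H, OF this] obtain \<xi> where \<xi>: "t - real m \<le> \<xi>"
    "(\<Sum>i\<le>m. (-1) ^ i * real (m choose i) * H 0 (t - real i)) = H m \<xi>" by auto
  have "\<exists>\<zeta>. \<xi> - 1 < \<zeta> \<and> \<zeta> < \<xi> \<and> G m \<xi> - G m (\<xi> - 1) = (\<xi> - (\<xi> - 1)) * G (Suc m) \<zeta>"
    by (rule MVT2) (use \<xi> in \<open>auto intro!: Suc.prems\<close>)
  then obtain \<zeta> where \<zeta>: "\<xi> - 1 < \<zeta>" "H m \<xi> = G (Suc m) \<zeta>" by (auto simp: H_def)
  have "(\<Sum>i\<le>Suc m. (-1) ^ i * real (Suc m choose i) * G 0 (t - real i)) = (\<Sum>i\<le>m. (-1) ^ i * real (m choose i) * H 0 (t - real i))"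
    unfolding alternating_binomial_sum_Suc H_def by (rule sum.cong) (auto simp: algebra_simps)
  then show ?case using \<xi> \<zeta> by (intro exI[of _ \<zeta>]) auto
qed

text \<open>An unnormalised B-spline of real degree r: the m-th backward difference of the truncated
  power.\<close>

definition power_spline :: "real \<Rightarrow> nat \<Rightarrow> real \<Rightarrow> real" where
  "power_spline r m t = (\<Sum>i\<le>m. (-1) ^ i * real (m choose i) * max 0 (t - real i) powr r)"

lemma power_spline_mean_value:
  assumes t: "real m < t"
  shows "\<exists>\<xi>\<ge>t - real m. power_spline r m t = (\<Prod>l<m. r - real l) * \<xi> powr (r - real m)"
proof -
  define G where "G = (\<lambda>j x. (\<Prod>l<j. r - real l) * x powr (r - real j))"
  have "(G j has_real_derivative G (Suc j) x) (at x)" if "t - real m \<le> x" for j x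
  proof -
    have x: "x > 0" using that t by simp
    have e: "r - real (Suc j) = r - real j - 1" by simp
    have "((\<lambda>x. (\<Prod>l<j. r - real l) * x powr (r - real j)) has_real_derivative (\<Prod>l<j. r - real l) * ((r - real j) * x powr (r - real j - 1))) (at x)"
      by (intro DERIV_cmult has_real_derivative_powr x)
    then show ?thesis unfolding G_def e prod.lessThan_Suc mult.assoc .
  qed
  then obtain \<xi> where "t - real m \<le> \<xi>" "(\<Sum>i\<le>m. (-1) ^ i * real (m choose i) * G 0 (t - real i)) = G m \<xi>"
    using finite_difference_mean_value[of m t G] by blast
  moreover have "(\<Sum>i\<le>m. (-1) ^ i * real (m choose i) * G 0 (t - real i)) = power_spline r m t"
    unfolding power_spline_def by (rule sum.cong) (use t in \<open>auto simp: G_def max_def\<close>)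
  ultimately show ?thesis by (auto simp: G_def)
qed

text \<open>Beyond m no truncation acts, and m-th differences annihilate polynomials of degree below
  m.\<close>

lemma power_spline_polynomial:
  assumes "real m < t" "k < m"
  shows "power_spline (real k) m t = 0"
proof -
  have "(\<Prod>l<m. real k - real l) = 0" using assms(2) by (intro prod_zero) auto
  then show ?thesis using power_spline_mean_value[OF assms(1), of "real k"] by auto
qed

lemma power_spline_1: "power_spline r m 1 = 1"
proof -
  have "power_spline r m 1 = (\<Sum>i\<le>m. if i = 0 then 1 else 0)"
    unfolding power_spline_def by (rule sum.cong) (auto simp: max_def)
  then show ?thesis by simp
qed

lemma continuous_on_power_spline:
  assumes "r > 0" shows "continuous_on S (power_spline r m)"
  unfolding power_spline_def[abs_def] using assms by (intro continuous_intros continuous_on_powr') auto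

text \<open>By the mean value formula the spline decays like t^(r-m), and r + 2 \<le> m makes this
  an integrable t^(-2).\<close>

lemma power_spline_integral_bound:
  assumes r: "r > 0" and m: "r + 2 \<le> real m"
  shows "\<exists>C>0. \<forall>N\<ge>0. integral {0..N} (\<lambda>t. \<bar>power_spline r m t\<bar>) \<le> C"
proof -
  have "compact (power_spline r m ` {0..real m + 1})"
    by (intro compact_continuous_image continuous_on_power_spline r) auto
  then obtain A where A: "A > 0" "\<And>x. x \<in> power_spline r m ` {0..real m + 1} \<Longrightarrow> norm x \<le> A"
    using compact_imp_bounded bounded_pos by metis
  define D where "D = \<bar>\<Prod>l<m. r - real l\<bar>"
  define E where "E = (A + D) * (real m + 2)\<^sup>2"
  have D: "D \<ge> 0" by (simp add: D_def)
  have E: "E > 0" unfolding E_def using A D by (intro mult_pos_pos add_pos_nonneg) auto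
  have bd: "\<bar>power_spline r m t\<bar> \<le> E / (1 + t)\<^sup>2" if t: "0 \<le> t" for t
  proof (cases "t \<le> real m + 1")
    case True
    then have "\<bar>power_spline r m t\<bar> \<le> A" using A(2)[of "power_spline r m t"] t by auto
    moreover have "A * (1 + t)\<^sup>2 \<le> (A + D) * (real m + 2)\<^sup>2"
      using True t A D by (intro mult_mono power_mono) auto
    then have "A \<le> E / (1 + t)\<^sup>2" using t by (simp add: E_def pos_le_divide_eq)
    ultimately show ?thesis by linarith
  next
    case False
    then obtain \<xi> where \<xi>: "t - real m \<le> \<xi>" "power_spline r m t = (\<Prod>l<m. r - real l) * \<xi> powr (r - real m)"
      using power_spline_mean_value[of m t r] by auto
    define u where "u = t - real m"
    have u: "u \<ge> 1" "u \<le> \<xi>" using False \<xi> by (auto simp: u_def)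
    have "\<xi> powr (r - real m) \<le> \<xi> powr (- 2)" using u m by (intro powr_mono) auto
    also have "\<dots> \<le> u powr (- 2)" using u by (intro powr_mono2') auto
    also have "\<dots> = 1 / u\<^sup>2" using u by (simp add: powr_minus_divide)
    also have "\<dots> \<le> (real m + 2)\<^sup>2 / (1 + t)\<^sup>2"
    proof -
      have "real m * 1 \<le> real m * u" using u by (intro mult_left_mono) auto
      then have "1 + t \<le> (real m + 2) * u" using u(1) by (simp add: u_def[symmetric] algebra_simps) (simp add: u_def)
      then have "(1 + t)\<^sup>2 \<le> ((real m + 2) * u)\<^sup>2" using t by (intro power_mono) auto
      then show ?thesis using u t by (simp add: divide_simps power_mult_distrib mult.commute)
    qed
    finally have "\<bar>power_spline r m t\<bar> \<le> D * ((real m + 2)\<^sup>2 / (1 + t)\<^sup>2)"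
      unfolding \<xi>(2) abs_mult D_def by (intro mult_mono) auto
    also have "\<dots> \<le> E / (1 + t)\<^sup>2"
      unfolding E_def times_divide_eq_right using A D by (intro divide_right_mono mult_right_mono) auto
    finally show ?thesis .
  qed
  have "integral {0..N} (\<lambda>t. \<bar>power_spline r m t\<bar>) \<le> E" if N: "N \<ge> 0" for N
  proof -
    have hi: "((\<lambda>t. E / (1 + t)\<^sup>2) has_integral (- E / (1 + N)) - (- E / (1 + 0))) {0..N}"
    proof (rule fundamental_theorem_of_calculus)
      fix t assume "t \<in> {0..N}"
      then have "((\<lambda>t. - E / (1 + t)) has_real_derivative E / (1 + t)\<^sup>2) (at t within {0..N})"
        by (auto intro!: derivative_eq_intros simp: power2_eq_square)
      then show "((\<lambda>t. - E / (1 + t)) has_vector_derivative E / (1 + t)\<^sup>2) (at t within {0..N})"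
        by (simp add: has_real_derivative_iff_has_vector_derivative)
    qed (use N in simp)
    have "integral {0..N} (\<lambda>t. \<bar>power_spline r m t\<bar>) \<le> integral {0..N} (\<lambda>t. E / (1 + t)\<^sup>2)"
    proof (rule integral_le)
      show "(\<lambda>t. \<bar>power_spline r m t\<bar>) integrable_on {0..N}"
        by (intro integrable_continuous_real continuous_on_rabs continuous_on_power_spline r)
      show "(\<lambda>t. E / (1 + t)\<^sup>2) integrable_on {0..N}" using hi by blast
    qed (use bd in auto)
    also have "\<dots> = E - E / (1 + N)" using integral_unique[OF hi] by simp
    also have "\<dots> \<le> E" using E N by simp
    finally show ?thesis .
  qed
  then show ?thesis using E by blast
qed

text \<open>Semigroup law of fractional integration: truncated powers of exponents a and b convolve
  to one of exponent a + b + 1, with a Beta constant. The truncations also cover u \<ge> \<tau>,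
  where both sides are 0.\<close>

lemma has_integral_truncated_Beta:
  fixes a b u \<tau> N :: real
  assumes a: "a > 0" "b > 0" and u: "0 \<le> u" and N: "\<tau> \<le> N"
  shows "((\<lambda>t. max 0 (t - u) powr a * max 0 (\<tau> - t) powr b) has_integral Beta (a + 1) (b + 1) * max 0 (\<tau> - u) powr (a + b + 1)) {0..N}"
proof (cases "u < \<tau>")
  case True
  define L where "L = \<tau> - u"
  have L: "L > 0" using True by (simp add: L_def)
  define I where "I = Beta (a + 1) (b + 1)"
  have "((\<lambda>t. t powr a * (1 - t) powr b) has_integral I) (cbox 0 1)"
    using has_integral_Beta_real[of "a + 1" "b + 1"] a by (simp add: I_def)
  from has_integral_affinity[OF this, of "1 / L" "- u / L"] L
  have "((\<lambda>x. (x / L + - u / L) powr a * (1 - (x / L + - u / L)) powr b) has_integral L * I) ((\<lambda>x. L * x + u) ` {0..1})"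
    by simp
  moreover have "(\<lambda>x. L * x + u) ` {0..1} = {u..\<tau>}"
    using L by (simp add: image_affinity_atLeastAtMost L_def)
  ultimately have "((\<lambda>x. (x / L + - u / L) powr a * (1 - (x / L + - u / L)) powr b) has_integral L * I) {u..\<tau>}" by simp
  then have "((\<lambda>x. L powr (a + b) * ((x / L + - u / L) powr a * (1 - (x / L + - u / L)) powr b)) has_integral L powr (a + b) * (L * I)) {u..\<tau>}"
    by (rule has_integral_mult_right)
  then have "((\<lambda>t. max 0 (t - u) powr a * max 0 (\<tau> - t) powr b) has_integral L powr (a + b) * (L * I)) {u..\<tau>}"
  proof (rule has_integral_eq[rotated])
    fix x assume x: "x \<in> {u..\<tau>}"
    have 1: "x / L + - u / L = (x - u) / L" using L by (simp add: diff_divide_distrib)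
    have 2: "1 - (x - u) / L = (\<tau> - x) / L" using L by (simp add: L_def field_simps)
    show "L powr (a + b) * ((x / L + - u / L) powr a * (1 - (x / L + - u / L)) powr b) = max 0 (x - u) powr a * max 0 (\<tau> - x) powr b"
      unfolding 1 2 using x L by (simp add: powr_divide powr_add)
  qed
  then have "((\<lambda>t. max 0 (t - u) powr a * max 0 (\<tau> - t) powr b) has_integral L powr (a + b) * (L * I)) {0..N}"
    by (rule has_integral_on_superset) (use u N in \<open>auto simp: max_def\<close>)
  moreover have "L powr (a + b) * (L * I) = I * max 0 (\<tau> - u) powr (a + b + 1)"
    using L by (simp add: L_def[symmetric] powr_add)
  ultimately show ?thesis unfolding I_def by metis
next
  case False
  have "((\<lambda>t. max 0 (t - u) powr a * max 0 (\<tau> - t) powr b) has_integral 0) {0..N}"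
    by (rule has_integral_eq[OF _ has_integral_0]) (use False in \<open>auto simp: max_def\<close>)
  then show ?thesis using False by simp
qed

text \<open>Integration against the spline \<open>power_spline (k - \<delta> - 1) (k + 1)\<close> turns the truncated powers of exponent \<open>\<delta>\<close> into
  \<open>(k + 1)\<close>-st differences of truncated \<open>k\<close>-th powers, which vanish except at the point \<open>1\<close>.\<close>
lemma isolated_coefficient_bound:
  assumes \<delta>: "\<delta> > (0::real)"
  obtains k :: nat and C where "C > 0"
    "\<And>P (\<tau> :: real \<Rightarrow> real) c N M u. finite P \<Longrightarrow> u \<in> P \<Longrightarrow> \<tau> u = 1 \<Longrightarrow> (\<And>v. v \<in> P \<Longrightarrow> v \<noteq> u \<Longrightarrow> real k < \<tau> v) \<Longrightarrow>
       (\<And>v. v \<in> P \<Longrightarrow> \<tau> v \<le> N) \<Longrightarrow> (\<And>t. 0 \<le> t \<Longrightarrow> t < N \<Longrightarrow> \<bar>\<Sum>v\<in>P. c v * max 0 (\<tau> v - t) powr \<delta>\<bar> \<le> M) \<Longrightarrow> \<bar>c u\<bar> \<le> C * M"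
proof -
  \<comment> \<open>Large enough for r = k - \<delta> - 1 to be positive, while r + \<delta> + 1 = k
    is an integer, so that differences of order k + 1 annihilate the resulting k-th powers.\<close>
  define k where "k = nat \<lceil>\<delta>\<rceil> + 2"
  define r where "r = real k - \<delta> - 1"
  have k: "\<delta> + 2 \<le> real k" unfolding k_def using of_nat_ceiling[of \<delta>] by simp
  have r: "r > 0" "r + 2 \<le> real (k + 1)" using k \<delta> by (auto simp: r_def)
  obtain C0 where C0: "C0 > 0" "\<And>N. N \<ge> 0 \<Longrightarrow> integral {0..N} (\<lambda>t. \<bar>power_spline r (k + 1) t\<bar>) \<le> C0"
    using power_spline_integral_bound[OF r] by blast
  define B where "B = Beta (r + 1) (\<delta> + 1)"
  have B: "B > 0" unfolding B_def Beta_def using r \<delta> by (intro divide_pos_pos mult_pos_pos Gamma_real_pos) auto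
  show thesis
  \<comment> \<open>The gap demanded of the other points is k + 1, the order of the difference:
    \<open>power_spline_polynomial\<close> needs an argument beyond it.\<close>
  proof (rule that[of "C0 / B" "k + 1"])
    show "C0 / B > 0" using C0 B by simp
    fix P and \<tau> c :: "real \<Rightarrow> real" and N M u
    assume P: "finite P" "u \<in> P" "\<tau> u = 1" "\<And>v. v \<in> P \<Longrightarrow> v \<noteq> u \<Longrightarrow> real (k + 1) < \<tau> v" "\<And>v. v \<in> P \<Longrightarrow> \<tau> v \<le> N"
      and M: "\<And>t. 0 \<le> t \<Longrightarrow> t < N \<Longrightarrow> \<bar>\<Sum>v\<in>P. c v * max 0 (\<tau> v - t) powr \<delta>\<bar> \<le> M"
    define F where "F = (\<lambda>t. \<Sum>v\<in>P. c v * max 0 (\<tau> v - t) powr \<delta>)"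
    have N: "N \<ge> 1" using P(5)[OF P(2)] P(3) by simp
    have M0: "0 \<le> M" using M[of 0] N by linarith
    have FM: "\<bar>F t\<bar> \<le> M" if "0 \<le> t" "t \<le> N" for t
    proof (cases "t < N")
      case True then show ?thesis using M[OF that(1)] by (simp add: F_def)
    next
      case False
      then have "F t = 0" unfolding F_def using P(5) by (intro sum.neutral) (auto simp: max_def dest: P(5))
      then show ?thesis using M0 by simp
    qed
    have ex: "r + \<delta> + 1 = real k" by (simp add: r_def)
    have "((\<lambda>t. \<Sum>v\<in>P. c v * (\<Sum>i\<le>k + 1. (-1) ^ i * real ((k + 1) choose i) * (max 0 (t - real i) powr r * max 0 (\<tau> v - t) powr \<delta>))) has_integral
       (\<Sum>v\<in>P. c v * (\<Sum>i\<le>k + 1. (-1) ^ i * real ((k + 1) choose i) * (B * max 0 (\<tau> v - real i) powr (r + \<delta> + 1))))) {0..N}"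
      unfolding B_def by (intro has_integral_sum has_integral_mult_right has_integral_truncated_Beta P r \<delta>) auto
    moreover have "(\<Sum>i\<le>k + 1. (-1) ^ i * real ((k + 1) choose i) * (max 0 (t - real i) powr r * y)) = power_spline r (k + 1) t * y" for t y
      unfolding power_spline_def sum_distrib_right by (simp only: mult.assoc)
    moreover have "(\<Sum>i\<le>k + 1. (-1) ^ i * real ((k + 1) choose i) * (B * max 0 (y - real i) powr (r + \<delta> + 1))) = B * power_spline (real k) (k + 1) y" for y
      unfolding power_spline_def sum_distrib_left ex by (rule sum.cong) auto
    ultimately have "((\<lambda>t. \<Sum>v\<in>P. c v * (power_spline r (k + 1) t * max 0 (\<tau> v - t) powr \<delta>)) has_integral
       (\<Sum>v\<in>P. c v * (B * power_spline (real k) (k + 1) (\<tau> v)))) {0..N}" by simp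
    moreover have "(\<Sum>v\<in>P. c v * (power_spline r (k + 1) t * max 0 (\<tau> v - t) powr \<delta>)) = power_spline r (k + 1) t * F t" for t
      unfolding F_def sum_distrib_left by (rule sum.cong) auto
    moreover have "(\<Sum>v\<in>P. c v * (B * power_spline (real k) (k + 1) (\<tau> v))) = c u * B"
    proof -
      have "(\<Sum>v\<in>P. c v * (B * power_spline (real k) (k + 1) (\<tau> v))) = (\<Sum>v\<in>P. if v = u then c u * B else 0)"
        by (rule sum.cong) (use P(3,4) power_spline_polynomial[of "k + 1" _ k] in \<open>auto simp: power_spline_1\<close>)
      then show ?thesis using P by simp
    qed
    ultimately have hi: "((\<lambda>t. power_spline r (k + 1) t * F t) has_integral c u * B) {0..N}" by simp
    have "norm (integral {0..N} (\<lambda>t. power_spline r (k + 1) t * F t)) \<le> integral {0..N} (\<lambda>t. \<bar>power_spline r (k + 1) t\<bar> * M)"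
    proof (rule integral_norm_bound_integral)
      show "(\<lambda>t. power_spline r (k + 1) t * F t) integrable_on {0..N}" using hi by blast
      show "(\<lambda>t. \<bar>power_spline r (k + 1) t\<bar> * M) integrable_on {0..N}"
        by (intro integrable_continuous_real continuous_intros continuous_on_power_spline r)
      show "norm (power_spline r (k + 1) t * F t) \<le> \<bar>power_spline r (k + 1) t\<bar> * M" if "t \<in> {0..N}" for t
        using FM[of t] that by (auto simp: abs_mult intro!: mult_left_mono)
    qed
    also have "\<dots> = integral {0..N} (\<lambda>t. \<bar>power_spline r (k + 1) t\<bar>) * M" by simp
    also have "\<dots> \<le> C0 * M" using C0(2)[of N] N M0 by (intro mult_right_mono) auto
    finally have "\<bar>c u\<bar> * B \<le> C0 * M" using integral_unique[OF hi] B by (simp add: abs_mult)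
    then show "\<bar>c u\<bar> \<le> C0 / B * M" using B by (simp add: pos_le_divide_eq)
  qed
qed

text \<open>In the variable t with R^2 = a - ht the Riesz factors become (h/R^2)^\<delta> times
  truncated powers of \<tau> - t. For h of size s the zero s sits at \<tau> = 1 and, by separation,
  all smaller zeros sit beyond k. Undoing the scaling costs (a/h)^\<delta>, and a/h is of size
  s.\<close>

lemma riesz_limitation:
  assumes nu: "\<nu> > -1" and \<delta>: "\<delta> > 0"
  obtains C where "C > 0"
    "\<And>b M s. (\<And>R. R > 0 \<Longrightarrow> \<bar>\<Sum>u\<in>bzeros \<nu> \<inter> {..<R}. (1 - u\<^sup>2 / R\<^sup>2) powr \<delta> * b u\<bar> \<le> M) \<Longrightarrow> s \<in> bzeros \<nu> \<Longrightarrow> 1 \<le> s \<Longrightarrow> \<bar>b s\<bar> \<le> C * M * s powr \<delta>"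
proof (rule isolated_coefficient_bound[OF \<delta>])
  fix k :: nat and C :: real
  assume C: "C > 0"
    "\<And>P (\<tau> :: real \<Rightarrow> real) c N M u. finite P \<Longrightarrow> u \<in> P \<Longrightarrow> \<tau> u = 1 \<Longrightarrow> (\<And>v. v \<in> P \<Longrightarrow> v \<noteq> u \<Longrightarrow> real k < \<tau> v) \<Longrightarrow>
       (\<And>v. v \<in> P \<Longrightarrow> \<tau> v \<le> N) \<Longrightarrow> (\<And>t. 0 \<le> t \<Longrightarrow> t < N \<Longrightarrow> \<bar>\<Sum>v\<in>P. c v * max 0 (\<tau> v - t) powr \<delta>\<bar> \<le> M) \<Longrightarrow> \<bar>c u\<bar> \<le> C * M"
  obtain d where d: "d > 0" "\<And>s t. s \<in> bzeros \<nu> \<Longrightarrow> t \<in> bzeros \<nu> \<Longrightarrow> s < t \<Longrightarrow> d \<le> t - s" using bzeros_separated[OF nu] by blast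
  \<comment> \<open>The squares of s and of another zero differ by at least ds. For h = \<kappa>s
    this exceeds kh, and \<kappa> \<le> d keeps the zeros above s out of the sum.\<close>
  define \<kappa> where "\<kappa> = d / (real k + 1)"
  have \<kappa>: "\<kappa> > 0" "\<kappa> \<le> d" "real k * \<kappa> < d" using d by (auto simp: \<kappa>_def divide_simps)
  show thesis
  proof (rule that[of "C * ((1 + \<kappa>) / \<kappa>) powr \<delta>"])
    show "C * ((1 + \<kappa>) / \<kappa>) powr \<delta> > 0" using C \<kappa> by simp
    fix b :: "real \<Rightarrow> real" and M s
    assume bd: "\<And>R. R > 0 \<Longrightarrow> \<bar>\<Sum>u\<in>bzeros \<nu> \<inter> {..<R}. (1 - u\<^sup>2 / R\<^sup>2) powr \<delta> * b u\<bar> \<le> M"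
      and s: "s \<in> bzeros \<nu>" "1 \<le> s"
    have M0: "0 \<le> M" using bd[of 1] by linarith
    define h where "h = \<kappa> * s"
    define a where "a = s\<^sup>2 + h"
    have h: "h > 0" using \<kappa> s by (simp add: h_def)
    have a: "a > 0" using s h by (simp add: a_def add_nonneg_pos)
    define P where "P = bzeros \<nu> \<inter> {..<sqrt a}"
    define \<tau> where "\<tau> = (\<lambda>u. (a - u\<^sup>2) / h)"
    have fP: "finite P" unfolding P_def by (rule finite_subset[OF _ finite_bzeros_atMost[OF nu, of "sqrt a"]]) auto
    have "s < sqrt a" using h by (intro real_less_rsqrt) (simp add: a_def)
    then have sP: "s \<in> P" using s by (simp add: P_def)
    have far: "real k < \<tau> u" if u: "u \<in> P" "u \<noteq> s" for u
    proof -
      have u0: "u \<in> bzeros \<nu>" "0 < u" "u < sqrt a" using u by (auto simp: P_def bzeros_def)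
      have "u\<^sup>2 < (sqrt a)\<^sup>2" using u0 by (intro power_strict_mono) auto
      then have "u\<^sup>2 < a" using a by simp
      have "u < s"
      proof (rule ccontr)
        assume "\<not> u < s"
        then have su: "s < u" using u by simp
        then have "d * s \<le> (u - s) * (u + s)" using d(2)[OF s(1) u0(1) su] s d su by (intro mult_mono) auto
        also have "\<dots> = u\<^sup>2 - s\<^sup>2" by (simp add: algebra_simps power2_eq_square)
        finally have "s\<^sup>2 + d * s \<le> u\<^sup>2" by simp
        moreover have "\<kappa> * s \<le> d * s" using \<kappa> s by (intro mult_right_mono) auto
        ultimately show False using \<open>u\<^sup>2 < a\<close> by (simp add: a_def h_def)
      qed
      then have "d * s \<le> (s - u) * (s + u)" using d(2)[OF u0(1) s(1)] s d u0 by (intro mult_mono) auto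
      also have "\<dots> = s\<^sup>2 - u\<^sup>2" by (simp add: algebra_simps power2_eq_square)
      finally have "d * s \<le> a - u\<^sup>2" using h by (simp add: a_def)
      moreover have "real k * h < d * s" using mult_strict_right_mono[OF \<kappa>(3), of s] s by (simp add: h_def mult.assoc)
      ultimately show ?thesis using h by (simp add: \<tau>_def pos_less_divide_eq)
    qed
    have "\<bar>b s * h powr \<delta>\<bar> \<le> C * (M * a powr \<delta>)"
    proof (rule C(2)[OF fP sP, where \<tau> = \<tau> and c = "\<lambda>u. b u * h powr \<delta>" and N = "a / h"])
      show "\<tau> s = 1" using h by (simp add: \<tau>_def a_def)
      show "\<And>v. v \<in> P \<Longrightarrow> v \<noteq> s \<Longrightarrow> real k < \<tau> v" by (rule far)
      show "\<And>v. v \<in> P \<Longrightarrow> \<tau> v \<le> a / h" using h by (simp add: \<tau>_def divide_right_mono)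
      fix t assume t: "0 \<le> t" "t < a / h"
      define R where "R = sqrt (a - h * t)"
      have "h * t < a" using t h by (simp add: pos_less_divide_eq mult.commute)
      then have R: "R > 0" "R\<^sup>2 = a - h * t" by (auto simp: R_def)
      have Ra: "R \<le> sqrt a" using t h by (simp add: R_def)
      have "(\<Sum>v\<in>P. b v * h powr \<delta> * max 0 (\<tau> v - t) powr \<delta>) = (\<Sum>v\<in>P. if v < R then R\<^sup>2 powr \<delta> * ((1 - v\<^sup>2 / R\<^sup>2) powr \<delta> * b v) else 0)"
      proof (rule sum.cong[OF refl])
        fix v assume "v \<in> P"
        then have v: "v > 0" by (auto simp: P_def bzeros_def)
        have "h powr \<delta> * max 0 (\<tau> v - t) powr \<delta> = (h * max 0 (\<tau> v - t)) powr \<delta>" using h by (simp add: powr_mult)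
        also have "h * max 0 (\<tau> v - t) = max 0 (R\<^sup>2 - v\<^sup>2)"
        proof -
          have "h * (\<tau> v - t) = R\<^sup>2 - v\<^sup>2" using h unfolding R(2) \<tau>_def by (simp add: right_diff_distrib diff_divide_distrib)
          moreover have "h * max 0 (\<tau> v - t) = max 0 (h * (\<tau> v - t))" using h by (simp add: max_def zero_le_mult_iff)
          ultimately show ?thesis by simp
        qed
        also have "\<dots> = (if v < R then R\<^sup>2 * (1 - v\<^sup>2 / R\<^sup>2) else 0)"
        proof (cases "v < R")
          case True
          then have "v\<^sup>2 < R\<^sup>2" using v by (intro power_strict_mono) auto
          then show ?thesis using True R(1) by (simp add: right_diff_distrib)
        next
          case False
          then have "R\<^sup>2 \<le> v\<^sup>2" using R(1) by (intro power_mono) auto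
          then show ?thesis using False by simp
        qed
        finally have e: "h powr \<delta> * max 0 (\<tau> v - t) powr \<delta> = (if v < R then R\<^sup>2 * (1 - v\<^sup>2 / R\<^sup>2) else 0) powr \<delta>" .
        have "0 \<le> 1 - v\<^sup>2 / R\<^sup>2" if "v < R" using that v R(1) by (simp add: divide_le_eq_1 power_mono)
        then show "b v * h powr \<delta> * max 0 (\<tau> v - t) powr \<delta> = (if v < R then R\<^sup>2 powr \<delta> * ((1 - v\<^sup>2 / R\<^sup>2) powr \<delta> * b v) else 0)"
          unfolding mult.assoc e by (simp add: powr_mult)
      qed
      also have "\<dots> = (\<Sum>v\<in>{v \<in> P. v < R}. R\<^sup>2 powr \<delta> * ((1 - v\<^sup>2 / R\<^sup>2) powr \<delta> * b v))"
        by (rule sum.inter_filter[OF fP, symmetric])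
      also have "{v \<in> P. v < R} = bzeros \<nu> \<inter> {..<R}" using Ra by (auto simp: P_def)
      also have "(\<Sum>v\<in>bzeros \<nu> \<inter> {..<R}. R\<^sup>2 powr \<delta> * ((1 - v\<^sup>2 / R\<^sup>2) powr \<delta> * b v)) = R\<^sup>2 powr \<delta> * (\<Sum>v\<in>bzeros \<nu> \<inter> {..<R}. (1 - v\<^sup>2 / R\<^sup>2) powr \<delta> * b v)"
        by (simp add: sum_distrib_left)
      finally have "\<bar>\<Sum>v\<in>P. b v * h powr \<delta> * max 0 (\<tau> v - t) powr \<delta>\<bar> = R\<^sup>2 powr \<delta> * \<bar>\<Sum>v\<in>bzeros \<nu> \<inter> {..<R}. (1 - v\<^sup>2 / R\<^sup>2) powr \<delta> * b v\<bar>"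
        by (simp add: abs_mult)
      also have "\<dots> \<le> a powr \<delta> * M"
        using R(2) h t(1) \<open>h * t < a\<close> \<delta> by (intro mult_mono bd R(1) powr_mono2) auto
      finally show "\<bar>\<Sum>v\<in>P. b v * h powr \<delta> * max 0 (\<tau> v - t) powr \<delta>\<bar> \<le> M * a powr \<delta>" by (simp add: mult.commute)
    qed
    then have "\<bar>b s\<bar> * h powr \<delta> \<le> C * (M * a powr \<delta>)" using h by (simp add: abs_mult)
    then have "\<bar>b s\<bar> \<le> C * M * (a powr \<delta> / h powr \<delta>)" using h by (simp add: pos_le_divide_eq mult.assoc)
    also have "a powr \<delta> / h powr \<delta> = (a / h) powr \<delta>" using a h by (simp add: powr_divide)
    finally have le: "\<bar>b s\<bar> \<le> C * M * (a / h) powr \<delta>" .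
    have "(a / h) powr \<delta> \<le> (s * ((1 + \<kappa>) / \<kappa>)) powr \<delta>"
    proof (rule powr_mono2)
      have "a / h = (s + \<kappa>) / \<kappa>" using s \<kappa> by (simp add: a_def h_def field_simps power2_eq_square)
      also have "\<dots> \<le> (s + s * \<kappa>) / \<kappa>" using s \<kappa> by (intro divide_right_mono) auto
      finally show "a / h \<le> s * ((1 + \<kappa>) / \<kappa>)" by (simp add: algebra_simps)
    qed (use a h \<delta> in auto)
    also have "\<dots> = s powr \<delta> * ((1 + \<kappa>) / \<kappa>) powr \<delta>" by (rule powr_mult)
    finally have "C * M * (a / h) powr \<delta> \<le> C * M * (s powr \<delta> * ((1 + \<kappa>) / \<kappa>) powr \<delta>)"
      using C(1) M0 by (intro mult_left_mono) auto
    with le show "\<bar>b s\<bar> \<le> C * ((1 + \<kappa>) / \<kappa>) powr \<delta> * M * s powr \<delta>" by (simp only: ac_simps)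
  qed
qed

section \<open>Divergence below the critical exponent\<close>

lemma mu_nu_initial_interval:
  assumes nu: "\<nu> > -1" and r: "0 < r" "r \<le> 1"
  shows "(\<integral>y. indicator {..<r} y \<partial>mu_nu \<nu>) = r powr (2 * \<nu> + 2) / (2 * \<nu> + 2)"
proof -
  have hi: "((\<lambda>y. y powr (2 * \<nu> + 1)) has_integral r powr (2 * \<nu> + 1 + 1) / (2 * \<nu> + 1 + 1)) {0..r}"
    using nu r by (intro has_integral_powr_from_0) auto
  have "(\<integral>y. indicator {..<r} y \<partial>mu_nu \<nu>) = (LINT y:{0<..<1}|lebesgue. y powr (2 * \<nu> + 1) * indicator {..<r} y)"
    by (intro integral_mu_nu borel_measurable_mu_nu) auto
  also have "\<dots> = (LINT y:{0<..<r}|lebesgue. y powr (2 * \<nu> + 1))"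
    unfolding set_lebesgue_integral_def using r by (intro Bochner_Integration.integral_cong) (auto simp: indicator_def)
  also have "\<dots> = integral {0<..<r} (\<lambda>y. y powr (2 * \<nu> + 1))"
    by (rule set_lebesgue_integral_eq_integral(2)[OF set_integrable_subset[OF set_integrable_powr_unit]]) (use nu r in auto)
  also have "\<dots> = integral {0..r} (\<lambda>y. y powr (2 * \<nu> + 1))" by (simp add: integral_open_interval_real)
  also note integral_unique[OF hi]
  finally show ?thesis by (simp add: add.assoc)
qed

lemma geometric_sum_le:
  assumes "q \<ge> (2::real)"
  shows "(\<Sum>k<n. q ^ k) \<le> 2 * q ^ n / q"
proof (induction n)
  case (Suc n)
  have "2 * q ^ n \<le> q * q ^ n" using assms by (intro mult_right_mono) auto
  then have "2 * q ^ n / q \<le> q ^ n" using assms by (simp add: pos_divide_le_eq mult.commute)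
  then show ?case using Suc assms by simp
qed (use assms in simp)

lemma power_powr_commute: "K > 0 \<Longrightarrow> (K ^ k) powr a = (K powr a) ^ k" for K a :: real
  by (induction k) (simp_all add: powr_mult)

text \<open>A step-function model of the power y^(-b): comparison with that power decides
  integrability, while \<open>bphi_integral\<close> gives the coefficients of each indicator
  exactly.\<close>

definition lacunary :: "real \<Rightarrow> real \<Rightarrow> real \<Rightarrow> real \<Rightarrow> real" where
  "lacunary K b c y = (\<Sum>k. (K powr b) ^ k * indicator {..<c / K ^ k} y)"

lemma lacunary_finite_support:
  fixes K :: real
  assumes K: "K \<ge> 2" and c: "c > 0" and y: "y > 0"
  obtains n where "\<And>k. c / K ^ k \<le> y \<longleftrightarrow> n \<le> k"
proof -
  obtain m where m: "c / y < K ^ m" using real_arch_pow[of K "c / y"] K by auto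
  then have "c / K ^ m \<le> y" using y K by (simp add: divide_less_eq pos_divide_le_eq mult.commute less_imp_le)
  define n where "n = (LEAST k. c / K ^ k \<le> y)"
  have n: "c / K ^ n \<le> y" unfolding n_def by (rule LeastI) fact
  have "c / K ^ k \<le> y \<longleftrightarrow> n \<le> k" for k
  proof
    assume "c / K ^ k \<le> y" then show "n \<le> k" unfolding n_def by (rule Least_le)
  next
    assume "n \<le> k"
    then have "c / K ^ k \<le> c / K ^ n" using K c by (intro divide_left_mono power_increasing mult_pos_pos) auto
    then show "c / K ^ k \<le> y" using n by linarith
  qed
  then show thesis by (rule that)
qed

lemma lacunary_summable:
  fixes K :: real
  assumes K: "K \<ge> 2" and c: "c > 0" and y: "y > 0"
  shows "summable (\<lambda>k. (K powr b) ^ k * indicator {..<c / K ^ k} y)"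
proof -
  obtain n where n: "\<And>k. c / K ^ k \<le> y \<longleftrightarrow> n \<le> k" using lacunary_finite_support[OF assms] by blast
  show ?thesis by (rule summable_finite[of "{..<n}"]) (use n in \<open>auto simp: not_less indicator_def\<close>)
qed

text \<open>Only the levels with K^k < c/y are active, and their geometric sum is at most twice its
  last term, which is below (c/y)^b.\<close>

lemma lacunary_bounds:
  assumes K: "K \<ge> 2" and b: "b \<ge> 1" and c: "c > 0" and y: "y > 0"
  shows "0 \<le> lacunary K b c y" "lacunary K b c y \<le> 2 * c powr b * y powr (- b)"
proof -
  show "0 \<le> lacunary K b c y" unfolding lacunary_def by (rule suminf_nonneg[OF lacunary_summable[OF K c y]]) simp
  obtain n where n: "\<And>k. c / K ^ k \<le> y \<longleftrightarrow> n \<le> k" using lacunary_finite_support[OF K c y] by blast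
  have "K powr 1 \<le> K powr b" using K b by (intro powr_mono) auto
  then have q: "K powr b \<ge> 2" using K by simp
  have "lacunary K b c y = (\<Sum>k<n. (K powr b) ^ k * indicator {..<c / K ^ k} y)"
    unfolding lacunary_def by (rule suminf_finite) (use n in \<open>auto simp: not_less indicator_def\<close>)
  also have "\<dots> = (\<Sum>k<n. (K powr b) ^ k)"
    by (rule sum.cong) (use n in \<open>auto simp: indicator_def not_less[symmetric]\<close>)
  also have "\<dots> \<le> 2 * c powr b * y powr (- b)"
  proof (cases n)
    case (Suc m)
    have "(\<Sum>k<n. (K powr b) ^ k) \<le> 2 * (K powr b) ^ n / K powr b" by (rule geometric_sum_le[OF q])
    also have "\<dots> = 2 * (K ^ m) powr b" using K by (simp add: Suc power_powr_commute)
    also have "\<dots> \<le> 2 * (c / y) powr b"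
    proof -
      have "y < c / K ^ m" using n[of m] Suc by simp
      then have "K ^ m \<le> c / y" using y K by (simp add: pos_le_divide_eq pos_less_divide_eq mult.commute less_imp_le)
      then show ?thesis using K b by (intro mult_left_mono powr_mono2) auto
    qed
    also have "\<dots> = 2 * c powr b * y powr (- b)" using c y by (simp add: powr_divide powr_minus_divide)
    finally show ?thesis .
  qed simp
  finally show "lacunary K b c y \<le> 2 * c powr b * y powr (- b)" .
qed

lemma in_Lp_lacunary:
  assumes K: "K \<ge> 2" and b: "b \<ge> 1" and c: "c > 0" and p: "1 \<le> p" "b * p < 2 * \<nu> + 2"
  shows "in_Lp_mu \<nu> p (lacunary K b c)"
  unfolding in_Lp_mu_def
proof
  have "lacunary K b c \<in> borel_measurable borel" unfolding lacunary_def[abs_def] by measurable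
  then show m: "lacunary K b c \<in> borel_measurable (mu_nu \<nu>)" by (rule borel_measurable_mu_nu)
  define B where "B = (2 * c powr b) powr p"
  show "integrable (mu_nu \<nu>) (\<lambda>x. \<bar>lacunary K b c x\<bar> powr p)"
  proof (rule Bochner_Integration.integrable_bound[of _ "\<lambda>y. B * y powr (- (b * p))"])
    show "integrable (mu_nu \<nu>) (\<lambda>y. B * y powr (- (b * p)))"
    proof (subst integrable_mu_nu_iff)
      have "set_integrable lebesgue {0<..<1} (\<lambda>y. B * y powr (2 * \<nu> + 1 - b * p))"
        using p by (intro set_integrable_mult_right set_integrable_powr_unit) auto
      also have "(\<lambda>y. B * y powr (2 * \<nu> + 1 - b * p)) = (\<lambda>y. y powr (2 * \<nu> + 1) * (B * y powr (- (b * p))))"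
        by (simp add: powr_add[symmetric] mult.left_commute)
      finally show "set_integrable lebesgue {0<..<1} (\<lambda>y. y powr (2 * \<nu> + 1) * (B * y powr (- (b * p))))" .
    qed (intro borel_measurable_mu_nu, measurable)
    show "(\<lambda>x. \<bar>lacunary K b c x\<bar> powr p) \<in> borel_measurable (mu_nu \<nu>)" using m by measurable
    show "AE y in mu_nu \<nu>. norm (\<bar>lacunary K b c y\<bar> powr p) \<le> norm (B * y powr (- (b * p)))"
    proof (rule AE_I2)
      fix y assume "y \<in> space (mu_nu \<nu>)"
      then have y: "y > 0" by simp
      have "\<bar>lacunary K b c y\<bar> powr p \<le> (2 * c powr b * y powr (- b)) powr p"
        using lacunary_bounds[OF K b c y] p by (intro powr_mono2) auto
      also have "\<dots> = B * y powr (- (b * p))" by (simp add: B_def powr_mult powr_powr)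
      finally show "norm (\<bar>lacunary K b c y\<bar> powr p) \<le> norm (B * y powr (- (b * p)))" by (simp add: B_def)
    qed
  qed
qed

text \<open>For \<open>s\<close> comparable to \<open>K ^ k\<close>, the terms of index at least \<open>k\<close> live where \<open>bphi \<nu> (s y) \<ge> 1/2\<close> and so cannot
  cancel; the decay of \<open>bphi'\<close> makes the earlier ones negligible once \<open>K\<close> is large.\<close>
lemma lacunary_coefficient_lower_bound:
  assumes nu: "\<nu> > -1/2" and b: "\<nu> + 3/2 \<le> b" "b < 2 * \<nu> + 2"
  obtains K c c' where "K \<ge> 2" "c > 0" "c' > 0"
    "\<And>k s. K ^ k \<le> s \<Longrightarrow> s \<le> 2 * K ^ k \<Longrightarrow> c' * s powr (b - 2 * \<nu> - 2) \<le> (\<integral>y. bphi \<nu> (s * y) * lacunary K b c y \<partial>mu_nu \<nu>)"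
proof -
  have nu1: "\<nu> > -1" using nu by simp
  obtain b0 where b0: "b0 > 0" "\<And>x::real. \<bar>x\<bar> \<le> b0 \<Longrightarrow> 1/2 \<le> bphi \<nu> x" using bphi_real_ge_half[OF nu1] by blast
  \<comment> \<open>For s \<le> 2K^k and y < c/K^k this gives sy \<le> 2c \<le> b0, the range where
    \<open>bphi\<close> is at least 1/2.\<close>
  define c where "c = min 1 (b0 / 2)"
  have c: "c > 0" "c \<le> 1" "2 * c \<le> b0" using b0 by (auto simp: c_def)
  obtain C where C: "C > 0" "\<And>x::real. x > 0 \<Longrightarrow> \<bar>bphi' \<nu> x\<bar> \<le> C * x * (1 + x) powr (- (\<nu> + 3/2))"
    using bphi'_upper_bound_real[OF nu1] by blast
  define c0 where "c0 = c powr (2 * \<nu> + 2) / (4 * \<nu> + 4)"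
  have c0: "c0 > 0" using nu c by (simp add: c0_def)
  \<comment> \<open>In units of K^(k(b - 2\<nu> - 2)) the early terms will total at most 2C/K
    against the main term c0; this K makes them at most half of it.\<close>
  define K where "K = max 2 (4 * C / c0)"
  have K: "K \<ge> 2" "4 * C / c0 \<le> K" by (auto simp: K_def)
  have K0: "K > 0" using K by simp
  have b1: "b \<ge> 1" using b nu by simp
  define f where "f = lacunary K b c"
  define a where "a = b - 2 * \<nu> - 2"
  have fi: "integrable (mu_nu \<nu>) f"
    using in_Lp_lacunary[OF K(1) b1 c(1), of 1 \<nu>] b integrable_abs_iff[of f "mu_nu \<nu>"] by (simp add: f_def in_Lp_mu_def)
  have "c0 / 2 * s powr a \<le> (\<integral>y. bphi \<nu> (s * y) * f y \<partial>mu_nu \<nu>)" if s: "K ^ k \<le> s" "s \<le> 2 * K ^ k" for k s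
  proof -
    have Kk: "K ^ k > 0" using K0 by simp
    then have s0: "s > 0" using s by linarith
    define r where "r = (\<lambda>l. c / K ^ l)"
    have r: "0 < r l" "r l \<le> 1" for l
    proof -
      show "0 < r l" using c K0 by (simp add: r_def)
      have "1 \<le> K ^ l" using K by (intro one_le_power) auto
      then show "r l \<le> 1" using c K0 by (simp add: r_def pos_divide_le_eq)
    qed
    define \<Phi> where "\<Phi> = (\<lambda>y. bphi \<nu> (s * y))"
    \<comment> \<open>The tail from level k on lives in (0, r k), where \<open>bphi\<close> is at
      least 1/2. Nothing cancels there, so level k alone gives a lower bound.\<close>
    define g where "g = (\<lambda>y. \<Sum>l. (K powr b) ^ (l + k) * indicator {..<r (l + k)} y)"
    have fg: "f y = g y + (\<Sum>l<k. (K powr b) ^ l * indicator {..<r l} y)" if "y > 0" for y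
      unfolding f_def lacunary_def g_def r_def by (rule suminf_split_initial_segment[OF lacunary_summable[OF K(1) c(1) that]])
    have gsum: "summable (\<lambda>l. (K powr b) ^ (l + k) * indicator {..<r (l + k)} y)" if "y > 0" for y
      using lacunary_summable[OF K(1) c(1) that, of b] unfolding r_def by (rule summable_ignore_initial_segment)
    have g1: "(K powr b) ^ k * indicator {..<r k} y \<le> g y" if "y > 0" for y
      using sum_le_suminf[OF gsum[OF that], of "{0}"] by (simp add: g_def)
    have g0: "g y = 0" if "r k \<le> y" for y
    proof -
      have "r (l + k) \<le> r k" for l unfolding r_def using K c by (intro divide_left_mono power_increasing mult_pos_pos) auto
      then have "r (l + k) \<le> y" for l using that order_trans by blast
      then have "(\<lambda>l. (K powr b) ^ (l + k) * indicator {..<r (l + k)} y) = (\<lambda>l. 0)" by (auto simp: not_less)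
      then show ?thesis by (simp add: g_def)
    qed
    have \<Phi>g: "(K powr b) ^ k / 2 * indicator {..<r k} y \<le> \<Phi> y * g y" if y: "y > 0" for y
    proof (cases "y < r k")
      case True
      have "s * y \<le> 2 * K ^ k * r k" using s True y Kk by (intro mult_mono) auto
      also have "\<dots> = 2 * c" using K0 by (simp add: r_def)
      finally have "s * y \<le> b0" using c by linarith
      then have "1/2 \<le> \<Phi> y" unfolding \<Phi>_def using y s0 by (intro b0(2)) auto
      moreover have "(K powr b) ^ k \<le> g y" using g1[OF y] True by simp
      ultimately have "1/2 * (K powr b) ^ k \<le> \<Phi> y * g y" by (intro mult_mono) auto
      then show ?thesis using True by simp
    next
      case False
      then show ?thesis using g0[of y] by simp
    qed
    have ii: "integrable (mu_nu \<nu>) (\<lambda>y. indicator {..<r l} y :: real)" for l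
      using integrable_mu_nu_bounded[OF mu_nu_finite[OF nu1, of 1] borel_measurable_mu_nu, of "indicator {..<r l}" 1]
      by (simp add: indicator_def)
    have i\<Phi>: "integrable (mu_nu \<nu>) (\<lambda>y. \<Phi> y * indicator {..<r l} y)" for l
      unfolding \<Phi>_def by (rule integrable_bphi_times[OF nu1 ii])
    have gi: "integrable (mu_nu \<nu>) g"
    proof -
      have "integrable (mu_nu \<nu>) (\<lambda>y. f y - (\<Sum>l<k. (K powr b) ^ l * indicator {..<r l} y))"
        by (intro Bochner_Integration.integrable_diff fi Bochner_Integration.integrable_sum integrable_mult_right ii)
      then show ?thesis by (rule Bochner_Integration.integrable_cong[THEN iffD1, rotated -1]) (auto simp: fg)
    qed
    have i\<Phi>g: "integrable (mu_nu \<nu>) (\<lambda>y. \<Phi> y * g y)" unfolding \<Phi>_def by (rule integrable_bphi_times[OF nu1 gi])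
    have pw: "\<Phi> y * f y = \<Phi> y * g y + (\<Sum>l<k. (K powr b) ^ l * (\<Phi> y * indicator {..<r l} y))" if "y > 0" for y
      unfolding fg[OF that] distrib_left sum_distrib_left by (simp only: mult.left_commute)
    have "(\<integral>y. \<Phi> y * f y \<partial>mu_nu \<nu>) = (\<integral>y. \<Phi> y * g y + (\<Sum>l<k. (K powr b) ^ l * (\<Phi> y * indicator {..<r l} y)) \<partial>mu_nu \<nu>)"
      by (rule Bochner_Integration.integral_cong) (simp_all only: pw space_mu_nu greaterThanLessThan_iff)
    also have "\<dots> = (\<integral>y. \<Phi> y * g y \<partial>mu_nu \<nu>) + (\<Sum>l<k. (K powr b) ^ l * (\<integral>y. \<Phi> y * indicator {..<r l} y \<partial>mu_nu \<nu>))"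
      by (subst Bochner_Integration.integral_add)
        (auto intro!: i\<Phi>g Bochner_Integration.integrable_sum integrable_mult_right i\<Phi> simp: Bochner_Integration.integral_sum[OF integrable_mult_right[OF i\<Phi>]])
    finally have eq: "(\<integral>y. \<Phi> y * f y \<partial>mu_nu \<nu>) = (\<integral>y. \<Phi> y * g y \<partial>mu_nu \<nu>) + (\<Sum>l<k. (K powr b) ^ l * (\<integral>y. \<Phi> y * indicator {..<r l} y \<partial>mu_nu \<nu>))" .
    have "c0 * (K ^ k) powr a = (K powr b) ^ k / 2 * (r k powr (2 * \<nu> + 2) / (2 * \<nu> + 2))"
    proof -
      have "r k powr (2 * \<nu> + 2) = c powr (2 * \<nu> + 2) * (K ^ k) powr (- (2 * \<nu> + 2))"
        unfolding powr_minus_divide using c Kk by (simp add: r_def powr_divide)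
      moreover have "(K ^ k) powr a = (K ^ k) powr b * (K ^ k) powr (- (2 * \<nu> + 2))"
        unfolding a_def powr_add[symmetric] by (simp add: algebra_simps)
      ultimately show ?thesis using nu by (simp add: c0_def power_powr_commute[OF K0] field_simps)
    qed
    also have "\<dots> = (\<integral>y. (K powr b) ^ k / 2 * indicator {..<r k} y \<partial>mu_nu \<nu>)"
      unfolding mu_nu_initial_interval[OF nu1 r, symmetric] by (rule integral_mult_right_zero[symmetric])
    also have "\<dots> \<le> (\<integral>y. \<Phi> y * g y \<partial>mu_nu \<nu>)"
      by (rule integral_mono_AE[OF integrable_mult_right[OF ii] i\<Phi>g], rule AE_I2) (use \<Phi>g in auto)
    finally have main: "c0 * (K ^ k) powr a \<le> (\<integral>y. \<Phi> y * g y \<partial>mu_nu \<nu>)" .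
    \<comment> \<open>Growth exponent of the early terms in l. It is at least 1, so their sum is
      dominated by level k - 1, which is smaller by 1/K than level k would be.\<close>
    define e where "e = b - \<nu> - 1/2"
    have "K powr 1 \<le> K powr e" using K b by (intro powr_mono) (auto simp: e_def)
    then have q: "K \<le> K powr e" "2 \<le> K powr e" using K by auto
    have early: "(K powr b) ^ l * \<bar>\<integral>y. \<Phi> y * indicator {..<r l} y \<partial>mu_nu \<nu>\<bar> \<le> C * s powr (- (\<nu> + 3/2)) * (K powr e) ^ l" for l
    proof -
      define x where "x = s * r l"
      have x: "x > 0" using s0 r by (simp add: x_def)
      have "\<bar>bphi' \<nu> x\<bar> \<le> C * x * (1 + x) powr (- (\<nu> + 3/2))" by (rule C(2)[OF x])
      also have "\<dots> \<le> C * x * x powr (- (\<nu> + 3/2))" using x C nu by (intro mult_left_mono powr_mono2') auto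
      also have "\<dots> = C * x powr (- (\<nu> + 1/2))"
      proof -
        have "x * x powr (- (\<nu> + 3/2)) = x powr 1 * x powr (- (\<nu> + 3/2))" using x by simp
        also have "\<dots> = x powr (- (\<nu> + 1/2))" unfolding powr_add[symmetric] by (simp add: algebra_simps)
        finally show ?thesis by simp
      qed
      finally have bp: "\<bar>bphi' \<nu> (s * r l)\<bar> \<le> C * (s powr (- (\<nu> + 1/2)) * r l powr (- (\<nu> + 1/2)))"
        using s0 r[of l] by (simp add: x_def powr_mult)
      have "\<bar>\<integral>y. \<Phi> y * indicator {..<r l} y \<partial>mu_nu \<nu>\<bar> = r l powr (2 * \<nu> + 1) * \<bar>bphi' \<nu> (s * r l)\<bar> / s"
        unfolding \<Phi>_def bphi_integral[OF nu1 s0 r] using s0 by (simp add: abs_mult)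
      also have "\<dots> \<le> r l powr (2 * \<nu> + 1) * (C * (s powr (- (\<nu> + 1/2)) * r l powr (- (\<nu> + 1/2)))) / s"
        using bp s0 by (intro divide_right_mono mult_left_mono) auto
      also have "\<dots> = C * (s powr (- (\<nu> + 1/2)) / s) * (r l powr (2 * \<nu> + 1) * r l powr (- (\<nu> + 1/2)))" by simp
      also have "r l powr (2 * \<nu> + 1) * r l powr (- (\<nu> + 1/2)) = r l powr (\<nu> + 1/2)"
        unfolding powr_add[symmetric] by (simp add: algebra_simps)
      also have "s powr (- (\<nu> + 1/2)) / s = s powr (- (\<nu> + 3/2))"
      proof -
        have "s powr (- (\<nu> + 1/2)) / s = s powr (- (\<nu> + 1/2) - 1)" unfolding powr_diff[of s "- (\<nu> + 1/2)"] using s0 by simp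
        also have "- (\<nu> + 1/2) - 1 = - (\<nu> + 3/2)" by simp
        finally show ?thesis .
      qed
      finally have 1: "\<bar>\<integral>y. \<Phi> y * indicator {..<r l} y \<partial>mu_nu \<nu>\<bar> \<le> C * s powr (- (\<nu> + 3/2)) * r l powr (\<nu> + 1/2)" .
      have "r l powr (\<nu> + 1/2) \<le> (1 / K ^ l) powr (\<nu> + 1/2)"
        unfolding r_def using c K0 nu by (intro powr_mono2 divide_right_mono) auto
      also have "\<dots> = (K powr (- (\<nu> + 1/2))) ^ l"
        unfolding powr_minus_divide using K0 by (simp add: powr_divide power_powr_commute power_one_over)
      finally have "C * s powr (- (\<nu> + 3/2)) * r l powr (\<nu> + 1/2) \<le> C * s powr (- (\<nu> + 3/2)) * (K powr (- (\<nu> + 1/2))) ^ l"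
        using C by (intro mult_left_mono) auto
      with 1 have "(K powr b) ^ l * \<bar>\<integral>y. \<Phi> y * indicator {..<r l} y \<partial>mu_nu \<nu>\<bar> \<le> (K powr b) ^ l * (C * s powr (- (\<nu> + 3/2)) * (K powr (- (\<nu> + 1/2))) ^ l)"
        by (intro mult_left_mono) auto
      also have "\<dots> = C * s powr (- (\<nu> + 3/2)) * (K powr b * K powr (- (\<nu> + 1/2))) ^ l" by (simp add: power_mult_distrib)
      also have "K powr b * K powr (- (\<nu> + 1/2)) = K powr e" unfolding powr_add[symmetric] e_def by (rule arg_cong[of _ _ "(powr) K"]) simp
      finally show ?thesis .
    qed
    have "\<bar>\<Sum>l<k. (K powr b) ^ l * (\<integral>y. \<Phi> y * indicator {..<r l} y \<partial>mu_nu \<nu>)\<bar> \<le> (\<Sum>l<k. (K powr b) ^ l * \<bar>\<integral>y. \<Phi> y * indicator {..<r l} y \<partial>mu_nu \<nu>\<bar>)"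
      by (rule order_trans[OF sum_abs]) (simp add: abs_mult)
    also have "\<dots> \<le> (\<Sum>l<k. C * s powr (- (\<nu> + 3/2)) * (K powr e) ^ l)" by (intro sum_mono early)
    also have "\<dots> = C * s powr (- (\<nu> + 3/2)) * (\<Sum>l<k. (K powr e) ^ l)" by (rule sum_distrib_left[symmetric])
    also have "\<dots> \<le> C * (K ^ k) powr (- (\<nu> + 3/2)) * (2 * (K powr e) ^ k / K)"
    proof (intro mult_mono)
      show "s powr (- (\<nu> + 3/2)) \<le> (K ^ k) powr (- (\<nu> + 3/2))" using s Kk nu by (intro powr_mono2') auto
      have "(\<Sum>l<k. (K powr e) ^ l) \<le> 2 * (K powr e) ^ k / K powr e" by (rule geometric_sum_le[OF q(2)])
      also have "\<dots> \<le> 2 * (K powr e) ^ k / K" using q K0 by (intro divide_left_mono) auto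
      finally show "(\<Sum>l<k. (K powr e) ^ l) \<le> 2 * (K powr e) ^ k / K" .
    qed (use C in \<open>auto intro!: sum_nonneg\<close>)
    also have "\<dots> = 2 * C / K * ((K ^ k) powr (- (\<nu> + 3/2)) * (K ^ k) powr e)" by (simp add: power_powr_commute[OF K0])
    also have "(K ^ k) powr (- (\<nu> + 3/2)) * (K ^ k) powr e = (K ^ k) powr a"
      unfolding powr_add[symmetric] a_def e_def by (rule arg_cong[of _ _ "(powr) (K ^ k)"]) simp
    also have "2 * C / K * (K ^ k) powr a \<le> c0 / 2 * (K ^ k) powr a"
    proof (intro mult_right_mono)
      have "4 * C \<le> K * c0" using K(2) c0 by (simp add: pos_divide_le_eq)
      then show "2 * C / K \<le> c0 / 2" using K0 by (simp add: pos_divide_le_eq mult.commute)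
    qed simp
    finally have "c0 * (K ^ k) powr a - c0 / 2 * (K ^ k) powr a \<le> (\<integral>y. \<Phi> y * f y \<partial>mu_nu \<nu>)"
      using main unfolding eq by linarith
    moreover have "c0 / 2 * s powr a \<le> c0 / 2 * (K ^ k) powr a"
      using s Kk c0 b by (intro mult_left_mono powr_mono2') (auto simp: a_def)
    ultimately show ?thesis unfolding \<Phi>_def by linarith
  qed
  then show thesis using that[of K c "c0 / 2"] K c c0 by (simp add: f_def a_def)
qed

text \<open>Convergence bounds the sums for large R; below that only finitely many terms occur, with
  multipliers at most 1. The limitation theorem asks for a bound at all R > 0.\<close>

lemma riesz_sums_bounded_of_convergent:
  assumes nu: "\<nu> > -1" and \<delta>: "\<delta> > 0"
    and conv: "((\<lambda>R. \<Sum>u\<in>bzeros \<nu> \<inter> {..<R}. (1 - u\<^sup>2 / R\<^sup>2) powr \<delta> * \<beta> u) \<longlongrightarrow> L) at_top"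
  obtains M where "\<And>R. R > 0 \<Longrightarrow> \<bar>\<Sum>u\<in>bzeros \<nu> \<inter> {..<R}. (1 - u\<^sup>2 / R\<^sup>2) powr \<delta> * \<beta> u\<bar> \<le> (M :: real)"
proof -
  define T where "T = (\<lambda>R. \<Sum>u\<in>bzeros \<nu> \<inter> {..<R}. (1 - u\<^sup>2 / R\<^sup>2) powr \<delta> * \<beta> u)"
  have "eventually (\<lambda>R. dist (T R) L < 1) at_top" using tendstoD[OF conv, of 1] by (simp add: T_def)
  then obtain R0 where R0: "\<And>R. R \<ge> R0 \<Longrightarrow> dist (T R) L < 1" by (auto simp: eventually_at_top_linorder)
  define S where "S = (\<Sum>u\<in>bzeros \<nu> \<inter> {..R0}. \<bar>\<beta> u\<bar>)"
  have S: "S \<ge> 0" unfolding S_def by (intro sum_nonneg) auto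
  have "\<bar>T R\<bar> \<le> \<bar>L\<bar> + 1 + S" if R: "R > 0" for R
  proof (cases "R0 \<le> R")
    case True
    then have "\<bar>T R - L\<bar> < 1" using R0 by (simp add: dist_real_def)
    then show ?thesis using S by linarith
  next
    case False
    have "\<bar>T R\<bar> \<le> (\<Sum>u\<in>bzeros \<nu> \<inter> {..<R}. \<bar>(1 - u\<^sup>2 / R\<^sup>2) powr \<delta> * \<beta> u\<bar>)" unfolding T_def by (rule sum_abs)
    also have "\<dots> \<le> (\<Sum>u\<in>bzeros \<nu> \<inter> {..<R}. \<bar>\<beta> u\<bar>)"
    proof (rule sum_mono)
      fix u assume "u \<in> bzeros \<nu> \<inter> {..<R}"
      then have "u\<^sup>2 \<le> R\<^sup>2" by (intro power_mono) (auto simp: bzeros_def)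
      then have "(1 - u\<^sup>2 / R\<^sup>2) powr \<delta> \<le> 1" using R \<delta> by (intro powr_le1) (auto simp: divide_le_eq_1)
      then have "(1 - u\<^sup>2 / R\<^sup>2) powr \<delta> * \<bar>\<beta> u\<bar> \<le> 1 * \<bar>\<beta> u\<bar>" by (intro mult_right_mono) auto
      then show "\<bar>(1 - u\<^sup>2 / R\<^sup>2) powr \<delta> * \<beta> u\<bar> \<le> \<bar>\<beta> u\<bar>" by (simp add: abs_mult)
    qed
    also have "\<dots> \<le> S" unfolding S_def using False by (intro sum_mono2 finite_bzeros_atMost nu) auto
    finally show ?thesis by linarith
  qed
  then show thesis using that unfolding T_def by blast
qed

text \<open>The normaliser gives s^(2\<nu>+1) and the coefficient s^(b-2\<nu>-2), so the term at s
  is at least of size s^(b-1) |\<phi>(sx)|, while limitation allows only s^\<delta>. Since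
  s^(\<nu>+1/2) \<phi>(sx) is about sin(sx + \<eta>) up to O(1/s), the sine must tend to 0, at a
  rate governed by b - \<nu> - 3/2 - \<delta> > 0.\<close>

lemma lacunary_means_diverge:
  assumes nu: "\<nu> > -1/2" and \<delta>: "\<delta> > 0" and b: "\<nu> + 3/2 + \<delta> < b" "b < 2 * \<nu> + 2"
  obtains K c where "K \<ge> 2" "c > 0"
    "\<And>x L. 0 < x \<Longrightarrow> x < 1 \<Longrightarrow> \<not> ((\<lambda>R. bochner_riesz \<nu> \<delta> R (lacunary K b c) x) \<longlongrightarrow> L) at_top"
proof -
  have nu1: "\<nu> > -1" using nu by simp
  obtain K c c' where K: "K \<ge> 2" "c > 0" "c' > 0"
    and low: "\<And>k s. K ^ k \<le> s \<Longrightarrow> s \<le> 2 * K ^ k \<Longrightarrow> c' * s powr (b - 2 * \<nu> - 2) \<le> (\<integral>y. bphi \<nu> (s * y) * lacunary K b c y \<partial>mu_nu \<nu>)"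
  proof (rule lacunary_coefficient_lower_bound[OF nu _ b(2)])
    show "\<nu> + 3/2 \<le> b" using b \<delta> by simp
  qed blast
  have False if x: "0 < x" "x < 1" and conv: "((\<lambda>R. bochner_riesz \<nu> \<delta> R (lacunary K b c) x) \<longlongrightarrow> L) at_top" for x L
  proof -
    define T where "T = (\<lambda>s. \<integral>y. bphi \<nu> (s * y) * lacunary K b c y \<partial>mu_nu \<nu>)"
    define \<beta> where "\<beta> = (\<lambda>s. 2 / (bphi' \<nu> s)\<^sup>2 * bphi \<nu> (s * x) * T s)"
    have "((\<lambda>R. \<Sum>u\<in>bzeros \<nu> \<inter> {..<R}. (1 - u\<^sup>2 / R\<^sup>2) powr \<delta> * \<beta> u) \<longlongrightarrow> L) at_top"
    proof (rule Lim_transform_eventually[OF conv])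
      show "\<forall>\<^sub>F R in at_top. bochner_riesz \<nu> \<delta> R (lacunary K b c) x = (\<Sum>u\<in>bzeros \<nu> \<inter> {..<R}. (1 - u\<^sup>2 / R\<^sup>2) powr \<delta> * \<beta> u)"
        using eventually_gt_at_top[of 0] by eventually_elim (simp add: bochner_riesz_bzeros[OF nu1 _ x(1)] \<beta>_def T_def)
    qed
    then obtain M where M: "\<And>R. R > 0 \<Longrightarrow> \<bar>\<Sum>u\<in>bzeros \<nu> \<inter> {..<R}. (1 - u\<^sup>2 / R\<^sup>2) powr \<delta> * \<beta> u\<bar> \<le> M"
      using riesz_sums_bounded_of_convergent[OF nu1 \<delta>] by blast
    have "\<exists>C1. \<forall>s\<in>bzeros \<nu>. 1 \<le> s \<longrightarrow> \<bar>\<beta> s\<bar> \<le> C1 * s powr \<delta>"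
    proof (rule riesz_limitation[OF nu1 \<delta>])
      fix C assume "\<And>b M s. (\<And>R. R > 0 \<Longrightarrow> \<bar>\<Sum>u\<in>bzeros \<nu> \<inter> {..<R}. (1 - u\<^sup>2 / R\<^sup>2) powr \<delta> * b u\<bar> \<le> M) \<Longrightarrow> s \<in> bzeros \<nu> \<Longrightarrow> 1 \<le> s \<Longrightarrow> \<bar>b s\<bar> \<le> C * M * s powr \<delta>"
      from this[OF M] show ?thesis by blast
    qed
    then obtain C1 where C1: "\<And>s. s \<in> bzeros \<nu> \<Longrightarrow> 1 \<le> s \<Longrightarrow> \<bar>\<beta> s\<bar> \<le> C1 * s powr \<delta>" by blast
    obtain C where C: "C > 0" "\<And>x::real. x > 0 \<Longrightarrow> \<bar>bphi' \<nu> x\<bar> \<le> C * x * (1 + x) powr (- (\<nu> + 3/2))"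
      using bphi'_upper_bound_real[OF nu1] by blast
    obtain \<eta> A Ca where as: "A > 0" "Ca > 0" "bessel_asymptotic \<nu> A \<eta> Ca" using bessel_asymptotic_exists[OF nu1] by blast
    define e where "e = b - \<nu> - 3/2 - \<delta>"
    have e: "e > 0" using b by (simp add: e_def)
    define B where "B = C1 * C\<^sup>2 / (2 * c')"
    have small: "A * \<bar>sin (s * x + \<eta>)\<bar> \<le> B * s powr (- e) + Ca / (s * x)"
      if s: "s \<in> bzeros \<nu>" "1 \<le> s" "1 \<le> s * x" "K ^ k \<le> s" "s \<le> 2 * K ^ k" for s k
    proof -
      have s0: "s > 0" using s by simp
      have D0: "bphi' \<nu> s \<noteq> 0" by (rule bphi'_at_zero_nonzero[OF nu1 s(1)])
      have "\<bar>bphi' \<nu> s\<bar> \<le> C * s * (1 + s) powr (- (\<nu> + 3/2))" by (rule C(2)[OF s0])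
      also have "\<dots> \<le> C * s * s powr (- (\<nu> + 3/2))" using s0 C nu by (intro mult_left_mono powr_mono2') auto
      also have "\<dots> = C * s powr (- (\<nu> + 1/2))"
      proof -
        have "s * s powr (- (\<nu> + 3/2)) = s powr 1 * s powr (- (\<nu> + 3/2))" using s0 by simp
        also have "\<dots> = s powr (- (\<nu> + 1/2))" unfolding powr_add[symmetric] by (simp add: algebra_simps)
        finally show ?thesis by simp
      qed
      finally have "\<bar>bphi' \<nu> s\<bar>\<^sup>2 \<le> (C * s powr (- (\<nu> + 1/2)))\<^sup>2" by (intro power_mono) auto
      also have "\<dots> = C\<^sup>2 * (s powr (- (\<nu> + 1/2)) * s powr (- (\<nu> + 1/2)))" by (simp add: power2_eq_square)
      also have "s powr (- (\<nu> + 1/2)) * s powr (- (\<nu> + 1/2)) = s powr (- (2 * \<nu> + 1))"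
        unfolding powr_add[symmetric] by (rule arg_cong[of _ _ "(powr) s"]) simp
      finally have "2 / (C\<^sup>2 * s powr (- (2 * \<nu> + 1))) \<le> 2 / (bphi' \<nu> s)\<^sup>2"
        using D0 C s0 by (intro divide_left_mono) auto
      moreover have "c' * s powr (b - 2 * \<nu> - 2) \<le> T s" unfolding T_def by (rule low[OF s(4,5)])
      ultimately have "2 / (C\<^sup>2 * s powr (- (2 * \<nu> + 1))) * (c' * s powr (b - 2 * \<nu> - 2)) \<le> 2 / (bphi' \<nu> s)\<^sup>2 * T s"
        using K C by (intro mult_mono) auto
      moreover have "2 / (C\<^sup>2 * s powr (- (2 * \<nu> + 1))) * (c' * s powr (b - 2 * \<nu> - 2)) = 2 * c' / C\<^sup>2 * s powr (b - 1)"
      proof -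
        have "s powr (b - 1) = s powr (b - 2 * \<nu> - 2) / s powr (- (2 * \<nu> + 1))"
          unfolding powr_diff[symmetric] by (simp add: algebra_simps)
        then show ?thesis by simp
      qed
      ultimately have 1: "2 * c' / C\<^sup>2 * s powr (b - 1) \<le> 2 / (bphi' \<nu> s)\<^sup>2 * T s" by simp
      moreover have "0 \<le> 2 * c' / C\<^sup>2 * s powr (b - 1)" using K by simp
      ultimately have "\<bar>\<beta> s\<bar> = (2 / (bphi' \<nu> s)\<^sup>2 * T s) * \<bar>bphi \<nu> (s * x)\<bar>"
      proof -
        have "\<beta> s = (2 / (bphi' \<nu> s)\<^sup>2 * T s) * bphi \<nu> (s * x)" by (simp add: \<beta>_def)
        moreover have "0 \<le> 2 / (bphi' \<nu> s)\<^sup>2 * T s"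
          using \<open>2 * c' / C\<^sup>2 * s powr (b - 1) \<le> 2 / (bphi' \<nu> s)\<^sup>2 * T s\<close> \<open>0 \<le> 2 * c' / C\<^sup>2 * s powr (b - 1)\<close> by linarith
        ultimately show ?thesis by (simp only: abs_mult[of "2 / (bphi' \<nu> s)\<^sup>2 * T s"] abs_of_nonneg)
      qed
      then have "2 * c' / C\<^sup>2 * s powr (b - 1) * \<bar>bphi \<nu> (s * x)\<bar> \<le> C1 * s powr \<delta>"
        using mult_right_mono[OF 1, of "\<bar>bphi \<nu> (s * x)\<bar>"] C1[OF s(1,2)] by linarith
      then have "\<bar>bphi \<nu> (s * x)\<bar> \<le> C1 * s powr \<delta> / (2 * c' / C\<^sup>2 * s powr (b - 1))"
        using K C s0 by (subst pos_le_divide_eq) (auto simp: mult.commute)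
      also have "\<dots> = B * (s powr \<delta> / s powr (b - 1))" by (simp add: B_def)
      also have "s powr \<delta> / s powr (b - 1) = s powr (\<delta> - (b - 1))" by (rule powr_diff[symmetric])
      finally have 2: "\<bar>bphi \<nu> (s * x)\<bar> \<le> B * s powr (\<delta> - (b - 1))" .
      have "(s * x) powr (\<nu> + 1/2) * \<bar>bphi \<nu> (s * x)\<bar> \<le> s powr (\<nu> + 1/2) * (B * s powr (\<delta> - (b - 1)))"
        using 2 s0 x nu by (intro mult_mono powr_mono2) auto
      also have "\<dots> = B * (s powr (\<nu> + 1/2) * s powr (\<delta> - (b - 1)))" by simp
      also have "s powr (\<nu> + 1/2) * s powr (\<delta> - (b - 1)) = s powr (- e)"
        unfolding powr_add[symmetric] e_def by (rule arg_cong[of _ _ "(powr) s"]) simp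
      finally have 3: "\<bar>(s * x) powr (\<nu> + 1/2) * bphi \<nu> (s * x)\<bar> \<le> B * s powr (- e)" by (simp add: abs_mult)
      have sx: "s * x > 0" using s0 x by simp
      have "norm (bU \<nu> (of_real (s * x)) - of_real A * sin (of_real (s * x) + of_real \<eta>)) \<le> Ca * exp (Im (of_real (s * x))) / norm (of_real (s * x) :: complex)"
        using as(3)[unfolded bessel_asymptotic_def, rule_format, of "of_real (s * x)"] s(3) sx by (simp del: of_real_mult)
      moreover have "bU \<nu> (of_real (s * x)) - of_real A * sin (of_real (s * x) + of_real \<eta>) =
          complex_of_real ((s * x) powr (\<nu> + 1/2) * bphi \<nu> (s * x) - A * sin (s * x + \<eta>))"
        unfolding bU_of_real(1)[OF nu1 sx] by (simp only: of_real_add[symmetric] sin_of_real of_real_mult[symmetric] of_real_diff[symmetric])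
      ultimately have "\<bar>(s * x) powr (\<nu> + 1/2) * bphi \<nu> (s * x) - A * sin (s * x + \<eta>)\<bar> \<le> Ca / (s * x)"
        using sx by (simp only: norm_of_real Im_complex_of_real exp_zero mult_1_right abs_of_pos)
      with 3 have "\<bar>A * sin (s * x + \<eta>)\<bar> \<le> B * s powr (- e) + Ca / (s * x)" by linarith
      then show ?thesis using as(1) by (simp add: abs_mult)
    qed
    \<comment> \<open>An eighth, because four errors \<epsilon> accumulate: two sines and twice
      \<epsilon> from the spacing of the zeros. They total sin(\<pi>x)/2.\<close>
    define \<epsilon> where "\<epsilon> = sin (pi * x) / 8"
    have sp: "sin (pi * x) > 0" using x by (intro sin_gt_zero) auto
    have eps: "\<epsilon> > 0" "\<epsilon> \<le> 1 / 8" using sp by (auto simp: \<epsilon>_def)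
    have "\<epsilon> < pi / 2" using eps pi_gt3 by linarith
    then obtain K0 where K0: "\<And>k. k \<ge> K0 \<Longrightarrow> \<exists>s\<in>bzeros \<nu>. \<bar>s - (real k * pi - \<eta>)\<bar> < \<epsilon>"
      using bzero_near[OF nu1 as(3,1,2) eps(1)] by blast
    have "((\<lambda>s. B * s powr (- e) + Ca / (s * x)) \<longlongrightarrow> 0) at_top"
    proof -
      have "((\<lambda>s. s powr (- e)) \<longlongrightarrow> 0) at_top" "((\<lambda>s. 1 / (s * x)) \<longlongrightarrow> 0) at_top" using e x by real_asymp+
      from tendsto_add[OF tendsto_mult_left[OF this(1), of B] tendsto_mult_left[OF this(2), of Ca]] show ?thesis by simp
    qed
    then have "eventually (\<lambda>s. B * s powr (- e) + Ca / (s * x) < A * \<epsilon>) at_top"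
      using as(1) eps(1) by (intro order_tendstoD(2)) auto
    then obtain T0 where T0: "\<And>s. s \<ge> T0 \<Longrightarrow> B * s powr (- e) + Ca / (s * x) < A * \<epsilon>" by (auto simp: eventually_at_top_linorder)
    \<comment> \<open>Large enough that two neighbouring zeros fit into [K^k, 2K^k] and all
      asymptotic thresholds are passed; 20 is a generous margin.\<close>
    obtain k where k: "\<bar>T0\<bar> + 1 / x + real K0 * pi + \<bar>\<eta>\<bar> + 20 < K ^ k" using real_arch_pow[of K] K by auto
    have kp: "1 / x > 0" "real K0 * pi \<ge> 0" using x by auto
    \<comment> \<open>The first index with j\<pi> - \<eta> \<ge> K^k + 1, so that the zeros near
      j\<pi> - \<eta> and (j+1)\<pi> - \<eta> both lie in the window.\<close>
    define j where "j = nat \<lceil>(K ^ k + \<eta> + 1) / pi\<rceil>"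
    have z0: "0 < (K ^ k + \<eta> + 1) / pi"
    proof (rule divide_pos_pos)
      show "0 < K ^ k + \<eta> + 1" using k kp by linarith
    qed simp
    have "(K ^ k + \<eta> + 1) / pi \<le> real j" "real j < (K ^ k + \<eta> + 1) / pi + 1"
      using z0 unfolding j_def by linarith+
    then have j: "K ^ k + \<eta> + 1 \<le> real j * pi" "real j * pi < K ^ k + \<eta> + 1 + pi"
      by (auto simp: field_simps)
    have "real K0 * pi \<le> real j * pi" using j(1) k kp by linarith
    then have jK: "K0 \<le> j" by simp
    obtain s where s: "s \<in> bzeros \<nu>" "\<bar>s - (real j * pi - \<eta>)\<bar> < \<epsilon>" using K0[OF jK] by blast
    obtain s' where s': "s' \<in> bzeros \<nu>" "\<bar>s' - (real (Suc j) * pi - \<eta>)\<bar> < \<epsilon>" using K0[of "Suc j"] jK by force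
    have Sj: "real (Suc j) * pi = real j * pi + pi" by (simp add: algebra_simps)
    have p4: "pi < 4" by (rule pi_less_4)
    have sin_small: "\<bar>sin (u * x + \<eta>)\<bar> < \<epsilon>" if u: "u \<in> bzeros \<nu>" "K ^ k \<le> u" "u \<le> 2 * K ^ k" for u
    proof -
      have u1: "1 \<le> u" "T0 \<le> u" "1 / x \<le> u" using u k kp by linarith+
      then have "1 \<le> u * x" using x by (simp add: pos_divide_le_eq)
      then have "A * \<bar>sin (u * x + \<eta>)\<bar> < A * \<epsilon>" using small[OF u(1) u1(1) _ u(2,3)] T0[OF u1(2)] by linarith
      then show ?thesis using as(1) by simp
    qed
    have "\<bar>sin (s * x + \<eta>)\<bar> < \<epsilon>" using s j eps k kp p4 by (intro sin_small) linarith+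
    moreover have "\<bar>sin (s' * x + \<eta>)\<bar> < \<epsilon>" using s' j eps k kp p4 pi_gt_zero unfolding Sj by (intro sin_small) linarith+
    \<comment> \<open>Subtracting the two phases eliminates \<eta>, and s' - s is within 2\<epsilon>
      of \<pi>.\<close>
    moreover have "\<bar>sin ((s' - s) * x)\<bar> \<le> \<bar>sin (s' * x + \<eta>)\<bar> + \<bar>sin (s * x + \<eta>)\<bar>"
    proof -
      have "sin ((s' - s) * x) = sin ((s' * x + \<eta>) - (s * x + \<eta>))" by (simp add: algebra_simps)
      also have "\<dots> = sin (s' * x + \<eta>) * cos (s * x + \<eta>) - cos (s' * x + \<eta>) * sin (s * x + \<eta>)" by (rule sin_diff)
      finally have "\<bar>sin ((s' - s) * x)\<bar> \<le> \<bar>sin (s' * x + \<eta>)\<bar> * \<bar>cos (s * x + \<eta>)\<bar> + \<bar>cos (s' * x + \<eta>)\<bar> * \<bar>sin (s * x + \<eta>)\<bar>"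
        by (metis abs_mult abs_triangle_ineq4)
      also have "\<dots> \<le> \<bar>sin (s' * x + \<eta>)\<bar> * 1 + 1 * \<bar>sin (s * x + \<eta>)\<bar>"
        by (intro add_mono mult_mono) auto
      finally show ?thesis by simp
    qed
    moreover have "\<bar>sin (pi * x) - sin ((s' - s) * x)\<bar> \<le> 2 * \<epsilon>"
    proof -
      have "\<bar>sin (pi * x) - sin ((s' - s) * x)\<bar> = 2 * \<bar>sin ((pi * x - (s' - s) * x) / 2)\<bar> * \<bar>cos ((pi * x + (s' - s) * x) / 2)\<bar>"
        by (simp add: sin_diff_sin abs_mult)
      also have "\<dots> \<le> 2 * \<bar>(pi * x - (s' - s) * x) / 2\<bar> * 1"
        by (intro mult_mono abs_sin_x_le_abs_x) auto
      also have "\<dots> = \<bar>pi - (s' - s)\<bar> * x" using x by (simp add: left_diff_distrib[symmetric] abs_mult)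
      also have "\<dots> \<le> (2 * \<epsilon>) * 1" using s(2) s'(2) x unfolding Sj by (intro mult_mono) auto
      finally show ?thesis by simp
    qed
    ultimately show False using eps(1) unfolding \<epsilon>_def by linarith
  qed
  then show thesis using that[OF K(1,2)] by blast
qed

theorem theorem1:
  fixes \<nu> \<delta> p :: real
  assumes "\<nu> > -1" and "\<delta> > 0" and "1 \<le> p"
  shows "(\<forall>f. in_Lp_mu \<nu> p f \<longrightarrow>
            (AE x in lebesgue_on {0<..<1}. ((\<lambda>R. bochner_riesz \<nu> \<delta> R f x) \<longlongrightarrow> f x) at_top))
         \<longleftrightarrow> p0 \<nu> \<delta> \<le> p"
proof
  assume conv: "\<forall>f. in_Lp_mu \<nu> p f \<longrightarrow> (AE x in lebesgue_on {0<..<1}. ((\<lambda>R. bochner_riesz \<nu> \<delta> R f x) \<longlongrightarrow> f x) at_top)"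
  show "p0 \<nu> \<delta> \<le> p"
  proof (rule ccontr)
    assume neg: "\<not> p0 \<nu> \<delta> \<le> p"
    then have nu: "\<nu> > -1/2" and p: "p < 4 * (\<nu> + 1) / (2 * \<nu> + 3 + 2 * \<delta>)"
      using assms by (auto simp: p0_def split: if_splits)
    have den: "2 * \<nu> + 3 + 2 * \<delta> > 0" using nu assms by simp
    have "p * (2 * \<nu> + 3 + 2 * \<delta>) < 4 * (\<nu> + 1)" using p den by (simp add: pos_less_divide_eq)
    then have "p * (\<nu> + 3/2 + \<delta>) < 2 * \<nu> + 2" by (simp add: algebra_simps)
    then have "\<nu> + 3/2 + \<delta> < (2 * \<nu> + 2) / p" using assms(3) by (simp add: pos_less_divide_eq mult.commute)
    \<comment> \<open>p < p0 says precisely that there is room between the exponent where divergence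
      starts and the one where integrability ends.\<close>
    then obtain b where b: "\<nu> + 3/2 + \<delta> < b" "b < (2 * \<nu> + 2) / p" using dense by blast
    have bp: "b * p < 2 * \<nu> + 2" using b(2) assms(3) by (simp add: pos_less_divide_eq)
    have b1: "b \<ge> 1" using b nu assms by simp
    then have "b * 1 \<le> b * p" using assms by (intro mult_left_mono) auto
    then have "b < 2 * \<nu> + 2" using bp by simp
    with lacunary_means_diverge[OF nu assms(2) b(1)] obtain K c where K: "K \<ge> 2" "c > 0"
      and div: "\<And>x L. 0 < x \<Longrightarrow> x < 1 \<Longrightarrow> \<not> ((\<lambda>R. bochner_riesz \<nu> \<delta> R (lacunary K b c) x) \<longlongrightarrow> L) at_top" by metis
    have "in_Lp_mu \<nu> p (lacunary K b c)" by (rule in_Lp_lacunary[OF K(1) b1 K(2) assms(3) bp])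
    then have "AE x in lebesgue_on {0<..<1}. ((\<lambda>R. bochner_riesz \<nu> \<delta> R (lacunary K b c) x) \<longlongrightarrow> lacunary K b c x) at_top"
      using conv by blast
    \<comment> \<open>Convergence fails at every point of (0,1), so the almost everywhere statement
      would make this interval a null set.\<close>
    then have "AE x in lebesgue. \<not> x \<in> {0<..<1::real}" using div by (auto simp: AE_restrict_space_iff)
    then have "emeasure lebesgue {0<..<1::real} = 0" by (subst (asm) AE_iff_measurable[of "{0<..<1}"]) auto
    then show False by simp
  qed
next
  assume "p0 \<nu> \<delta> \<le> p"
  then show "\<forall>f. in_Lp_mu \<nu> p f \<longrightarrow> (AE x in lebesgue_on {0<..<1}. ((\<lambda>R. bochner_riesz \<nu> \<delta> R f x) \<longlongrightarrow> f x) at_top)"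
    using almost_everywhere_convergence[OF assms(1,2)] assms(3) by blast
qed

end
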